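(* For all $1<p<\infty$ and all integers $N\ge 2$ there exist a constant $\alpha(p,N)>0$ and positive constants $C_1,C_2$ depending only on $p$ and $N$ such that, for every $0<\delta\le 1$, $$C_1\,\delta^{\alpha(p,N)}\le\omega_p(B_\delta,x_0,\mathbb{R}^N_+)\le C_2\,\delta^{\alpha(p,N)},$$ where $B_\delta\subset\mathbb{R}^{N-1}=\partial\mathbb{R}^N_+$ is the ball in $\mathbb{R}^{N-1}$ centered at the origin of radius $\delta$ and $x_0=(0,\dots,0,1)$.
   Context: $\mathbb{R}^N_+=\{(x',x_N): x'\in\mathbb{R}^{N-1},\ x_N>0\}$, with boundary identified with $\mathbb{R}^{N-1}$. A function is $p$-harmonic in a domain if it is a continuous weak solution in $W^{1,p}_{\mathrm{loc}}$ of $\mathrm{div}(|\nabla u|^{p-2}\nabla u)=0$. A function $u:\Omega\to(-\infty,\infty]$ is $p$-superharmonic if it is lower semicontinuous, not identically $\infty$, and satisfies the comparison principle: for every open $D$ compactly contained in $\Omega$ and every $h\in C(\overline D)$ that is $p$-harmonic in $D$, $h\le u$ on $\partial D$ implies $h\le u$ in $D$. For a domain $\Omega\subset\mathbb{R}^N$, $E\subset\partial\Omega$ and $x\in\Omega$, the $p$-harmonic measure $\omega_p(E,x,\Omega)$ is the value at $x$ of the upper Perron solution of the characteristic function of $E$, i.e. the infimum of $u(x)$ over all nonnegative $p$-superharmonic functions $u$ in $\Omega$ with $\liminf_{z\to y}u(z)\ge 1$ for every $y\in E$. *)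

theory Defs
  imports "HOL-Analysis.Analysis"
begin

definition gradient :: "('a::euclidean_space \<Rightarrow> real) \<Rightarrow> 'a \<Rightarrow> 'a" where
  "gradient f x = (\<Sum>i\<in>Basis. frechet_derivative f (at x) i *\<^sub>R i)"

primrec times_differentiable :: "nat \<Rightarrow> ('a::euclidean_space \<Rightarrow> real) \<Rightarrow> bool" where
  "times_differentiable 0 f \<longleftrightarrow> continuous_on UNIV f"
| "times_differentiable (Suc k) f \<longleftrightarrow>
     f differentiable_on UNIV \<and>
     (\<forall>i\<in>Basis. times_differentiable k (\<lambda>x. frechet_derivative f (at x) i))"

text \<open>The test functions \<open>C\<^sub>c\<^sup>\<infinity>(\<Omega>)\<close>, extended by zero to the whole space.\<close>

definition test_functions :: "'a::euclidean_space set \<Rightarrow> ('a \<Rightarrow> real) set" where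
  "test_functions \<Omega> =
     {\<phi>. (\<forall>k. times_differentiable k \<phi>) \<and>
         compact (closure {x. \<phi> x \<noteq> 0}) \<and> closure {x. \<phi> x \<noteq> 0} \<subseteq> \<Omega>}"

definition Lp_loc :: "real \<Rightarrow> 'a::euclidean_space set \<Rightarrow> ('a \<Rightarrow> 'b::euclidean_space) set" where
  "Lp_loc p \<Omega> =
     {f. f \<in> borel_measurable (lebesgue_on \<Omega>) \<and>
         (\<forall>K. compact K \<and> K \<subseteq> \<Omega> \<longrightarrow> integrable (lebesgue_on K) (\<lambda>x. norm (f x) powr p))}"

definition weak_gradient ::
  "'a::euclidean_space set \<Rightarrow> ('a \<Rightarrow> real) \<Rightarrow> ('a \<Rightarrow> 'a) \<Rightarrow> bool" where
  "weak_gradient \<Omega> u G \<longleftrightarrow>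
     u \<in> Lp_loc 1 \<Omega> \<and> G \<in> Lp_loc 1 \<Omega> \<and>
     (\<forall>\<phi>\<in>test_functions \<Omega>. \<forall>i\<in>Basis.
        (\<integral>x. u x * (gradient \<phi> x \<bullet> i) \<partial>lebesgue_on \<Omega>) =
        - (\<integral>x. (G x \<bullet> i) * \<phi> x \<partial>lebesgue_on \<Omega>))"

definition W1p_loc :: "real \<Rightarrow> 'a::euclidean_space set \<Rightarrow> ('a \<Rightarrow> real) set" where
  "W1p_loc p \<Omega> = {u. u \<in> Lp_loc p \<Omega> \<and> (\<exists>G\<in>Lp_loc p \<Omega>. weak_gradient \<Omega> u G)}"

text \<open>
  The weak gradient is unique up to null sets, so it does not matter which one is chosen in the
  weak form of \<open>div (|\<nabla>u|\<^sup>p\<^sup>-\<^sup>2 \<nabla>u) = 0\<close>. Where the gradient vanishes, the integrand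
  is \<open>0\<close> also for \<open>p < 2\<close>.
\<close>

definition p_harmonic_on :: "real \<Rightarrow> 'a::euclidean_space set \<Rightarrow> ('a \<Rightarrow> real) \<Rightarrow> bool" where
  "p_harmonic_on p \<Omega> u \<longleftrightarrow>
     continuous_on \<Omega> u \<and> u \<in> W1p_loc p \<Omega> \<and>
     (\<exists>G. weak_gradient \<Omega> u G \<and>
        (\<forall>\<phi>\<in>test_functions \<Omega>.
           (\<integral>x. norm (G x) powr (p - 2) * (G x \<bullet> gradient \<phi> x) \<partial>lebesgue_on \<Omega>) = 0))"

definition lower_semicontinuous_on ::
  "'a::topological_space set \<Rightarrow> ('a \<Rightarrow> ereal) \<Rightarrow> bool" where
  "lower_semicontinuous_on S u \<longleftrightarrow> (\<forall>x\<in>S. u x \<le> Liminf (at x within S) u)"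

definition p_superharmonic_on :: "real \<Rightarrow> 'a::euclidean_space set \<Rightarrow> ('a \<Rightarrow> ereal) \<Rightarrow> bool" where
  "p_superharmonic_on p \<Omega> u \<longleftrightarrow>
     (\<forall>x\<in>\<Omega>. u x \<noteq> -\<infinity>) \<and>
     lower_semicontinuous_on \<Omega> u \<and>
     (\<exists>x\<in>\<Omega>. u x \<noteq> \<infinity>) \<and>
     (\<forall>D h. open D \<and> compact (closure D) \<and> closure D \<subseteq> \<Omega> \<and>
            continuous_on (closure D) h \<and> p_harmonic_on p D h \<and>
            (\<forall>x\<in>frontier D. ereal (h x) \<le> u x)
        \<longrightarrow> (\<forall>x\<in>D. ereal (h x) \<le> u x))"

definition p_harmonic_measure ::
  "real \<Rightarrow> 'a::euclidean_space set \<Rightarrow> 'a \<Rightarrow> 'a set \<Rightarrow> ereal" where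
  "p_harmonic_measure p E x \<Omega> =
     (INF u \<in> {u. p_superharmonic_on p \<Omega> u \<and> (\<forall>z\<in>\<Omega>. 0 \<le> u z) \<and>
                  (\<forall>y\<in>E. 1 \<le> Liminf (at y within \<Omega>) u)}. u x)"

text \<open>
  \<open>\<real>\<^sup>N\<close> is the Euclidean space \<^typ>\<open>(real^'m) \<times> real\<close> of pairs \<open>(x', x\<^sub>N)\<close>, with
  \<open>N = CARD('m) + 1\<close>; as \<open>CARD('m) \<ge> 1\<close>, this covers exactly the dimensions \<open>N \<ge> 2\<close>.
\<close>

definition upper_half_space :: "((real^'m) \<times> real) set" where
  "upper_half_space = {(x', t). 0 < t}"

definition boundary_ball :: "real \<Rightarrow> ((real^'m) \<times> real) set" where
  "boundary_ball \<delta> = ball 0 \<delta> \<times> {0}"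

end

theory Submission
  imports Defs
begin

text \<open>
  The exponent \<open>\<alpha>\<close> is the homogeneity of the positive \<open>p\<close>-harmonic function
  \<open>U(x) = |x|\<^sup>-\<^sup>\<beta> f(\<theta>)\<close> in the half-space that vanishes on the boundary away from the origin
  (\<open>\<theta>\<close> is the angle between \<open>x\<close> and the \<open>x\<^sub>N\<close>-axis). Once \<open>U\<close> is available
  (\<open>singular_solution\<close>), both bounds follow by comparing with translates and dilates of it, and
  \<open>\<alpha> = \<beta>\<close>.

  Upper bound (\<open>harmonic_measure_upper_bound\<close>). Move the singularity to depth \<open>\<delta>\<close> below the
  boundary. By homogeneity the function \<open>\<delta>\<^sup>\<beta> U(x + \<delta> e\<^sub>N)\<close> is bounded below on \<open>B\<^sub>\<delta>\<close> by a
  constant that does not depend on \<open>\<delta>\<close>, so a constant multiple of it is a competitor for the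
  harmonic measure, of size \<open>\<delta>\<^sup>\<beta>\<close> at \<open>x\<^sub>0\<close>.

  Lower bound (\<open>harmonic_measure_lower_bound\<close>). Let \<open>u\<close> be any competitor. A suitable superlevel
  set of the translated singular function, with the singularity at depth proportional to \<open>\<delta>\<close>,
  touches the boundary only inside \<open>B\<^sub>\<delta>\<close>, where \<open>u\<close> is nearly \<open>1\<close>; comparison there gives a
  lower bound for \<open>u\<close> by an absolute constant on a half-ball of radius proportional to \<open>\<delta>\<close>.
  Outside of this half-ball \<open>u\<close> is then compared with a multiple of \<open>\<delta>\<^sup>\<beta> U\<close>, which gives
  \<open>u(x\<^sub>0) \<ge> C \<delta>\<^sup>\<beta>\<close>.

  Comparison principle (\<open>p_harmonic_comparison\<close>). Competitors are compared with \<open>p\<close>-harmonic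
  functions by definition. That \<open>U\<close> itself is \<open>p\<close>-superharmonic is the comparison principle for two
  continuous weak solutions \<open>h\<close>, \<open>v\<close>. Its idea is to test both equations with a function of
  \<open>h - v - \<epsilon>\<close> that vanishes where this is negative, and to use that the flux
  \<open>|\<xi>|\<^sup>p\<^sup>-\<^sup>2 \<xi>\<close> is strictly monotone. Since test functions are smooth, \<open>h - v\<close> is first
  mollified, and the limit is taken by the convergence of mollifications in \<open>L\<^sup>p\<close>
  (\<open>mollify_tendsto_Lp\<close>, \<open>weighted_limit\<close>).

  Construction of \<open>U\<close>. With \<open>\<nabla>U = r\<^sup>-\<^sup>\<beta>\<^sup>-\<^sup>1 \<sigma>(\<theta>) X\<close> and \<open>|X| = 1\<close>, let \<open>\<phi>(\<theta>)\<close> be the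
  angle between \<open>-\<nabla>U\<close> and the radial direction. For a homogeneous function the \<open>p\<close>-Laplace
  equation decouples: \<open>\<phi>\<close> solves the first order equation
  \<open>\<phi>' = (\<beta> (p - 1) + (p - N) cos\<^sup>2 \<phi> - (N - 2) cot \<theta> sin \<phi> cos \<phi>) / (1 + (p - 2) sin\<^sup>2 \<phi>)\<close>,
  and the amplitude \<open>\<sigma>\<close> is then a quadrature. The symmetry at the axis is \<open>\<phi>(0) = 0\<close>, the boundary
  condition \<open>f(\<pi>/2) = 0\<close> is \<open>\<phi>(\<pi>/2) = \<pi>/2\<close>, and \<open>\<beta>\<close> is found by shooting
  (\<open>angular_shooting\<close>). Because the gradient of \<open>U\<close> has no zeros, no degenerate or singular points of
  the equation occur, and \<open>U\<close> and its flux are locally Lipschitz and differentiable off the axis; this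
  is enough to integrate by parts (\<open>integration_by_parts\<close>, \<open>p_harmonic_criterion\<close>).
\<close>

section \<open>Smooth functions\<close>

lemma frechet_eq: "(f has_derivative f') (at x) \<Longrightarrow> frechet_derivative f (at x) = f'"
  using frechet_derivative_at by force

lemma times_differentiable_Suc_I:
  assumes "\<And>x. (f has_derivative D x) (at x)" "\<And>i. i \<in> Basis \<Longrightarrow> times_differentiable k (\<lambda>x. D x i)"
  shows "times_differentiable (Suc k) f"
proof -
  have "f differentiable_on UNIV"
    using assms(1) by (auto simp: differentiable_on_def differentiable_def)
  moreover have "frechet_derivative f (at x) = D x" for x
    using assms(1) frechet_eq by blast
  ultimately show ?thesis using assms(2) by simp
qed

lemma times_differentiable_SucD:
  assumes "times_differentiable (Suc k) f"
  shows "(f has_derivative frechet_derivative f (at x)) (at x)"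
    "i \<in> Basis \<Longrightarrow> times_differentiable k (\<lambda>x. frechet_derivative f (at x) i)"
  using assms by (auto simp: differentiable_on_def frechet_derivative_works)

lemma times_differentiable_lower: "times_differentiable (Suc k) f \<Longrightarrow> times_differentiable k f"
proof (induction k arbitrary: f)
  case 0
  then show ?case by (simp add: differentiable_imp_continuous_on)
next
  case (Suc k)
  from Suc.prems have "f differentiable_on UNIV" by simp
  moreover have "times_differentiable k (\<lambda>x. frechet_derivative f (at x) i)" if "i \<in> Basis" for i
    using Suc.IH times_differentiable_SucD(2)[OF Suc.prems that] by blast
  ultimately show ?case by simp
qed

lemma times_differentiable_continuous: "times_differentiable k f \<Longrightarrow> continuous_on UNIV f"
proof (induction k)
  case (Suc k)
  then show ?case using times_differentiable_lower by blast
qed simp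

lemma times_differentiable_const: "times_differentiable k (\<lambda>x. c)"
proof (induction k arbitrary: c)
  case (Suc k)
  show ?case
    by (rule times_differentiable_Suc_I[where D="\<lambda>x h. 0"]) (use Suc in auto)
qed simp

lemma times_differentiable_add:
  "times_differentiable k f \<Longrightarrow> times_differentiable k g \<Longrightarrow> times_differentiable k (\<lambda>x. f x + g x)"
proof (induction k arbitrary: f g)
  case 0 then show ?case by (simp add: continuous_on_add)
next
  case (Suc k)
  show ?case
    by (rule times_differentiable_Suc_I[OF has_derivative_add[OF times_differentiable_SucD(1)[OF Suc.prems(1)]
        times_differentiable_SucD(1)[OF Suc.prems(2)]]])
      (intro Suc.IH times_differentiable_SucD(2) Suc.prems)
qed

lemma times_differentiable_mult:
  "times_differentiable k f \<Longrightarrow> times_differentiable k g \<Longrightarrow> times_differentiable k (\<lambda>x. f x * g x)"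
proof (induction k arbitrary: f g)
  case 0 then show ?case by (simp add: continuous_on_mult)
next
  case (Suc k)
  show ?case
  proof (rule times_differentiable_Suc_I[OF has_derivative_mult[OF times_differentiable_SucD(1)[OF Suc.prems(1)]
        times_differentiable_SucD(1)[OF Suc.prems(2)]]])
    fix i :: 'a assume i: "i \<in> Basis"
    show "times_differentiable k (\<lambda>x. f x * frechet_derivative g (at x) i + frechet_derivative f (at x) i * g x)"
      by (intro times_differentiable_add Suc.IH times_differentiable_lower[OF Suc.prems(1)]
          times_differentiable_lower[OF Suc.prems(2)] Suc.prems[THEN times_differentiable_SucD(2)] i)
  qed
qed

lemma times_differentiable_sum:
  "(\<And>i. i \<in> A \<Longrightarrow> times_differentiable k (f i)) \<Longrightarrow> times_differentiable k (\<lambda>x. \<Sum>i\<in>A. f i x)"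
  by (induction A rule: infinite_finite_induct)
    (simp_all add: times_differentiable_const times_differentiable_add)

lemma times_differentiable_inner: "times_differentiable k (\<lambda>x. x \<bullet> a)"
proof (cases k)
  case 0 then show ?thesis by (auto intro!: continuous_intros)
next
  case (Suc j)
  have "((\<lambda>x. x \<bullet> a) has_derivative (\<lambda>h. h \<bullet> a)) (at x)" for x
    by (rule bounded_linear_imp_has_derivative) (rule bounded_linear_inner_left)
  then show ?thesis unfolding Suc
    by (rule times_differentiable_Suc_I) (rule times_differentiable_const)
qed

lemma times_differentiable_reflect:
  "times_differentiable k f \<Longrightarrow> times_differentiable k (\<lambda>y. f (a - y))"
proof (induction k arbitrary: f)
  case 0
  have "continuous_on UNIV f" using 0 by simp
  then have "continuous_on UNIV (\<lambda>y. f (a - y))"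
    by (rule continuous_on_compose2) (auto intro!: continuous_intros)
  then show ?case by simp
next
  case (Suc k)
  have D: "((\<lambda>y. f (a - y)) has_derivative (\<lambda>h. frechet_derivative f (at (a-y)) (-h))) (at y)" for y
    by (rule has_derivative_compose[where g=f])
      (auto intro!: derivative_eq_intros times_differentiable_SucD(1)[OF Suc.prems])
  show ?case
  proof (rule times_differentiable_Suc_I[OF D])
    fix i :: 'a assume i: "i \<in> Basis"
    have lin: "linear (frechet_derivative f (at z))" for z
      using times_differentiable_SucD(1)[OF Suc.prems] has_derivative_linear by blast
    have "times_differentiable k (\<lambda>x. (-1) * frechet_derivative f (at (a - x)) i)"
      by (intro times_differentiable_mult times_differentiable_const Suc.IH times_differentiable_SucD(2)[OF Suc.prems i])
    then show "times_differentiable k (\<lambda>x. frechet_derivative f (at (a - x)) (- i))"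
      by (simp add: linear_neg[OF lin])
  qed
qed

text \<open>
  The smooth function \<open>e\<^sup>-\<^sup>1\<^sup>/\<^sup>t\<close> (extended by \<open>0\<close>) is the case \<open>n = 0\<close>. The powers of \<open>t\<close> in the
  denominator make the family closed under differentiation, so that smoothness is one induction.
\<close>
definition flat_exp :: "nat \<Rightarrow> real \<Rightarrow> real" where
  "flat_exp n t = (if t \<le> 0 then 0 else exp (- 1 / t) / t ^ n)"

lemma flat_exp_tendsto_0: "((\<lambda>t. exp (- 1 / t) / t ^ n) \<longlongrightarrow> (0::real)) (at_right 0)"
proof -
  have "((\<lambda>s::real. s ^ n / exp s) \<longlongrightarrow> 0) at_top"
    by (rule tendsto_power_div_exp_0)
  then have "((\<lambda>t::real. (inverse t) ^ n / exp (inverse t)) \<longlongrightarrow> 0) (at_right 0)"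
    by (rule filterlim_compose[OF _ filterlim_inverse_at_top_right])
  then show ?thesis
    by (simp add: field_simps exp_minus)
qed

lemma flat_exp_deriv: "(flat_exp n has_real_derivative (flat_exp (n+2) t - real n * flat_exp (n+1) t)) (at t)"
proof -
  consider "t < 0" | "t > 0" | "t = 0" by linarith
  then show ?thesis
  proof cases
    case 1
    have "((\<lambda>t. 0) has_real_derivative 0) (at t)" by simp
    then show ?thesis
      by (rule has_field_derivative_transform_within_open[where S="{..<0}" , THEN DERIV_cong])
        (use 1 in \<open>auto simp: flat_exp_def\<close>)
  next
    case 2
    have "((\<lambda>t. exp (- 1 / t) / t ^ n) has_real_derivative
        (exp (- 1 / t) * (1 / t\<^sup>2) * t ^ n - exp (- 1 / t) * (real n * t ^ (n - 1))) / (t ^ n * t ^ n)) (at t)"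
      using 2 by (auto intro!: derivative_eq_intros simp: power2_eq_square)
    also have "(exp (- 1 / t) * (1 / t\<^sup>2) * t ^ n - exp (- 1 / t) * (real n * t ^ (n - 1))) / (t ^ n * t ^ n)
        = flat_exp (n+2) t - real n * flat_exp (n+1) t"
      using 2 by (cases n) (auto simp: flat_exp_def field_simps power2_eq_square)
    finally have "((\<lambda>t. exp (- 1 / t) / t ^ n) has_real_derivative (flat_exp (n+2) t - real n * flat_exp (n+1) t)) (at t)" .
    then show ?thesis
      by (rule has_field_derivative_transform_within_open[where S="{0<..}"])
        (use 2 in \<open>auto simp: flat_exp_def\<close>)
  next
    case 3
    \<comment> \<open>at the origin the difference quotient from the right is the expression with exponent one higher\<close>
    have "((\<lambda>h. flat_exp n h / h) \<longlongrightarrow> 0) (at_right 0)"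
      by (rule Lim_transform_eventually[OF flat_exp_tendsto_0[of "Suc n"]])
        (auto simp: flat_exp_def eventually_at_filter)
    moreover have "((\<lambda>h. flat_exp n h / h) \<longlongrightarrow> 0) (at_left 0)"
      by (rule Lim_transform_eventually[OF tendsto_const])
        (auto simp: flat_exp_def eventually_at_filter)
    ultimately have "((\<lambda>h. flat_exp n h / h) \<longlongrightarrow> 0) (at 0)"
      by (simp add: filterlim_at_split)
    then show ?thesis using 3 by (simp add: DERIV_def flat_exp_def)
  qed
qed

lemma flat_exp_continuous [continuous_intros]:
  "continuous_on S f \<Longrightarrow> continuous_on S (\<lambda>x. flat_exp n (f x))"
proof -
  have "continuous_on UNIV (flat_exp n)"
    using flat_exp_deriv DERIV_isCont continuous_at_imp_continuous_on by blast
  then show "continuous_on S f \<Longrightarrow> continuous_on S (\<lambda>x. flat_exp n (f x))"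
    by (rule continuous_on_compose2) auto
qed

lemma flat_exp_nonneg: "0 \<le> flat_exp n t" by (simp add: flat_exp_def)
lemma flat_exp_pos: "0 < t \<Longrightarrow> 0 < flat_exp n t" by (simp add: flat_exp_def)

text \<open>
  \<open>flat_exp 2\<close> is the derivative of \<open>flat_exp 0\<close>; its boundedness makes \<open>flat_exp 0\<close> a usable
  truncation in the proof of the comparison principle.
\<close>
lemma flat_exp_2_le: "flat_exp 2 t \<le> 2"
proof (cases "t \<le> 0")
  case False
  then have t: "t > 0" by simp
  have "1 + 1/t + (1/t)\<^sup>2/2 \<le> exp (1/t)"
    by (rule exp_lower_Taylor_quadratic) (use t in simp)
  then have "1 / t^2 \<le> 2 * exp (1/t)" using t
    by (smt (verit) divide_nonneg_pos field_sum_of_halves power_one_over)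
  then show ?thesis using t by (simp add: flat_exp_def exp_minus field_simps)
qed (simp add: flat_exp_def)

lemma times_differentiable_flat_exp:
  "times_differentiable k g \<Longrightarrow> times_differentiable k (\<lambda>x. flat_exp n (g x))"
proof (induction k arbitrary: g n)
  case 0 then show ?case by (auto intro: flat_exp_continuous)
next
  case (Suc k)
  have D: "((\<lambda>x. flat_exp n (g x)) has_derivative
     (\<lambda>h. (flat_exp (n+2) (g x) + (- real n) * flat_exp (n+1) (g x)) * frechet_derivative g (at x) h)) (at x)" for x
    using has_derivative_compose[OF times_differentiable_SucD(1)[OF Suc.prems, of x]
        flat_exp_deriv[of n "g x", unfolded has_field_derivative_def]]
    by simp
  show ?case
    by (rule times_differentiable_Suc_I[OF D])
      (intro times_differentiable_mult times_differentiable_add times_differentiable_const Suc.IH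
        times_differentiable_lower[OF Suc.prems] times_differentiable_SucD(2)[OF Suc.prems])
qed

section \<open>Mollification\<close>

text \<open>
  Nonempty open sets have positive measure; this turns statements that hold almost everywhere into
  statements at points of a given open set.
\<close>
lemma not_AE_open:
  fixes S :: "'a::euclidean_space set"
  assumes "open S" "x \<in> S" "AE y in lborel. y \<in> S \<longrightarrow> P y"
  shows "\<exists>y\<in>S. P y"
proof (rule ccontr)
  assume "\<not> ?thesis"
  then have "AE y in lborel. y \<notin> S" using assms(3) by (auto elim!: AE_mp)
  then have "S \<in> null_sets lborel" using assms(1) by (subst AE_iff_null_sets) auto
  then have "negligible S" by (simp add: negligible_iff_null_sets null_sets_completionI)
  then show False using open_not_negligible assms by blast
qed

lemma integrable_compact_support:
  fixes f :: "'a::euclidean_space \<Rightarrow> real"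
  assumes "continuous_on UNIV f" "compact K" "\<And>x. x \<notin> K \<Longrightarrow> f x = 0"
  shows "integrable lborel f"
proof -
  have "integrable lborel (\<lambda>x. indicator K x *\<^sub>R f x)"
    by (rule borel_integrable_compact[OF assms(2) continuous_on_subset[OF assms(1)]]) simp
  also have "(\<lambda>x. indicator K x *\<^sub>R f x) = f"
    using assms(3) by (auto simp: indicator_def fun_eq_iff)
  finally show ?thesis .
qed

definition bump :: "real \<Rightarrow> 'a::euclidean_space \<Rightarrow> real" where
  "bump \<eta> x = flat_exp 0 (\<eta>\<^sup>2 - x \<bullet> x)"

definition mollifier :: "real \<Rightarrow> 'a::euclidean_space \<Rightarrow> real" where
  "mollifier \<eta> x = bump \<eta> x / (\<integral>y. bump \<eta> (y::'a) \<partial>lborel)"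

lemma times_differentiable_bump: "times_differentiable k (bump \<eta>)"
proof -
  have "times_differentiable k (\<lambda>x::'a. flat_exp 0 (\<eta>\<^sup>2 + (-1) * (\<Sum>i\<in>Basis. (x \<bullet> i) * (x \<bullet> i))))"
    by (intro times_differentiable_flat_exp times_differentiable_add times_differentiable_mult
        times_differentiable_const times_differentiable_sum times_differentiable_inner)
  then show ?thesis
    by (simp add: bump_def[abs_def] euclidean_inner[symmetric])
qed

lemma bump_zero: "0 < \<eta> \<Longrightarrow> \<eta> \<le> norm x \<Longrightarrow> bump \<eta> x = 0"
  by (simp add: bump_def flat_exp_def dot_square_norm)

lemma bump_integral_pos:
  assumes "0 < \<eta>"
  shows "integrable lborel (bump \<eta> :: 'a::euclidean_space \<Rightarrow> real)" "0 < (\<integral>y. bump \<eta> (y::'a) \<partial>lborel)"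
proof -
  have c: "continuous_on UNIV (bump \<eta> :: 'a \<Rightarrow> real)"
    using times_differentiable_continuous[OF times_differentiable_bump[of 0]] .
  show int: "integrable lborel (bump \<eta> :: 'a \<Rightarrow> real)"
    by (rule integrable_compact_support[OF c compact_cball[of 0 \<eta>]]) (auto intro: bump_zero[OF assms])
  have "(\<integral>y. bump \<eta> (y::'a) \<partial>lborel) \<noteq> 0"
  proof
    assume "(\<integral>y. bump \<eta> (y::'a) \<partial>lborel) = 0"
    then have "AE x::'a in lborel. bump \<eta> x = 0"
      using integral_nonneg_eq_0_iff_AE[OF int] by (simp add: bump_def[abs_def] flat_exp_nonneg)
    then have "AE x::'a in lborel. x \<in> ball 0 \<eta> \<longrightarrow> bump \<eta> x = 0" by auto
    then obtain x :: 'a where "x \<in> ball 0 \<eta>" "bump \<eta> x = 0"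
      using not_AE_open[OF open_ball, of "0::'a" "0::'a" \<eta> "\<lambda>x. bump \<eta> x = 0"] assms by auto
    moreover have "x \<bullet> x < \<eta>\<^sup>2" using calculation assms
      by (simp add: dot_square_norm power_strict_mono)
    ultimately show False using flat_exp_pos[of "\<eta>\<^sup>2 - x \<bullet> x" 0] by (simp add: bump_def)
  qed
  moreover have "0 \<le> (\<integral>y. bump \<eta> (y::'a) \<partial>lborel)"
    by (rule Bochner_Integration.integral_nonneg) (simp add: bump_def flat_exp_nonneg)
  ultimately show "0 < (\<integral>y. bump \<eta> (y::'a) \<partial>lborel)" by linarith
qed

lemma mollifier_nonneg: "0 < \<eta> \<Longrightarrow> 0 \<le> mollifier \<eta> x"
  using bump_integral_pos(2)[where 'a='a] by (simp add: mollifier_def bump_def flat_exp_nonneg less_imp_le)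

lemma mollifier_zero: "0 < \<eta> \<Longrightarrow> \<eta> \<le> norm x \<Longrightarrow> mollifier \<eta> x = 0"
  by (simp add: mollifier_def bump_zero)

lemma mollifier_minus: "mollifier \<eta> (x - y) = mollifier \<eta> (y - x)"
proof -
  have "(x - y) \<bullet> (x - y) = (y - x) \<bullet> (y - x)"
    by (simp add: inner_diff inner_commute)
  then show ?thesis by (simp add: mollifier_def bump_def)
qed

lemma times_differentiable_mollifier: "times_differentiable k (mollifier \<eta>)"
proof -
  have "times_differentiable k (\<lambda>x. inverse (\<integral>y. bump \<eta> (y::'a) \<partial>lborel) * bump \<eta> x)"
    by (intro times_differentiable_mult times_differentiable_const times_differentiable_bump)
  then show ?thesis by (simp add: mollifier_def[abs_def] field_simps)
qed

lemma integral_mollifier: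
  assumes "0 < \<eta>"
  shows "integrable lborel (mollifier \<eta> :: 'a::euclidean_space \<Rightarrow> real)"
    "(\<integral>y. mollifier \<eta> (y::'a) \<partial>lborel) = 1"
  using bump_integral_pos[OF assms, where 'a='a] by (simp_all add: mollifier_def[abs_def])

lemma integral_mollifier_shift:
  assumes "0 < \<eta>"
  shows "integrable lborel (\<lambda>y. mollifier \<eta> (x - y :: 'a::euclidean_space))"
    "(\<integral>y. mollifier \<eta> (x - y :: 'a::euclidean_space) \<partial>lborel) = 1"
proof -
  have 1: "mollifier \<eta> (x - y) = mollifier \<eta> (-x + y)" for y
    by (subst mollifier_minus) (simp add: algebra_simps)
  have m: "mollifier \<eta> \<in> borel_measurable (borel :: 'a measure)"
    using integral_mollifier(1)[OF assms] by auto
  have d: "distr lborel borel ((+) (-x)) = (lborel :: 'a measure)" by (rule lborel_distr_plus)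
  show "integrable lborel (\<lambda>y. mollifier \<eta> (x - y))" unfolding 1
    using integral_mollifier(1)[OF assms, where 'a='a] integrable_distr_eq[of "(+) (-x)" lborel borel "mollifier \<eta>"] d m
    by auto
  show "(\<integral>y. mollifier \<eta> (x - y) \<partial>lborel) = 1" unfolding 1
    using integral_mollifier(2)[OF assms, where 'a='a] integral_distr[of "(+) (-x)" lborel borel "mollifier \<eta>"] d m
    by auto
qed

lemma uniformly_continuous_compact_support:
  fixes f :: "'a::euclidean_space \<Rightarrow> real"
  assumes c: "continuous_on UNIV f" and z: "\<And>x. norm x > R \<Longrightarrow> f x = 0" and e: "0 < e"
  obtains d where "0 < d" "\<And>x y. norm (y - x) < d \<Longrightarrow> \<bar>f y - f x\<bar> < e"
proof -
  have "uniformly_continuous_on (cball 0 (R+1)) f"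
    by (rule compact_uniformly_continuous) (use c continuous_on_subset in auto)
  then obtain d where d: "0 < d" "\<And>x y. x \<in> cball 0 (R+1) \<Longrightarrow> y \<in> cball 0 (R+1) \<Longrightarrow> dist y x < d \<Longrightarrow> dist (f y) (f x) < e"
    using e unfolding uniformly_continuous_on_def by metis
  show ?thesis
  proof (rule that[of "min d 1"])
    fix x y :: 'a assume xy: "norm (y - x) < min d 1"
    show "\<bar>f y - f x\<bar> < e"
    proof (cases "norm x \<le> R + 1 \<and> norm y \<le> R + 1")
      case True
      then show ?thesis using d(2)[of x y] xy by (auto simp: dist_norm dist_real_def)
    next
      case False
      have "norm x \<le> norm y + norm (y - x)" "norm y \<le> norm x + norm (y - x)"
        by norm+
      then have "norm x > R" "norm y > R" using False xy by auto
      then show ?thesis using z e by simp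
    qed
  qed (use d in auto)
qed

lemma frechet_derivative_outside_support:
  fixes f :: "'a::euclidean_space \<Rightarrow> real"
  assumes "\<And>x. norm x > R \<Longrightarrow> f x = 0" "norm x > R"
  shows "frechet_derivative f (at x) i = 0"
proof -
  have "(f has_derivative (\<lambda>h. 0)) (at x)"
    by (rule has_derivative_transform_within_open[OF has_derivative_const open_Compl[OF closed_cball[of 0 R]]])
      (use assms in auto)
  from frechet_eq[OF this] show ?thesis by simp
qed

lemma uniform_differentiable_compact_support:
  fixes f :: "'a::euclidean_space \<Rightarrow> real"
  assumes c: "times_differentiable (Suc 0) f" and z: "\<And>x. norm x > R \<Longrightarrow> f x = 0" and e: "0 < e"
  obtains d where "0 < d"
    "\<And>x h. norm h < d \<Longrightarrow> \<bar>f (x + h) - f x - (\<Sum>i\<in>Basis. (h \<bullet> i) * frechet_derivative f (at x) i)\<bar> \<le> e * norm h"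
proof -
  let ?D = "\<lambda>x. frechet_derivative f (at x)"
  note D = times_differentiable_SucD(1)[OF c]
  have Dsum: "?D x h = (\<Sum>i\<in>Basis. (h \<bullet> i) * ?D x i)" for x h
  proof -
    have "linear (?D x)" using D has_derivative_linear by blast
    then have "?D x (\<Sum>i\<in>Basis. (h \<bullet> i) *\<^sub>R i) = (\<Sum>i\<in>Basis. (h \<bullet> i) * ?D x i)"
      by (simp add: linear_sum linear_scale)
    then show ?thesis by (simp add: euclidean_representation)
  qed
  have z': "?D x i = 0" if "norm x > R" for x i
  by (rule frechet_derivative_outside_support[OF z that])
  define e' where "e' = e / real DIM('a)"
  have e': "0 < e'" using e by (simp add: e'_def)
  have "\<exists>d>0. \<forall>x y. norm (y - x) < d \<longrightarrow> \<bar>?D y i - ?D x i\<bar> < e'" if i: "i \<in> Basis" for i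
  proof -
    have "continuous_on UNIV (\<lambda>x. ?D x i)"
      using times_differentiable_SucD(2)[OF c i] by simp
    from uniformly_continuous_compact_support[OF this z' e'] show ?thesis by blast
  qed
  then obtain d where d: "\<And>i. i \<in> Basis \<Longrightarrow> 0 < d i"
     "\<And>i x y. i \<in> Basis \<Longrightarrow> norm (y - x) < d i \<Longrightarrow> \<bar>?D y i - ?D x i\<bar> < e'"
    by metis
  show ?thesis
  proof (rule that[of "Min (d ` Basis)"])
    show "0 < Min (d ` Basis)" using d(1) by (subst Min_gr_iff) auto
    fix x h :: 'a assume h: "norm h < Min (d ` Basis)"
    have h': "norm h < d i" if "i \<in> Basis" for i using h that by (subst (asm) Min_gr_iff) auto
    have "((\<lambda>t. f (x + t *\<^sub>R h)) has_derivative (\<lambda>s. ?D (x + t *\<^sub>R h) (s *\<^sub>R h))) (at t)" for t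
      by (rule has_derivative_compose[OF _ D]) (auto intro!: derivative_eq_intros)
    then have der: "((\<lambda>t. f (x + t *\<^sub>R h)) has_derivative (\<lambda>s. ?D (x + t *\<^sub>R h) (s *\<^sub>R h))) (at t within {0..1})" for t
      using has_derivative_at_withinI by blast
    obtain t where t: "t \<in> {0..1}" "f (x + 1 *\<^sub>R h) - f (x + 0 *\<^sub>R h) = ?D (x + t *\<^sub>R h) ((1-0) *\<^sub>R h)"
      using mvt_very_simple[OF zero_le_one, of "\<lambda>t. f (x + t *\<^sub>R h)", OF der] by blast
    have nt: "norm (x + t *\<^sub>R h - x) \<le> norm h" using t(1) by (simp add: mult_left_le_one_le)
    have "f (x + h) - f x - (\<Sum>i\<in>Basis. (h \<bullet> i) * ?D x i) =
      (\<Sum>i\<in>Basis. (h \<bullet> i) * (?D (x + t *\<^sub>R h) i - ?D x i))"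
      using t(2) Dsum[of "x + t *\<^sub>R h" h] by (simp add: sum_subtractf algebra_simps)
    also have "\<bar>\<dots>\<bar> \<le> (\<Sum>i\<in>(Basis::'a set). norm h * e')"
    proof (rule order_trans[OF sum_abs sum_mono])
      fix i :: 'a assume i: "i \<in> Basis"
      have "\<bar>?D (x + t *\<^sub>R h) i - ?D x i\<bar> \<le> e'"
        by (rule less_imp_le[OF d(2)[OF i]]) (rule le_less_trans[OF nt h'[OF i]])
      then show "\<bar>(h \<bullet> i) * (?D (x + t *\<^sub>R h) i - ?D x i)\<bar> \<le> norm h * e'"
        unfolding abs_mult by (intro mult_mono Basis_le_norm i) auto
    qed
    also have "\<dots> = e * norm h" by (simp add: e'_def)
    finally show "\<bar>f (x + h) - f x - (\<Sum>i\<in>Basis. (h \<bullet> i) * ?D x i)\<bar> \<le> e * norm h" .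
  qed
qed

lemma integrable_mult_bounded:
  fixes f g :: "'a::euclidean_space \<Rightarrow> real"
  assumes "integrable M f" "g \<in> borel_measurable M" "\<And>y. \<bar>g y\<bar> \<le> C"
  shows "integrable M (\<lambda>y. f y * g y)"
proof (rule Bochner_Integration.integrable_bound)
  show "integrable M (\<lambda>y. C * f y)" using assms by simp
  have "\<bar>f y\<bar> * \<bar>g y\<bar> \<le> \<bar>C\<bar> * \<bar>f y\<bar>" for y
    using assms(3)[of y] by (subst mult.commute) (auto intro!: mult_right_mono)
  then show "AE x in M. norm (f x * g x) \<le> norm (C * f x)" by (auto simp: abs_mult)
  show "(\<lambda>y. f y * g y) \<in> borel_measurable M" using assms by auto
qed

lemma bounded_compact_support:
  fixes f :: "'a::euclidean_space \<Rightarrow> real"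
  assumes c: "continuous_on UNIV f" and z: "\<And>x. norm x > R \<Longrightarrow> f x = 0"
  obtains C where "0 \<le> C" "\<And>x. \<bar>f x\<bar> \<le> C"
proof -
  have "bounded (f ` cball 0 R)"
    by (intro compact_imp_bounded compact_continuous_image) (use c continuous_on_subset in auto)
  then obtain C where C: "\<forall>x\<in>cball 0 R. \<bar>f x\<bar> \<le> C" by (auto simp: bounded_iff)
  show ?thesis
  proof (rule that[of "max 0 C"])
    fix x show "\<bar>f x\<bar> \<le> max 0 C"
      using C z[of x] by (cases "norm x \<le> R") (auto simp: le_max_iff_disj)
  qed simp
qed

lemma conv_integrable:
  fixes f g :: "'a::euclidean_space \<Rightarrow> real"
  assumes "integrable lborel f" and c: "continuous_on UNIV g" and z: "\<And>x. norm x > R \<Longrightarrow> g x = 0"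
  shows "integrable lborel (\<lambda>y. f y * g (x - y))"
proof -
  obtain C where "\<And>x. \<bar>g x\<bar> \<le> C" using bounded_compact_support[OF c z] by blast
  moreover have "continuous_on UNIV (\<lambda>y. g (x - y))"
    by (rule continuous_on_compose2[OF c]) (auto intro!: continuous_intros)
  ultimately show ?thesis
    by (intro integrable_mult_bounded[OF assms(1)]) (auto intro: borel_measurable_continuous_onI)
qed

text \<open>
  The first order expansion of \<open>g\<close> is uniform because \<open>g\<close> has compact support. It can therefore be
  integrated against \<open>f\<close>, which is merely integrable.
\<close>
lemma conv_has_derivative:
  fixes f g :: "'a::euclidean_space \<Rightarrow> real"
  assumes f: "integrable lborel f" and c: "times_differentiable (Suc 0) g" and z: "\<And>x. norm x > R \<Longrightarrow> g x = 0"
  shows "((\<lambda>x. \<integral>y. f y * g (x - y) \<partial>lborel) has_derivative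
    (\<lambda>h. \<Sum>i\<in>Basis. (h \<bullet> i) * (\<integral>y. f y * frechet_derivative g (at (x - y)) i \<partial>lborel))) (at x)"
  unfolding has_derivative_at_alt
proof (intro conjI allI impI)
  let ?D = "\<lambda>x. frechet_derivative g (at x)"
  show "bounded_linear (\<lambda>h. \<Sum>i\<in>Basis. (h \<bullet> i) * (\<integral>y. f y * ?D (x - y) i \<partial>lborel))"
    by (intro bounded_linear_sum bounded_linear_mult_const bounded_linear_inner_left)
  have z': "?D x i = 0" if "norm x > R" for x i
  by (rule frechet_derivative_outside_support[OF z that])
  fix e :: real assume e: "0 < e"
  define I where "I = (\<integral>y. \<bar>f y\<bar> \<partial>lborel)"
  have I: "0 \<le> I" by (simp add: I_def)
  define e' where "e' = e / (I + 1)"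
  have e': "0 < e'" "e' * I \<le> e" using e I by (auto simp: e'_def field_simps)
  obtain d where d: "0 < d"
    "\<And>x h. norm h < d \<Longrightarrow> \<bar>g (x + h) - g x - (\<Sum>i\<in>Basis. (h \<bullet> i) * ?D x i)\<bar> \<le> e' * norm h"
    using uniform_differentiable_compact_support[OF c z e'(1)] by blast
  have ig: "integrable lborel (\<lambda>y. f y * g (x - y))" for x
    by (rule conv_integrable[OF f times_differentiable_continuous[OF c] z])
  have iD: "integrable lborel (\<lambda>y. f y * ?D (x - y) i)" if "i \<in> Basis" for i
    by (rule conv_integrable[OF f times_differentiable_continuous[OF times_differentiable_SucD(2)[OF c that]] z'])
  show "\<exists>d>0. \<forall>y. norm (y - x) < d \<longrightarrow>
       norm ((\<integral>u. f u * g (y - u) \<partial>lborel) - (\<integral>u. f u * g (x - u) \<partial>lborel) -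
          (\<Sum>i\<in>Basis. ((y - x) \<bullet> i) * (\<integral>u. f u * ?D (x - u) i \<partial>lborel))) \<le> e * norm (y - x)"
  proof (intro exI[of _ d] conjI allI impI d(1))
    fix y assume y: "norm (y - x) < d"
    let ?h = "y - x"
    have iS: "integrable lborel (\<lambda>u. f u * (\<Sum>i\<in>Basis. (?h \<bullet> i) * ?D (x - u) i))"
    proof -
      have "integrable lborel (\<lambda>u. \<Sum>i\<in>Basis. (?h \<bullet> i) * (f u * ?D (x - u) i))"
        using iD by auto
      then show ?thesis by (simp add: sum_distrib_left mult.left_commute)
    qed
    have "(\<integral>u. f u * g (y - u) \<partial>lborel) - (\<integral>u. f u * g (x - u) \<partial>lborel) -
          (\<Sum>i\<in>Basis. (?h \<bullet> i) * (\<integral>u. f u * ?D (x - u) i \<partial>lborel))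
       = (\<integral>u. f u * g (y - u) \<partial>lborel) - (\<integral>u. f u * g (x - u) \<partial>lborel) -
          (\<integral>u. f u * (\<Sum>i\<in>Basis. (?h \<bullet> i) * ?D (x - u) i) \<partial>lborel)"
    proof -
      have "(\<integral>u. f u * (\<Sum>i\<in>Basis. (?h \<bullet> i) * ?D (x - u) i) \<partial>lborel) =
        (\<integral>u. (\<Sum>i\<in>Basis. (?h \<bullet> i) * (f u * ?D (x - u) i)) \<partial>lborel)"
        by (simp add: sum_distrib_left mult.left_commute)
      also have "\<dots> = (\<Sum>i\<in>Basis. (\<integral>u. (?h \<bullet> i) * (f u * ?D (x - u) i) \<partial>lborel))"
        by (rule Bochner_Integration.integral_sum) (use iD in auto)
      also have "\<dots> = (\<Sum>i\<in>Basis. (?h \<bullet> i) * (\<integral>u. f u * ?D (x - u) i \<partial>lborel))"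
        by simp
      finally show ?thesis by simp
    qed
    also have "\<dots> = (\<integral>u. f u * g (y - u) - f u * g (x - u) - f u * (\<Sum>i\<in>Basis. (?h \<bullet> i) * ?D (x - u) i) \<partial>lborel)"
      using ig iS by simp
    also have "\<dots> = (\<integral>u. f u * (g ((x - u) + ?h) - g (x - u) - (\<Sum>i\<in>Basis. (?h \<bullet> i) * ?D (x - u) i)) \<partial>lborel)"
      by (intro Bochner_Integration.integral_cong) (auto simp: algebra_simps)
    also have "norm \<dots> \<le> (\<integral>u. \<bar>f u\<bar> * (e' * norm ?h) \<partial>lborel)"
    proof (rule order_trans[OF Bochner_Integration.integral_norm_bound Bochner_Integration.integral_mono])
      have "integrable lborel (\<lambda>u. f u * g (y - u) - f u * g (x - u) - f u * (\<Sum>i\<in>Basis. (?h \<bullet> i) * ?D (x - u) i))"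
        using ig iS by simp
      then have "integrable lborel (\<lambda>u. f u * (g ((x - u) + ?h) - g (x - u) - (\<Sum>i\<in>Basis. (?h \<bullet> i) * ?D (x - u) i)))"
        by (simp add: algebra_simps)
      then show "integrable lborel (\<lambda>u. norm (f u * (g ((x - u) + ?h) - g (x - u) - (\<Sum>i\<in>Basis. (?h \<bullet> i) * ?D (x - u) i))))"
        by (rule Bochner_Integration.integrable_norm)
      show "integrable lborel (\<lambda>u. \<bar>f u\<bar> * (e' * norm ?h))" using f by auto
      fix u
      show "norm (f u * (g (x - u + ?h) - g (x - u) - (\<Sum>i\<in>Basis. (?h \<bullet> i) * ?D (x - u) i))) \<le> \<bar>f u\<bar> * (e' * norm ?h)"
        using d(2)[OF y, of "x - u"] by (auto simp: abs_mult intro!: mult_left_mono)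
    qed
    also have "\<dots> = e' * I * norm ?h" by (simp add: I_def)
    also have "\<dots> \<le> e * norm ?h" using e' by (intro mult_right_mono) auto
    finally show "norm ((\<integral>u. f u * g (y - u) \<partial>lborel) - (\<integral>u. f u * g (x - u) \<partial>lborel) -
          (\<Sum>i\<in>Basis. (?h \<bullet> i) * (\<integral>u. f u * ?D (x - u) i \<partial>lborel))) \<le> e * norm ?h" .
  qed
qed

lemma conv_frechet:
  fixes f g :: "'a::euclidean_space \<Rightarrow> real"
  assumes f: "integrable lborel f" and c: "times_differentiable (Suc 0) g" and z: "\<And>x. norm x > R \<Longrightarrow> g x = 0"
    and i: "i \<in> Basis"
  shows "frechet_derivative (\<lambda>x. \<integral>y. f y * g (x - y) \<partial>lborel) (at x) i =
     (\<integral>y. f y * frechet_derivative g (at (x - y)) i \<partial>lborel)"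
proof -
  have "(\<Sum>j\<in>Basis. (i \<bullet> j) * F j) = F i" for F :: "'a \<Rightarrow> real"
    using i by (simp add: inner_Basis if_distrib[where f="\<lambda>x. x * _"] cong: if_cong)
  then show ?thesis using frechet_eq[OF conv_has_derivative[OF f c z]] by simp
qed

lemma times_differentiable_conv:
  fixes f g :: "'a::euclidean_space \<Rightarrow> real"
  assumes f: "integrable lborel f" and c: "\<And>k. times_differentiable k g" and z: "\<And>x. norm x > R \<Longrightarrow> g x = 0"
  shows "times_differentiable k (\<lambda>x. \<integral>y. f y * g (x - y) \<partial>lborel)"
  using c z
proof (induction k arbitrary: g)
  case 0
  show ?case
    using differentiable_imp_continuous_on conv_has_derivative[OF f 0(1) 0(2)]
    by (auto simp: differentiable_on_def differentiable_def intro!: has_derivative_continuous_on)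
next
  case (Suc k)
  note D = conv_has_derivative[OF f Suc.prems(1) Suc.prems(2)]
  show ?case
  proof (rule times_differentiable_Suc_I[OF D])
    fix i :: 'a assume i: "i \<in> Basis"
    have z': "frechet_derivative g (at x) i = 0" if "norm x > R" for x
    by (rule frechet_derivative_outside_support[OF Suc.prems(2) that])
    have "times_differentiable k (\<lambda>x. \<integral>y. f y * frechet_derivative g (at (x - y)) i \<partial>lborel)"
      by (rule Suc.IH[OF times_differentiable_SucD(2)[OF Suc.prems(1) i] z'])
    moreover have "(\<Sum>j\<in>Basis. (i \<bullet> j) * F j) = F i" for F :: "'a \<Rightarrow> real"
      using i by (simp add: inner_Basis if_distrib[where f="\<lambda>x. x * _"] cong: if_cong)
    ultimately show "times_differentiable k (\<lambda>x. \<Sum>j\<in>Basis. (i \<bullet> j) * (\<integral>y. f y * frechet_derivative g (at (x - y)) j \<partial>lborel))"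
      by simp
  qed
qed

section \<open>Approximation in the mean of order p\<close>

text \<open>
  Convexity of the power: its graph lies above the tangent at \<open>c\<close>. This replaces Jensen's
  inequality for the averages that occur in mollification.
\<close>
lemma powr_tangent:
  fixes a c p :: real
  assumes "1 \<le> p" "0 \<le> a" "0 \<le> c"
  shows "c powr p + p * c powr (p - 1) * (a - c) \<le> a powr p"
proof (cases "p = 1 \<or> c = 0")
  case True
  then show ?thesis using assms by auto
next
  case False
  then have p: "p > 1" and c: "c > 0" using assms by auto
  define q where "q = p / (p - 1)"
  have q: "q > 1" "1/p + 1/q = 1" using p by (auto simp: q_def field_simps)
  have "a * c powr (p - 1) \<le> a powr p / p + (c powr (p - 1)) powr q / q"
    by (rule Youngs_inequality[OF p q]) (use assms in auto)
  also have "(c powr (p - 1)) powr q = c powr p" using p by (simp add: powr_powr q_def)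
  finally have "p * (a * c powr (p - 1)) \<le> a powr p + (p - 1) * c powr p"
    using p by (simp add: q_def field_simps)
  moreover have "c powr p = c * c powr (p - 1)"
    using c by (simp add: powr_mult_base)
  ultimately show ?thesis by (simp add: algebra_simps)
qed

lemma powr_sum2:
  fixes a b p :: real
  assumes "1 \<le> p" "0 \<le> a" "0 \<le> b"
  shows "(a + b) powr p \<le> 2 powr p * (a powr p + b powr p)"
proof -
  have "(a + b) powr p \<le> (2 * max a b) powr p"
    by (rule powr_mono2) (use assms in auto)
  also have "\<dots> = 2 powr p * (max a b) powr p" using assms by (simp add: powr_mult)
  also have "\<dots> \<le> 2 powr p * (a powr p + b powr p)"
    by (intro mult_left_mono) (auto simp: max_def)
  finally show ?thesis .
qed

definition mollify :: "real \<Rightarrow> ('a::euclidean_space \<Rightarrow> real) \<Rightarrow> 'a \<Rightarrow> real" where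
  "mollify \<eta> f x = (\<integral>y. f y * mollifier \<eta> (x - y) \<partial>lborel)"

lemma times_differentiable_mollify:
  assumes "integrable lborel f" "0 < \<eta>"
  shows "times_differentiable k (mollify \<eta> f)"
  unfolding mollify_def[abs_def]
  by (rule times_differentiable_conv[where R=\<eta>]) (use assms in \<open>auto intro: times_differentiable_mollifier mollifier_zero\<close>)

lemma mollify_integrable:
  assumes "integrable lborel f" "0 < \<eta>"
  shows "integrable lborel (\<lambda>y. f y * mollifier \<eta> (x - y))"
  by (rule conv_integrable[where R=\<eta>])
    (use assms in \<open>auto intro: times_differentiable_continuous[OF times_differentiable_mollifier[of 0]] mollifier_zero\<close>)

lemma mollify_diff:
  assumes "integrable lborel f" "integrable lborel g" "0 < \<eta>"
  shows "mollify \<eta> (\<lambda>x. f x - g x) x = mollify \<eta> f x - mollify \<eta> g x"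
  using mollify_integrable[OF assms(1,3)] mollify_integrable[OF assms(2,3)]
  by (simp add: mollify_def algebra_simps)

lemma mollify_zero:
  assumes "0 < \<eta>" "\<And>y. norm (x - y) < \<eta> \<Longrightarrow> f y = 0"
  shows "mollify \<eta> f x = 0"
proof -
  have "f y * mollifier \<eta> (x - y) = 0" for y
    using assms mollifier_zero[OF assms(1), of "x - y"] by (cases "norm (x - y) < \<eta>") auto
  then have "(\<lambda>y. f y * mollifier \<eta> (x - y)) = (\<lambda>y. 0)" by (rule ext)
  then show ?thesis by (simp add: mollify_def)
qed

text \<open>
  A mollification is an average over a ball, so it inherits one-sided bounds that hold on that ball.
\<close>
lemma mollify_le:
  assumes "integrable lborel f" "0 < \<eta>" "\<And>y. norm (x - y) < \<eta> \<Longrightarrow> f y \<le> C"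
  shows "mollify \<eta> f x \<le> C"
proof -
  have "mollify \<eta> f x \<le> (\<integral>y. C * mollifier \<eta> (x - y) \<partial>lborel)"
    unfolding mollify_def
  proof (rule Bochner_Integration.integral_mono[OF mollify_integrable[OF assms(1,2)]])
    show "integrable lborel (\<lambda>y. C * mollifier \<eta> (x - y))"
      using integral_mollifier_shift(1)[OF assms(2), of x] by simp
    fix y
    show "f y * mollifier \<eta> (x - y) \<le> C * mollifier \<eta> (x - y)"
    proof (cases "norm (x - y) < \<eta>")
      case True
      then show ?thesis using assms(3) mollifier_nonneg[OF assms(2)] by (intro mult_right_mono) auto
    next
      case False
      then show ?thesis using mollifier_zero[OF assms(2), of "x - y"] by auto
    qed
  qed
  also have "\<dots> = C" using integral_mollifier_shift(2)[OF assms(2), of x] by simp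
  finally show ?thesis .
qed

lemma mollify_uminus: "mollify \<eta> (\<lambda>x. - f x) x = - mollify \<eta> f x"
  by (simp add: mollify_def)

lemma mollify_near:
  assumes "integrable lborel f" "0 < \<eta>" "\<And>y. norm (x - y) < \<eta> \<Longrightarrow> \<bar>f y - f x\<bar> \<le> e"
  shows "\<bar>mollify \<eta> f x - f x\<bar> \<le> e"
proof -
  have "mollify \<eta> f x \<le> f x + e"
    by (rule mollify_le[OF assms(1,2)]) (use assms(3) in \<open>force simp: abs_le_iff\<close>)
  moreover have "mollify \<eta> (\<lambda>y. - f y) x \<le> - f x + e"
    by (rule mollify_le[OF _ assms(2)]) (use assms(1,3) in \<open>force simp: abs_le_iff\<close>)+
  ultimately show ?thesis by (simp add: mollify_uminus)
qed

text \<open>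
  Integrate \<open>powr_tangent\<close>, with \<open>c\<close> the average of \<open>|f|\<close> near \<open>x\<close>, against the mollifier:
  the linear term drops out.
\<close>
lemma mollify_Jensen:
  fixes f :: "'a::euclidean_space \<Rightarrow> real"
  assumes p: "1 \<le> p" and f: "integrable lborel f" and fp: "integrable lborel (\<lambda>x. \<bar>f x\<bar> powr p)" and e: "0 < \<eta>"
  shows "\<bar>mollify \<eta> f x\<bar> powr p \<le> mollify \<eta> (\<lambda>x. \<bar>f x\<bar> powr p) x"
proof -
  have f': "integrable lborel (\<lambda>x. \<bar>f x\<bar>)" using f by simp
  define c where "c = mollify \<eta> (\<lambda>x. \<bar>f x\<bar>) x"
  have c: "0 \<le> c" unfolding c_def mollify_def
    by (rule Bochner_Integration.integral_nonneg) (simp add: mollifier_nonneg[OF e])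
  have "\<bar>mollify \<eta> f x\<bar> \<le> c"
    unfolding c_def mollify_def
    by (rule order_trans[OF integral_abs_bound]) (simp add: abs_mult mollifier_nonneg[OF e])
  then have "\<bar>mollify \<eta> f x\<bar> powr p \<le> c powr p" using p by (intro powr_mono2) auto
  also have "c powr p = (\<integral>y. (c powr p + p * c powr (p - 1) * (\<bar>f y\<bar> - c)) * mollifier \<eta> (x - y) \<partial>lborel)"
  proof -
    have "(\<integral>y. (c powr p + p * c powr (p - 1) * (\<bar>f y\<bar> - c)) * mollifier \<eta> (x - y) \<partial>lborel) =
      (\<integral>y. (c powr p - p * c powr (p - 1) * c) * mollifier \<eta> (x - y) + p * c powr (p - 1) * (\<bar>f y\<bar> * mollifier \<eta> (x - y)) \<partial>lborel)"
      by (intro Bochner_Integration.integral_cong) (auto simp: algebra_simps)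
    also have "\<dots> = (c powr p - p * c powr (p - 1) * c) * 1 + p * c powr (p - 1) * c"
      using integral_mollifier_shift[OF e, of x] mollify_integrable[OF f' e, of x]
      by (simp add: c_def mollify_def)
    finally show ?thesis by simp
  qed
  also have "\<dots> \<le> mollify \<eta> (\<lambda>x. \<bar>f x\<bar> powr p) x"
    unfolding mollify_def
  proof (rule Bochner_Integration.integral_mono)
    have "integrable lborel (\<lambda>y. (c powr p - p * c powr (p - 1) * c) * mollifier \<eta> (x - y) + p * c powr (p - 1) * (\<bar>f y\<bar> * mollifier \<eta> (x - y)))"
      using integral_mollifier_shift[OF e, of x] mollify_integrable[OF f' e, of x] by simp
    then show "integrable lborel (\<lambda>y. (c powr p + p * c powr (p - 1) * (\<bar>f y\<bar> - c)) * mollifier \<eta> (x - y))"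
      by (simp add: algebra_simps)
    show "integrable lborel (\<lambda>y. \<bar>f y\<bar> powr p * mollifier \<eta> (x - y))"
      by (rule mollify_integrable[OF fp e])
    fix y
    show "(c powr p + p * c powr (p - 1) * (\<bar>f y\<bar> - c)) * mollifier \<eta> (x - y) \<le> \<bar>f y\<bar> powr p * mollifier \<eta> (x - y)"
      by (intro mult_right_mono powr_tangent p c mollifier_nonneg e) auto
  qed
  finally show ?thesis .
qed

text \<open>
  Tonelli: mollification preserves the mass of a nonnegative function since every translate of the
  mollifier has integral \<open>1\<close>.
\<close>
lemma mollify_nonneg_integral:
  fixes f :: "'a::euclidean_space \<Rightarrow> real"
  assumes f: "integrable lborel f" and nn: "\<And>x. 0 \<le> f x" and e: "0 < \<eta>"
  shows "(\<integral>\<^sup>+x. ennreal (mollify \<eta> f x) \<partial>lborel) = (\<integral>\<^sup>+x. ennreal (f x) \<partial>lborel)"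
proof -
  have fm[measurable]: "f \<in> borel_measurable borel" using f by auto
  have mm[measurable]: "(mollifier \<eta> :: 'a \<Rightarrow> real) \<in> borel_measurable borel"
    using integral_mollifier(1)[OF e] by auto
  have "(\<integral>\<^sup>+x. ennreal (mollify \<eta> f x) \<partial>lborel) = (\<integral>\<^sup>+x. \<integral>\<^sup>+y. ennreal (f y * mollifier \<eta> (x - y)) \<partial>lborel \<partial>lborel)"
    unfolding mollify_def
    by (intro nn_integral_cong nn_integral_eq_integral[symmetric] mollify_integrable f e)
      (simp add: nn mollifier_nonneg e)
  also have "\<dots> = (\<integral>\<^sup>+y. \<integral>\<^sup>+x. ennreal (f y * mollifier \<eta> (x - y)) \<partial>lborel \<partial>lborel)"
    by (rule lborel_pair.Fubini'[symmetric]) simp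
  also have "\<dots> = (\<integral>\<^sup>+y. ennreal (f y) \<partial>lborel)"
  proof (intro nn_integral_cong)
    fix y :: 'a
    have "(\<integral>\<^sup>+x. ennreal (f y * mollifier \<eta> (x - y)) \<partial>lborel) = ennreal (\<integral>x. f y * mollifier \<eta> (x - y) \<partial>lborel)"
      by (rule nn_integral_eq_integral)
        (use integral_mollifier_shift(1)[OF e, of y] in \<open>auto simp: mollifier_minus[of _ _ y] nn mollifier_nonneg e\<close>)
    also have "(\<integral>x. f y * mollifier \<eta> (x - y) \<partial>lborel) = f y"
      using integral_mollifier_shift(2)[OF e, of y] by (simp add: mollifier_minus[of _ _ y])
    finally show "(\<integral>\<^sup>+x. ennreal (f y * mollifier \<eta> (x - y)) \<partial>lborel) = ennreal (f y)" .
  qed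
  finally show ?thesis .
qed

lemma mollify_Lp:
  fixes f :: "'a::euclidean_space \<Rightarrow> real"
  assumes p: "1 \<le> p" and f: "integrable lborel f" and fp: "integrable lborel (\<lambda>x. \<bar>f x\<bar> powr p)" and e: "0 < \<eta>"
  shows "integrable lborel (\<lambda>x. \<bar>mollify \<eta> f x\<bar> powr p)"
    "(\<integral>x. \<bar>mollify \<eta> f x\<bar> powr p \<partial>lborel) \<le> (\<integral>x. \<bar>f x\<bar> powr p \<partial>lborel)"
proof -
  have m: "(\<lambda>x. \<bar>mollify \<eta> f x\<bar> powr p) \<in> borel_measurable lborel"
    using borel_measurable_continuous_onI[OF times_differentiable_continuous[OF times_differentiable_mollify[OF f e, of 0]]]
    by measurable
  have "(\<integral>\<^sup>+x. ennreal (\<bar>mollify \<eta> f x\<bar> powr p) \<partial>lborel) \<le> (\<integral>\<^sup>+x. ennreal (mollify \<eta> (\<lambda>x. \<bar>f x\<bar> powr p) x) \<partial>lborel)"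
    by (intro nn_integral_mono ennreal_leI mollify_Jensen[OF p f fp e])
  also have "\<dots> = (\<integral>\<^sup>+x. ennreal (\<bar>f x\<bar> powr p) \<partial>lborel)"
    by (rule mollify_nonneg_integral[OF fp _ e]) simp
  also have "\<dots> = ennreal (\<integral>x. \<bar>f x\<bar> powr p \<partial>lborel)"
    by (rule nn_integral_eq_integral[OF fp]) simp
  finally have *: "(\<integral>\<^sup>+x. ennreal (\<bar>mollify \<eta> f x\<bar> powr p) \<partial>lborel) \<le> ennreal (\<integral>x. \<bar>f x\<bar> powr p \<partial>lborel)" .
  show i: "integrable lborel (\<lambda>x. \<bar>mollify \<eta> f x\<bar> powr p)"
    by (rule integrableI_nonneg[OF m]) (use * in \<open>auto simp: less_top[symmetric] top_unique\<close>)
  have "ennreal (\<integral>x. \<bar>mollify \<eta> f x\<bar> powr p \<partial>lborel) = (\<integral>\<^sup>+x. ennreal (\<bar>mollify \<eta> f x\<bar> powr p) \<partial>lborel)"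
    by (rule nn_integral_eq_integral[OF i, symmetric]) simp
  with * show "(\<integral>x. \<bar>mollify \<eta> f x\<bar> powr p \<partial>lborel) \<le> (\<integral>x. \<bar>f x\<bar> powr p \<partial>lborel)"
    by (metis ennreal_le_iff Bochner_Integration.integral_nonneg powr_ge_zero)
qed

lemma integrable_cball_const: "integrable lborel (\<lambda>x::'a::euclidean_space. C * indicator (cball 0 R) x :: real)"
  by (intro integrable_mult_right borel_integrable_compact[of "cball 0 R" "\<lambda>x. 1::real", simplified])

text \<open>
  Clip \<open>f\<close> to a large level \<open>M\<close>, approximate it pointwise by continuous functions, clip these too
  and cut them off outside the ball; both steps converge by domination.
\<close>
lemma continuous_dense_Lp:
  fixes f :: "'a::euclidean_space \<Rightarrow> real"
  assumes p: "1 \<le> p" and f: "f \<in> borel_measurable borel" and fp: "integrable lborel (\<lambda>x. \<bar>f x\<bar> powr p)"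
    and z: "\<And>x. norm x > R \<Longrightarrow> f x = 0" and e: "0 < e"
  obtains g where "continuous_on UNIV g" "\<And>x. norm x > R + 1 \<Longrightarrow> g x = 0"
    "integrable lborel (\<lambda>x. \<bar>f x - g x\<bar> powr p)" "(\<integral>x. \<bar>f x - g x\<bar> powr p \<partial>lborel) < e"
proof -
  note f[measurable]
  define cl where "cl M t = max (- real M) (min (real M) t)" for M :: nat and t :: real
  define e' where "e' = e / (2 * 2 powr p)"
  have e': "0 < e'" "2 powr p * e' = e / 2" using e by (auto simp: e'_def)
  have clm[measurable]: "cl M \<in> borel_measurable borel" for M
    unfolding cl_def by measurable
  have D1: "\<bar>f x - cl M (f x)\<bar> powr p \<le> \<bar>f x\<bar> powr p" for M x
    by (rule powr_mono2) (use p in \<open>auto simp: cl_def\<close>)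
  have "(\<lambda>M. \<integral>x. \<bar>f x - cl M (f x)\<bar> powr p \<partial>lborel) \<longlonglongrightarrow> integral\<^sup>L lborel (\<lambda>x::'a. 0::real)"
  proof (rule integral_dominated_convergence[OF _ _ fp])
    show "AE x in lborel. (\<lambda>M. \<bar>f x - cl M (f x)\<bar> powr p) \<longlonglongrightarrow> 0"
    proof (rule AE_I2)
      fix x
      obtain N :: nat where N: "\<bar>f x\<bar> \<le> real N" using real_arch_simple by blast
      have "\<forall>\<^sub>F M in sequentially. 0 = \<bar>f x - cl M (f x)\<bar> powr p"
        using eventually_ge_at_top[of N] by eventually_elim (use N in \<open>auto simp: cl_def\<close>)
      then show "(\<lambda>M. \<bar>f x - cl M (f x)\<bar> powr p) \<longlonglongrightarrow> 0"
        by (rule Lim_transform_eventually[OF tendsto_const])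
    qed
    show "AE x in lborel. norm (\<bar>f x - cl M (f x)\<bar> powr p) \<le> \<bar>f x\<bar> powr p" for M using D1 by simp
  qed measurable
  then have "\<forall>\<^sub>F M in sequentially. (\<integral>x. \<bar>f x - cl M (f x)\<bar> powr p \<partial>lborel) < e'"
    by (rule order_tendstoD(2)) (use e'(1) in simp)
  then obtain M where M: "(\<integral>x. \<bar>f x - cl M (f x)\<bar> powr p \<partial>lborel) < e'"
    by (auto simp: eventually_sequentially)
  have i1: "integrable lborel (\<lambda>x. \<bar>f x - cl M (f x)\<bar> powr p)"
    by (rule Bochner_Integration.integrable_bound[OF fp]) (use D1 in auto)
  have "f measurable_on UNIV"
    by (rule lebesgue_measurable_imp_measurable_on_real) (use f in \<open>auto intro: measurable_completion\<close>)
  then obtain N g where N: "negligible N" and g: "\<And>n. continuous_on UNIV (g n)"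
    and lim: "\<And>x. x \<notin> N \<Longrightarrow> (\<lambda>n. g n x) \<longlonglongrightarrow> f x"
    unfolding measurable_on_def by auto
  define cut where "cut x = max 0 (min 1 (R + 1 - norm x))" for x :: 'a
  define h where "h n x = cut x * cl M (g n x)" for n x
  have hc: "continuous_on UNIV (h n)" for n
    unfolding h_def cut_def cl_def by (intro continuous_intros g)
  have [measurable]: "h n \<in> borel_measurable borel" for n
    by (rule borel_measurable_continuous_onI[OF hc])
  have hz: "h n x = 0" if "norm x > R + 1" for n x using that by (simp add: h_def cut_def)
  have cut: "0 \<le> cut x" "cut x \<le> 1" "norm x \<le> R \<Longrightarrow> cut x = 1" for x by (auto simp: cut_def)
  have clb: "\<bar>cl M t\<bar> \<le> real M" for t by (auto simp: cl_def)
  have D2: "\<bar>cl M (f x) - h n x\<bar> powr p \<le> (2 * real M) powr p * indicator (cball 0 (R+1)) x" for n x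
  proof (cases "norm x \<le> R + 1")
    case True
    have "\<bar>h n x\<bar> \<le> 1 * real M" unfolding h_def abs_mult using cut clb by (intro mult_mono) auto
    then have "\<bar>cl M (f x) - h n x\<bar> \<le> 2 * real M" using clb[of "f x"] by linarith
    then have "\<bar>cl M (f x) - h n x\<bar> powr p \<le> (2 * real M) powr p" using p by (intro powr_mono2) auto
    then show ?thesis using True by simp
  next
    case False
    then have "f x = 0" using z by simp
    then show ?thesis using False hz by (simp add: cl_def)
  qed
  have dom: "integrable lborel (\<lambda>x::'a. (2 * real M) powr p * indicator (cball 0 (R+1)) x)"
    by (rule integrable_cball_const)
  have "(\<lambda>n. \<integral>x. \<bar>cl M (f x) - h n x\<bar> powr p \<partial>lborel) \<longlonglongrightarrow> integral\<^sup>L lborel (\<lambda>x::'a. 0::real)"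
  proof (rule integral_dominated_convergence[OF _ _ dom])
    have "AE x in lebesgue. x \<notin> N" using N by (simp add: AE_not_in negligible_iff_null_sets)
    then have "AE x in lborel. x \<notin> N" by (simp add: AE_completion_iff)
    then show "AE x in lborel. (\<lambda>n. \<bar>cl M (f x) - h n x\<bar> powr p) \<longlonglongrightarrow> 0"
    proof eventually_elim
      case (elim x)
      have eq: "cl M (f x) = cut x * cl M (f x)"
        using cut(3)[of x] z[of x] by (cases "norm x \<le> R") (auto simp: cl_def)
      have "(\<lambda>n. h n x) \<longlonglongrightarrow> cut x * cl M (f x)"
        unfolding h_def cl_def by (intro tendsto_intros lim elim)
      then have "(\<lambda>n. h n x) \<longlonglongrightarrow> cl M (f x)" by (subst eq)
      then have "(\<lambda>n. \<bar>cl M (f x) - h n x\<bar>) \<longlonglongrightarrow> \<bar>cl M (f x) - cl M (f x)\<bar>"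
        by (intro tendsto_intros)
      then have "(\<lambda>n. \<bar>cl M (f x) - h n x\<bar>) \<longlonglongrightarrow> 0" by simp
      then show ?case using p by (intro tendsto_zero_powrI[OF _ tendsto_const]) auto
    qed
    show "AE x in lborel. norm (\<bar>cl M (f x) - h n x\<bar> powr p) \<le> (2 * real M) powr p * indicator (cball 0 (R+1)) x" for n
      using D2 by simp
  qed measurable
  then have "\<forall>\<^sub>F n in sequentially. (\<integral>x. \<bar>cl M (f x) - h n x\<bar> powr p \<partial>lborel) < e'"
    by (rule order_tendstoD(2)) (use e'(1) in simp)
  then obtain n where n: "(\<integral>x. \<bar>cl M (f x) - h n x\<bar> powr p \<partial>lborel) < e'"
    by (auto simp: eventually_sequentially)
  have i2: "integrable lborel (\<lambda>x. \<bar>cl M (f x) - h n x\<bar> powr p)"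
    by (rule Bochner_Integration.integrable_bound[OF dom]) (use D2 in auto)
  have le: "\<bar>f x - h n x\<bar> powr p \<le> 2 powr p * (\<bar>f x - cl M (f x)\<bar> powr p + \<bar>cl M (f x) - h n x\<bar> powr p)" for x
  proof -
    have "\<bar>f x - h n x\<bar> powr p \<le> (\<bar>f x - cl M (f x)\<bar> + \<bar>cl M (f x) - h n x\<bar>) powr p"
      by (rule powr_mono2) (use p in auto)
    also have "\<dots> \<le> 2 powr p * (\<bar>f x - cl M (f x)\<bar> powr p + \<bar>cl M (f x) - h n x\<bar> powr p)"
      by (rule powr_sum2) (use p in auto)
    finally show ?thesis .
  qed
  have i3: "integrable lborel (\<lambda>x. 2 powr p * (\<bar>f x - cl M (f x)\<bar> powr p + \<bar>cl M (f x) - h n x\<bar> powr p))"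
    using i1 i2 by simp
  show ?thesis
  proof (rule that[OF hc hz])
    show i4: "integrable lborel (\<lambda>x. \<bar>f x - h n x\<bar> powr p)"
      by (rule Bochner_Integration.integrable_bound[OF i3]) (use le in auto)
    have "(\<integral>x. \<bar>f x - h n x\<bar> powr p \<partial>lborel) \<le> (\<integral>x. 2 powr p * (\<bar>f x - cl M (f x)\<bar> powr p + \<bar>cl M (f x) - h n x\<bar> powr p) \<partial>lborel)"
      by (rule Bochner_Integration.integral_mono[OF i4 i3 le])
    also have "\<dots> = 2 powr p * ((\<integral>x. \<bar>f x - cl M (f x)\<bar> powr p \<partial>lborel) + (\<integral>x. \<bar>cl M (f x) - h n x\<bar> powr p \<partial>lborel))"
      using i1 i2 by simp
    also have "\<dots> < 2 powr p * (e' + e')" using M n by (intro mult_strict_left_mono) auto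
    also have "\<dots> = e" using e'(2) by (simp add: distrib_left)
    finally show "(\<integral>x. \<bar>f x - h n x\<bar> powr p \<partial>lborel) < e" .
  qed
qed

lemma compact_support_integrable_powr:
  fixes f :: "'a::euclidean_space \<Rightarrow> real"
  assumes p: "1 \<le> p" and f: "f \<in> borel_measurable borel" and fp: "integrable lborel (\<lambda>x. \<bar>f x\<bar> powr p)"
    and z: "\<And>x. norm x > R \<Longrightarrow> f x = 0"
  shows "integrable lborel f"
proof (rule Bochner_Integration.integrable_bound)
  show "integrable lborel (\<lambda>x. 1 * indicator (cball 0 R) x + \<bar>f x\<bar> powr p)"
    by (rule Bochner_Integration.integrable_add[OF integrable_cball_const fp])
  have "\<bar>f x\<bar> \<le> 1 * indicator (cball 0 R) x + \<bar>f x\<bar> powr p" for x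
  proof (cases "norm x \<le> R")
    case True
    have "\<bar>f x\<bar> \<le> 1 + \<bar>f x\<bar> powr p"
    proof (cases "\<bar>f x\<bar> \<le> 1")
      case False
      then have "\<bar>f x\<bar> powr 1 \<le> \<bar>f x\<bar> powr p" using p by (intro powr_mono) auto
      then show ?thesis using False by simp
    qed (smt (verit) powr_ge_zero)
    then show ?thesis using True by simp
  qed (use z in auto)
  then show "AE x in lborel. norm (f x) \<le> norm (1 * indicator (cball 0 R) x + \<bar>f x\<bar> powr p)"
    by (intro AE_I2) (smt (verit) real_norm_def)
  show "f \<in> borel_measurable lborel" using f by simp
qed

text \<open>
  For continuous \<open>g\<close> with compact support the mollifications converge uniformly. Such \<open>g\<close> are
  dense, and mollification is a contraction in the \<open>p\<close>-th mean, so the error made in replacing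
  \<open>f\<close> by \<open>g\<close> does not grow under mollification.
\<close>
lemma mollify_tendsto_Lp:
  fixes f :: "'a::euclidean_space \<Rightarrow> real"
  assumes p: "1 \<le> p" and f: "f \<in> borel_measurable borel" and fp: "integrable lborel (\<lambda>x. \<bar>f x\<bar> powr p)"
    and z: "\<And>x. norm x > R \<Longrightarrow> f x = 0"
  shows "\<And>\<eta>. 0 < \<eta> \<Longrightarrow> integrable lborel (\<lambda>x. \<bar>mollify \<eta> f x - f x\<bar> powr p)"
    "((\<lambda>\<eta>. \<integral>x. \<bar>mollify \<eta> f x - f x\<bar> powr p \<partial>lborel) \<longlongrightarrow> 0) (at_right 0)"
proof -
  note f[measurable]
  have fi: "integrable lborel f" by (rule compact_support_integrable_powr[OF p f fp z])
  have mm[measurable]: "mollify \<eta> f \<in> borel_measurable borel" if "0 < \<eta>" for \<eta>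
    by (rule borel_measurable_continuous_onI[OF times_differentiable_continuous[OF times_differentiable_mollify[OF fi that, of 0]]])
  have sum2: "\<bar>a - c\<bar> powr p \<le> 2 powr p * (\<bar>a - b\<bar> powr p + \<bar>b - c\<bar> powr p)" for a b c :: real
  proof -
    have "\<bar>a - c\<bar> powr p \<le> (\<bar>a - b\<bar> + \<bar>b - c\<bar>) powr p" by (rule powr_mono2) (use p in auto)
    also have "\<dots> \<le> 2 powr p * (\<bar>a - b\<bar> powr p + \<bar>b - c\<bar> powr p)" by (rule powr_sum2) (use p in auto)
    finally show ?thesis .
  qed
  show I: "integrable lborel (\<lambda>x. \<bar>mollify \<eta> f x - f x\<bar> powr p)" if e: "0 < \<eta>" for \<eta>
  proof (rule Bochner_Integration.integrable_bound)
    show "integrable lborel (\<lambda>x. 2 powr p * (\<bar>mollify \<eta> f x\<bar> powr p + \<bar>f x\<bar> powr p))"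
      using mollify_Lp(1)[OF p fi fp e] fp by simp
    show "AE x in lborel. norm (\<bar>mollify \<eta> f x - f x\<bar> powr p) \<le> norm (2 powr p * (\<bar>mollify \<eta> f x\<bar> powr p + \<bar>f x\<bar> powr p))"
      using sum2[of _ _ 0] by simp
    show "(\<lambda>x. \<bar>mollify \<eta> f x - f x\<bar> powr p) \<in> borel_measurable lborel" using mm[OF e] by measurable
  qed
  show "((\<lambda>\<eta>. \<integral>x. \<bar>mollify \<eta> f x - f x\<bar> powr p \<partial>lborel) \<longlongrightarrow> 0) (at_right 0)"
  proof (rule tendstoI)
    fix e :: real assume e: "0 < e"
    define k where "k = 2 powr p * (1 + 2 powr p)"
    have k: "0 < k" by (simp add: k_def add_pos_pos)
    obtain g where g: "continuous_on UNIV g" "\<And>x. norm x > R + 1 \<Longrightarrow> g x = 0"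
      "integrable lborel (\<lambda>x. \<bar>f x - g x\<bar> powr p)" "(\<integral>x. \<bar>f x - g x\<bar> powr p \<partial>lborel) < e / (2 * k)"
      using continuous_dense_Lp[OF p f fp z, of R "e / (2 * k)"] e k by auto
    have gi: "integrable lborel g"
      by (rule integrable_compact_support[OF g(1) compact_cball[of 0 "R+1"]]) (use g(2) in auto)
    define V where "V = integral\<^sup>L lborel (\<lambda>x::'a. indicator (cball 0 (R+2)) x :: real)"
    have V: "0 \<le> V" unfolding V_def by (rule Bochner_Integration.integral_nonneg) auto
    define s where "s = (e / (4 * k * (V + 1))) powr (1/p)"
    have s: "0 < s" "s powr p = e / (4 * k * (V + 1))" using e k V p by (auto simp: s_def powr_powr)
    obtain d where d: "0 < d" "\<And>x y. norm (y - x) < d \<Longrightarrow> \<bar>g y - g x\<bar> < s"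
      using uniformly_continuous_compact_support[OF g(1,2) s(1)] by blast
    have "(\<integral>x. \<bar>mollify \<eta> f x - f x\<bar> powr p \<partial>lborel) < e" if eta: "0 < \<eta>" "\<eta> < min d 1" for \<eta>
    proof -
      have mg: "mollify \<eta> f x - mollify \<eta> g x = mollify \<eta> (\<lambda>x. f x - g x) x" for x
        using mollify_diff[OF fi gi eta(1)] by simp
      have B: "\<bar>mollify \<eta> g x - g x\<bar> powr p \<le> s powr p * indicator (cball 0 (R+2)) x" for x
      proof (cases "norm x \<le> R + 2")
        case True
        have "\<bar>mollify \<eta> g x - g x\<bar> \<le> s"
          by (rule mollify_near[OF gi eta(1)]) (use d(2)[of _ x] eta(2) in \<open>force simp: norm_minus_commute less_imp_le\<close>)
        then have "\<bar>mollify \<eta> g x - g x\<bar> powr p \<le> s powr p" using p by (intro powr_mono2) auto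
        then show ?thesis using True by simp
      next
        case False
        have "mollify \<eta> g x = 0"
        proof (rule mollify_zero[OF eta(1)])
          fix y assume "norm (x - y) < \<eta>"
          moreover have "norm x \<le> norm y + norm (x - y)" by norm
          ultimately show "g y = 0" using g(2) eta(2) False by auto
        qed
        then show ?thesis using g(2) False by simp
      qed
      have ib: "integrable lborel (\<lambda>x::'a. s powr p * indicator (cball 0 (R+2)) x)" by (rule integrable_cball_const)
      have ic: "integrable lborel (\<lambda>x. \<bar>mollify \<eta> f x - mollify \<eta> g x\<bar> powr p)"
        unfolding mg by (rule mollify_Lp(1)[OF p _ g(3) eta(1)]) (use fi gi in simp)
      have c: "(\<integral>x. \<bar>mollify \<eta> f x - mollify \<eta> g x\<bar> powr p \<partial>lborel) \<le> (\<integral>x. \<bar>f x - g x\<bar> powr p \<partial>lborel)"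
        unfolding mg by (rule mollify_Lp(2)[OF p _ g(3) eta(1)]) (use fi gi in simp)
      have g3: "integrable lborel (\<lambda>x. \<bar>g x - f x\<bar> powr p)" using g(3) by (simp add: abs_minus_commute)
      have pw: "\<bar>mollify \<eta> f x - f x\<bar> powr p \<le> 2 powr p * (\<bar>mollify \<eta> f x - mollify \<eta> g x\<bar> powr p
          + 2 powr p * (s powr p * indicator (cball 0 (R+2)) x + \<bar>g x - f x\<bar> powr p))" for x
        by (rule order_trans[OF sum2[of "mollify \<eta> f x" "f x" "mollify \<eta> g x"]])
          (intro mult_left_mono add_left_mono order_trans[OF sum2[of "mollify \<eta> g x" "f x" "g x"]] add_right_mono B; simp)
      have "(\<integral>x. \<bar>mollify \<eta> f x - f x\<bar> powr p \<partial>lborel) \<le> (\<integral>x. 2 powr p * (\<bar>mollify \<eta> f x - mollify \<eta> g x\<bar> powr p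
          + 2 powr p * (s powr p * indicator (cball 0 (R+2)) x + \<bar>g x - f x\<bar> powr p)) \<partial>lborel)"
        by (rule Bochner_Integration.integral_mono[OF I[OF eta(1)] _ pw]) (use ib ic g3 in simp)
      also have "\<dots> = 2 powr p * ((\<integral>x. \<bar>mollify \<eta> f x - mollify \<eta> g x\<bar> powr p \<partial>lborel)
          + 2 powr p * (s powr p * V + (\<integral>x. \<bar>g x - f x\<bar> powr p \<partial>lborel)))"
        using ib ic g3 unfolding V_def by simp
      also have "\<dots> \<le> 2 powr p * (e / (2 * k) + 2 powr p * (s powr p * V + e / (2 * k)))"
        by (intro mult_left_mono add_mono order_trans[OF c]) (use g(4) in \<open>auto simp: abs_minus_commute\<close>)
      also have "\<dots> = e / 2 + 2 powr p * 2 powr p * (s powr p * V)"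
      proof -
        have "2 powr p * (E + 2 powr p * (X + E)) = k * E + 2 powr p * 2 powr p * X" for E X :: real
          unfolding k_def by algebra
        moreover have "k * (e / (2 * k)) = e / 2" using k by simp
        ultimately show ?thesis by presburger
      qed
      also have "\<dots> \<le> e / 2 + k * (s powr p * V)"
        using V by (intro add_left_mono mult_right_mono) (auto simp: k_def algebra_simps)
      also have "\<dots> \<le> e / 2 + k * (s powr p * (V + 1))"
        using k by (intro add_left_mono mult_left_mono) auto
      also have "\<dots> = e / 2 + e / 4"
      proof -
        have "k * (V + 1) \<noteq> 0" using k V by auto
        then have "k * (e / (4 * (k * (V + 1))) * (V + 1)) = e / 4" by (simp add: divide_simps)
        then show ?thesis by (simp add: s(2) mult.assoc)
      qed
      also have "\<dots> < e" using e by simp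
      finally show ?thesis .
    qed
    moreover have "0 \<le> (\<integral>x. \<bar>mollify \<eta> f x - f x\<bar> powr p \<partial>lborel)" for \<eta>
      by (rule Bochner_Integration.integral_nonneg) simp
    ultimately show "\<forall>\<^sub>F \<eta> in at_right 0. dist (\<integral>x. \<bar>mollify \<eta> f x - f x\<bar> powr p \<partial>lborel) 0 < e"
      unfolding eventually_at_right_field using d(1)
      by (intro exI[of _ "min d 1"]) (auto simp: dist_real_def)
  qed
qed

section \<open>Integration by parts for locally Lipschitz functions\<close>

text \<open>
  The neighbourhoods are relative to \<open>S\<close>, so that the notion also applies to functions on compact
  intervals; there and on compact subsets of open sets it is a global Lipschitz bound.
\<close>
definition loc_lipschitz :: "'a::metric_space set \<Rightarrow> ('a \<Rightarrow> 'b::metric_space) \<Rightarrow> bool" where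
  "loc_lipschitz S f \<longleftrightarrow> (\<forall>x\<in>S. \<exists>u>0. \<exists>L. L-lipschitz_on (cball x u \<inter> S) f)"

lemma loc_lipschitz_compact:
  assumes "loc_lipschitz S f" "compact K" "K \<subseteq> S"
  obtains L where "L-lipschitz_on K f"
proof -
  have "local_lipschitz {0::real} K (\<lambda>_. f)"
  proof (rule local_lipschitzI)
    fix t :: real and x assume "x \<in> K"
    then obtain u L where "u > 0" "L-lipschitz_on (cball x u \<inter> S) f"
      using assms(1,3) unfolding loc_lipschitz_def by blast
    then show "\<exists>u>0. \<exists>L. \<forall>t\<in>cball t u \<inter> {0::real}. L-lipschitz_on (cball x u \<inter> K) f"
      using assms(3) by (meson Int_mono lipschitz_on_subset order_refl)
  qed
  from local_lipschitz_compact_implies_lipschitz[OF this assms(2) compact_sing] that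
  show thesis by (metis continuous_on_const insertI1)
qed

lemma loc_lipschitz_continuous: "loc_lipschitz S f \<Longrightarrow> open S \<Longrightarrow> continuous_on S f"
proof (rule continuous_at_imp_continuous_on, rule ballI)
  fix x assume "loc_lipschitz S f" "open S" and x: "x \<in> S"
  then obtain u L where u: "u > 0" "L-lipschitz_on (cball x u \<inter> S) f"
    unfolding loc_lipschitz_def by blast
  have "continuous_on (ball x u \<inter> S) f"
    using lipschitz_on_continuous_on[OF u(2)] by (rule continuous_on_subset) auto
  then show "isCont f x"
    by (rule continuous_on_interior) (use \<open>open S\<close> x u(1) in \<open>simp add: interior_open\<close>)
qed

lemma gradient_inner: "i \<in> Basis \<Longrightarrow> gradient f x \<bullet> i = frechet_derivative f (at x) i"
  unfolding gradient_def by (simp add: inner_sum_left inner_Basis if_distrib cong: if_cong)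

lemma inner_gradient: "X \<bullet> gradient f x = (\<Sum>i\<in>Basis. (X \<bullet> i) * frechet_derivative f (at x) i)"
  by (subst euclidean_inner) (simp add: gradient_inner)

lemma test_functionsD:
  assumes "\<phi> \<in> test_functions \<Omega>"
  shows "times_differentiable k \<phi>" "compact (closure {x. \<phi> x \<noteq> 0})" "closure {x. \<phi> x \<noteq> 0} \<subseteq> \<Omega>"
    "\<phi> x \<noteq> 0 \<Longrightarrow> x \<in> closure {x. \<phi> x \<noteq> 0}"
  using assms closure_subset[of "{x. \<phi> x \<noteq> 0}"] unfolding test_functions_def by auto

lemma frechet_derivative_outside_closure:
  fixes \<phi> :: "'a::euclidean_space \<Rightarrow> real"
  assumes "x \<notin> closure {x. \<phi> x \<noteq> 0}"
  shows "frechet_derivative \<phi> (at x) i = 0"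
proof -
  define S where "S = - closure {x. \<phi> x \<noteq> 0}"
  have S: "open S" "x \<in> S" "\<And>y. y \<in> S \<Longrightarrow> 0 = \<phi> y"
    using assms closure_subset[of "{x. \<phi> x \<noteq> 0}"] unfolding S_def by auto
  have "(\<phi> has_derivative (\<lambda>h. 0)) (at x)"
    by (rule has_derivative_transform_within_open[OF has_derivative_const S])
  from frechet_eq[OF this] show ?thesis by simp
qed

text \<open>
  The integrals of the difference quotients vanish by translation invariance, and the Lipschitz bound
  dominates them. The derivative is only an almost everywhere limit, and its measurability is not
  clear from the assumption; the conclusion therefore speaks of a measurable version \<open>d'\<close>.
\<close>
lemma integral_directional_derivative_eq_0:
  fixes \<psi> :: "'a::euclidean_space \<Rightarrow> real"
  assumes c: "continuous_on UNIV \<psi>" and z: "\<And>x. norm x > R \<Longrightarrow> \<psi> x = 0"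
    and L: "\<And>x h. norm h \<le> 1 \<Longrightarrow> \<bar>\<psi> (x + h) - \<psi> x\<bar> \<le> L * norm h"
    and d: "AE x in lborel. (\<psi> has_derivative D x) (at x)" and i: "norm i = 1"
  obtains d' where "integrable lborel d'" "integral\<^sup>L lborel d' = 0" "AE x in lborel. d' x = D x i"
proof -
  define t where "t n = 1 / real (Suc n)" for n
  have t: "0 < t n" "t n \<le> 1" for n by (auto simp: t_def)
  have t0: "t \<longlonglongrightarrow> 0" unfolding t_def by (rule LIMSEQ_inverse_real_of_nat[unfolded inverse_eq_divide])
  have int: "integrable lborel \<psi>"
    by (rule integrable_compact_support[OF c compact_cball[of 0 R]]) (use z in auto)
  have [measurable]: "\<psi> \<in> borel_measurable borel" by (rule borel_measurable_continuous_onI[OF c])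
  define q where "q n x = (\<psi> (x + t n *\<^sub>R i) - \<psi> x) / t n" for n x
  have sh: "integrable lborel (\<lambda>x. \<psi> (x + t n *\<^sub>R i))" "(\<integral>x. \<psi> (x + t n *\<^sub>R i) \<partial>lborel) = integral\<^sup>L lborel \<psi>" for n
  proof -
    have d: "distr lborel borel ((+) (t n *\<^sub>R i)) = (lborel :: 'a measure)" by (rule lborel_distr_plus)
    show "integrable lborel (\<lambda>x. \<psi> (x + t n *\<^sub>R i))"
      using int integrable_distr_eq[of "(+) (t n *\<^sub>R i)" lborel borel \<psi>] d by (auto simp: add.commute)
    show "(\<integral>x. \<psi> (x + t n *\<^sub>R i) \<partial>lborel) = integral\<^sup>L lborel \<psi>"
      using integral_distr[of "(+) (t n *\<^sub>R i)" lborel borel \<psi>] d by (auto simp: add.commute)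
  qed
  have q0: "integral\<^sup>L lborel (q n) = 0" for n
    using sh[of n] int unfolding q_def by simp
  have qm[measurable]: "q n \<in> borel_measurable borel" for n unfolding q_def by measurable
  define d' where "d' x = lim (\<lambda>n. q n x)" for x
  have dm: "d' \<in> borel_measurable lborel" unfolding d'_def by measurable
  have conv: "AE x in lborel. (\<lambda>n. q n x) \<longlonglongrightarrow> D x i"
    using d
  proof eventually_elim
    case (elim x)
    have "((\<lambda>t. (\<psi> (x + t *\<^sub>R i) - \<psi> x) / t) \<longlongrightarrow> D x i) (at 0)"
    proof -
      have "((\<lambda>t. \<psi> (x + t *\<^sub>R i)) has_derivative (\<lambda>s. D x (s *\<^sub>R i))) (at 0)"
        by (rule has_derivative_compose[where g=\<psi>]) (use elim in \<open>auto intro!: derivative_eq_intros\<close>)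
      moreover have "D x (s *\<^sub>R i) = D x i * s" for s
        using has_derivative_linear[OF elim] by (simp add: linear_scale)
      ultimately have "((\<lambda>t. \<psi> (x + t *\<^sub>R i)) has_real_derivative D x i) (at 0)"
        by (simp add: has_field_derivative_def)
      then show ?thesis by (simp add: DERIV_def)
    qed
    moreover have "filterlim t (at 0) sequentially"
      using t0 t by (auto simp: filterlim_at less_imp_neq[symmetric])
    ultimately show ?case unfolding q_def by (rule filterlim_compose)
  qed
  have eq: "AE x in lborel. d' x = D x i"
    using conv by eventually_elim (auto simp: d'_def limI)
  have conv': "AE x in lborel. (\<lambda>n. q n x) \<longlonglongrightarrow> d' x"
    using conv eq by eventually_elim simp
  have bd: "AE x in lborel. norm (q n x) \<le> L * indicator (cball 0 (R+1)) x" for n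
  proof (rule AE_I2)
    fix x :: 'a
    show "norm (q n x) \<le> L * indicator (cball 0 (R+1)) x"
    proof (cases "norm x \<le> R + 1")
      case True
      have "\<bar>\<psi> (x + t n *\<^sub>R i) - \<psi> x\<bar> \<le> L * t n"
        using L[of "t n *\<^sub>R i" x] t[of n] i by simp
      then show ?thesis using True t[of n] by (simp add: q_def abs_divide divide_le_eq)
    next
      case False
      have "norm (x + t n *\<^sub>R i) \<ge> norm x - norm (t n *\<^sub>R i)" by (rule norm_diff_ineq)
      then have "norm (x + t n *\<^sub>R i) > R" using False t[of n] i by simp
      then show ?thesis using z False by (simp add: q_def)
    qed
  qed
  have "(\<lambda>n. integral\<^sup>L lborel (q n)) \<longlonglongrightarrow> integral\<^sup>L lborel d'"
    by (rule integral_dominated_convergence[OF dm _ integrable_cball_const conv' bd]) measurable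
  then have "integral\<^sup>L lborel d' = 0" unfolding q0 using LIMSEQ_unique tendsto_const by blast
  moreover have "integrable lborel d'"
    by (rule integrable_dominated_convergence[OF dm _ integrable_cball_const conv' bd]) measurable
  ultimately show thesis using that eq by blast
qed

text \<open>
  The product \<open>w \<phi>\<close>, extended by zero, is Lipschitz with compact support, so the previous lemma
  applies to it. Differentiability almost everywhere is an assumption, which the functions treated
  below satisfy by inspection; Rademacher's theorem is avoided in this way.
\<close>
lemma integration_by_parts:
  fixes w \<phi> :: "'a::euclidean_space \<Rightarrow> real"
  assumes op: "open \<Omega>" and w: "loc_lipschitz \<Omega> w" and phi: "\<phi> \<in> test_functions \<Omega>" and i: "i \<in> Basis"
    and d: "AE x in lborel. x \<in> \<Omega> \<longrightarrow> (w has_derivative W x) (at x)"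
  obtains d' where "integrable lborel d'" "integral\<^sup>L lborel d' = 0"
    "AE x in lborel. d' x = (if x \<in> \<Omega> then W x i * \<phi> x + w x * frechet_derivative \<phi> (at x) i else 0)"
proof -
  define KK where "KK = closure {x. \<phi> x \<noteq> 0}"
  have K: "compact KK" "KK \<subseteq> \<Omega>" using test_functionsD(2,3)[OF phi] by (simp_all add: KK_def)
  note D = times_differentiable_SucD(1)[OF test_functionsD(1)[OF phi]]
  have cphi: "continuous_on UNIV \<phi>" by (rule times_differentiable_continuous[OF test_functionsD(1)[OF phi]])
  have z0: "\<phi> x = 0" if "x \<notin> KK" for x using that closure_subset[of "{x. \<phi> x \<noteq> 0}"] by (auto simp: KK_def)
  obtain R where R: "\<And>x. x \<in> KK \<Longrightarrow> norm x \<le> R" using compact_imp_bounded[OF K(1)] unfolding bounded_iff by blast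
  have phiR: "\<phi> x = 0" if "norm x > R" for x using z0[of x] R[of x] that by linarith
  obtain e where e: "e > 0" "(\<Union>x\<in>KK. cball x e) \<subseteq> \<Omega>"
    using compact_subset_open_imp_cball_epsilon_subset[OF K(1) op K(2)] by blast
  define K' where "K' = {x + y | x y. x \<in> KK \<and> y \<in> cball 0 e}"
  have K'eq: "K' = (\<Union>x\<in>KK. cball x e)"
  proof -
    have "z \<in> K'" if "x \<in> KK" "z \<in> cball x e" for x z
      unfolding K'_def using that by (intro CollectI exI[of _ x] exI[of _ "z - x"]) (auto simp: dist_norm norm_minus_commute)
    moreover have "K' \<subseteq> (\<Union>x\<in>KK. cball x e)" unfolding K'_def by (force simp: dist_norm)
    ultimately show ?thesis by blast
  qed
  have K': "compact K'" "K' \<subseteq> \<Omega>" using compact_sums[OF K(1) compact_cball[of 0 e]] e K'eq by (auto simp: K'_def)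
  obtain Lw where Lw: "Lw-lipschitz_on K' w" using loc_lipschitz_compact[OF w K'] by blast
  have Lw0: "0 \<le> Lw" using Lw by (rule lipschitz_on_nonneg)
  have "bounded (w ` K')"
    by (intro compact_imp_bounded compact_continuous_image K' continuous_on_subset[OF loc_lipschitz_continuous[OF w op]])
  then obtain Mw where Mw: "\<And>x. x \<in> K' \<Longrightarrow> \<bar>w x\<bar> \<le> Mw" by (auto simp: bounded_iff)
  obtain Mp where Mp: "0 \<le> Mp" "\<And>x. \<bar>\<phi> x\<bar> \<le> Mp" using bounded_compact_support[OF cphi phiR] by blast
  \<comment> \<open>the partial derivatives are bounded, so the mean value theorem gives a global Lipschitz constant\<close>
  have "\<exists>Lp\<ge>0. \<forall>x y. \<bar>\<phi> x - \<phi> y\<bar> \<le> Lp * norm (x - y)"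
  proof -
    have "\<exists>C. \<forall>x. \<bar>frechet_derivative \<phi> (at x) j\<bar> \<le> C" if "j \<in> Basis" for j
    proof -
      have c: "continuous_on UNIV (\<lambda>x. frechet_derivative \<phi> (at x) j)"
        by (rule times_differentiable_continuous[OF times_differentiable_SucD(2)[OF test_functionsD(1)[OF phi, of "Suc 0"] that]])
      have z: "frechet_derivative \<phi> (at x) j = 0" if "norm x > R" for x
        by (rule frechet_derivative_outside_support[OF phiR that])
      show ?thesis using bounded_compact_support[OF c z] by blast
    qed
    then obtain C where C: "\<And>j x. j \<in> Basis \<Longrightarrow> \<bar>frechet_derivative \<phi> (at x) j\<bar> \<le> C j" by metis
    define Lp where "Lp = (\<Sum>j\<in>Basis. C j)"
    have C0: "0 \<le> C j" if "j \<in> Basis" for j using C[OF that, of 0] by linarith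
    have "onorm (frechet_derivative \<phi> (at x)) \<le> Lp" for x
    proof (rule onorm_le)
      fix h :: 'a
      have "linear (frechet_derivative \<phi> (at x))" using D has_derivative_linear by blast
      then have "frechet_derivative \<phi> (at x) (\<Sum>j\<in>Basis. (h \<bullet> j) *\<^sub>R j) = (\<Sum>j\<in>Basis. (h \<bullet> j) * frechet_derivative \<phi> (at x) j)"
        by (simp add: linear_sum linear_scale)
      then have "frechet_derivative \<phi> (at x) h = (\<Sum>j\<in>Basis. (h \<bullet> j) * frechet_derivative \<phi> (at x) j)"
        by (simp add: euclidean_representation)
      also have "\<bar>\<dots>\<bar> \<le> (\<Sum>j\<in>Basis. norm h * C j)"
        by (rule order_trans[OF sum_abs sum_mono]) (auto simp: abs_mult intro!: mult_mono Basis_le_norm C)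
      finally show "norm (frechet_derivative \<phi> (at x) h) \<le> Lp * norm h"
        by (simp add: Lp_def sum_distrib_left mult.commute)
    qed
    then have "norm (\<phi> x - \<phi> y) \<le> Lp * norm (x - y)" for x y
      by (intro differentiable_bound[where S=UNIV and f'="\<lambda>x. frechet_derivative \<phi> (at x)"]) (use D in auto)
    moreover have "0 \<le> Lp" unfolding Lp_def by (rule sum_nonneg) (rule C0)
    ultimately show ?thesis by auto
  qed
  then obtain Lp where Lp: "0 \<le> Lp" "\<And>x y. \<bar>\<phi> x - \<phi> y\<bar> \<le> Lp * norm (x - y)" by blast
  define \<psi> where "\<psi> x = (if x \<in> \<Omega> then w x * \<phi> x else 0)" for x
  define Mw' where "Mw' = max 0 Mw"
  define L where "L = Mw' * Lp + Lw * Mp + 2 * (Mw' * Mp) / e"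
  have Mw'0: "0 \<le> Mw'" by (simp add: Mw'_def)
  have psi0: "\<psi> x = 0" if "x \<notin> KK" for x using z0[OF that] by (simp add: \<psi>_def)
  have psib: "\<bar>\<psi> x\<bar> \<le> Mw' * Mp" for x
  proof (cases "x \<in> KK")
    case True
    then have "x \<in> K'" using e(1) unfolding K'eq by (force intro!: UN_I[of x])
    then have "\<bar>w x\<bar> \<le> Mw'" using Mw by (force simp: Mw'_def)
    then show ?thesis using Mp by (auto simp: \<psi>_def abs_mult intro!: mult_mono mult_nonneg_nonneg)
  qed (use psi0 Mp Mw'0 in auto)
  have psiL1: "\<bar>\<psi> y - \<psi> x\<bar> \<le> L * norm (y - x)" if "x \<in> KK" for x y
  proof (cases "norm (y - x) \<le> e")
    case True
    then have xy: "x \<in> K'" "y \<in> K'" unfolding K'eq using that e(1)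
      by (auto intro!: bexI[of _ x] simp: dist_norm norm_minus_commute)
    then have om: "x \<in> \<Omega>" "y \<in> \<Omega>" using K' by auto
    have "\<psi> y - \<psi> x = w y * (\<phi> y - \<phi> x) + (w y - w x) * \<phi> x"
      using om by (simp add: \<psi>_def algebra_simps)
    also have "\<bar>\<dots>\<bar> \<le> \<bar>w y\<bar> * \<bar>\<phi> y - \<phi> x\<bar> + \<bar>w y - w x\<bar> * \<bar>\<phi> x\<bar>"
      by (rule order_trans[OF abs_triangle_ineq]) (simp add: abs_mult)
    also have "\<dots> \<le> Mw' * (Lp * norm (y - x)) + (Lw * norm (y - x)) * Mp"
      using Mw[OF xy(2)] Lp Mp lipschitz_onD[OF Lw xy(2) xy(1)] Mw'0 Lw0
      by (intro add_mono mult_mono) (auto simp: Mw'_def dist_norm)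
    also have "\<dots> \<le> L * norm (y - x)"
      using Mw'0 Mp e(1) by (simp add: L_def algebra_simps)
    finally show ?thesis .
  next
    case False
    have "\<bar>\<psi> y - \<psi> x\<bar> \<le> 2 * (Mw' * Mp)" using psib[of x] psib[of y] by linarith
    also have "\<dots> \<le> (2 * (Mw' * Mp) / e) * norm (y - x)"
    proof -
      have "2 * (Mw' * Mp) * 1 \<le> 2 * (Mw' * Mp) * (norm (y - x) / e)"
        using False e(1) Mw'0 Mp(1) by (intro mult_left_mono) auto
      then show ?thesis by simp
    qed
    also have "\<dots> \<le> L * norm (y - x)"
      using Mw'0 Mp Lp Lw0 by (intro mult_right_mono) (auto simp: L_def)
    finally show ?thesis .
  qed
  have L0: "0 \<le> L" using Mw'0 Mp Lp Lw0 e(1) by (simp add: L_def)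
  have psiL: "\<bar>\<psi> y - \<psi> x\<bar> \<le> L * norm (y - x)" for x y
  proof (cases "x \<in> KK \<or> y \<in> KK")
    case True
    then show ?thesis using psiL1[of x y] psiL1[of y x] by (auto simp: abs_minus_commute norm_minus_commute)
  qed (use psi0 L0 in auto)
  have "L-lipschitz_on UNIV \<psi>"
    by (rule lipschitz_onI) (use psiL L0 in \<open>auto simp: dist_norm\<close>)
  then have c: "continuous_on UNIV \<psi>" by (rule lipschitz_on_continuous_on)
  define E where "E x = (\<lambda>h. if x \<in> \<Omega> then W x h * \<phi> x + w x * frechet_derivative \<phi> (at x) h else 0)" for x
  have dE: "AE x in lborel. (\<psi> has_derivative E x) (at x)"
    using d
  proof eventually_elim
    case (elim x)
    show ?case
    proof (cases "x \<in> \<Omega>")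
      case True
      then have "((\<lambda>x. w x * \<phi> x) has_derivative (\<lambda>h. w x * frechet_derivative \<phi> (at x) h + W x h * \<phi> x)) (at x)"
        using elim D by (intro has_derivative_mult) auto
      then have "(\<psi> has_derivative (\<lambda>h. w x * frechet_derivative \<phi> (at x) h + W x h * \<phi> x)) (at x)"
        by (rule has_derivative_transform_within_open[OF _ op True]) (simp add: \<psi>_def)
      then show ?thesis using True by (simp add: E_def add.commute)
    next
      case False
      then have "x \<notin> KK" using K by auto
      define S where "S = - KK"
      have S: "open S" "x \<in> S" "\<And>y. y \<in> S \<Longrightarrow> 0 = \<psi> y"
        using \<open>x \<notin> KK\<close> psi0 unfolding S_def KK_def by auto
      have "(\<psi> has_derivative (\<lambda>h. 0)) (at x)"
        by (rule has_derivative_transform_within_open[OF has_derivative_const S])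
      then show ?thesis using False by (simp add: E_def)
    qed
  qed
  have z: "\<psi> x = 0" if "norm x > R" for x using psi0[of x] R[of x] that by linarith
  have psiL': "\<bar>\<psi> (x + h) - \<psi> x\<bar> \<le> L * norm h" for x h
    using psiL[of x "x + h"] by simp
  show thesis
    by (rule integral_directional_derivative_eq_0[OF c z psiL' dE norm_Basis[OF i]])
      (use that in \<open>auto simp: E_def\<close>)
qed

section \<open>Weak gradients\<close>

lemma lebesgue_on_integral_lborel:
  fixes f :: "'a::euclidean_space \<Rightarrow> real"
  assumes D: "D \<in> sets lebesgue" and f: "f \<in> borel_measurable (lebesgue_on D)" and g: "g \<in> borel_measurable borel"
    and eq: "AE x in lborel. g x = (if x \<in> D then f x else 0)"
  shows "integral\<^sup>L (lebesgue_on D) f = integral\<^sup>L lborel g"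
    "integrable (lebesgue_on D) f \<longleftrightarrow> integrable lborel g"
proof -
  let ?F = "\<lambda>x. if x \<in> D then f x else 0"
  have F: "?F \<in> borel_measurable lebesgue" by (rule borel_measurable_if_I[OF f D])
  have g': "g \<in> borel_measurable lebesgue" "g \<in> borel_measurable lborel" using g by (auto intro: measurable_completion)
  have AE: "AE x in lebesgue. ?F x = g x" using eq by (intro AE_completion) (auto elim: eventually_mono)
  have "integral\<^sup>L (lebesgue_on D) f = integral\<^sup>L lebesgue ?F" by (rule Lebesgue_Measure.integral_restrict_UNIV[OF D, symmetric])
  also have "\<dots> = integral\<^sup>L lebesgue g" by (rule Bochner_Integration.integral_cong_AE[OF F g'(1) AE])
  also have "\<dots> = integral\<^sup>L lborel g" by (rule integral_completion[OF g'(2)])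
  finally show "integral\<^sup>L (lebesgue_on D) f = integral\<^sup>L lborel g" .
  have "integrable (lebesgue_on D) f \<longleftrightarrow> integrable lebesgue ?F" by (rule Lebesgue_Measure.integrable_restrict_UNIV[OF D, symmetric])
  also have "\<dots> \<longleftrightarrow> integrable lebesgue g" by (rule Bochner_Integration.integrable_cong_AE[OF F g'(1) AE])
  also have "\<dots> \<longleftrightarrow> integrable lborel g" by (rule integrable_completion[OF g'(2)])
  finally show "integrable (lebesgue_on D) f \<longleftrightarrow> integrable lborel g" .
qed

text \<open>
  Functions that are Lebesgue measurable on a set are traded for Borel functions on the whole space,
  because convolutions and Tonelli's theorem are convenient only for the latter.
\<close>
lemma borel_representative:
  fixes f :: "'a::euclidean_space \<Rightarrow> 'b::euclidean_space"
  assumes K: "K \<in> sets borel" and f: "f \<in> borel_measurable (lebesgue_on K)"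
  obtains g where "g \<in> borel_measurable borel" "\<And>x. x \<notin> K \<Longrightarrow> g x = 0" "AE x in lborel. x \<in> K \<longrightarrow> g x = f x"
proof -
  have "\<exists>g. g \<in> borel_measurable borel \<and> (AE x in lborel. x \<in> K \<longrightarrow> g x = f x \<bullet> i)" for i
  proof -
    have "(\<lambda>x. f x \<bullet> i) \<in> borel_measurable (lebesgue_on K)" using f by measurable
    then have "(\<lambda>x. if x \<in> K then f x \<bullet> i else 0) \<in> borel_measurable lebesgue"
      using K by (intro borel_measurable_if_I) auto
    from completion_ex_borel_measurable_real[OF this] obtain g where
      "g \<in> borel_measurable lborel" "AE x in lborel. (if x \<in> K then f x \<bullet> i else 0) = g x" by blast
    then show ?thesis by (intro exI[of _ g]) (auto elim!: eventually_mono)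
  qed
  then obtain g where g: "\<And>i. g i \<in> borel_measurable borel" "\<And>i. AE x in lborel. x \<in> K \<longrightarrow> g i x = f x \<bullet> i"
    by metis
  define g' where "g' x = indicator K x *\<^sub>R (\<Sum>i\<in>Basis. g i x *\<^sub>R i)" for x
  have "AE x in lborel. \<forall>i\<in>Basis. x \<in> K \<longrightarrow> g i x = f x \<bullet> i"
    by (rule AE_finite_allI) (use g in auto)
  then have "AE x in lborel. x \<in> K \<longrightarrow> g' x = f x"
    by eventually_elim (auto simp: g'_def euclidean_representation)
  moreover have "g' \<in> borel_measurable borel" unfolding g'_def using g(1) K by measurable
  ultimately show thesis using that by (simp add: g'_def)
qed

lemma Lp_loc_representative:
  fixes f :: "'a::euclidean_space \<Rightarrow> 'b::euclidean_space"
  assumes f: "f \<in> Lp_loc p D" and K: "compact K" "K \<subseteq> D" and p: "0 < p"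
  obtains g where "g \<in> borel_measurable borel" "\<And>x. x \<notin> K \<Longrightarrow> g x = 0" "AE x in lborel. x \<in> K \<longrightarrow> g x = f x"
    "integrable lborel (\<lambda>x. norm (g x) powr p)"
proof -
  have fK: "f \<in> borel_measurable (lebesgue_on K)"
    using f K(2) by (auto simp: Lp_loc_def intro: measurable_restrict_mono)
  have Kb: "K \<in> sets borel" using K(1) by (simp add: borel_compact)
  obtain g where g: "g \<in> borel_measurable borel" "\<And>x. x \<notin> K \<Longrightarrow> g x = 0" "AE x in lborel. x \<in> K \<longrightarrow> g x = f x"
    using borel_representative[OF Kb fK] by blast
  have "integrable (lebesgue_on K) (\<lambda>x. norm (f x) powr p)" using f K by (auto simp: Lp_loc_def)
  moreover have "integrable (lebesgue_on K) (\<lambda>x. norm (f x) powr p) \<longleftrightarrow> integrable lborel (\<lambda>x. norm (g x) powr p)"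
  proof (rule lebesgue_on_integral_lborel(2))
    show "K \<in> sets lebesgue" using Kb by simp
    show "AE x in lborel. norm (g x) powr p = (if x \<in> K then norm (f x) powr p else 0)"
      using g(3) by eventually_elim (auto simp: g(2))
    show "(\<lambda>x. norm (f x) powr p) \<in> borel_measurable (lebesgue_on K)" using fK by measurable
    show "(\<lambda>x. norm (g x) powr p) \<in> borel_measurable borel" using g(1) by measurable
  qed
  ultimately show thesis using that g by blast
qed

lemma continuous_measurable_lebesgue_on:
  fixes f :: "'a::euclidean_space \<Rightarrow> 'b::euclidean_space"
  assumes "continuous_on UNIV f"
  shows "f \<in> borel_measurable (lebesgue_on D)"
proof -
  have "f \<in> borel_measurable lborel" using borel_measurable_continuous_onI[OF assms] by simp
  then have "f \<in> borel_measurable lebesgue" by (rule measurable_completion)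
  then show ?thesis by (rule measurable_restrict_space1)
qed

lemma Lp_loc_test_integral:
  fixes f :: "'a::euclidean_space \<Rightarrow> 'b::euclidean_space"
  assumes f: "f \<in> Lp_loc q D" and op: "open D" and K: "compact K" "K \<subseteq> D"
    and g: "g \<in> borel_measurable borel" "\<And>x. x \<notin> K \<Longrightarrow> g x = 0" "AE x in lborel. x \<in> K \<longrightarrow> g x = f x"
    and phi: "continuous_on UNIV \<phi>" "\<And>x. x \<notin> K \<Longrightarrow> \<phi> x = 0"
  shows "integral\<^sup>L (lebesgue_on D) (\<lambda>x. (f x \<bullet> i) * \<phi> x) = integral\<^sup>L lborel (\<lambda>x. (g x \<bullet> i) * \<phi> x)"
    "integrable (lebesgue_on D) (\<lambda>x. (f x \<bullet> i) * \<phi> x) \<longleftrightarrow> integrable lborel (\<lambda>x. (g x \<bullet> i) * \<phi> x)"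
proof -
  have [measurable]: "f \<in> borel_measurable (lebesgue_on D)" using f by (simp add: Lp_loc_def)
  have [measurable]: "\<phi> \<in> borel_measurable (lebesgue_on D)" by (rule continuous_measurable_lebesgue_on[OF phi(1)])
  have [measurable]: "\<phi> \<in> borel_measurable borel" by (rule borel_measurable_continuous_onI[OF phi(1)])
  note g(1)[measurable]
  have 1: "D \<in> sets lebesgue" using op by simp
  have 2: "(\<lambda>x. (f x \<bullet> i) * \<phi> x) \<in> borel_measurable (lebesgue_on D)" by measurable
  have 3: "(\<lambda>x. (g x \<bullet> i) * \<phi> x) \<in> borel_measurable borel" by measurable
  have 4: "AE x in lborel. (g x \<bullet> i) * \<phi> x = (if x \<in> D then (f x \<bullet> i) * \<phi> x else 0)"
    using g(3) by eventually_elim (use K phi(2) g(2) in \<open>metis (no_types, lifting) inner_zero_left mult_zero_left mult_zero_right subsetD\<close>)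
  show "integral\<^sup>L (lebesgue_on D) (\<lambda>x. (f x \<bullet> i) * \<phi> x) = integral\<^sup>L lborel (\<lambda>x. (g x \<bullet> i) * \<phi> x)"
    "integrable (lebesgue_on D) (\<lambda>x. (f x \<bullet> i) * \<phi> x) \<longleftrightarrow> integrable lborel (\<lambda>x. (g x \<bullet> i) * \<phi> x)"
    using lebesgue_on_integral_lborel[OF 1 2 3 4] by auto
qed

lemma Lp_loc_1_test_integrable:
  fixes f :: "'a::euclidean_space \<Rightarrow> 'b::euclidean_space"
  assumes f: "f \<in> Lp_loc 1 D" and op: "open D" and K: "compact K" "K \<subseteq> D"
    and phi: "continuous_on UNIV \<phi>" "\<And>x. x \<notin> K \<Longrightarrow> \<phi> x = 0"
  shows "integrable (lebesgue_on D) (\<lambda>x. (f x \<bullet> i) * \<phi> x)"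
proof -
  obtain g where g: "g \<in> borel_measurable borel" "\<And>x. x \<notin> K \<Longrightarrow> g x = 0" "AE x in lborel. x \<in> K \<longrightarrow> g x = f x"
    "integrable lborel (\<lambda>x. norm (g x) powr 1)" using Lp_loc_representative[OF f K zero_less_one] by blast
  have gi: "integrable lborel (\<lambda>x. g x \<bullet> i)"
  proof (rule Bochner_Integration.integrable_bound)
    show "integrable lborel (\<lambda>x. norm i * norm (g x))" using g(4) by simp
    show "(\<lambda>x. g x \<bullet> i) \<in> borel_measurable lborel" using g(1) by measurable
    show "AE x in lborel. norm (g x \<bullet> i) \<le> norm (norm i * norm (g x))"
      by (intro AE_I2) (simp add: Cauchy_Schwarz_ineq2 mult.commute[of "norm i"])
  qed
  obtain R where "\<And>x. x \<in> K \<Longrightarrow> norm x \<le> R" using compact_imp_bounded[OF K(1)] unfolding bounded_iff by blast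
  then have "\<phi> x = 0" if "norm x > R" for x using phi(2) that by (meson not_le)
  then obtain C where "\<And>x. \<bar>\<phi> x\<bar> \<le> C" using bounded_compact_support[OF phi(1)] by blast
  then have "integrable lborel (\<lambda>x. (g x \<bullet> i) * \<phi> x)"
    by (intro integrable_mult_bounded[OF gi]) (auto intro: borel_measurable_continuous_onI[OF phi(1)])
  then show ?thesis using Lp_loc_test_integral(2)[OF f op K g(1-3) phi] by simp
qed

lemma Lp_loc_1_diff:
  fixes f g :: "'a::euclidean_space \<Rightarrow> 'b::euclidean_space"
  assumes "f \<in> Lp_loc 1 D" "g \<in> Lp_loc 1 D"
  shows "(\<lambda>x. f x - g x) \<in> Lp_loc 1 D"
proof -
  have m: "f \<in> borel_measurable (lebesgue_on D)" "g \<in> borel_measurable (lebesgue_on D)"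
    using assms by (auto simp: Lp_loc_def)
  have "integrable (lebesgue_on K) (\<lambda>x. norm (f x - g x) powr 1)" if K: "compact K" "K \<subseteq> D" for K
  proof (rule Bochner_Integration.integrable_bound)
    show "integrable (lebesgue_on K) (\<lambda>x. norm (f x) powr 1 + norm (g x) powr 1)"
      using assms K by (auto simp: Lp_loc_def)
    have [measurable]: "f \<in> borel_measurable (lebesgue_on K)" "g \<in> borel_measurable (lebesgue_on K)"
      using m measurable_restrict_mono K(2) by blast+
    show "(\<lambda>x. norm (f x - g x) powr 1) \<in> borel_measurable (lebesgue_on K)" by measurable
    show "AE x in lebesgue_on K. norm (norm (f x - g x) powr 1) \<le> norm (norm (f x) powr 1 + norm (g x) powr 1)"
      using norm_triangle_ineq4 by (auto simp: abs_of_nonneg)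
  qed
  then show ?thesis using m by (auto simp: Lp_loc_def)
qed

lemma test_function_props:
  fixes \<phi> :: "'a::euclidean_space \<Rightarrow> real"
  assumes "\<phi> \<in> test_functions D" "i \<in> Basis"
  shows "continuous_on UNIV \<phi>" "continuous_on UNIV (\<lambda>x. frechet_derivative \<phi> (at x) i)"
    "x \<notin> closure {x. \<phi> x \<noteq> 0} \<Longrightarrow> \<phi> x = 0"
    "x \<notin> closure {x. \<phi> x \<noteq> 0} \<Longrightarrow> frechet_derivative \<phi> (at x) i = 0"
proof -
  show "continuous_on UNIV \<phi>" using times_differentiable_continuous[OF test_functionsD(1)[OF assms(1), of 0]] .
  show "continuous_on UNIV (\<lambda>x. frechet_derivative \<phi> (at x) i)"
    using times_differentiable_continuous[OF times_differentiable_SucD(2)[OF test_functionsD(1)[OF assms(1), of "Suc 0"] assms(2)]] .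
  show "x \<notin> closure {x. \<phi> x \<noteq> 0} \<Longrightarrow> \<phi> x = 0" using test_functionsD(4)[OF assms(1), of x] by blast
  show "x \<notin> closure {x. \<phi> x \<noteq> 0} \<Longrightarrow> frechet_derivative \<phi> (at x) i = 0"
    by (rule frechet_derivative_outside_closure)
qed

lemma weak_gradient_eq:
  assumes "weak_gradient D u G" "\<phi> \<in> test_functions D" "i \<in> Basis"
  shows "integral\<^sup>L (lebesgue_on D) (\<lambda>x. u x * frechet_derivative \<phi> (at x) i) =
     - integral\<^sup>L (lebesgue_on D) (\<lambda>x. (G x \<bullet> i) * \<phi> x)"
  using assms unfolding weak_gradient_def by (simp add: gradient_inner)

lemma weak_gradient_diff:
  fixes u v :: "'a::euclidean_space \<Rightarrow> real"
  assumes op: "open D" and u: "weak_gradient D u G" and v: "weak_gradient D v H"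
  shows "weak_gradient D (\<lambda>x. u x - v x) (\<lambda>x. G x - H x)"
  unfolding weak_gradient_def
proof (intro conjI ballI)
  have L: "u \<in> Lp_loc 1 D" "v \<in> Lp_loc 1 D" "G \<in> Lp_loc 1 D" "H \<in> Lp_loc 1 D"
    using u v by (auto simp: weak_gradient_def)
  show "(\<lambda>x. u x - v x) \<in> Lp_loc 1 D" "(\<lambda>x. G x - H x) \<in> Lp_loc 1 D" using L Lp_loc_1_diff by blast+
  fix \<phi> i assume phi: "\<phi> \<in> test_functions D" and i: "i \<in> (Basis :: 'a set)"
  note P = test_function_props[OF phi i] and K = test_functionsD(2,3)[OF phi]
  have iu: "integrable (lebesgue_on D) (\<lambda>x. u x * frechet_derivative \<phi> (at x) i)"
    using Lp_loc_1_test_integrable[OF L(1) op K P(2,4), of 1] by simp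
  have iv: "integrable (lebesgue_on D) (\<lambda>x. v x * frechet_derivative \<phi> (at x) i)"
    using Lp_loc_1_test_integrable[OF L(2) op K P(2,4), of 1] by simp
  have iG: "integrable (lebesgue_on D) (\<lambda>x. (G x \<bullet> i) * \<phi> x)"
    by (rule Lp_loc_1_test_integrable[OF L(3) op K P(1,3)])
  have iH: "integrable (lebesgue_on D) (\<lambda>x. (H x \<bullet> i) * \<phi> x)"
    by (rule Lp_loc_1_test_integrable[OF L(4) op K P(1,3)])
  show "(\<integral>x. (u x - v x) * (gradient \<phi> x \<bullet> i) \<partial>lebesgue_on D) = - (\<integral>x. ((G x - H x) \<bullet> i) * \<phi> x \<partial>lebesgue_on D)"
    using weak_gradient_eq[OF u phi i] weak_gradient_eq[OF v phi i] iu iv iG iH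
    by (simp add: gradient_inner i left_diff_distrib inner_diff_left)
qed

text \<open>
  As a function of \<open>y\<close>, the kernel of the mollification at \<open>x\<close> is an admissible test function
  as soon as the ball around \<open>x\<close> lies in the domain.
\<close>
lemma mollifier_test_function:
  fixes x :: "'a::euclidean_space"
  assumes "0 < \<eta>" "cball x \<eta> \<subseteq> D"
  shows "(\<lambda>y. mollifier \<eta> (x - y)) \<in> test_functions D"
proof -
  have "{y. mollifier \<eta> (x - y) \<noteq> 0} \<subseteq> cball x \<eta>"
  proof
    fix y assume "y \<in> {y. mollifier \<eta> (x - y) \<noteq> 0}"
    then show "y \<in> cball x \<eta>" using mollifier_zero[OF assms(1), of "x - y"] by (fastforce simp: dist_norm)
  qed
  then have c: "closure {y. mollifier \<eta> (x - y) \<noteq> 0} \<subseteq> cball x \<eta>" by (intro closure_minimal) auto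
  moreover have "compact (closure {y. mollifier \<eta> (x - y) \<noteq> 0})"
    using c bounded_subset[OF bounded_cball] by (simp add: compact_eq_bounded_closed)
  ultimately show ?thesis using assms(2) times_differentiable_reflect[OF times_differentiable_mollifier]
    by (auto simp: test_functions_def)
qed

text \<open>
  Differentiating under the integral puts the derivative on the mollifier, and the defining property
  of the weak gradient moves it back to \<open>u\<close>. Here \<open>u'\<close> and \<open>g\<close> are Borel versions of
  \<open>u\<close> and \<open>G\<close>, cut off outside \<open>K\<close>.
\<close>
lemma mollify_weak_gradient:
  fixes u :: "'a::euclidean_space \<Rightarrow> real"
  assumes wg: "weak_gradient D u G" and op: "open D" and K: "compact K" "K \<subseteq> D" and x: "0 < \<eta>" "cball x \<eta> \<subseteq> K"
    and i: "i \<in> Basis"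
    and u': "u' \<in> borel_measurable borel" "\<And>x. x \<notin> K \<Longrightarrow> u' x = 0" "AE x in lborel. x \<in> K \<longrightarrow> u' x = u x" "integrable lborel u'"
    and g: "g \<in> borel_measurable borel" "\<And>x. x \<notin> K \<Longrightarrow> g x = 0" "AE x in lborel. x \<in> K \<longrightarrow> g x = G x"
  shows "frechet_derivative (mollify \<eta> u') (at x) i = mollify \<eta> (\<lambda>y. g y \<bullet> i) x"
proof -
  define \<phi> where "\<phi> y = mollifier \<eta> (x - y)" for y
  have L: "u \<in> Lp_loc 1 D" "G \<in> Lp_loc 1 D" using wg by (auto simp: weak_gradient_def)
  have phi: "\<phi> \<in> test_functions D" unfolding \<phi>_def by (rule mollifier_test_function) (use x K in auto)
  note P = test_function_props[OF phi i]
  have z: "\<phi> y = 0" "frechet_derivative \<phi> (at y) i = 0" if "y \<notin> K" for y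
  proof -
    have "{y. \<phi> y \<noteq> 0} \<subseteq> cball x \<eta>"
    proof
      fix y assume "y \<in> {y. \<phi> y \<noteq> 0}"
      then show "y \<in> cball x \<eta>" using mollifier_zero[OF x(1), of "x - y"] by (fastforce simp: dist_norm \<phi>_def)
    qed
    then have "closure {y. \<phi> y \<noteq> 0} \<subseteq> cball x \<eta>" by (intro closure_minimal) auto
    then have "y \<notin> closure {y. \<phi> y \<noteq> 0}" using that x(2) by blast
    then show "\<phi> y = 0" "frechet_derivative \<phi> (at y) i = 0" using P(3,4) by blast+
  qed
  have D: "frechet_derivative \<phi> (at y) i = - frechet_derivative (mollifier \<eta>) (at (x - y)) i" for y
  proof -
    have M: "(mollifier \<eta> has_derivative frechet_derivative (mollifier \<eta>) (at (x - y))) (at (x - y))"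
      using times_differentiable_SucD(1)[OF times_differentiable_mollifier] .
    have "(\<phi> has_derivative (\<lambda>h. frechet_derivative (mollifier \<eta>) (at (x-y)) (-h))) (at y)"
      unfolding \<phi>_def
      by (rule has_derivative_compose[where g="mollifier \<eta>" and f="\<lambda>y. x - y"]) (auto intro!: derivative_eq_intros M)
    from frechet_eq[OF this] show ?thesis
      using linear_neg[OF has_derivative_linear[OF M]] by simp
  qed
  have "frechet_derivative (mollify \<eta> u') (at x) i = (\<integral>y. u' y * frechet_derivative (mollifier \<eta>) (at (x - y)) i \<partial>lborel)"
    unfolding mollify_def[abs_def]
    by (rule conv_frechet[OF u'(4) times_differentiable_mollifier _ i, of \<eta>]) (rule mollifier_zero[OF x(1)], simp)
  also have "\<dots> = - (\<integral>y. u' y * frechet_derivative \<phi> (at y) i \<partial>lborel)" by (simp add: D)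
  also have "(\<integral>y. u' y * frechet_derivative \<phi> (at y) i \<partial>lborel) = (\<integral>y. u y * frechet_derivative \<phi> (at y) i \<partial>lebesgue_on D)"
    using Lp_loc_test_integral(1)[OF L(1) op K u'(1-3) P(2) z(2), of 1] by simp
  also have "\<dots> = - (\<integral>y. (G y \<bullet> i) * \<phi> y \<partial>lebesgue_on D)" by (rule weak_gradient_eq[OF wg phi i])
  also have "(\<integral>y. (G y \<bullet> i) * \<phi> y \<partial>lebesgue_on D) = (\<integral>y. (g y \<bullet> i) * \<phi> y \<partial>lborel)"
    by (rule Lp_loc_test_integral(1)[OF L(2) op K g P(1) z(1)])
  finally show ?thesis by (simp add: mollify_def[abs_def] \<phi>_def)
qed

lemma compact_neighbourhood:
  fixes K :: "'a::euclidean_space set"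
  assumes "compact K" "open D" "K \<subseteq> D"
  obtains d K' where "0 < d" "compact K'" "K' \<subseteq> D" "K \<subseteq> K'" "\<And>x. x \<in> K \<Longrightarrow> cball x d \<subseteq> K'"
    "\<And>y. y \<in> K' \<Longrightarrow> \<exists>x\<in>K. y \<in> cball x d"
proof -
  obtain e where e: "e > 0" "(\<Union>x\<in>K. cball x e) \<subseteq> D"
    using compact_subset_open_imp_cball_epsilon_subset[OF assms] by blast
  define K' where "K' = {x + y | x y. x \<in> K \<and> y \<in> cball 0 e}"
  have eq: "K' = (\<Union>x\<in>K. cball x e)"
  proof -
    have "z \<in> K'" if "x \<in> K" "z \<in> cball x e" for x z
      unfolding K'_def using that by (intro CollectI exI[of _ x] exI[of _ "z - x"]) (auto simp: dist_norm norm_minus_commute)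
    moreover have "K' \<subseteq> (\<Union>x\<in>K. cball x e)" unfolding K'_def by (force simp: dist_norm)
    ultimately show ?thesis by blast
  qed
  have "compact K'" using compact_sums[OF assms(1) compact_cball[of 0 e]] by (simp add: K'_def)
  moreover have "K \<subseteq> K'" unfolding eq using e(1) by (auto intro!: bexI)
  ultimately show thesis using that[of e K'] e eq by blast
qed

text \<open>
  By \<open>mollify_weak_gradient\<close>, applied to the function \<open>0\<close>, the mollifications of \<open>G - H\<close> vanish,
  and they converge to \<open>G - H\<close> in the mean.
\<close>
lemma weak_gradient_unique:
  fixes u :: "'a::euclidean_space \<Rightarrow> real"
  assumes op: "open D" and G: "weak_gradient D u G" and H: "weak_gradient D u H"
  shows "AE x in lborel. x \<in> D \<longrightarrow> G x = H x"
proof -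
  have wg: "weak_gradient D (\<lambda>x. u x - u x) (\<lambda>x. G x - H x)" by (rule weak_gradient_diff[OF op G H])
  then have L: "(\<lambda>x. G x - H x) \<in> Lp_loc 1 D" by (simp add: weak_gradient_def)
  have comp: "AE x in lborel. x \<in> K \<longrightarrow> G x = H x" if K: "compact K" "K \<subseteq> D" for K
  proof -
    obtain d K' where K': "0 < d" "compact K'" "K' \<subseteq> D" "\<And>x. x \<in> K \<Longrightarrow> cball x d \<subseteq> K'" "K \<subseteq> K'"
      using compact_neighbourhood[OF K(1) op K(2)] by metis
    obtain g where g: "g \<in> borel_measurable borel" "\<And>x. x \<notin> K' \<Longrightarrow> g x = 0" "AE x in lborel. x \<in> K' \<longrightarrow> g x = G x - H x"
      "integrable lborel (\<lambda>x. norm (g x) powr 1)" using Lp_loc_representative[OF L K'(2,3) zero_less_one] by blast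
    obtain R where R: "\<And>x. x \<in> K' \<Longrightarrow> norm x \<le> R" using compact_imp_bounded[OF K'(2)] unfolding bounded_iff by blast
    have "AE x in lborel. x \<in> K \<longrightarrow> g x \<bullet> i = 0" if i: "i \<in> Basis" for i
    proof -
      have gm: "(\<lambda>x. g x \<bullet> i) \<in> borel_measurable borel" using g(1) by measurable
      have gi: "integrable lborel (\<lambda>x. \<bar>g x \<bullet> i\<bar> powr 1)"
      proof (rule Bochner_Integration.integrable_bound[OF g(4)])
        show "(\<lambda>x. \<bar>g x \<bullet> i\<bar> powr 1) \<in> borel_measurable lborel" using gm by measurable
        show "AE x in lborel. norm (\<bar>g x \<bullet> i\<bar> powr 1) \<le> norm (norm (g x) powr 1)"
          using Basis_le_norm[OF i] by simp
      qed
      have gz: "g x \<bullet> i = 0" if "norm x > R" for x using g(2)[of x] R[of x] that by force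
      have T: "0 < \<eta> \<Longrightarrow> integrable lborel (\<lambda>x. \<bar>mollify \<eta> (\<lambda>y. g y \<bullet> i) x - g x \<bullet> i\<bar> powr 1)"
        "((\<lambda>\<eta>. \<integral>x. \<bar>mollify \<eta> (\<lambda>y. g y \<bullet> i) x - g x \<bullet> i\<bar> powr 1 \<partial>lborel) \<longlongrightarrow> 0) (at_right 0)" for \<eta>
        using mollify_tendsto_Lp[OF order_refl gm gi gz] by blast+
      have m0: "mollify \<eta> (\<lambda>y. g y \<bullet> i) x = 0" if eta: "0 < \<eta>" "\<eta> < d" and x: "x \<in> K" for \<eta> x
      proof -
        have cb: "cball x \<eta> \<subseteq> K'" using K'(4)[OF x] eta by force
        have "frechet_derivative (mollify \<eta> (\<lambda>x. 0)) (at x) i = mollify \<eta> (\<lambda>y. g y \<bullet> i) x"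
          by (rule mollify_weak_gradient[OF wg op K'(2,3) eta(1) cb i _ _ _ _ g(1-3)]) auto
        moreover have "mollify \<eta> (\<lambda>x::'a. 0) = (\<lambda>x. 0)" by (simp add: mollify_def[abs_def])
        ultimately show ?thesis by (simp add: frechet_derivative_const)
      qed
      have Kb: "K \<in> sets borel" using K(1) by (simp add: borel_compact)
      have iK: "integrable lborel (\<lambda>x. indicator K x * \<bar>g x \<bullet> i\<bar>)"
      proof (rule Bochner_Integration.integrable_bound[OF gi])
        show "(\<lambda>x. indicator K x * \<bar>g x \<bullet> i\<bar>) \<in> borel_measurable lborel" using gm Kb by measurable
      qed (auto simp: indicator_def)
      have le: "(\<integral>x. indicator K x * \<bar>g x \<bullet> i\<bar> \<partial>lborel) \<le> (\<integral>x. \<bar>mollify \<eta> (\<lambda>y. g y \<bullet> i) x - g x \<bullet> i\<bar> powr 1 \<partial>lborel)"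
        if eta: "0 < \<eta>" "\<eta> < d" for \<eta>
        by (rule Bochner_Integration.integral_mono[OF iK T(1)[OF eta(1)]])
          (use m0[OF eta] in \<open>auto simp: indicator_def\<close>)
      have "(\<integral>x. indicator K x * \<bar>g x \<bullet> i\<bar> \<partial>lborel) \<le> 0"
      proof (rule tendsto_lowerbound[OF T(2)])
        show "\<forall>\<^sub>F \<eta> in at_right 0. (\<integral>x. indicator K x * \<bar>g x \<bullet> i\<bar> \<partial>lborel) \<le> (\<integral>x. \<bar>mollify \<eta> (\<lambda>y. g y \<bullet> i) x - g x \<bullet> i\<bar> powr 1 \<partial>lborel)"
          unfolding eventually_at_right_field using le K'(1) by blast
      qed simp
      moreover have "0 \<le> (\<integral>x. indicator K x * \<bar>g x \<bullet> i\<bar> \<partial>lborel)"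
        by (rule Bochner_Integration.integral_nonneg) simp
      ultimately have "(\<integral>x. indicator K x * \<bar>g x \<bullet> i\<bar> \<partial>lborel) = 0" by linarith
      then have "AE x in lborel. indicator K x * \<bar>g x \<bullet> i\<bar> = 0"
        using integral_nonneg_eq_0_iff_AE[OF iK] by simp
      then show ?thesis by eventually_elim (auto simp: indicator_def)
    qed
    then have "AE x in lborel. \<forall>i\<in>Basis. x \<in> K \<longrightarrow> g x \<bullet> i = 0" by (intro AE_finite_allI) auto
    with g(3) show ?thesis
    proof eventually_elim
      case (elim x)
      show ?case
      proof
        assume x: "x \<in> K"
        then have "g x = 0" using elim(2) by (simp add: euclidean_all_zero_iff)
        then show "G x = H x" using elim(1) x K'(5) by auto
      qed
    qed
  qed
  obtain \<D> where D: "countable \<D>" "\<Union>\<D> = D" "\<And>X. X \<in> \<D> \<Longrightarrow> compact X"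
  proof -
    obtain C :: "nat \<Rightarrow> 'a set" where C: "\<And>n. compact (C n)" "(\<Union>n. C n) = D"
      using open_Union_compact_subsets[OF op] by metis
    show thesis by (rule that[of "range C"]) (use C in auto)
  qed
  have "AE x in lborel. \<forall>X\<in>\<D>. x \<in> X \<longrightarrow> G x = H x"
    by (subst AE_ball_countable[OF D(1)]) (use comp D in blast)
  then show ?thesis by eventually_elim (use D(2) in blast)
qed

text \<open>
  The definition provides one weak gradient in \<open>L\<^sup>p\<close> and one that satisfies the equation; by
  uniqueness they agree almost everywhere, so a single one does both.
\<close>
lemma p_harmonic_gradient:
  fixes u :: "'a::euclidean_space \<Rightarrow> real"
  assumes op: "open D" and ph: "p_harmonic_on p D u"
  obtains G where "weak_gradient D u G" "G \<in> Lp_loc p D"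
    "\<And>\<phi>. \<phi> \<in> test_functions D \<Longrightarrow> (\<integral>x. norm (G x) powr (p - 2) * (G x \<bullet> gradient \<phi> x) \<partial>lebesgue_on D) = 0"
proof -
  obtain G where G: "G \<in> Lp_loc p D" "weak_gradient D u G" using ph by (auto simp: p_harmonic_on_def W1p_loc_def)
  obtain H where H: "weak_gradient D u H"
    "\<And>\<phi>. \<phi> \<in> test_functions D \<Longrightarrow> (\<integral>x. norm (H x) powr (p - 2) * (H x \<bullet> gradient \<phi> x) \<partial>lebesgue_on D) = 0"
    using ph by (auto simp: p_harmonic_on_def)
  have m[measurable]: "G \<in> borel_measurable (lebesgue_on D)" "H \<in> borel_measurable (lebesgue_on D)"
    using G H by (auto simp: Lp_loc_def weak_gradient_def)
  have "AE x in lebesgue. x \<in> D \<longrightarrow> G x = H x"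
    by (rule AE_completion[OF weak_gradient_unique[OF op G(2) H(1)]])
  then have AE: "AE x in lebesgue_on D. G x = H x" using op by (subst AE_restrict_space_iff) auto
  have "(\<integral>x. norm (G x) powr (p - 2) * (G x \<bullet> gradient \<phi> x) \<partial>lebesgue_on D) = 0" if phi: "\<phi> \<in> test_functions D" for \<phi>
  proof -
    have gm[measurable]: "gradient \<phi> \<in> borel_measurable (lebesgue_on D)"
      unfolding gradient_def[abs_def]
      by (intro continuous_measurable_lebesgue_on continuous_on_sum continuous_on_scaleR continuous_on_const test_function_props(2)[OF phi])
    have "(\<integral>x. norm (G x) powr (p - 2) * (G x \<bullet> gradient \<phi> x) \<partial>lebesgue_on D) = (\<integral>x. norm (H x) powr (p - 2) * (H x \<bullet> gradient \<phi> x) \<partial>lebesgue_on D)"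
    proof (rule Bochner_Integration.integral_cong_AE)
      show "AE x in lebesgue_on D. norm (G x) powr (p - 2) * (G x \<bullet> gradient \<phi> x) = norm (H x) powr (p - 2) * (H x \<bullet> gradient \<phi> x)"
        using AE by eventually_elim simp
    qed measurable
    then show ?thesis using H(2)[OF phi] by simp
  qed
  then show thesis using that G by blast
qed

section \<open>Monotonicity of the flux and passage to the limit\<close>

text \<open>
  Expanding the product and using \<open>a \<bullet> b \<le> |a| |b|\<close> bounds it below by
  \<open>(|a|\<^sup>p\<^sup>-\<^sup>1 - |b|\<^sup>p\<^sup>-\<^sup>1) (|a| - |b|)\<close>. Equality forces \<open>|a| = |b|\<close> and equality in
  Cauchy-Schwarz.
\<close>
lemma p_monotone:
  fixes a b :: "'a::real_inner"
  assumes p: "1 < p"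
  shows "0 \<le> (norm a powr (p - 2) *\<^sub>R a - norm b powr (p - 2) *\<^sub>R b) \<bullet> (a - b)"
    "(norm a powr (p - 2) *\<^sub>R a - norm b powr (p - 2) *\<^sub>R b) \<bullet> (a - b) = 0 \<Longrightarrow> a = b"
proof -
  define A B where "A = norm a powr (p - 2)" and "B = norm b powr (p - 2)"
  have AB: "0 \<le> A" "0 \<le> B" by (auto simp: A_def B_def)
  have Am: "A * norm a = norm a powr (p - 1)" and Bm: "B * norm b = norm b powr (p - 1)"
    using powr_mult_base[of "norm a" "p - 2"] powr_mult_base[of "norm b" "p - 2"]
    by (auto simp: A_def B_def mult.commute)
  have CS: "a \<bullet> b \<le> norm a * norm b" by (rule norm_cauchy_schwarz)
  have eq: "(A *\<^sub>R a - B *\<^sub>R b) \<bullet> (a - b) =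
     (norm a powr (p - 1) - norm b powr (p - 1)) * (norm a - norm b) + (A + B) * (norm a * norm b - a \<bullet> b)"
    unfolding Am[symmetric] Bm[symmetric]
    by (simp add: inner_diff_left inner_diff_right inner_commute[of b a] dot_square_norm power2_eq_square algebra_simps)
  have 1: "0 \<le> (norm a powr (p - 1) - norm b powr (p - 1)) * (norm a - norm b)"
  proof (cases "norm a \<le> norm b")
    case True
    then have "norm a powr (p - 1) \<le> norm b powr (p - 1)" using p by (intro powr_mono2) auto
    then show ?thesis using True by (intro mult_nonpos_nonpos) auto
  next
    case False
    then have "norm b powr (p - 1) \<le> norm a powr (p - 1)" using p by (intro powr_mono2) auto
    then show ?thesis using False by (intro mult_nonneg_nonneg) auto
  qed
  have 2: "0 \<le> (A + B) * (norm a * norm b - a \<bullet> b)" using AB CS by (intro mult_nonneg_nonneg) auto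
  show "0 \<le> (norm a powr (p - 2) *\<^sub>R a - norm b powr (p - 2) *\<^sub>R b) \<bullet> (a - b)"
    using eq 1 2 by (simp add: A_def B_def)
  assume "(norm a powr (p - 2) *\<^sub>R a - norm b powr (p - 2) *\<^sub>R b) \<bullet> (a - b) = 0"
  then have "(A *\<^sub>R a - B *\<^sub>R b) \<bullet> (a - b) = 0" by (simp add: A_def B_def)
  then have z: "(norm a powr (p - 1) - norm b powr (p - 1)) * (norm a - norm b) = 0"
    "(A + B) * (norm a * norm b - a \<bullet> b) = 0"
    using eq 1 2 by linarith+
  have n: "norm a = norm b"
  proof (rule ccontr)
    assume ne: "norm a \<noteq> norm b"
    then have e: "norm a powr (p - 1) = norm b powr (p - 1)" using z(1) by auto
    have "norm a powr (p - 1) \<noteq> norm b powr (p - 1)"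
    proof (cases "norm a < norm b")
      case True
      then have "norm a powr (p - 1) < norm b powr (p - 1)" using p by (intro powr_less_mono2) auto
      then show ?thesis by simp
    next
      case False
      then have "norm b powr (p - 1) < norm a powr (p - 1)" using p ne by (intro powr_less_mono2) auto
      then show ?thesis by simp
    qed
    with e show False by simp
  qed
  show "a = b"
  proof (cases "a = 0")
    case True
    then show ?thesis using n by simp
  next
    case False
    then have "0 < A" by (simp add: A_def)
    then have "a \<bullet> b = norm a * norm b" using z(2) AB by (auto simp: add_pos_nonneg)
    moreover have "a \<bullet> a = norm a * norm a" "b \<bullet> b = norm b * norm b"
      by (simp_all add: dot_square_norm power2_eq_square)
    ultimately have "(a - b) \<bullet> (a - b) = 0"
      using n by (simp add: inner_diff_left inner_diff_right inner_commute[of b a])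
    then show ?thesis by simp
  qed
qed

text \<open>
  The free parameter \<open>t\<close> makes the factor in front of the dual term small at the expense of the
  factor in front of the other term, which serves as a substitute for Hoelder's inequality.
\<close>
lemma Young_scaled:
  fixes a b p t :: real
  assumes p: "1 < p" and t: "0 < t" and ab: "0 \<le> a" "0 \<le> b"
  shows "a * b \<le> t powr (p / (p - 1)) * a powr (p / (p - 1)) + t powr (- p) * b powr p"
proof -
  define q where "q = p / (p - 1)"
  have q: "1 < q" "1 / q + 1 / p = 1" using p by (auto simp: q_def field_simps)
  have "a * b = (t * a) * (b / t)" using t by simp
  also have "\<dots> \<le> (t * a) powr q / q + (b / t) powr p / p"
    by (rule Youngs_inequality[OF q(1) p q(2)]) (use t ab in auto)
  also have "\<dots> \<le> (t * a) powr q + (b / t) powr p"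
  proof (rule add_mono)
    show "(t * a) powr q / q \<le> (t * a) powr q" using q(1) divide_left_mono[of 1 q "(t * a) powr q"] by simp
    show "(b / t) powr p / p \<le> (b / t) powr p" using p divide_left_mono[of 1 p "(b / t) powr p"] by simp
  qed
  also have "\<dots> = t powr q * a powr q + t powr (- p) * b powr p"
    using t ab by (simp add: powr_mult powr_divide powr_minus divide_simps)
  finally show ?thesis by (simp add: q_def)
qed

lemma Young_integrable:
  fixes X F :: "'a \<Rightarrow> real"
  assumes p: "1 < p" and X: "X \<in> borel_measurable M" "integrable M (\<lambda>x. \<bar>X x\<bar> powr (p / (p - 1)))"
    and F: "F \<in> borel_measurable M" "integrable M (\<lambda>x. \<bar>F x\<bar> powr p)"
  shows "integrable M (\<lambda>x. X x * F x)"
proof (rule Bochner_Integration.integrable_bound)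
  show "integrable M (\<lambda>x. \<bar>X x\<bar> powr (p / (p - 1)) + \<bar>F x\<bar> powr p)" using X F by simp
  show "(\<lambda>x. X x * F x) \<in> borel_measurable M" using X F by measurable
  have "\<bar>X x * F x\<bar> \<le> \<bar>X x\<bar> powr (p / (p - 1)) + \<bar>F x\<bar> powr p" for x
    using Young_scaled[OF p zero_less_one, of "\<bar>X x\<bar>" "\<bar>F x\<bar>"] by (simp add: abs_mult)
  then show "AE x in M. norm (X x * F x) \<le> norm (\<bar>X x\<bar> powr (p / (p - 1)) + \<bar>F x\<bar> powr p)"
    by (intro AE_I2) simp
qed

text \<open>
  The weights converge only pointwise, and the functions \<open>Fn\<close> only in the mean. Writing
  \<open>s\<^sub>n F\<^sub>n = s\<^sub>n (F\<^sub>n - F) + s\<^sub>n F\<close>, the first part is small by \<open>Young_scaled\<close> and the second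
  converges by domination.
\<close>
lemma weighted_limit:
  fixes X F :: "'a \<Rightarrow> real"
  assumes p: "1 < p" and X: "X \<in> borel_measurable M" "integrable M (\<lambda>x. \<bar>X x\<bar> powr (p / (p - 1)))"
    and F: "F \<in> borel_measurable M" "integrable M (\<lambda>x. \<bar>F x\<bar> powr p)"
    and Fn: "\<And>n. Fn n \<in> borel_measurable M" "\<And>n. integrable M (\<lambda>x. \<bar>Fn n x - F x\<bar> powr p)"
    and lim: "(\<lambda>n. \<integral>x. \<bar>Fn n x - F x\<bar> powr p \<partial>M) \<longlonglongrightarrow> 0"
    and s: "\<And>n. s n \<in> borel_measurable M" "\<And>n x. \<bar>s n x\<bar> \<le> C" "\<And>x. (\<lambda>n. s n x) \<longlonglongrightarrow> s' x" "s' \<in> borel_measurable M"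
  shows "\<And>n. integrable M (\<lambda>x. X x * (s n x * Fn n x))" "integrable M (\<lambda>x. X x * (s' x * F x))"
    "(\<lambda>n. \<integral>x. X x * (s n x * Fn n x) \<partial>M) \<longlonglongrightarrow> (\<integral>x. X x * (s' x * F x) \<partial>M)"
proof -
  note [measurable] = X(1) F(1) Fn(1) s(1) s(4)
  have C0: "0 \<le> C" using s(2)[of 0 undefined] by linarith
  have s'b: "\<bar>s' x\<bar> \<le> C" for x
    by (rule tendsto_upperbound[OF tendsto_rabs[OF s(3)]]) (use s(2) in auto)
  have iXF: "integrable M (\<lambda>x. X x * F x)" by (rule Young_integrable[OF p X F])
  have iXD: "integrable M (\<lambda>x. X x * (Fn n x - F x))" for n
    by (rule Young_integrable[OF p X _ Fn(2)]) measurable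
  have i1: "integrable M (\<lambda>x. s n x * (X x * (Fn n x - F x)))" for n
  proof (rule Bochner_Integration.integrable_bound)
    show "integrable M (\<lambda>x. C * (X x * (Fn n x - F x)))" using iXD by simp
    show "AE x in M. norm (s n x * (X x * (Fn n x - F x))) \<le> norm (C * (X x * (Fn n x - F x)))"
      using s(2) C0 by (intro AE_I2) (simp add: abs_mult mult_right_mono)
  qed measurable
  have i2: "integrable M (\<lambda>x. s n x * (X x * F x))" for n
  proof (rule Bochner_Integration.integrable_bound)
    show "integrable M (\<lambda>x. C * (X x * F x))" using iXF by simp
    show "AE x in M. norm (s n x * (X x * F x)) \<le> norm (C * (X x * F x))"
      using s(2) C0 by (intro AE_I2) (simp add: abs_mult mult_right_mono)
  qed measurable
  have i3: "integrable M (\<lambda>x. s' x * (X x * F x))"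
  proof (rule Bochner_Integration.integrable_bound)
    show "integrable M (\<lambda>x. C * (X x * F x))" using iXF by simp
    show "AE x in M. norm (s' x * (X x * F x)) \<le> norm (C * (X x * F x))"
      using s'b C0 by (intro AE_I2) (simp add: abs_mult mult_right_mono)
  qed measurable
  have split: "X x * (s n x * Fn n x) = s n x * (X x * (Fn n x - F x)) + s n x * (X x * F x)" for n x
    by (simp add: algebra_simps)
  show "integrable M (\<lambda>x. X x * (s n x * Fn n x))" for n unfolding split using i1 i2 by simp
  show "integrable M (\<lambda>x. X x * (s' x * F x))" using i3 by (simp add: mult.left_commute)
  have L2: "(\<lambda>n. \<integral>x. s n x * (X x * F x) \<partial>M) \<longlonglongrightarrow> (\<integral>x. s' x * (X x * F x) \<partial>M)"
  proof (rule integral_dominated_convergence[where w="\<lambda>x. norm (C * (X x * F x))"])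
    show "integrable M (\<lambda>x. norm (C * (X x * F x)))" using iXF by simp
    show "AE x in M. (\<lambda>n. s n x * (X x * F x)) \<longlonglongrightarrow> s' x * (X x * F x)"
      by (intro AE_I2 tendsto_intros s(3))
    show "AE x in M. norm (s n x * (X x * F x)) \<le> norm (C * (X x * F x))" for n
      using s(2) C0 by (intro AE_I2) (simp add: abs_mult mult_right_mono)
  qed measurable
  have L1: "(\<lambda>n. \<integral>x. s n x * (X x * (Fn n x - F x)) \<partial>M) \<longlonglongrightarrow> 0"
  proof (rule LIMSEQ_I)
    fix e :: real assume e: "0 < e"
    define q where "q = p / (p - 1)"
    have q: "1 < q" using p by (auto simp: q_def field_simps)
    define A where "A = (\<integral>x. \<bar>X x\<bar> powr q \<partial>M)"
    have A: "0 \<le> A" unfolding A_def by (rule Bochner_Integration.integral_nonneg) simp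
    define t where "t = (e / (2 * (C + 1) * (A + 1))) powr (1 / q)"
    have t: "0 < t" "t powr q = e / (2 * (C + 1) * (A + 1))" using e A C0 q by (auto simp: t_def powr_powr)
    have ct: "(C + 1) * (t powr q * (A + 1)) = e / 2"
    proof -
      have "(C + 1) * (A + 1) \<noteq> 0" using A C0 by auto
      then show ?thesis unfolding t(2) by (simp add: divide_simps)
    qed
    define e' where "e' = e / (2 * (C + 1) * t powr (- p))"
    have e': "0 < e'" using e C0 t by (simp add: e'_def)
    have ce: "(C + 1) * (t powr (- p) * e') = e / 2"
    proof -
      have "(C + 1) * t powr (- p) \<noteq> 0" using t C0 by auto
      then show ?thesis unfolding e'_def by (simp add: divide_simps)
    qed
    obtain N where N: "\<And>n. n \<ge> N \<Longrightarrow> norm ((\<integral>x. \<bar>Fn n x - F x\<bar> powr p \<partial>M) - 0) < e'"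
      using LIMSEQ_D[OF lim e'] by blast
    show "\<exists>N. \<forall>n\<ge>N. norm ((\<integral>x. s n x * (X x * (Fn n x - F x)) \<partial>M) - 0) < e"
    proof (intro exI allI impI)
      fix n assume n: "n \<ge> N"
      let ?I = "\<integral>x. \<bar>Fn n x - F x\<bar> powr p \<partial>M"
      have I: "?I < e'" using N[OF n] by simp
      have pw: "norm (s n x * (X x * (Fn n x - F x))) \<le> (C + 1) * (t powr q * \<bar>X x\<bar> powr q + t powr (- p) * \<bar>Fn n x - F x\<bar> powr p)" for x
      proof -
        have "norm (s n x * (X x * (Fn n x - F x))) = \<bar>s n x\<bar> * (\<bar>X x\<bar> * \<bar>Fn n x - F x\<bar>)"
          by (simp add: abs_mult)
        also have "\<dots> \<le> (C + 1) * (t powr q * \<bar>X x\<bar> powr q + t powr (- p) * \<bar>Fn n x - F x\<bar> powr p)"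
          by (intro mult_mono Young_scaled[OF p t(1), folded q_def]) (use s(2)[of n x] C0 in auto)
        finally show ?thesis .
      qed
      have iX: "integrable M (\<lambda>x. \<bar>X x\<bar> powr q)" using X(2) by (simp add: q_def)
      have "norm (\<integral>x. s n x * (X x * (Fn n x - F x)) \<partial>M) \<le> (\<integral>x. norm (s n x * (X x * (Fn n x - F x))) \<partial>M)"
        by (rule integral_norm_bound)
      also have "\<dots> \<le> (\<integral>x. (C + 1) * (t powr q * \<bar>X x\<bar> powr q + t powr (- p) * \<bar>Fn n x - F x\<bar> powr p) \<partial>M)"
        by (rule Bochner_Integration.integral_mono[OF Bochner_Integration.integrable_norm[OF i1] _ pw]) (use iX Fn(2) in simp)
      also have "\<dots> = (C + 1) * (t powr q * A + t powr (- p) * ?I)"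
        using iX Fn(2) by (simp add: A_def)
      also have "\<dots> < (C + 1) * (t powr q * (A + 1) + t powr (- p) * e')"
        using t(1) I C0 by (intro mult_strict_left_mono add_strict_mono) auto
      also have "\<dots> = e" unfolding distrib_left[of "C + 1"] ct ce by simp
      finally show "norm ((\<integral>x. s n x * (X x * (Fn n x - F x)) \<partial>M) - 0) < e" by simp
    qed
  qed
  have "(\<integral>x. X x * (s n x * Fn n x) \<partial>M) = (\<integral>x. s n x * (X x * (Fn n x - F x)) \<partial>M) + (\<integral>x. s n x * (X x * F x) \<partial>M)" for n
    unfolding split by (rule Bochner_Integration.integral_add[OF i1 i2])
  then show "(\<lambda>n. \<integral>x. X x * (s n x * Fn n x) \<partial>M) \<longlonglongrightarrow> (\<integral>x. X x * (s' x * F x) \<partial>M)"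
    using tendsto_add[OF L1 L2] by (simp add: mult.left_commute)
qed

section \<open>The comparison principle\<close>

text \<open>
  Suppose that \<open>h - v > \<epsilon>\<close> somewhere. The set where \<open>h - v \<ge> \<epsilon>\<close> is a compact subset of the open
  set \<open>D\<close>. With \<open>\<Phi> = flat_exp 0\<close>, the functions \<open>\<Phi>(W\<^sub>n - \<epsilon>)\<close> for mollifications
  \<open>W\<^sub>n\<close> of \<open>h - v\<close> are test functions. Subtracting the two weak equations and passing to the limit gives
  \<open>\<integral> \<Phi>'(h - v - \<epsilon>) (A(\<nabla>h) - A(\<nabla>v)) \<bullet> (\<nabla>h - \<nabla>v) = 0\<close> with the flux
  \<open>A(\<xi>) = |\<xi>|\<^sup>p\<^sup>-\<^sup>2 \<xi>\<close>. By strict monotonicity \<open>\<nabla>h = \<nabla>v\<close> almost everywhere on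
  \<open>{h - v > \<epsilon>}\<close>, so the limit \<open>\<Phi>(h - v - \<epsilon>)\<close> of the test functions has vanishing
  gradient and compact support, and must be zero: a contradiction.
\<close>
lemma p_harmonic_comparison:
  fixes h v :: "'a::euclidean_space \<Rightarrow> real"
  assumes p: "1 < p" and op: "open D" and cD: "compact (closure D)"
    and hc: "continuous_on (closure D) h" and vc: "continuous_on (closure D) v"
    and hp: "p_harmonic_on p D h" and vp: "p_harmonic_on p D v"
    and bd: "\<And>x. x \<in> frontier D \<Longrightarrow> h x \<le> v x"
    and x0: "x0 \<in> D"
  shows "h x0 \<le> v x0"
proof (rule field_le_epsilon)
  fix \<epsilon> :: real assume eps: "0 < \<epsilon>"
  define K where "K = {x \<in> closure D. \<epsilon> \<le> h x - v x}"
  have "closedin (top_of_set (closure D)) (closure D \<inter> (\<lambda>x. h x - v x) -` {\<epsilon>..})"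
    by (intro continuous_closedin_preimage continuous_intros hc vc)
  also have "closure D \<inter> (\<lambda>x. h x - v x) -` {\<epsilon>..} = K" by (auto simp: K_def)
  finally have "closedin (top_of_set (closure D)) K" .
  then have K: "compact K" using closedin_compact[OF cD] by blast
  have KD: "K \<subseteq> D"
  proof
    fix x assume x: "x \<in> K"
    show "x \<in> D"
    proof (rule ccontr)
      assume "x \<notin> D"
      then have "x \<in> frontier D" using x op by (simp add: K_def frontier_def interior_open)
      then show False using bd x eps by (force simp: K_def)
    qed
  qed
  \<comment> \<open>two nested compact neighbourhoods: the test functions live in the inner one, and the mollification there uses only values in the outer one\<close>
  obtain d K1 where K1: "0 < d" "compact K1" "K1 \<subseteq> D" "K \<subseteq> K1" "\<And>x. x \<in> K \<Longrightarrow> cball x d \<subseteq> K1"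
    using compact_neighbourhood[OF K op KD] by metis
  obtain d' K2 where K2: "0 < d'" "compact K2" "K2 \<subseteq> D" "K1 \<subseteq> K2" "\<And>x. x \<in> K1 \<Longrightarrow> cball x d' \<subseteq> K2"
    using compact_neighbourhood[OF K1(2) op K1(3)] by metis
  have K2b: "K2 \<in> sets borel" using K2(2) by (simp add: borel_compact)
  obtain G where G: "weak_gradient D h G" "G \<in> Lp_loc p D"
    "\<And>\<phi>. \<phi> \<in> test_functions D \<Longrightarrow> (\<integral>x. norm (G x) powr (p - 2) * (G x \<bullet> gradient \<phi> x) \<partial>lebesgue_on D) = 0"
    using p_harmonic_gradient[OF op hp] by blast
  obtain H where H: "weak_gradient D v H" "H \<in> Lp_loc p D"
    "\<And>\<phi>. \<phi> \<in> test_functions D \<Longrightarrow> (\<integral>x. norm (H x) powr (p - 2) * (H x \<bullet> gradient \<phi> x) \<partial>lebesgue_on D) = 0"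
    using p_harmonic_gradient[OF op vp] by blast
  have p0: "0 < p" using p by simp
  obtain g where g: "g \<in> borel_measurable borel" "\<And>x. x \<notin> K2 \<Longrightarrow> g x = 0" "AE x in lborel. x \<in> K2 \<longrightarrow> g x = G x"
    "integrable lborel (\<lambda>x. norm (g x) powr p)" using Lp_loc_representative[OF G(2) K2(2,3) p0] by blast
  obtain k where k: "k \<in> borel_measurable borel" "\<And>x. x \<notin> K2 \<Longrightarrow> k x = 0" "AE x in lborel. x \<in> K2 \<longrightarrow> k x = H x"
    "integrable lborel (\<lambda>x. norm (k x) powr p)" using Lp_loc_representative[OF H(2) K2(2,3) p0] by blast
  note gm[measurable] = g(1) and km[measurable] = k(1)
  define w where "w x = (if x \<in> K2 then h x - v x else 0)" for x
  have cK2: "continuous_on K2 (\<lambda>x. h x - v x)"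
    using K2(3) closure_subset[of D] by (intro continuous_intros continuous_on_subset[OF hc] continuous_on_subset[OF vc]) auto
  have wi: "integrable lborel w"
  proof -
    have "integrable lborel (\<lambda>x. indicator K2 x *\<^sub>R (h x - v x))" by (rule borel_integrable_compact[OF K2(2) cK2])
    also have "(\<lambda>x. indicator K2 x *\<^sub>R (h x - v x)) = w" by (auto simp: w_def indicator_def fun_eq_iff)
    finally show ?thesis .
  qed
  have wm[measurable]: "w \<in> borel_measurable borel" using wi by auto
  define \<Gamma> where "\<Gamma> x = g x - k x" for x
  have Gm[measurable]: "\<Gamma> \<in> borel_measurable borel" unfolding \<Gamma>_def by measurable
  have wg: "weak_gradient D (\<lambda>x. h x - v x) (\<lambda>x. G x - H x)" by (rule weak_gradient_diff[OF op G(1) H(1)])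
  have GAE: "AE x in lborel. x \<in> K2 \<longrightarrow> \<Gamma> x = G x - H x"
    using g(3) k(3) by eventually_elim (auto simp: \<Gamma>_def)
  have Gz: "\<Gamma> x = 0" if "x \<notin> K2" for x using g(2) k(2) that by (simp add: \<Gamma>_def)
  have comp_int: "integrable lborel (\<lambda>x. \<bar>f x \<bullet> i\<bar> powr r)"
    if "f \<in> borel_measurable borel" "integrable lborel (\<lambda>x. norm (f x) powr r)" "i \<in> Basis" "0 \<le> r" for f :: "'a \<Rightarrow> 'a" and i r
  proof (rule Bochner_Integration.integrable_bound[OF that(2)])
    show "(\<lambda>x. \<bar>f x \<bullet> i\<bar> powr r) \<in> borel_measurable lborel" using that(1) by measurable
    show "AE x in lborel. norm (\<bar>f x \<bullet> i\<bar> powr r) \<le> norm (norm (f x) powr r)"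
      using that(3,4) by (intro AE_I2) (simp add: powr_mono2 Basis_le_norm)
  qed
  have Gp: "integrable lborel (\<lambda>x. norm (\<Gamma> x) powr p)"
  proof (rule Bochner_Integration.integrable_bound)
    show "integrable lborel (\<lambda>x. 2 powr p * (norm (g x) powr p + norm (k x) powr p))" using g(4) k(4) by simp
    show "(\<lambda>x. norm (\<Gamma> x) powr p) \<in> borel_measurable lborel" by measurable
    have "norm (\<Gamma> x) powr p \<le> 2 powr p * (norm (g x) powr p + norm (k x) powr p)" for x
    proof -
      have "norm (\<Gamma> x) powr p \<le> (norm (g x) + norm (k x)) powr p"
        unfolding \<Gamma>_def using p by (intro powr_mono2 norm_triangle_ineq4) auto
      also have "\<dots> \<le> 2 powr p * (norm (g x) powr p + norm (k x) powr p)" by (rule powr_sum2) (use p in auto)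
      finally show ?thesis .
    qed
    then show "AE x in lborel. norm (norm (\<Gamma> x) powr p) \<le> norm (2 powr p * (norm (g x) powr p + norm (k x) powr p))"
      by (intro AE_I2) simp
  qed
  obtain R where R: "\<And>x. x \<in> K2 \<Longrightarrow> norm x \<le> R" using compact_imp_bounded[OF K2(2)] unfolding bounded_iff by blast
  define \<eta> where "\<eta> n = min d d' / real (Suc n)" for n
  have eta: "0 < \<eta> n" "\<eta> n \<le> d" "\<eta> n \<le> d'" for n
  proof -
    have "min d d' / real (Suc n) \<le> min d d' / 1" using K1(1) K2(1) by (intro divide_left_mono) auto
    then show "0 < \<eta> n" "\<eta> n \<le> d" "\<eta> n \<le> d'" using K1(1) K2(1) by (auto simp: \<eta>_def)
  qed
  have eta0: "\<eta> \<longlonglongrightarrow> 0"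
    using tendsto_mult_right_zero[OF LIMSEQ_inverse_real_of_nat, of "min d d'"] by (simp add: \<eta>_def[abs_def] divide_inverse)
  then have etaf: "filterlim \<eta> (at_right 0) sequentially"
    using eta(1) less_imp_neq[OF eta(1)] by (simp add: filterlim_at)
  define W where "W n = mollify (\<eta> n) w" for n
  \<comment> \<open>the test functions; by the chain rule their partial derivatives are the products of s and F\<close>
  define \<phi> where "\<phi> n x = flat_exp 0 (W n x - \<epsilon>)" for n x
  define s where "s n x = flat_exp 2 (W n x - \<epsilon>)" for n x
  define s' where "s' x = flat_exp 2 (w x - \<epsilon>)" for x
  define F where "F i n x = mollify (\<eta> n) (\<lambda>y. \<Gamma> y \<bullet> i) x" for i n x
  have Wtd: "times_differentiable j (W n)" for j n unfolding W_def by (rule times_differentiable_mollify[OF wi eta(1)])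
  have outK: "w y \<le> \<epsilon>" if "y \<notin> K" for y
    using that K2(3) closure_subset[of D] eps by (fastforce simp: w_def K_def)
  have Wle: "W n x \<le> \<epsilon>" if "x \<notin> K1" for n x
    unfolding W_def
  proof (rule mollify_le[OF wi eta(1)])
    fix y assume y: "norm (x - y) < \<eta> n"
    have "y \<notin> K"
    proof
      assume "y \<in> K"
      then have "cball y d \<subseteq> K1" by (rule K1(5))
      moreover have "x \<in> cball y d" using y eta(2)[of n] by (simp add: dist_norm norm_minus_commute)
      ultimately show False using that by blast
    qed
    then show "w y \<le> \<epsilon>" by (rule outK)
  qed
  have out: "\<phi> n x = 0" "s n x = 0" if "x \<notin> K1" for n x
    using Wle[OF that] by (auto simp: \<phi>_def s_def flat_exp_def)
  have out': "s' x = 0" "flat_exp 0 (w x - \<epsilon>) = 0" if "x \<notin> K1" for x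
    using outK[of x] K1(4) that by (auto simp: s'_def flat_exp_def)
  have phitd: "times_differentiable j (\<phi> n)" for j n
    unfolding \<phi>_def diff_conv_add_uminus
    by (intro times_differentiable_flat_exp times_differentiable_add times_differentiable_const Wtd)
  have phi: "\<phi> n \<in> test_functions D" for n
  proof -
    have "{x. \<phi> n x \<noteq> 0} \<subseteq> K1" using out by blast
    then have c: "closure {x. \<phi> n x \<noteq> 0} \<subseteq> K1" by (intro closure_minimal compact_imp_closed K1(2))
    then have "compact (closure {x. \<phi> n x \<noteq> 0})"
      using bounded_subset[OF compact_imp_bounded[OF K1(2)]] by (simp add: compact_eq_bounded_closed)
    then show ?thesis using c K1(3) phitd by (auto simp: test_functions_def)
  qed
  have Dphi: "frechet_derivative (\<phi> n) (at x) i = s n x * F i n x" if i: "i \<in> Basis" for n x i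
  proof -
    have DW: "(W n has_derivative frechet_derivative (W n) (at x)) (at x)"
      by (rule times_differentiable_SucD(1)[OF Wtd])
    have "((\<lambda>x. W n x - \<epsilon>) has_derivative frechet_derivative (W n) (at x)) (at x)"
      using has_derivative_diff[OF DW has_derivative_const[of \<epsilon>]] by simp
    from has_derivative_compose[OF this flat_exp_deriv[of 0 "W n x - \<epsilon>", unfolded has_field_derivative_def]]
    have "(\<phi> n has_derivative (\<lambda>u. s n x * frechet_derivative (W n) (at x) u)) (at x)"
      by (simp add: \<phi>_def[abs_def] s_def numeral_2_eq_2)
    from frechet_eq[OF this] have e: "frechet_derivative (\<phi> n) (at x) i = s n x * frechet_derivative (W n) (at x) i" by simp
    show ?thesis
    proof (cases "x \<in> K1")
      case True
      have cb: "cball x (\<eta> n) \<subseteq> K2" using K2(5)[OF True] eta(3)[of n] by force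
      have "frechet_derivative (W n) (at x) i = F i n x"
        unfolding W_def F_def
        by (rule mollify_weak_gradient[OF wg op K2(2,3) eta(1) cb i wm _ _ wi Gm Gz GAE]) (auto simp: w_def)
      then show ?thesis using e by simp
    next
      case False
      then show ?thesis using e out(2) by simp
    qed
  qed
  have gradphi: "X \<bullet> gradient (\<phi> n) x = (\<Sum>i\<in>Basis. (X \<bullet> i) * (s n x * F i n x))" for X n x
    unfolding inner_gradient using Dphi by simp
  have Gic: "(\<lambda>x. \<Gamma> x \<bullet> i) \<in> borel_measurable borel" for i by measurable
  have Gip: "integrable lborel (\<lambda>x. \<bar>\<Gamma> x \<bullet> i\<bar> powr p)" if "i \<in> Basis" for i
    by (rule comp_int[OF Gm Gp that]) (use p in simp)
  have Giz: "\<Gamma> x \<bullet> i = 0" if "norm x > R" for x i using Gz[of x] R[of x] that by force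
  have p1: "1 \<le> p" using p by simp
  have Fi: "integrable lborel (\<lambda>x. \<bar>F i n x - \<Gamma> x \<bullet> i\<bar> powr p)" if "i \<in> Basis" for i n
    unfolding F_def using mollify_tendsto_Lp(1)[OF p1 Gic Gip[OF that] Giz eta(1)] by blast
  have Flim: "(\<lambda>n. \<integral>x. \<bar>F i n x - \<Gamma> x \<bullet> i\<bar> powr p \<partial>lborel) \<longlonglongrightarrow> 0" if "i \<in> Basis" for i
  proof -
    have "((\<lambda>\<eta>. \<integral>x. \<bar>mollify \<eta> (\<lambda>y. \<Gamma> y \<bullet> i) x - \<Gamma> x \<bullet> i\<bar> powr p \<partial>lborel) \<longlongrightarrow> 0) (at_right 0)"
      using mollify_tendsto_Lp(2)[OF p1 Gic Gip[OF that] Giz] by blast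
    from filterlim_compose[OF this etaf] show ?thesis by (simp add: F_def)
  qed
  have Gii: "integrable lborel (\<lambda>x. \<Gamma> x \<bullet> i)" if "i \<in> Basis" for i
    using compact_support_integrable_powr[OF p1 Gic Gip[OF that] Giz] by blast
  have Fm: "F i n \<in> borel_measurable lborel" if "i \<in> Basis" for i n
  proof -
    have "continuous_on UNIV (F i n)" unfolding F_def[abs_def]
      using times_differentiable_continuous[OF times_differentiable_mollify[OF Gii[OF that] eta(1), of 0]] .
    then show ?thesis by (simp add: borel_measurable_continuous_onI)
  qed
  have Wc: "continuous_on UNIV (W n)" for n using times_differentiable_continuous[OF Wtd[of 0]] .
  have Wlim: "(\<lambda>n. W n x) \<longlonglongrightarrow> w x" if x: "x \<in> K1" for x
  proof (rule LIMSEQ_I)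
    fix r :: real assume r: "0 < r"
    have xD: "x \<in> K2" "ball x d' \<subseteq> K2" using K2(4,5) x ball_subset_cball by blast+
    obtain c where c: "0 < c" "\<And>y. y \<in> K2 \<Longrightarrow> dist y x < c \<Longrightarrow> dist (h y - v y) (h x - v x) < r / 2"
      using cK2 xD(1) half_gt_zero[OF r] unfolding continuous_on_iff by metis
    have "\<forall>\<^sub>F n in sequentially. \<eta> n < c" using order_tendstoD(2)[OF eta0 c(1)] .
    then obtain N where N: "\<And>n. n \<ge> N \<Longrightarrow> \<eta> n < c" unfolding eventually_sequentially by blast
    show "\<exists>N. \<forall>n\<ge>N. norm (W n x - w x) < r"
    proof (intro exI allI impI)
      fix n assume n: "n \<ge> N"
      have "\<bar>W n x - w x\<bar> \<le> r / 2"
        unfolding W_def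
      proof (rule mollify_near[OF wi eta(1)])
        fix y assume y: "norm (x - y) < \<eta> n"
        then have "y \<in> K2" using xD(2) eta(3)[of n] by (auto simp: dist_norm)
        moreover have "dist y x < c" using y N[OF n] by (simp add: dist_norm norm_minus_commute)
        ultimately show "\<bar>w y - w x\<bar> \<le> r / 2" using c(2)[of y] xD(1) by (simp add: w_def dist_real_def)
      qed
      then show "norm (W n x - w x) < r" using r by simp
    qed
  qed
  have cont_fe: "isCont (flat_exp j) t" for j t using flat_exp_deriv DERIV_isCont by blast
  have slim: "(\<lambda>n. s n x) \<longlonglongrightarrow> s' x" for x
  proof (cases "x \<in> K1")
    case True
    show ?thesis unfolding s_def s'_def
      by (rule isCont_tendsto_compose[OF cont_fe tendsto_diff[OF Wlim[OF True] tendsto_const]])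
  qed (simp add: out out')
  have sm: "s n \<in> borel_measurable lborel" for n
    unfolding s_def[abs_def] using Wc by (auto intro!: borel_measurable_continuous_onI continuous_intros)
  have sm': "s' \<in> borel_measurable lborel"
  proof -
    have "flat_exp 2 \<in> borel_measurable borel"
      using cont_fe by (auto intro!: borel_measurable_continuous_onI continuous_at_imp_continuous_on)
    then show ?thesis unfolding s'_def[abs_def] by measurable
  qed
  have sb: "\<bar>s n x\<bar> \<le> 2" for n x using flat_exp_2_le flat_exp_nonneg by (simp add: s_def)
  define q where "q = p / (p - 1)"
  \<comment> \<open>the limit of a weak equation with flux X, tested with the functions just constructed\<close>
  have passage: "(\<Sum>i\<in>Basis. \<integral>x. (X x \<bullet> i) * (s' x * (\<Gamma> x \<bullet> i)) \<partial>lborel) = 0"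
      "\<And>i. i \<in> Basis \<Longrightarrow> integrable lborel (\<lambda>x. (X x \<bullet> i) * (s' x * (\<Gamma> x \<bullet> i)))"
      "\<And>i. i \<in> Basis \<Longrightarrow> (\<lambda>n. \<integral>x. (X x \<bullet> i) * (s n x * F i n x) \<partial>lborel) \<longlonglongrightarrow> (\<integral>x. (X x \<bullet> i) * (s' x * (\<Gamma> x \<bullet> i)) \<partial>lborel)"
    if X: "X \<in> borel_measurable borel" "integrable lborel (\<lambda>x. norm (X x) powr q)"
      and z: "\<And>n. (\<integral>x. X x \<bullet> gradient (\<phi> n) x \<partial>lborel) = 0" for X :: "'a \<Rightarrow> 'a"
  proof -
    have q0: "0 \<le> q" using p by (simp add: q_def)
    have Xi: "(\<lambda>x. X x \<bullet> i) \<in> borel_measurable lborel" for i using X(1) by measurable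
    note WL = weighted_limit[OF p Xi comp_int[OF X _ q0, unfolded q_def] _ Gip Fm Fi Flim sm sb slim sm']
    show lim: "(\<lambda>n. \<integral>x. (X x \<bullet> i) * (s n x * F i n x) \<partial>lborel) \<longlonglongrightarrow> (\<integral>x. (X x \<bullet> i) * (s' x * (\<Gamma> x \<bullet> i)) \<partial>lborel)"
      if i: "i \<in> Basis" for i
      by (rule WL(3)) (use i Gic in auto)
    show "integrable lborel (\<lambda>x. (X x \<bullet> i) * (s' x * (\<Gamma> x \<bullet> i)))" if i: "i \<in> Basis" for i
      by (rule WL(2)) (use i Gic in auto)
    have int: "integrable lborel (\<lambda>x. (X x \<bullet> i) * (s n x * F i n x))" if i: "i \<in> Basis" for i n
      by (rule WL(1)) (use i Gic in auto)
    have "(\<lambda>n. \<Sum>i\<in>Basis. \<integral>x. (X x \<bullet> i) * (s n x * F i n x) \<partial>lborel) \<longlonglongrightarrow> (\<Sum>i\<in>Basis. \<integral>x. (X x \<bullet> i) * (s' x * (\<Gamma> x \<bullet> i)) \<partial>lborel)"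
      by (intro tendsto_sum lim)
    moreover have "(\<Sum>i\<in>Basis. \<integral>x. (X x \<bullet> i) * (s n x * F i n x) \<partial>lborel) = 0" for n
    proof -
      have "(\<integral>x. (\<Sum>i\<in>Basis. (X x \<bullet> i) * (s n x * F i n x)) \<partial>lborel) = (\<Sum>i\<in>Basis. \<integral>x. (X x \<bullet> i) * (s n x * F i n x) \<partial>lborel)"
        by (rule Bochner_Integration.integral_sum) (rule int)
      then show ?thesis using z[of n] unfolding gradphi by simp
    qed
    ultimately show "(\<Sum>i\<in>Basis. \<integral>x. (X x \<bullet> i) * (s' x * (\<Gamma> x \<bullet> i)) \<partial>lborel) = 0"
      by (simp add: LIMSEQ_const_iff)
  qed
  have flux: "(\<lambda>x. norm (f x) powr (p - 2) *\<^sub>R f x) \<in> borel_measurable borel"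
    "integrable lborel (\<lambda>x. norm (norm (f x) powr (p - 2) *\<^sub>R f x) powr q)"
    if f: "f \<in> borel_measurable borel" "integrable lborel (\<lambda>x. norm (f x) powr p)" for f :: "'a \<Rightarrow> 'a"
  proof -
    show "(\<lambda>x. norm (f x) powr (p - 2) *\<^sub>R f x) \<in> borel_measurable borel" using f(1) by measurable
    have "norm (norm (f x) powr (p - 2) *\<^sub>R f x) powr q = norm (f x) powr p" for x
    proof -
      have "norm (norm (f x) powr (p - 2) *\<^sub>R f x) = norm (f x) powr (p - 1)"
        using powr_mult_base[of "norm (f x)" "p - 2"] by (simp add: mult.commute)
      then show ?thesis using p by (simp add: powr_powr q_def)
    qed
    then show "integrable lborel (\<lambda>x. norm (norm (f x) powr (p - 2) *\<^sub>R f x) powr q)" using f(2) by simp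
  qed
  have eqn: "(\<integral>x. (norm (f x) powr (p - 2) *\<^sub>R f x) \<bullet> gradient (\<phi> n) x \<partial>lborel) = 0"
    if f: "f \<in> borel_measurable borel" "\<And>x. x \<notin> K2 \<Longrightarrow> f x = 0" "AE x in lborel. x \<in> K2 \<longrightarrow> f x = E x"
      and E: "E \<in> Lp_loc p D"
       "\<And>\<phi>. \<phi> \<in> test_functions D \<Longrightarrow> (\<integral>x. norm (E x) powr (p - 2) * (E x \<bullet> gradient \<phi> x) \<partial>lebesgue_on D) = 0"
    for f E :: "'a \<Rightarrow> 'a" and n
  proof -
    have gc: "continuous_on UNIV (gradient (\<phi> n))"
      unfolding gradient_def[abs_def]
      by (intro continuous_on_sum continuous_on_scaleR continuous_on_const test_function_props(2)[OF phi])
    have [measurable]: "gradient (\<phi> n) \<in> borel_measurable borel" by (rule borel_measurable_continuous_onI[OF gc])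
    have [measurable]: "gradient (\<phi> n) \<in> borel_measurable (lebesgue_on D)" by (rule continuous_measurable_lebesgue_on[OF gc])
    have [measurable]: "E \<in> borel_measurable (lebesgue_on D)" using E(1) by (simp add: Lp_loc_def)
    note f(1)[measurable]
    have gz: "gradient (\<phi> n) x = 0" if "x \<notin> K2" for x
    proof -
      have "x \<notin> K1" using K2(4) that by blast
      then show ?thesis using out(2)[of x n] by (simp add: gradient_def Dphi)
    qed
    have "(\<integral>x. norm (E x) powr (p - 2) * (E x \<bullet> gradient (\<phi> n) x) \<partial>lebesgue_on D) = (\<integral>x. norm (f x) powr (p - 2) * (f x \<bullet> gradient (\<phi> n) x) \<partial>lborel)"
    proof (rule lebesgue_on_integral_lborel(1))
      show "D \<in> sets lebesgue" using op by simp
      show "AE x in lborel. norm (f x) powr (p - 2) * (f x \<bullet> gradient (\<phi> n) x) = (if x \<in> D then norm (E x) powr (p - 2) * (E x \<bullet> gradient (\<phi> n) x) else 0)"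
        using f(3)
      proof eventually_elim
        case (elim x)
        show ?case
        proof (cases "x \<in> K2")
          case True
          then show ?thesis using elim K2(3) by auto
        next
          case False
          then show ?thesis using gz f(2) by simp
        qed
      qed
    qed measurable
    then show ?thesis using E(2)[OF phi[of n]] by simp
  qed
  \<comment> \<open>A and B are the fluxes of h and v, cut off outside K2\<close>
  define A where "A x = norm (g x) powr (p - 2) *\<^sub>R g x" for x
  define B where "B x = norm (k x) powr (p - 2) *\<^sub>R k x" for x
  have A1: "A \<in> borel_measurable borel" unfolding A_def[abs_def] by (rule flux(1)[OF g(1,4)])
  have A2: "integrable lborel (\<lambda>x. norm (A x) powr q)" unfolding A_def by (rule flux(2)[OF g(1,4)])
  have A3: "(\<integral>x. A x \<bullet> gradient (\<phi> n) x \<partial>lborel) = 0" for n unfolding A_def by (rule eqn[OF g(1-3) G(2,3)])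
  note PA = passage[OF A1 A2 A3]
  have B1: "B \<in> borel_measurable borel" unfolding B_def[abs_def] by (rule flux(1)[OF k(1,4)])
  have B2: "integrable lborel (\<lambda>x. norm (B x) powr q)" unfolding B_def by (rule flux(2)[OF k(1,4)])
  have B3: "(\<integral>x. B x \<bullet> gradient (\<phi> n) x \<partial>lborel) = 0" for n unfolding B_def by (rule eqn[OF k(1-3) H(2,3)])
  note PB = passage[OF B1 B2 B3]
  have AB: "AE x in lborel. s' x *\<^sub>R \<Gamma> x = 0"
  proof -
    have pt: "(A x - B x) \<bullet> \<Gamma> x * s' x = (\<Sum>i\<in>Basis. (A x \<bullet> i) * (s' x * (\<Gamma> x \<bullet> i))) - (\<Sum>i\<in>Basis. (B x \<bullet> i) * (s' x * (\<Gamma> x \<bullet> i)))" for x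
    proof -
      have "C \<bullet> \<Gamma> x * s' x = (\<Sum>i\<in>Basis. (C \<bullet> i) * (s' x * (\<Gamma> x \<bullet> i)))" for C
        by (subst euclidean_inner) (simp add: sum_distrib_left mult.assoc mult.commute mult.left_commute)
      then show ?thesis by (simp add: inner_diff_left left_diff_distrib)
    qed
    have int: "integrable lborel (\<lambda>x. (A x - B x) \<bullet> \<Gamma> x * s' x)"
      unfolding pt using PA(2) PB(2) by (intro Bochner_Integration.integrable_diff Bochner_Integration.integrable_sum) auto
    have "(\<integral>x. (A x - B x) \<bullet> \<Gamma> x * s' x \<partial>lborel) =
      (\<integral>x. (\<Sum>i\<in>Basis. (A x \<bullet> i) * (s' x * (\<Gamma> x \<bullet> i))) \<partial>lborel) - (\<integral>x. (\<Sum>i\<in>Basis. (B x \<bullet> i) * (s' x * (\<Gamma> x \<bullet> i))) \<partial>lborel)"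
      unfolding pt using PA(2) PB(2) by (intro Bochner_Integration.integral_diff Bochner_Integration.integrable_sum) auto
    also have "\<dots> = 0"
      using PA(1,2) PB(1,2) by (simp add: Bochner_Integration.integral_sum)
    finally have z: "(\<integral>x. (A x - B x) \<bullet> \<Gamma> x * s' x \<partial>lborel) = 0" .
    have nn: "0 \<le> (A x - B x) \<bullet> \<Gamma> x * s' x" for x
      unfolding A_def B_def \<Gamma>_def s'_def by (intro mult_nonneg_nonneg p_monotone(1)[OF p] flat_exp_nonneg)
    have "AE x in lborel. (A x - B x) \<bullet> \<Gamma> x * s' x = 0"
      using integral_nonneg_eq_0_iff_AE[OF int] nn z by auto
    then show ?thesis
    proof eventually_elim
      case (elim x)
      then have "s' x = 0 \<or> (A x - B x) \<bullet> \<Gamma> x = 0" by auto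
      then show ?case
        using p_monotone(2)[OF p, of "g x" "k x"] unfolding A_def B_def \<Gamma>_def by auto
    qed
  qed
  \<comment> \<open>to see that the limit of the test functions is zero, compute their integrals by parts against the linear function with gradient i0, cut off outside K2; the limit of these integrals involves only the vanishing gradient\<close>
  obtain i0 :: 'a where i0: "i0 \<in> Basis" using nonempty_Basis by blast
  define X where "X x = (indicator K2 x * (x \<bullet> i0)) *\<^sub>R i0" for x
  have Xm: "X \<in> borel_measurable borel" unfolding X_def using K2b by measurable
  have XR: "norm (X x) \<le> R * indicator (cball 0 R) x" for x
  proof (cases "x \<in> K2")
    case True
    then show ?thesis using R[OF True] Basis_le_norm[OF i0, of x] i0 by (simp add: X_def)
  next
    case False
    have "0 \<le> R \<or> \<not> norm x \<le> R" using norm_ge_zero[of x] by linarith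
    then show ?thesis using False by (auto simp: X_def)
  qed
  have Xq: "integrable lborel (\<lambda>x. norm (X x) powr q)"
  proof (rule Bochner_Integration.integrable_bound)
    show "integrable lborel (\<lambda>x::'a. (R powr q) * indicator (cball 0 R) x)" by (rule integrable_cball_const)
    show "(\<lambda>x. norm (X x) powr q) \<in> borel_measurable lborel" using Xm by measurable
    have "norm (X x) powr q \<le> R powr q * indicator (cball 0 R) x" for x
    proof (cases "norm x \<le> R")
      case True
      then have "norm (X x) powr q \<le> R powr q" using XR[of x] p by (intro powr_mono2) (auto simp: q_def)
      then show ?thesis using True by simp
    next
      case False
      then have "X x = 0" using XR[of x] by simp
      then show ?thesis by simp
    qed
    then show "AE x in lborel. norm (norm (X x) powr q) \<le> norm (R powr q * indicator (cball 0 R) x)"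
      by (intro AE_I2) simp
  qed
  have Xi: "(\<lambda>x. X x \<bullet> i0) \<in> borel_measurable lborel" using Xm by measurable
  have q0: "0 \<le> q" using p by (simp add: q_def)
  have Gi0: "(\<lambda>x. \<Gamma> x \<bullet> i0) \<in> borel_measurable lborel" by measurable
  have "(\<lambda>n. \<integral>x. (X x \<bullet> i0) * (s n x * F i0 n x) \<partial>lborel) \<longlonglongrightarrow> (\<integral>x. (X x \<bullet> i0) * (s' x * (\<Gamma> x \<bullet> i0)) \<partial>lborel)"
    by (rule weighted_limit(3)[OF p Xi comp_int[OF Xm Xq i0 q0, unfolded q_def] Gi0 Gip[OF i0] Fm[OF i0] Fi[OF i0] Flim[OF i0] sm sb slim sm'])
  also have "(\<integral>x. (X x \<bullet> i0) * (s' x * (\<Gamma> x \<bullet> i0)) \<partial>lborel) = integral\<^sup>L lborel (\<lambda>x::'a. 0::real)"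
  proof (rule Bochner_Integration.integral_cong_AE)
    show "(\<lambda>x. (X x \<bullet> i0) * (s' x * (\<Gamma> x \<bullet> i0))) \<in> borel_measurable lborel" using Xm sm' by measurable
    show "AE x in lborel. (X x \<bullet> i0) * (s' x * (\<Gamma> x \<bullet> i0)) = 0" using AB by eventually_elim auto
  qed simp
  finally have Z1: "(\<lambda>n. \<integral>x. (X x \<bullet> i0) * (s n x * F i0 n x) \<partial>lborel) \<longlonglongrightarrow> 0" by simp
  have phii: "integrable lborel (\<phi> n)" for n
    by (rule integrable_compact_support[OF times_differentiable_continuous[OF phitd[of 0]] K1(2) out(1)])
  have parts: "(\<integral>x. \<phi> n x \<partial>lborel) = - (\<integral>x. (X x \<bullet> i0) * (s n x * F i0 n x) \<partial>lborel)" for n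
  proof -
    have ll: "loc_lipschitz UNIV (\<lambda>x::'a. x \<bullet> i0)"
      unfolding loc_lipschitz_def
    proof (intro ballI exI conjI)
      fix x :: 'a
      show "1-lipschitz_on (cball x 1 \<inter> UNIV) (\<lambda>x. x \<bullet> i0)"
        by (rule lipschitz_onI) (use Basis_le_norm[OF i0] in \<open>auto simp: dist_norm inner_diff_left[symmetric]\<close>)
    qed simp
    have der: "AE x::'a in lborel. x \<in> UNIV \<longrightarrow> ((\<lambda>x. x \<bullet> i0) has_derivative (\<lambda>h. h \<bullet> i0)) (at x)"
      by (auto intro!: bounded_linear_imp_has_derivative bounded_linear_inner_left)
    have tf: "\<phi> n \<in> test_functions UNIV" using phi[of n] by (auto simp: test_functions_def)
    obtain d' where d': "integrable lborel d'" "integral\<^sup>L lborel d' = 0"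
      "AE x in lborel. d' x = (if x \<in> UNIV then (i0 \<bullet> i0) * \<phi> n x + (x \<bullet> i0) * frechet_derivative (\<phi> n) (at x) i0 else 0)"
      by (rule integration_by_parts[OF open_UNIV ll tf i0 der])
    have e: "(x \<bullet> i0) * (s n x * F i0 n x) = (X x \<bullet> i0) * (s n x * F i0 n x)" for x
      using out(2)[of x n] K2(4) i0 by (cases "x \<in> K2") (auto simp: X_def)
    have i: "integrable lborel (\<lambda>x. (X x \<bullet> i0) * (s n x * F i0 n x))"
      by (rule weighted_limit(1)[OF p Xi comp_int[OF Xm Xq i0 q0, unfolded q_def] Gi0 Gip[OF i0] Fm[OF i0] Fi[OF i0] Flim[OF i0] sm sb slim sm'])
    have "integral\<^sup>L lborel d' = (\<integral>x. \<phi> n x + (X x \<bullet> i0) * (s n x * F i0 n x) \<partial>lborel)"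
    proof (rule Bochner_Integration.integral_cong_AE)
      show "AE x in lborel. d' x = \<phi> n x + (X x \<bullet> i0) * (s n x * F i0 n x)"
        using d'(3) by eventually_elim (use i0 in \<open>simp add: Dphi[OF i0] e\<close>)
      show "d' \<in> borel_measurable lborel" using d'(1) by auto
      show "(\<lambda>x. \<phi> n x + (X x \<bullet> i0) * (s n x * F i0 n x)) \<in> borel_measurable lborel"
        using i phii[of n] by auto
    qed
    then show ?thesis using d'(2) i phii[of n] by simp
  qed
  have Z2: "(\<lambda>n. \<integral>x. \<phi> n x \<partial>lborel) \<longlonglongrightarrow> (\<integral>x. flat_exp 0 (w x - \<epsilon>) \<partial>lborel)"
   and int0: "integrable lborel (\<lambda>x. flat_exp 0 (w x - \<epsilon>))"
  proof -
    have m0: "flat_exp 0 \<in> borel_measurable borel"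
      using cont_fe by (auto intro!: borel_measurable_continuous_onI continuous_at_imp_continuous_on)
    have m1: "(\<lambda>x. flat_exp 0 (w x - \<epsilon>)) \<in> borel_measurable lborel" using m0 by measurable
    have m2: "\<phi> n \<in> borel_measurable lborel" for n using phii by auto
    have dom: "integrable lborel (\<lambda>x::'a. 1 * indicator (cball 0 R) x :: real)" by (rule integrable_cball_const)
    have l: "AE x in lborel. (\<lambda>n. \<phi> n x) \<longlonglongrightarrow> flat_exp 0 (w x - \<epsilon>)"
    proof (rule AE_I2)
      fix x show "(\<lambda>n. \<phi> n x) \<longlonglongrightarrow> flat_exp 0 (w x - \<epsilon>)"
      proof (cases "x \<in> K1")
        case True
        show ?thesis unfolding \<phi>_def
          by (rule isCont_tendsto_compose[OF cont_fe tendsto_diff[OF Wlim[OF True] tendsto_const]])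
      qed (simp add: out out')
    qed
    have b: "AE x in lborel. norm (\<phi> n x) \<le> 1 * indicator (cball 0 R) x" for n
    proof (rule AE_I2)
      fix x show "norm (\<phi> n x) \<le> 1 * indicator (cball 0 R) x"
      proof (cases "x \<in> K1")
        case True
        then have "norm x \<le> R" using R K2(4) by blast
        then show ?thesis by (simp add: \<phi>_def flat_exp_def)
      qed (simp add: out)
    qed
    show "(\<lambda>n. \<integral>x. \<phi> n x \<partial>lborel) \<longlonglongrightarrow> (\<integral>x. flat_exp 0 (w x - \<epsilon>) \<partial>lborel)"
      by (rule integral_dominated_convergence[OF m1 m2 dom l b])
    show "integrable lborel (\<lambda>x. flat_exp 0 (w x - \<epsilon>))"
      by (rule integrable_dominated_convergence[OF m1 m2 dom l b])
  qed
  have Z3: "(\<lambda>n. \<integral>x. \<phi> n x \<partial>lborel) \<longlonglongrightarrow> - 0"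
    unfolding parts by (rule tendsto_minus[OF Z1])
  have "(\<integral>x. flat_exp 0 (w x - \<epsilon>) \<partial>lborel) = - 0" by (rule LIMSEQ_unique[OF Z2 Z3])
  then have "(\<integral>x. flat_exp 0 (w x - \<epsilon>) \<partial>lborel) = 0" by simp
  then have AE0: "AE x in lborel. flat_exp 0 (w x - \<epsilon>) = 0"
    using integral_nonneg_eq_0_iff_AE[OF int0] flat_exp_nonneg by auto
  show "h x0 \<le> v x0 + \<epsilon>"
  proof (rule ccontr)
    assume "\<not> h x0 \<le> v x0 + \<epsilon>"
    then have x0': "\<epsilon> < h x0 - v x0" by simp
    define S where "S = {x \<in> D. \<epsilon> < h x - v x}"
    have cDD: "continuous_on D (\<lambda>x. h x - v x)"
      using closure_subset[of D] by (intro continuous_intros continuous_on_subset[OF hc] continuous_on_subset[OF vc])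
    have "S = (\<lambda>x. h x - v x) -` {\<epsilon><..} \<inter> D" by (auto simp: S_def)
    then have oS: "open S" using continuous_on_open_vimage[OF op, of "\<lambda>x. h x - v x"] cDD by auto
    have xS: "x0 \<in> S" using x0 x0' by (simp add: S_def)
    have aS: "AE x in lborel. x \<in> S \<longrightarrow> flat_exp 0 (w x - \<epsilon>) = 0" using AE0 by eventually_elim simp
    obtain y where y: "y \<in> S" "flat_exp 0 (w y - \<epsilon>) = 0" using not_AE_open[OF oS xS aS] by auto
    have "y \<in> K" using y(1) closure_subset[of D] by (auto simp: S_def K_def)
    then have "y \<in> K2" using K1(4) K2(4) by blast
    then have "w y - \<epsilon> > 0" using y(1) by (simp add: w_def S_def)
    then show False using y(2) flat_exp_pos[of "w y - \<epsilon>" 0] by simp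
  qed
qed

section \<open>Singular initial value problems\<close>

lemma last_nonneg_point:
  fixes g :: "real \<Rightarrow> real"
  assumes "continuous_on {a..b} g" "0 \<le> g a" "a \<le> t1" "t1 \<le> b" "g t1 < 0"
  obtains t0 where "a \<le> t0" "t0 < t1" "g t0 = 0" "\<And>t. t0 < t \<Longrightarrow> t \<le> t1 \<Longrightarrow> g t < 0"
proof -
  have c1: "continuous_on {a..t1} g" using assms(1,4) by (auto intro: continuous_on_subset)
  define S where "S = {a..t1} \<inter> g -` {0..}"
  have S: "compact S" "a \<in> S"
    using continuous_closed_preimage[OF c1 closed_atLeastAtMost closed_atLeast[of 0]] assms(2,3)
    by (auto simp: S_def compact_eq_bounded_closed intro: bounded_subset[OF bounded_closed_interval[of a t1]])
  obtain t0 where t0: "t0 \<in> S" "\<And>t. t \<in> S \<Longrightarrow> t \<le> t0"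
    using compact_attains_sup[OF S(1)] S(2) by blast
  have neg: "g t < 0" if "t0 < t" "t \<le> t1" for t
    using t0(2)[of t] t0(1) that by (force simp: S_def)
  have lt: "t0 < t1" using t0(1) assms(5) by (force simp: S_def le_less)
  have "g t0 \<le> 0"
  proof (rule ccontr)
    assume "\<not> g t0 \<le> 0"
    moreover have "continuous_on {t0..t1} g" using c1 t0(1) by (auto intro: continuous_on_subset simp: S_def)
    ultimately obtain t where "t0 \<le> t" "t \<le> t1" "g t = 0"
      using IVT2'[of g t1 0 t0] assms(5) lt by auto
    then show False using neg[of t] \<open>\<not> g t0 \<le> 0\<close> by (cases "t = t0") auto
  qed
  then have "g t0 = 0" using t0(1) by (auto simp: S_def)
  then show thesis using that t0(1) lt neg by (auto simp: S_def)
qed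

text \<open>
  At the last zero before a point where \<open>g\<close> is negative, the mean value theorem would produce a
  negative derivative at a point where \<open>g\<close> is negative. In contrast to \<open>strict_barrier\<close> below, no
  derivative is needed at the left endpoint, which is a singular point in the applications.
\<close>
lemma barrier:
  fixes g :: "real \<Rightarrow> real"
  assumes c: "continuous_on {a..b} g" and a: "0 \<le> g a"
    and d: "\<And>t. a < t \<Longrightarrow> t < b \<Longrightarrow> (g has_real_derivative g' t) (at t)"
    and n: "\<And>t. a < t \<Longrightarrow> t < b \<Longrightarrow> g t < 0 \<Longrightarrow> 0 \<le> g' t"
    and t: "a \<le> t1" "t1 \<le> b"
  shows "0 \<le> g t1"
proof (rule ccontr)
  assume "\<not> 0 \<le> g t1"
  then have neg: "g t1 < 0" by simp
  obtain t0 where t0: "a \<le> t0" "t0 < t1" "g t0 = 0" "\<And>t. t0 < t \<Longrightarrow> t \<le> t1 \<Longrightarrow> g t < 0"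
    using last_nonneg_point[OF c a t neg] by blast
  have c': "continuous_on {t0..t1} g" using c t0 t by (auto intro: continuous_on_subset)
  obtain l z where z: "t0 < z" "z < t1" "DERIV g z :> l" "g t1 - g t0 = (t1 - t0) * l"
  proof -
    have "g differentiable (at x)" if "t0 < x" "x < t1" for x
      using d[of x] t0 t that by (auto simp: real_differentiable_def)
    then show thesis using MVT[OF t0(2) c'] that by blast
  qed
  have "l = g' z" using DERIV_unique[OF z(3) d] z t0 t by auto
  then have "0 \<le> l" using n[of z] t0 z t by auto
  then have "0 \<le> (t1 - t0) * l" using t0(2) by simp
  then show False using z(4) t0(3) neg by simp
qed

lemma strict_barrier:
  fixes g :: "real \<Rightarrow> real"
  assumes c: "continuous_on {a..b} g" and a: "0 \<le> g a"
    and d: "\<And>t. a \<le> t \<Longrightarrow> t < b \<Longrightarrow> (g has_real_derivative g' t) (at t)"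
    and n: "\<And>t. a \<le> t \<Longrightarrow> t < b \<Longrightarrow> g t = 0 \<Longrightarrow> 0 < g' t"
    and t: "a \<le> t1" "t1 \<le> b"
  shows "0 \<le> g t1"
proof (rule ccontr)
  assume "\<not> 0 \<le> g t1"
  then have neg: "g t1 < 0" by simp
  obtain t0 where t0: "a \<le> t0" "t0 < t1" "g t0 = 0" "\<And>t. t0 < t \<Longrightarrow> t \<le> t1 \<Longrightarrow> g t < 0"
    using last_nonneg_point[OF c a t neg] by blast
  have "DERIV g t0 :> g' t0" "0 < g' t0" using d[of t0] n[of t0] t0 t by auto
  from DERIV_pos_inc_right[OF this] obtain e where e: "e > 0" "\<And>h. 0 < h \<Longrightarrow> h < e \<Longrightarrow> g t0 < g (t0 + h)" by blast
  define h where "h = min (e / 2) (t1 - t0)"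
  have "0 < h" "h < e" "t0 + h \<le> t1" using e(1) t0(2) by (auto simp: h_def)
  then show False using e(2)[of h] t0(3) t0(4)[of "t0 + h"] by force
qed

text \<open>
  Substituting \<open>\<tau> = t s\<close> turns the integral into \<open>t\<^sup>-\<^sup>m \<integral>\<^sub>0\<^sup>t \<tau>\<^sup>m r(\<tau>) d\<tau>\<close>, the solution
  of \<open>y' + m y / t = r\<close> that stays bounded at the singular point \<open>t = 0\<close>. The form over the fixed
  interval makes sense for \<open>t = 0\<close> and depends continuously on parameters.
\<close>
lemma singular_integral_derivative:
  fixes r :: "real \<Rightarrow> real" and m :: nat
  assumes c: "continuous_on {0..T} r" and t: "0 < t" "t < T"
    and y: "\<And>t. t \<in> {0..T} \<Longrightarrow> y t = integral {0..1} (\<lambda>s. t * s ^ m * r (t * s))"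
  shows "(y has_real_derivative r t - real m * y t / t) (at t)"
proof -
  define F where "F s = integral {0..s} (\<lambda>u. u ^ m * r u)" for s
  have cont: "continuous_on {0..T} (\<lambda>u. u ^ m * r u)" by (intro continuous_intros c)
  have F0: "F 0 = 0" by (simp add: F_def)
  have dF: "(F has_real_derivative s ^ m * r s) (at s within {0..T})" if "s \<in> {0..T}" for s
    unfolding F_def using integral_has_real_derivative[OF cont that] .
  have eq: "y t = F t / t ^ m" if t: "0 < t" "t \<le> T" for t
  proof -
    have "((\<lambda>s. t * s ^ m * r (t * s)) has_integral (F (t * 1) / t ^ m - F (t * 0) / t ^ m)) {0..1}"
    proof (rule fundamental_theorem_of_calculus)
      fix s :: real assume s: "s \<in> {0..1}"
      have le: "t * s \<le> T" if "0 \<le> s" "s \<le> 1" for s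
      proof -
        have "t * s \<le> t * 1" by (intro mult_left_mono) (use that t in auto)
        then show ?thesis using t by linarith
      qed
      have ts: "t * s \<in> {0..T}" "(\<lambda>s. t * s) ` {0..1} \<subseteq> {0..T}" using t s le by auto
      have "((\<lambda>s. F (t * s)) has_real_derivative ((t * s) ^ m * r (t * s)) * t) (at s within {0..1})"
        by (rule DERIV_image_chain[where f=F and g="\<lambda>s. t * s", unfolded o_def, OF DERIV_subset[OF dF[OF ts(1)] ts(2)]])
          (auto intro!: derivative_eq_intros)
      then have "((\<lambda>s. F (t * s) / t ^ m) has_real_derivative ((t * s) ^ m * r (t * s)) * t / t ^ m) (at s within {0..1})"
        by (rule DERIV_cdivide)
      also have "((t * s) ^ m * r (t * s)) * t / t ^ m = t * s ^ m * r (t * s)"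
        using t by (simp add: power_mult_distrib)
      finally show "((\<lambda>s. F (t * s) / t ^ m) has_vector_derivative t * s ^ m * r (t * s)) (at s within {0..1})"
        by (simp add: has_real_derivative_iff_has_vector_derivative)
    qed simp
    then have "integral {0..1} (\<lambda>s. t * s ^ m * r (t * s)) = F t / t ^ m" by (simp add: integral_unique F0)
    then show ?thesis using y[of t] t by simp
  qed
  have "(F has_real_derivative t ^ m * r t) (at t)"
    using dF[of t] t by (simp add: at_within_Icc_at)
  then have "((\<lambda>t. F t / t ^ m) has_real_derivative (t ^ m * r t * t ^ m - F t * (real m * t ^ (m - 1))) / (t ^ m * t ^ m)) (at t)"
    using t by (intro DERIV_divide) (auto intro!: derivative_eq_intros)
  also have "(t ^ m * r t * t ^ m - F t * (real m * t ^ (m - 1))) / (t ^ m * t ^ m) = r t - real m * y t / t"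
  proof -
    have "F t = y t * t ^ m" using t eq[of t] by simp
    then show ?thesis using t by (cases m) (auto simp: field_simps)
  qed
  finally have "((\<lambda>t. F t / t ^ m) has_real_derivative r t - real m * y t / t) (at t)" .
  then show ?thesis
    by (rule has_field_derivative_transform_within_open[where S="{0<..<T}"]) (use t eq in auto)
qed

text \<open>
  The integral form of \<open>\<phi>' + m \<phi> / t = R(b, t, \<phi>)\<close>, \<open>\<phi>(0) = 0\<close>. Solving for all parameters
  \<open>b\<close> at once, by a contraction on bounded continuous functions of \<open>(b, t)\<close>, gives continuity in
  the parameter for free; this is what the shooting argument needs.
\<close>
lemma singular_picard:
  fixes R :: "real \<Rightarrow> real \<Rightarrow> real \<Rightarrow> real" and m :: nat
  assumes b: "b0 \<le> b1" and T: "0 \<le> T"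
    and c: "continuous_on (({b0..b1} \<times> {0..T}) \<times> UNIV) (\<lambda>x. R (fst (fst x)) (snd (fst x)) (snd x))"
    and M: "\<And>b t y. b \<in> {b0..b1} \<Longrightarrow> t \<in> {0..T} \<Longrightarrow> \<bar>R b t y\<bar> \<le> M"
    and K: "0 \<le> K" "\<And>b t y y'. b \<in> {b0..b1} \<Longrightarrow> t \<in> {0..T} \<Longrightarrow> \<bar>R b t y - R b t y'\<bar> \<le> K * \<bar>y - y'\<bar>"
  obtains \<phi> where "continuous_on ({b0..b1} \<times> {0..T}) (\<lambda>x. \<phi> (fst x) (snd x))"
    "\<And>b t. b \<in> {b0..b1} \<Longrightarrow> t \<in> {0..T} \<Longrightarrow> \<phi> b t = integral {0..1} (\<lambda>s. t * s ^ m * R b (t * s) (\<phi> b (t * s)))"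
proof -
  \<comment> \<open>weighting with exp (- L t) for this large L (Bielecki norm) makes the integral operator a contraction on the whole interval\<close>
  define \<Lambda> where "\<Lambda> = 2 * K + 1"
  have L: "0 < \<Lambda>" "K / \<Lambda> \<le> 1/2" using K(1) by (auto simp: \<Lambda>_def field_simps)
  \<comment> \<open>projections onto the two intervals extend everything to the plane, where bounded continuous functions form a complete space\<close>
  define cb where "cb x = max b0 (min b1 x)" for x
  define ct where "ct x = max 0 (min T x)" for x
  have cb: "cb x \<in> {b0..b1}" "x \<in> {b0..b1} \<Longrightarrow> cb x = x" for x using b by (auto simp: cb_def)
  have ct: "ct x \<in> {0..T}" "x \<in> {0..T} \<Longrightarrow> ct x = x" for x using T by (auto simp: ct_def)
  have cts: "ct x * s \<in> {0..T}" if "s \<in> {0..1}" for x s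
    using ct(1)[of x] that mult_left_mono[of s 1 "ct x"] by auto
  define f where "f g x s = ct (snd x) * s ^ m * R (cb (fst x)) (ct (snd x) * s)
    (exp (\<Lambda> * (ct (snd x) * s)) * apply_bcontfun g (cb (fst x), ct (snd x) * s))" for g :: "(real \<times> real) \<Rightarrow>\<^sub>C real" and x s
  have fc: "continuous_on (UNIV \<times> {0..1}) (\<lambda>(x, s). f g x s)" for g
  proof -
    have gc: "continuous_on UNIV (apply_bcontfun g)" by (rule continuous_on_apply_bcontfun)
    have 1: "continuous_on (UNIV \<times> {0..1}) (\<lambda>z. exp (\<Lambda> * (ct (snd (fst z)) * snd z)) * apply_bcontfun g (cb (fst (fst z)), ct (snd (fst z)) * snd z))"
      unfolding cb_def ct_def
      by (intro continuous_intros continuous_on_compose2[OF gc]) auto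
    have "continuous_on (UNIV \<times> {0..1}) (\<lambda>z. ((cb (fst (fst z)), ct (snd (fst z)) * snd z), exp (\<Lambda> * (ct (snd (fst z)) * snd z)) * apply_bcontfun g (cb (fst (fst z)), ct (snd (fst z)) * snd z)))"
      by (rule continuous_on_Pair[OF _ 1]) (unfold cb_def ct_def, intro continuous_intros)
    then have "continuous_on (UNIV \<times> {0..1}) (\<lambda>z. (\<lambda>x. R (fst (fst x)) (snd (fst x)) (snd x))
       ((cb (fst (fst z)), ct (snd (fst z)) * snd z), exp (\<Lambda> * (ct (snd (fst z)) * snd z)) * apply_bcontfun g (cb (fst (fst z)), ct (snd (fst z)) * snd z)))"
    proof (rule continuous_on_compose2[OF c])
      show "(\<lambda>z. ((cb (fst (fst z)), ct (snd (fst z)) * snd z), exp (\<Lambda> * (ct (snd (fst z)) * snd z)) * apply_bcontfun g (cb (fst (fst z)), ct (snd (fst z)) * snd z))) ` (UNIV \<times> {0..1})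
        \<subseteq> ({b0..b1} \<times> {0..T}) \<times> UNIV"
        using cb(1) cts by (simp add: image_subset_iff)
    qed
    then have RC: "continuous_on (UNIV \<times> {0..1}) (\<lambda>z. R (cb (fst (fst z))) (ct (snd (fst z)) * snd z)
       (exp (\<Lambda> * (ct (snd (fst z)) * snd z)) * apply_bcontfun g (cb (fst (fst z)), ct (snd (fst z)) * snd z)))"
      by simp
    have "continuous_on (UNIV \<times> {0..1}) (\<lambda>z. ct (snd (fst z)) * snd z ^ m)"
      unfolding ct_def by (intro continuous_intros)
    from continuous_on_mult[OF this RC]
    show ?thesis unfolding f_def split_beta by simp
  qed
  define H where "H g x = exp (- \<Lambda> * ct (snd x)) * integral {0..1} (f g x)" for g x
  have Hc: "continuous_on UNIV (H g)" for g
  proof -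
    have "continuous_on UNIV (\<lambda>x. integral (cbox 0 1) (f g x))"
      by (rule integral_continuous_on_param) (use fc[of g] in simp)
    then show ?thesis unfolding H_def ct_def by (intro continuous_intros) (auto simp: cbox_interval)
  qed
  have fi: "f g x integrable_on {0..1}" for g x
  proof (rule integrable_continuous_interval)
    show "continuous_on {0..1} (f g x)"
    proof -
      have "continuous_on {0..1} (\<lambda>s::real. (x, s))" by (intro continuous_intros)
      from continuous_on_compose2[OF fc[of g] this] show ?thesis by auto
    qed
  qed
  have M0: "0 \<le> M" using M[of b0 0 0] b T by auto
  have fb: "\<bar>f g x s\<bar> \<le> T * M" if "s \<in> {0..1}" for g x s
  proof -
    have "\<bar>f g x s\<bar> \<le> (T * 1) * M"
      unfolding f_def abs_mult using ct(1)[of "snd x"] cb(1)[of "fst x"] cts[OF that] that T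
      by (intro mult_mono M) (auto simp: power_le_one)
    then show ?thesis by simp
  qed
  have Hb: "\<bar>H g x\<bar> \<le> T * M" for g x
  proof -
    have "norm (integral {0..1} (f g x)) \<le> integral {0..1} (\<lambda>s::real. T * M)"
      by (rule integral_norm_bound_integral) (use fb fi in auto)
    then have "\<bar>integral {0..1} (f g x)\<bar> \<le> T * M" by simp
    moreover have "exp (- \<Lambda> * ct (snd x)) \<le> 1" using L ct(1)[of "snd x"] by simp
    ultimately have "\<bar>H g x\<bar> \<le> 1 * (T * M)"
      unfolding H_def abs_mult using T M0 by (intro mult_mono) auto
    then show ?thesis by simp
  qed
  define HH where "HH g = Bcontfun (H g)" for g
  have HH: "apply_bcontfun (HH g) = H g" for g
    unfolding HH_def by (rule Bcontfun_inverse) (use Hc Hb in \<open>auto simp: bcontfun_def bounded_iff intro!: exI[of _ "T * M"]\<close>)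
  have "\<forall>g h. dist (HH g) (HH h) \<le> (1/2) * dist g h"
  proof (intro allI)
    fix g h
    show "dist (HH g) (HH h) \<le> (1/2) * dist g h"
    proof (rule dist_bound)
      fix x :: "real \<times> real"
      let ?t = "ct (snd x)" and ?d = "dist g h"
      have pw: "\<bar>f g x s - f h x s\<bar> \<le> ?t * (K * (exp (\<Lambda> * (?t * s)) * ?d))" if s: "s \<in> {0..1}" for s
      proof -
        let ?z = "(cb (fst x), ?t * s)"
        have "\<bar>f g x s - f h x s\<bar> = (?t * s ^ m) * \<bar>R (cb (fst x)) (?t * s) (exp (\<Lambda> * (?t * s)) * apply_bcontfun g ?z) - R (cb (fst x)) (?t * s) (exp (\<Lambda> * (?t * s)) * apply_bcontfun h ?z)\<bar>"
          unfolding f_def right_diff_distrib[symmetric] abs_mult using ct(1)[of "snd x"] s by simp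
        also have "\<dots> \<le> (?t * 1) * (K * \<bar>exp (\<Lambda> * (?t * s)) * apply_bcontfun g ?z - exp (\<Lambda> * (?t * s)) * apply_bcontfun h ?z\<bar>)"
          using ct(1)[of "snd x"] s cts[OF s] cb(1) by (intro mult_mono K(2)) (auto simp: power_le_one)
        also have "\<dots> = ?t * (K * (exp (\<Lambda> * (?t * s)) * \<bar>apply_bcontfun g ?z - apply_bcontfun h ?z\<bar>))"
          unfolding right_diff_distrib[symmetric] abs_mult by simp
        also have "\<dots> \<le> ?t * (K * (exp (\<Lambda> * (?t * s)) * ?d))"
          using ct(1)[of "snd x"] K(1) dist_bounded[of g ?z h]
          by (intro mult_left_mono) (auto simp: dist_real_def)
        finally show ?thesis .
      qed
      have E: "((\<lambda>s. ?t * (K * (exp (\<Lambda> * (?t * s)) * ?d))) has_integral (K * ?d / \<Lambda> * exp (\<Lambda> * (?t * 1)) - K * ?d / \<Lambda> * exp (\<Lambda> * (?t * 0)))) {0..1}"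
      proof (rule fundamental_theorem_of_calculus)
        fix s :: real assume "s \<in> {0..1}"
        have "((\<lambda>s. K * ?d / \<Lambda> * exp (\<Lambda> * (?t * s))) has_real_derivative ?t * (K * (exp (\<Lambda> * (?t * s)) * ?d))) (at s within {0..1})"
          using L(1) by (auto intro!: derivative_eq_intros)
        then show "((\<lambda>s. K * ?d / \<Lambda> * exp (\<Lambda> * (?t * s))) has_vector_derivative ?t * (K * (exp (\<Lambda> * (?t * s)) * ?d))) (at s within {0..1})"
          by (simp add: has_real_derivative_iff_has_vector_derivative)
      qed simp
      have "norm (integral {0..1} (\<lambda>s. f g x s - f h x s)) \<le> integral {0..1} (\<lambda>s. ?t * (K * (exp (\<Lambda> * (?t * s)) * ?d)))"
        by (rule integral_norm_bound_integral) (use pw E fi[of g x] fi[of h x] in \<open>auto intro!: Henstock_Kurzweil_Integration.integrable_diff\<close>)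
      also have "\<dots> \<le> K * ?d / \<Lambda> * exp (\<Lambda> * ?t)"
        using integral_unique[OF E] K(1) L(1) by simp
      finally have "\<bar>integral {0..1} (f g x) - integral {0..1} (f h x)\<bar> \<le> K * ?d / \<Lambda> * exp (\<Lambda> * ?t)"
        using fi[of g x] fi[of h x] by (simp add: Henstock_Kurzweil_Integration.integral_diff)
      then have "exp (- \<Lambda> * ?t) * \<bar>integral {0..1} (f g x) - integral {0..1} (f h x)\<bar> \<le> exp (- \<Lambda> * ?t) * (K * ?d / \<Lambda> * exp (\<Lambda> * ?t))"
        by (rule mult_left_mono) simp
      also have "\<dots> = K / \<Lambda> * ?d" by (simp add: exp_minus)
      also have "\<dots> \<le> (1/2) * ?d" using L by (intro mult_right_mono) auto
      finally show "dist (apply_bcontfun (HH g) x) (apply_bcontfun (HH h) x) \<le> (1/2) * ?d"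
        unfolding HH H_def dist_real_def right_diff_distrib[symmetric] abs_mult by simp
    qed
  qed
  from banach_fix_type[OF _ _ this] obtain g where g: "HH g = g" by auto
  define \<phi> where "\<phi> b t = exp (\<Lambda> * t) * apply_bcontfun g (b, t)" for b t
  show thesis
  proof (rule that)
    have gc: "continuous_on UNIV (apply_bcontfun g)" by (rule continuous_on_apply_bcontfun)
    show "continuous_on ({b0..b1} \<times> {0..T}) (\<lambda>x. \<phi> (fst x) (snd x))"
      unfolding \<phi>_def by (intro continuous_intros continuous_on_compose2[OF gc]) auto
    fix b t assume bt: "b \<in> {b0..b1}" "t \<in> {0..T}"
    have "apply_bcontfun g (b, t) = H g (b, t)" using HH[of g] g by simp
    also have "\<dots> = exp (- \<Lambda> * t) * integral {0..1} (f g (b, t))"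
      using bt cb(2) ct(2) by (simp add: H_def)
    finally have "\<phi> b t = integral {0..1} (f g (b, t))"
      unfolding \<phi>_def by (simp add: exp_minus)
    also have "\<dots> = integral {0..1} (\<lambda>s. t * s ^ m * R b (t * s) (\<phi> b (t * s)))"
    proof -
      have "f g (b, t) = (\<lambda>s. t * s ^ m * R b (t * s) (\<phi> b (t * s)))"
        using bt cb(2) ct(2) by (simp add: f_def \<phi>_def fun_eq_iff)
      then show ?thesis by simp
    qed
    finally show "\<phi> b t = integral {0..1} (\<lambda>s. t * s ^ m * R b (t * s) (\<phi> b (t * s)))" .
  qed
qed

section \<open>The angle equation of homogeneous solutions\<close>

text \<open>
  In the following \<open>m = N - 2\<close>, and \<open>c\<close> stands for the angle \<open>\<phi>\<close> between \<open>-\<nabla>U\<close> and the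
  radial direction. The angle equation is \<open>\<phi>' = E(\<phi>) - m cot \<theta> S(\<phi>)\<close>, where \<open>E\<close> and \<open>S\<close>
  have the common denominator \<open>D\<close>.
\<close>
definition ang_D :: "real \<Rightarrow> real \<Rightarrow> real" where
  "ang_D p c = 1 + (p - 2) * (sin c)\<^sup>2"

definition ang_E :: "real \<Rightarrow> nat \<Rightarrow> real \<Rightarrow> real \<Rightarrow> real" where
  "ang_E p m \<beta> c = (\<beta> * (p - 1) + (p - (real m + 2)) * (cos c)\<^sup>2) / ang_D p c"

definition ang_S :: "real \<Rightarrow> real \<Rightarrow> real" where
  "ang_S p c = sin c * cos c / ang_D p c"

text \<open>
  The part of \<open>- cot t S(c)\<close> that remains after the singular term \<open>- c / t\<close> is split off. Near
  the axis \<open>c = O(t)\<close>, and there \<open>ang_B\<close> is Lipschitz in \<open>c\<close> uniformly in \<open>t\<close>, which brings the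
  angle equation into the form treated by \<open>singular_picard\<close>.
\<close>
definition ang_B :: "real \<Rightarrow> real \<Rightarrow> real \<Rightarrow> real" where
  "ang_B p t c = c / t - cot t * ang_S p c"

lemma ang_D_alt: "ang_D p c = (cos c)\<^sup>2 + (p - 1) * (sin c)\<^sup>2"
  unfolding ang_D_def cos_squared_eq by (simp add: algebra_simps)

lemma ang_D_bounds:
  assumes "1 < p"
  shows "min 1 (p - 1) \<le> ang_D p c" "0 < ang_D p c" "ang_D p c \<le> max 1 (p - 1)"
proof -
  have 1: "(cos c)\<^sup>2 + (sin c)\<^sup>2 = 1" by simp
  have "min 1 (p - 1) * ((cos c)\<^sup>2 + (sin c)\<^sup>2) \<le> ang_D p c"
  proof -
    have "min 1 (p - 1) * (cos c)\<^sup>2 \<le> 1 * (cos c)\<^sup>2" "min 1 (p - 1) * (sin c)\<^sup>2 \<le> (p - 1) * (sin c)\<^sup>2"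
      by (rule mult_right_mono; simp)+
    then show ?thesis unfolding ang_D_alt distrib_left by linarith
  qed
  then show l: "min 1 (p - 1) \<le> ang_D p c" by simp
  have "ang_D p c \<le> max 1 (p - 1) * ((cos c)\<^sup>2 + (sin c)\<^sup>2)"
  proof -
    have "1 * (cos c)\<^sup>2 \<le> max 1 (p - 1) * (cos c)\<^sup>2" "(p - 1) * (sin c)\<^sup>2 \<le> max 1 (p - 1) * (sin c)\<^sup>2"
      by (rule mult_right_mono; simp)+
    then show ?thesis unfolding ang_D_alt distrib_left by linarith
  qed
  then show "ang_D p c \<le> max 1 (p - 1)" by simp
  show "0 < ang_D p c" using l assms by (auto simp: min_def split: if_splits)
qed

lemma ang_D_deriv: "(ang_D p has_real_derivative 2 * (p - 2) * sin c * cos c) (at c)"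
  unfolding ang_D_def by (auto intro!: derivative_eq_intros)

lemma ang_S_deriv:
  assumes "1 < p"
  shows "(ang_S p has_real_derivative (1 - p * (sin c)\<^sup>2) / (ang_D p c)\<^sup>2) (at c)"
proof -
  have "(ang_S p has_real_derivative ((cos c * cos c + - sin c * sin c) * ang_D p c - sin c * cos c * (2 * (p - 2) * sin c * cos c)) / (ang_D p c * ang_D p c)) (at c)"
    unfolding ang_S_def[abs_def]
    by (rule DERIV_divide[OF DERIV_mult[OF DERIV_sin DERIV_cos, THEN DERIV_cong] ang_D_deriv])
      (use ang_D_bounds(2)[OF assms, of c] in auto)
  also have "(cos c * cos c + - sin c * sin c) * ang_D p c - sin c * cos c * (2 * (p - 2) * sin c * cos c) = 1 - p * (sin c)\<^sup>2"
  proof -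
    have "(cos c)\<^sup>2 = 1 - (sin c)\<^sup>2" by (simp add: cos_squared_eq)
    then show ?thesis unfolding ang_D_def by algebra
  qed
  finally show ?thesis by (simp add: power2_eq_square)
qed

lemma ang_Q_deriv:
  assumes "1 < p"
  shows "((\<lambda>c. (sin c)\<^sup>2 / ang_D p c) has_real_derivative 2 * sin c * cos c / (ang_D p c)\<^sup>2) (at c)"
proof -
  have d: "((\<lambda>c. (sin c)\<^sup>2) has_real_derivative 2 * sin c * cos c) (at c)"
    by (auto intro!: derivative_eq_intros)
  have "((\<lambda>c. (sin c)\<^sup>2 / ang_D p c) has_real_derivative (2 * sin c * cos c * ang_D p c - (sin c)\<^sup>2 * (2 * (p - 2) * sin c * cos c)) / (ang_D p c * ang_D p c)) (at c)"
    by (rule DERIV_divide[OF d ang_D_deriv]) (use ang_D_bounds(2)[OF assms, of c] in auto)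
  also have "2 * sin c * cos c * ang_D p c - (sin c)\<^sup>2 * (2 * (p - 2) * sin c * cos c) = 2 * sin c * cos c"
    unfolding ang_D_def by algebra
  finally show ?thesis by (simp add: power2_eq_square)
qed

lemma ang_E_alt:
  assumes "1 < p" and k: "\<kappa> = \<beta> * (p - 1) + p - (real m + 2)"
  shows "ang_E p m \<beta> c = \<kappa> - ((p - (real m + 2)) + \<kappa> * (p - 2)) * ((sin c)\<^sup>2 / ang_D p c)"
proof -
  have "ang_D p c \<noteq> 0" using ang_D_bounds(2)[OF assms(1), of c] by simp
  moreover have "\<beta> * (p - 1) + (p - (real m + 2)) * (cos c)\<^sup>2 = \<kappa> * ang_D p c - ((p - (real m + 2)) + \<kappa> * (p - 2)) * (sin c)\<^sup>2"
    unfolding k ang_D_def cos_squared_eq by algebra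
  ultimately show ?thesis unfolding ang_E_def by (simp add: diff_divide_distrib)
qed

lemma sin_cos_sum_ge_1: "0 \<le> t \<Longrightarrow> t \<le> pi / 2 \<Longrightarrow> 1 \<le> sin t + cos t"
proof -
  assume t: "0 \<le> t" "t \<le> pi / 2"
  have sc: "0 \<le> sin t" "0 \<le> cos t" using t by (auto intro: sin_ge_zero cos_ge_zero)
  have "1\<^sup>2 \<le> (sin t + cos t)\<^sup>2" using sc by (simp add: power2_sum)
  then show ?thesis using sc by (meson add_nonneg_nonneg power2_le_imp_le)
qed

lemma mult_cos_le_sin: "0 \<le> t \<Longrightarrow> t \<le> pi / 2 \<Longrightarrow> t * cos t \<le> sin t"
proof -
  assume t: "0 \<le> t" "t \<le> pi / 2"
  have "(\<lambda>t. sin t - t * cos t) 0 \<le> (\<lambda>t. sin t - t * cos t) t"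
  proof (rule DERIV_nonneg_imp_nondecreasing[OF t(1)])
    fix x assume x: "0 \<le> x" "x \<le> t"
    have "((\<lambda>t. sin t - t * cos t) has_real_derivative x * sin x) (at x)"
      by (auto intro!: derivative_eq_intros)
    moreover have "0 \<le> x * sin x" using x t by (auto intro!: mult_nonneg_nonneg sin_ge_zero)
    ultimately show "\<exists>y. ((\<lambda>t. sin t - t * cos t) has_real_derivative y) (at x) \<and> 0 \<le> y" by blast
  qed
  then show ?thesis by simp
qed

lemma cot_bounds:
  assumes "0 < t" "t \<le> pi / 2"
  shows "0 \<le> cot t" "cot t \<le> 1 / t" "1 / t - cot t \<le> 1"
proof -
  have s: "0 < sin t" "0 \<le> cos t" using assms by (auto intro: sin_gt_zero cos_ge_zero)
  show "0 \<le> cot t" using s by (simp add: cot_def)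
  show "cot t \<le> 1 / t" using s assms mult_cos_le_sin[of t] by (simp add: cot_def field_simps)
  have "sin t \<le> t * 1" using assms sin_x_le_x by simp
  also have "\<dots> \<le> t * (sin t + cos t)" using assms sin_cos_sum_ge_1[of t] by (intro mult_left_mono) auto
  finally have "sin t - t * cos t \<le> t * sin t" by (simp add: algebra_simps)
  then have "(sin t - t * cos t) / (t * sin t) \<le> 1" using s assms by (simp add: field_simps)
  then show "1 / t - cot t \<le> 1" using s assms by (simp add: cot_def field_simps)
qed

lemma ang_S_bounds:
  assumes "1 < p" "0 \<le> c" "c \<le> pi / 2"
  shows "0 \<le> ang_S p c" "ang_S p c \<le> c / min 1 (p - 1)"
proof -
  note D = ang_D_bounds[OF assms(1), of c]
  have s: "0 \<le> sin c" "0 \<le> cos c" using assms by (auto intro: sin_ge_zero cos_ge_zero)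
  show "0 \<le> ang_S p c" using s D by (simp add: ang_S_def)
  have "sin c * cos c \<le> c * 1" using s assms sin_x_le_x by (intro mult_mono) auto
  then show "ang_S p c \<le> c / min 1 (p - 1)" unfolding ang_S_def using D assms s
    by (intro frac_le) auto
qed

text \<open>
  The derivative in \<open>c\<close> is \<open>1 / t - cot t S'(c)\<close>. Since \<open>S'(0) = 1\<close> up to a quadratic error
  and \<open>1 / t - cot t\<close> is bounded, it is bounded for \<open>c \<le> L t\<close>.
\<close>
lemma ang_B_lipschitz:
  assumes p: "1 < p" and L: "0 \<le> L"
  obtains K where "0 \<le> K" "\<And>t c c'. 0 < t \<Longrightarrow> t \<le> pi / 2 \<Longrightarrow> 0 \<le> c \<Longrightarrow> c \<le> pi / 2 \<Longrightarrow> c \<le> L * t \<Longrightarrow>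
      0 \<le> c' \<Longrightarrow> c' \<le> pi / 2 \<Longrightarrow> c' \<le> L * t \<Longrightarrow> \<bar>ang_B p t c - ang_B p t c'\<bar> \<le> K * \<bar>c - c'\<bar>"
proof -
  define d where "d = min 1 (p - 1)"
  have d: "0 < d" "\<And>c. d \<le> ang_D p c" using p ang_D_bounds(1)[OF p] by (auto simp: d_def)
  define C where "C = (\<bar>p\<bar> + 2 * \<bar>p - 2\<bar> + (p - 2)\<^sup>2) / d\<^sup>2"
  have C0: "0 \<le> C" by (simp add: C_def)
  have S': "\<bar>1 - (1 - p * (sin c)\<^sup>2) / (ang_D p c)\<^sup>2\<bar> \<le> C * c" if c: "0 \<le> c" "c \<le> pi / 2" for c
  proof -
    have s: "0 \<le> sin c" "sin c \<le> c" "sin c \<le> 1" using c sin_x_le_x by (auto intro: sin_ge_zero)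
    have D0: "0 < ang_D p c" using ang_D_bounds(2)[OF p] .
    have "1 - (1 - p * (sin c)\<^sup>2) / (ang_D p c)\<^sup>2 = ((ang_D p c)\<^sup>2 - 1 + p * (sin c)\<^sup>2) / (ang_D p c)\<^sup>2"
      using D0 by (simp add: diff_divide_distrib add_divide_distrib)
    also have "(ang_D p c)\<^sup>2 - 1 + p * (sin c)\<^sup>2 = (sin c)\<^sup>2 * (p + 2 * (p - 2) + (p - 2)\<^sup>2 * (sin c)\<^sup>2)"
      unfolding ang_D_def by algebra
    finally have "\<bar>1 - (1 - p * (sin c)\<^sup>2) / (ang_D p c)\<^sup>2\<bar> = (sin c)\<^sup>2 * \<bar>p + 2 * (p - 2) + (p - 2)\<^sup>2 * (sin c)\<^sup>2\<bar> / (ang_D p c)\<^sup>2"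
      by (simp add: abs_mult abs_divide)
    also have "\<dots> \<le> c * (\<bar>p\<bar> + 2 * \<bar>p - 2\<bar> + (p - 2)\<^sup>2) / d\<^sup>2"
    proof (intro frac_le mult_mono)
      have "(sin c)\<^sup>2 = sin c * sin c" by (simp add: power2_eq_square)
      also have "\<dots> \<le> c * 1" using s by (intro mult_mono) auto
      finally show "(sin c)\<^sup>2 \<le> c" by simp
      have "(p - 2)\<^sup>2 * (sin c)\<^sup>2 \<le> (p - 2)\<^sup>2 * 1"
        by (intro mult_left_mono) (use s in \<open>auto simp: power_le_one\<close>)
      then have Y: "(p - 2)\<^sup>2 * (sin c)\<^sup>2 \<le> (p - 2)\<^sup>2" by simp
      have X: "0 \<le> (p - 2)\<^sup>2 * (sin c)\<^sup>2" by simp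
      have "\<bar>a + b + X\<bar> \<le> \<bar>a\<bar> + \<bar>b\<bar> + Y" if "0 \<le> X" "X \<le> Y" for a b X Y :: real
        using that by linarith
      from this[OF X Y, of p "2 * (p - 2)"]
      show "\<bar>p + 2 * (p - 2) + (p - 2)\<^sup>2 * (sin c)\<^sup>2\<bar> \<le> \<bar>p\<bar> + 2 * \<bar>p - 2\<bar> + (p - 2)\<^sup>2"
        by (simp only: abs_mult abs_numeral)
      show "d\<^sup>2 \<le> (ang_D p c)\<^sup>2" using d by (intro power_mono) (auto simp: less_imp_le)
    qed (use d c in auto)
    also have "\<dots> = C * c" by (simp add: C_def)
    finally show ?thesis .
  qed
  show thesis
  proof (rule that[of "1 + C * L"])
    show "0 \<le> 1 + C * L" using C0 L by simp
    fix t c c' assume t: "0 < t" "t \<le> pi / 2" and c: "0 \<le> c" "c \<le> pi / 2" "c \<le> L * t" "0 \<le> c'" "c' \<le> pi / 2" "c' \<le> L * t"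
    define I where "I = {0..min (pi / 2) (L * t)}"
    have "norm (ang_B p t c - ang_B p t c') \<le> (1 + C * L) * norm (c - c')"
    proof (rule field_differentiable_bound[where S=I and f'="\<lambda>c. 1 / t - cot t * ((1 - p * (sin c)\<^sup>2) / (ang_D p c)\<^sup>2)"])
      show "convex I" by (simp add: I_def)
      fix x assume x: "x \<in> I"
      show "(ang_B p t has_field_derivative 1 / t - cot t * ((1 - p * (sin x)\<^sup>2) / (ang_D p x)\<^sup>2)) (at x within I)"
        unfolding ang_B_def
        by (intro DERIV_diff DERIV_cmult DERIV_cdivide has_field_derivative_at_within[OF ang_S_deriv[OF p]] DERIV_ident)
      have "1 / t - cot t * ((1 - p * (sin x)\<^sup>2) / (ang_D p x)\<^sup>2) = (1 / t - cot t) + cot t * (1 - (1 - p * (sin x)\<^sup>2) / (ang_D p x)\<^sup>2)"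
        by (simp add: right_diff_distrib)
      also have "\<bar>\<dots>\<bar> \<le> \<bar>1 / t - cot t\<bar> + \<bar>cot t\<bar> * \<bar>1 - (1 - p * (sin x)\<^sup>2) / (ang_D p x)\<^sup>2\<bar>"
        by (rule order_trans[OF abs_triangle_ineq]) (simp add: abs_mult)
      also have "\<dots> \<le> 1 + (1 / t) * (C * (L * t))"
      proof (intro add_mono mult_mono)
        have "\<bar>1 - (1 - p * (sin x)\<^sup>2) / (ang_D p x)\<^sup>2\<bar> \<le> C * x" by (rule S') (use x in \<open>auto simp: I_def\<close>)
        also have "C * x \<le> C * (L * t)" using x C0 by (intro mult_left_mono) (auto simp: I_def)
        finally show "\<bar>1 - (1 - p * (sin x)\<^sup>2) / (ang_D p x)\<^sup>2\<bar> \<le> C * (L * t)" .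
      qed (use cot_bounds[OF t] t in auto)
      also have "\<dots> = 1 + C * L" using t by simp
      finally show "norm (1 / t - cot t * ((1 - p * (sin x)\<^sup>2) / (ang_D p x)\<^sup>2)) \<le> 1 + C * L" by simp
    qed (use c in \<open>auto simp: I_def\<close>)
    then show "\<bar>ang_B p t c - ang_B p t c'\<bar> \<le> (1 + C * L) * \<bar>c - c'\<bar>" by simp
  qed
qed

lemma ang_E_lipschitz:
  assumes p: "1 < p"
  shows "\<bar>ang_E p m \<beta> c - ang_E p m \<beta> c'\<bar> \<le> \<bar>(p - (real m + 2)) + (\<beta> * (p - 1) + p - (real m + 2)) * (p - 2)\<bar> * (2 / (min 1 (p - 1))\<^sup>2) * \<bar>c - c'\<bar>"
proof -
  define d where "d = min 1 (p - 1)"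
  have d: "0 < d" "\<And>c. d \<le> ang_D p c" using p ang_D_bounds(1)[OF p] by (auto simp: d_def)
  define \<nu> where "\<nu> = (p - (real m + 2)) + (\<beta> * (p - 1) + p - (real m + 2)) * (p - 2)"
  have Q: "norm ((sin c)\<^sup>2 / ang_D p c - (sin c')\<^sup>2 / ang_D p c') \<le> (2 / d\<^sup>2) * norm (c - c')"
  proof (rule field_differentiable_bound[where S=UNIV and f="\<lambda>c. (sin c)\<^sup>2 / ang_D p c" and f'="\<lambda>c. 2 * sin c * cos c / (ang_D p c)\<^sup>2"])
    fix x :: real
    have "\<bar>2 * sin x * cos x / (ang_D p x)\<^sup>2\<bar> = 2 * \<bar>sin x\<bar> * \<bar>cos x\<bar> / (ang_D p x)\<^sup>2" by (simp add: abs_mult abs_divide)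
    also have "\<dots> \<le> 2 * 1 * 1 / d\<^sup>2"
      using d by (intro frac_le mult_mono power_mono) (auto simp: less_imp_le)
    finally show "norm (2 * sin x * cos x / (ang_D p x)\<^sup>2) \<le> 2 / d\<^sup>2" by simp
  qed (use ang_Q_deriv[OF p] in auto)
  have "ang_E p m \<beta> c - ang_E p m \<beta> c' = \<nu> * ((sin c')\<^sup>2 / ang_D p c' - (sin c)\<^sup>2 / ang_D p c)"
    unfolding ang_E_alt[OF p refl] \<nu>_def by (simp add: right_diff_distrib)
  then have "\<bar>ang_E p m \<beta> c - ang_E p m \<beta> c'\<bar> = \<bar>\<nu>\<bar> * \<bar>(sin c)\<^sup>2 / ang_D p c - (sin c')\<^sup>2 / ang_D p c'\<bar>"
    by (simp add: abs_mult abs_minus_commute)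
  also have "\<dots> \<le> \<bar>\<nu>\<bar> * (2 / d\<^sup>2 * \<bar>c - c'\<bar>)" using Q by (intro mult_left_mono) auto
  finally show ?thesis by (simp add: \<nu>_def d_def mult.assoc)
qed

lemma ang_E_continuous:
  fixes f g :: "'a::metric_space \<Rightarrow> real"
  assumes "1 < p" "continuous_on S f" "continuous_on S g"
  shows "continuous_on S (\<lambda>x. ang_E p m (f x) (g x))"
proof -
  have "ang_D p c \<noteq> 0" for c using ang_D_bounds(2)[OF assms(1), of c] by simp
  then show ?thesis unfolding ang_E_def ang_D_def using assms by (intro continuous_intros) auto
qed

lemma ang_S_continuous:
  fixes g :: "'a::metric_space \<Rightarrow> real"
  assumes "1 < p" "continuous_on S g"
  shows "continuous_on S (\<lambda>x. ang_S p (g x))"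
proof -
  have "ang_D p c \<noteq> 0" for c using ang_D_bounds(2)[OF assms(1), of c] by simp
  then show ?thesis unfolding ang_S_def ang_D_def using assms by (intro continuous_intros) auto
qed

lemma ang_B_continuous:
  fixes cl :: "real \<Rightarrow> real \<Rightarrow> real"
  assumes p: "1 < p" and L: "0 \<le> L" and cl: "continuous_on UNIV (\<lambda>x. cl (fst x) (snd x))"
    and clb: "\<And>t y. 0 \<le> t \<Longrightarrow> 0 \<le> cl t y \<and> cl t y \<le> pi / 2 \<and> cl t y \<le> L * t"
  shows "continuous_on ({0..pi/2} \<times> UNIV) (\<lambda>x. ang_B p (fst x) (cl (fst x) (snd x)))"
proof -
  obtain K where K: "0 \<le> K" "\<And>t c c'. 0 < t \<Longrightarrow> t \<le> pi / 2 \<Longrightarrow> 0 \<le> c \<Longrightarrow> c \<le> pi / 2 \<Longrightarrow> c \<le> L * t \<Longrightarrow>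
      0 \<le> c' \<Longrightarrow> c' \<le> pi / 2 \<Longrightarrow> c' \<le> L * t \<Longrightarrow> \<bar>ang_B p t c - ang_B p t c'\<bar> \<le> K * \<bar>c - c'\<bar>"
    using ang_B_lipschitz[OF p L] by metis
  let ?f = "\<lambda>x. ang_B p (fst x) (cl (fst x) (snd x))"
  have B0: "ang_B p t 0 = 0" for t by (simp add: ang_B_def ang_S_def)
  have Bb: "\<bar>?f x\<bar> \<le> K * (L * fst x)" if x: "x \<in> {0..pi/2} \<times> UNIV" for x
  proof (cases "fst x = 0")
    case True
    then have "cl (fst x) (snd x) = 0" using clb[of 0 "snd x"] by simp
    then show ?thesis using True by (simp add: B0)
  next
    case False
    let ?c = "cl (fst x) (snd x)"
    have c: "0 \<le> ?c" "?c \<le> pi / 2" "?c \<le> L * fst x" using clb[of "fst x" "snd x"] x by auto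
    have "\<bar>ang_B p (fst x) ?c - ang_B p (fst x) 0\<bar> \<le> K * \<bar>?c - 0\<bar>"
      by (rule K(2)) (use x False c L in auto)
    also have "\<dots> \<le> K * (L * fst x)" using c K(1) by (intro mult_left_mono) auto
    finally show ?thesis by (simp add: B0)
  qed
  show ?thesis
    unfolding continuous_on_eq_continuous_within
  proof
    fix x :: "real \<times> real" assume x: "x \<in> {0..pi/2} \<times> UNIV"
    show "continuous (at x within {0..pi/2} \<times> UNIV) ?f"
    proof (cases "fst x = 0")
      case True
      have "((\<lambda>y. K * (L * fst y)) \<longlongrightarrow> K * (L * fst x)) (at x within {0..pi/2} \<times> UNIV)"
        by (intro tendsto_intros)
      then have lim: "((\<lambda>y. K * (L * fst y)) \<longlongrightarrow> 0) (at x within {0..pi/2} \<times> UNIV)" using True by simp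
      have "(?f \<longlongrightarrow> 0) (at x within {0..pi/2} \<times> UNIV)"
        by (rule Lim_null_comparison[OF _ lim]) (use Bb in \<open>auto simp: eventually_at_filter\<close>)
      moreover have "?f x = 0" using Bb[OF x] True by simp
      ultimately show ?thesis by (simp add: continuous_within)
    next
      case False
      define a where "a = fst x / 2"
      have a: "0 < a" "a < fst x" using False x by (auto simp: a_def)
      have "continuous_on ({a..pi/2} \<times> UNIV) ?f"
      proof -
        have clc: "continuous_on ({a..pi/2} \<times> UNIV) (\<lambda>x. cl (fst x) (snd x))" by (rule continuous_on_subset[OF cl]) auto
        have s: "sin (fst z) \<noteq> 0" if "z \<in> {a..pi/2} \<times> UNIV" for z :: "real \<times> real"
          using that a sin_gt_zero[of "fst z"] by force
        show ?thesis unfolding ang_B_def cot_def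
          using a by (intro continuous_intros clc ang_S_continuous[OF p clc]) (use s in auto)
      qed
      moreover have "x \<in> {a..pi/2} \<times> UNIV" using a x by (auto simp: mem_Times_iff)
      ultimately have "continuous (at x within {a..pi/2} \<times> UNIV) ?f" unfolding continuous_on_eq_continuous_within by blast
      moreover have "at x within {a..pi/2} \<times> UNIV = at x within {0..pi/2} \<times> UNIV"
      proof (rule at_within_nhd[where S="{a<..} \<times> UNIV"])
        show "x \<in> {a<..} \<times> UNIV" using a by (simp add: mem_Times_iff)
        show "open ({a<..} \<times> (UNIV :: real set))" by (intro open_Times) auto
      qed (use a in auto)
      ultimately show ?thesis by simp
    qed
  qed
qed

text \<open>
  The right-hand side is made bounded and globally Lipschitz by clipping the angle to
  \<open>[0, min (\<pi>/2) (L t)]\<close>. Barriers show that the solutions satisfy \<open>0 \<le> \<phi> \<le> L t\<close>, so that only the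
  clipping at \<open>\<pi>/2\<close> may be active; the additional term in the equation, by which the angle is drawn
  back to \<open>\<pi>/2\<close>, vanishes below \<open>\<pi>/2\<close>. The last statement is the expansion at the axis:
  with slope \<open>w\<close> the equation there reads \<open>w = E(0) - m w\<close>. The lower bound on
  \<open>b0\<close> says that \<open>E(0) \<ge> 0\<close>, so that the angle does not become negative.
\<close>
lemma angular_family:
  assumes p: "1 < p" and b: "0 \<le> b0" "b0 \<le> b1" and k0: "0 \<le> b0 * (p - 1) + p - (real m + 2)"
  obtains \<phi> L where "0 < L" "continuous_on ({b0..b1} \<times> {0..pi/2}) (\<lambda>x. \<phi> (fst x) (snd x))"
    "\<And>b t. b \<in> {b0..b1} \<Longrightarrow> t \<in> {0..pi/2} \<Longrightarrow> 0 \<le> \<phi> b t \<and> \<phi> b t \<le> L * t"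
    "\<And>b t. b \<in> {b0..b1} \<Longrightarrow> 0 < t \<Longrightarrow> t < pi/2 \<Longrightarrow> (\<phi> b has_real_derivative
       (ang_E p m b (min (\<phi> b t) (pi/2)) - real m * cot t * ang_S p (min (\<phi> b t) (pi/2)) - real m * (\<phi> b t - min (\<phi> b t) (pi/2)) / t)) (at t)"
    "\<And>b. b \<in> {b0..b1} \<Longrightarrow> \<exists>C. \<forall>t\<in>{0..pi/2}. \<bar>\<phi> b t - (b * (p - 1) + p - (real m + 2)) / (real m + 1) * t\<bar> \<le> C * t\<^sup>2"
proof -
  define d where "d = min 1 (p - 1)"
  have d: "0 < d" "\<And>c. d \<le> ang_D p c" using p ang_D_bounds(1)[OF p] by (auto simp: d_def)
  \<comment> \<open>a bound for the numerator of E over the lower bound d of its denominator, so the angle cannot outrun the line of slope L\<close>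
  define L where "L = (b1 * (p - 1) + \<bar>p - (real m + 2)\<bar>) / d + 1"
  have L0: "0 < L" using d b p by (auto simp: L_def intro!: add_nonneg_pos divide_nonneg_pos)
  have EL: "\<bar>ang_E p m \<beta> c\<bar> \<le> L" if "\<beta> \<in> {b0..b1}" for \<beta> c
  proof -
    have "\<bar>\<beta> * (p - 1) + (p - (real m + 2)) * (cos c)\<^sup>2\<bar> \<le> \<bar>\<beta> * (p - 1)\<bar> + \<bar>(p - (real m + 2)) * (cos c)\<^sup>2\<bar>" by simp
    also have "\<dots> \<le> b1 * (p - 1) + \<bar>p - (real m + 2)\<bar> * 1"
      unfolding abs_mult using that b p by (intro add_mono mult_mono) (auto simp: power_le_one abs_square_le_1)
    finally have 1: "\<bar>\<beta> * (p - 1) + (p - (real m + 2)) * (cos c)\<^sup>2\<bar> \<le> b1 * (p - 1) + \<bar>p - (real m + 2)\<bar>" by simp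
    have "\<bar>ang_E p m \<beta> c\<bar> = \<bar>\<beta> * (p - 1) + (p - (real m + 2)) * (cos c)\<^sup>2\<bar> / ang_D p c"
      using ang_D_bounds(2)[OF p, of c] by (simp add: ang_E_def abs_divide)
    also have "\<dots> \<le> (b1 * (p - 1) + \<bar>p - (real m + 2)\<bar>) / d"
      by (rule frac_le) (use 1 d b p in auto)
    finally show ?thesis by (simp add: L_def)
  qed
  define cl where "cl t y = max 0 (min y (min (pi/2) (L * t)))" for t y
  have clb: "0 \<le> cl t y \<and> cl t y \<le> pi / 2 \<and> cl t y \<le> L * t" if "0 \<le> t" for t y
  proof -
    have "0 \<le> max 0 (min y (min a b)) \<and> max 0 (min y (min a b)) \<le> a \<and> max 0 (min y (min a b)) \<le> b"
      if "0 \<le> a" "0 \<le> b" for a b :: real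
      using that by auto
    from this[of "pi/2" "L * t"] show ?thesis using that L0 pi_ge_zero unfolding cl_def by simp
  qed
  have cll: "\<bar>cl t y - cl t y'\<bar> \<le> \<bar>y - y'\<bar>" for t y y'
  proof -
    have "\<bar>max 0 (min y z) - max 0 (min y' z)\<bar> \<le> \<bar>y - y'\<bar>" for z :: real by linarith
    then show ?thesis unfolding cl_def .
  qed
  have clc: "continuous_on UNIV (\<lambda>x. cl (fst x) (snd x))" unfolding cl_def by (intro continuous_intros)
  obtain KB where KB: "0 \<le> KB" "\<And>t c c'. 0 < t \<Longrightarrow> t \<le> pi / 2 \<Longrightarrow> 0 \<le> c \<Longrightarrow> c \<le> pi / 2 \<Longrightarrow> c \<le> L * t \<Longrightarrow>
      0 \<le> c' \<Longrightarrow> c' \<le> pi / 2 \<Longrightarrow> c' \<le> L * t \<Longrightarrow> \<bar>ang_B p t c - ang_B p t c'\<bar> \<le> KB * \<bar>c - c'\<bar>"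
    using ang_B_lipschitz[OF p less_imp_le[OF L0]] by metis
  have B0: "ang_B p t 0 = 0" for t by (simp add: ang_B_def ang_S_def)
  have BL: "\<bar>ang_B p t (cl t y) - ang_B p t (cl t y')\<bar> \<le> KB * \<bar>y - y'\<bar>" if "t \<in> {0..pi/2}" for t y y'
  proof (cases "t = 0")
    case True
    then show ?thesis using KB(1) by (simp add: cl_def B0)
  next
    case False
    then have "\<bar>ang_B p t (cl t y) - ang_B p t (cl t y')\<bar> \<le> KB * \<bar>cl t y - cl t y'\<bar>"
      using that clb[of t y] clb[of t y'] by (intro KB(2)) auto
    also have "\<dots> \<le> KB * \<bar>y - y'\<bar>" using cll KB(1) by (intro mult_left_mono) auto
    finally show ?thesis .
  qed
  have Bs: "\<bar>ang_B p t (cl t y)\<bar> \<le> KB * (L * t)" if "t \<in> {0..pi/2}" for t y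
  proof (cases "t = 0")
    case True
    then show ?thesis by (simp add: cl_def B0)
  next
    case False
    then have "\<bar>ang_B p t (cl t y) - ang_B p t 0\<bar> \<le> KB * \<bar>cl t y - 0\<bar>"
      using that clb[of t y] L0 by (intro KB(2)) auto
    also have "\<dots> \<le> KB * (L * t)" using clb[of t y] that KB(1) by (intro mult_left_mono) auto
    finally show ?thesis by (simp add: B0)
  qed
  define \<nu> where "\<nu> \<beta> = \<bar>(p - (real m + 2)) + (\<beta> * (p - 1) + p - (real m + 2)) * (p - 2)\<bar> * (2 / (min 1 (p - 1))\<^sup>2)" for \<beta>
  have \<nu>0: "0 \<le> \<nu> \<beta>" for \<beta> by (simp add: \<nu>_def)
  have "bounded (\<nu> ` {b0..b1})"
    unfolding \<nu>_def by (intro compact_imp_bounded compact_continuous_image continuous_intros) simp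
  then obtain KE where KE': "\<forall>y\<in>\<nu> ` {b0..b1}. norm y \<le> KE" unfolding bounded_iff by blast
  have KE: "\<nu> \<beta> \<le> KE" if "\<beta> \<in> {b0..b1}" for \<beta>
    using bspec[OF KE' imageI[OF that]] by simp
  have KE0: "0 \<le> KE" using KE[of b0] \<nu>0[of b0] b by auto
  have ElL: "\<bar>ang_E p m \<beta> c - ang_E p m \<beta> c'\<bar> \<le> KE * \<bar>c - c'\<bar>" if "\<beta> \<in> {b0..b1}" for \<beta> c c'
  proof -
    have "\<bar>ang_E p m \<beta> c - ang_E p m \<beta> c'\<bar> \<le> \<nu> \<beta> * \<bar>c - c'\<bar>"
      unfolding \<nu>_def by (rule ang_E_lipschitz[OF p])
    also have "\<dots> \<le> KE * \<bar>c - c'\<bar>" by (rule mult_right_mono[OF KE[OF that]]) simp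
    finally show ?thesis .
  qed
  define R where "R \<beta> t y = ang_E p m \<beta> (cl t y) + real m * ang_B p t (cl t y)" for \<beta> t y
  have RL: "\<bar>R \<beta> t y - R \<beta> t y'\<bar> \<le> (KE + real m * KB) * \<bar>y - y'\<bar>" if "\<beta> \<in> {b0..b1}" "t \<in> {0..pi/2}" for \<beta> t y y'
  proof -
    have "R \<beta> t y - R \<beta> t y' = (ang_E p m \<beta> (cl t y) - ang_E p m \<beta> (cl t y')) + real m * (ang_B p t (cl t y) - ang_B p t (cl t y'))"
      by (simp add: R_def algebra_simps)
    also have "\<bar>\<dots>\<bar> \<le> \<bar>ang_E p m \<beta> (cl t y) - ang_E p m \<beta> (cl t y')\<bar> + real m * \<bar>ang_B p t (cl t y) - ang_B p t (cl t y')\<bar>"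
      by (rule order_trans[OF abs_triangle_ineq]) (simp add: abs_mult)
    also have "\<dots> \<le> KE * \<bar>y - y'\<bar> + real m * (KB * \<bar>y - y'\<bar>)"
      using cll[of t y y'] KE0 by (intro add_mono mult_left_mono BL that order_trans[OF ElL[OF that(1)]]) auto
    finally show ?thesis by (simp add: algebra_simps)
  qed
  have RM: "\<bar>R \<beta> t y\<bar> \<le> L + real m * (KB * (L * (pi/2)))" if "\<beta> \<in> {b0..b1}" "t \<in> {0..pi/2}" for \<beta> t y
  proof -
    have "\<bar>R \<beta> t y\<bar> \<le> \<bar>ang_E p m \<beta> (cl t y)\<bar> + real m * \<bar>ang_B p t (cl t y)\<bar>"
      unfolding R_def by (rule order_trans[OF abs_triangle_ineq]) (simp add: abs_mult)
    also have "\<dots> \<le> L + real m * (KB * (L * (pi/2)))"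
      using that KB(1) L0 by (intro add_mono EL mult_left_mono order_trans[OF Bs[OF that(2)]]) auto
    finally show ?thesis .
  qed
  have Rc: "continuous_on (({b0..b1} \<times> {0..pi/2}) \<times> UNIV) (\<lambda>x. R (fst (fst x)) (snd (fst x)) (snd x))"
  proof -
    have c1: "continuous_on (({b0..b1} \<times> {0..pi/2}) \<times> UNIV) (\<lambda>x. cl (snd (fst x)) (snd x))"
      unfolding cl_def by (intro continuous_intros)
    have A: "continuous_on (({b0..b1} \<times> {0..pi/2}) \<times> (UNIV :: real set)) (\<lambda>x. (snd (fst x), snd x))"
      by (intro continuous_intros)
    have B: "(\<lambda>x. (snd (fst x), snd x)) ` (({b0..b1} \<times> {0..pi/2}) \<times> UNIV) \<subseteq> {0..pi/2} \<times> (UNIV :: real set)"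
      by (auto simp: image_subset_iff)
    have c2: "continuous_on (({b0..b1} \<times> {0..pi/2}) \<times> UNIV) (\<lambda>x. ang_B p (snd (fst x)) (cl (snd (fst x)) (snd x)))"
      using continuous_on_compose2[OF ang_B_continuous[OF p less_imp_le[OF L0] clc clb] A B] by simp
    show ?thesis unfolding R_def
      by (intro continuous_on_add continuous_on_mult continuous_on_const c2 ang_E_continuous[OF p _ c1] continuous_intros)
  qed
  obtain \<phi> where phic: "continuous_on ({b0..b1} \<times> {0..pi/2}) (\<lambda>x. \<phi> (fst x) (snd x))"
    and phi: "\<And>b t. b \<in> {b0..b1} \<Longrightarrow> t \<in> {0..pi/2} \<Longrightarrow> \<phi> b t = integral {0..1} (\<lambda>s. t * s ^ m * R b (t * s) (\<phi> b (t * s)))"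
    by (rule singular_picard[OF b(2) _ Rc RM _ RL, of m]) (use KE0 KB(1) in auto)
  have phicb: "continuous_on {0..pi/2} (\<phi> b)" if "b \<in> {b0..b1}" for b
  proof -
    have "continuous_on {0..pi/2} (\<lambda>t. (b, t))" by (intro continuous_intros)
    moreover have "Pair b ` {0..pi/2} \<subseteq> {b0..b1} \<times> {0..pi/2}" using that by (auto simp: image_subset_iff)
    ultimately show ?thesis using continuous_on_compose2[OF phic, of "{0..pi/2}" "Pair b"] by simp
  qed
  have rc: "continuous_on {0..pi/2} (\<lambda>t. R b t (\<phi> b t))" if bb: "b \<in> {b0..b1}" for b
  proof -
    have "continuous_on {0..pi/2} (\<lambda>t. ((b, t), \<phi> b t))" by (intro continuous_intros phicb bb)
    moreover have "(\<lambda>t. ((b, t), \<phi> b t)) ` {0..pi/2} \<subseteq> ({b0..b1} \<times> {0..pi/2}) \<times> UNIV" using bb by (auto simp: image_subset_iff)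
    ultimately show ?thesis using continuous_on_compose2[OF Rc, of "{0..pi/2}" "\<lambda>t. ((b, t), \<phi> b t)"] by simp
  qed
  have der: "(\<phi> b has_real_derivative R b t (\<phi> b t) - real m * \<phi> b t / t) (at t)"
    if bb: "b \<in> {b0..b1}" and t: "0 < t" "t < pi/2" for b t
    using singular_integral_derivative[OF rc[OF bb] t phi[OF bb]] by blast
  have Rd: "R b t y - real m * y / t = ang_E p m b (cl t y) - real m * cot t * ang_S p (cl t y) - real m * (y - cl t y) / t" for b t y
    by (simp add: R_def ang_B_def algebra_simps diff_divide_distrib)
  have phi0: "\<phi> b 0 = 0" if "b \<in> {b0..b1}" for b using phi[OF that, of 0] by simp
  have pos: "0 \<le> \<phi> b t" if bb: "b \<in> {b0..b1}" and t: "t \<in> {0..pi/2}" for b t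
  proof (rule barrier[OF phicb[OF bb] _ der[OF bb]])
    fix t assume t: "0 < t" "t < pi/2" and neg: "\<phi> b t < 0"
    have "cl t (\<phi> b t) = 0" using neg by (simp add: cl_def)
    then have e: "R b t (\<phi> b t) = b * (p - 1) + p - (real m + 2)"
      by (simp add: R_def B0 ang_E_def ang_D_def)
    have "b0 * (p - 1) \<le> b * (p - 1)" using bb p by (intro mult_right_mono) auto
    moreover have "real m * \<phi> b t / t \<le> 0" using neg t by (intro divide_nonpos_pos mult_nonneg_nonpos) auto
    ultimately show "0 \<le> R b t (\<phi> b t) - real m * \<phi> b t / t" unfolding e using k0 by linarith
  qed (use t phi0[OF bb] in auto)
  have upper: "\<phi> b t \<le> L * t" if bb: "b \<in> {b0..b1}" and t: "t \<in> {0..pi/2}" for b t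
  proof -
    have "0 \<le> L * t - \<phi> b t"
    proof (rule barrier[where g="\<lambda>t. L * t - \<phi> b t" and a=0 and b="pi/2"])
      show "continuous_on {0..pi/2} (\<lambda>t. L * t - \<phi> b t)" by (intro continuous_intros phicb bb)
      fix t assume t: "0 < t" "t < pi/2"
      show "((\<lambda>t. L * t - \<phi> b t) has_real_derivative L - (R b t (\<phi> b t) - real m * \<phi> b t / t)) (at t)"
        by (auto intro!: derivative_eq_intros der[OF bb t])
      assume neg: "L * t - \<phi> b t < 0"
      have c: "cl t (\<phi> b t) \<le> \<phi> b t" "0 \<le> cl t (\<phi> b t)" "cl t (\<phi> b t) \<le> pi/2"
        using neg pos[OF bb, of t] t clb[of t "\<phi> b t"] by (auto simp: cl_def)
      have "0 \<le> real m * cot t * ang_S p (cl t (\<phi> b t))"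
        using cot_bounds(1)[of t] t ang_S_bounds(1)[OF p c(2,3)] by auto
      moreover have "0 \<le> real m * (\<phi> b t - cl t (\<phi> b t)) / t" using c t by auto
      moreover have "ang_E p m b (cl t (\<phi> b t)) \<le> L" using EL[OF bb, of "cl t (\<phi> b t)"] by linarith
      ultimately show "0 \<le> L - (R b t (\<phi> b t) - real m * \<phi> b t / t)" unfolding Rd by linarith
    qed (use t phi0[OF bb] in auto)
    then show ?thesis by simp
  qed
  show thesis
  proof (rule that[OF L0 phic])
    fix b assume bb: "b \<in> {b0..b1}"
    show "0 \<le> \<phi> b t \<and> \<phi> b t \<le> L * t" if "t \<in> {0..pi/2}" for t using pos upper bb that by blast
    show "(\<phi> b has_real_derivative
       (ang_E p m b (min (\<phi> b t) (pi/2)) - real m * cot t * ang_S p (min (\<phi> b t) (pi/2)) - real m * (\<phi> b t - min (\<phi> b t) (pi/2)) / t)) (at t)"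
      if t: "0 < t" "t < pi/2" for t
    proof -
      have "cl t (\<phi> b t) = min (\<phi> b t) (pi/2)" using pos[OF bb, of t] upper[OF bb, of t] t by (auto simp: cl_def)
      then show ?thesis using der[OF bb t] unfolding Rd by simp
    qed
    let ?\<kappa> = "b * (p - 1) + p - (real m + 2)"
    have R\<kappa>: "\<bar>R b s (\<phi> b s) - ?\<kappa>\<bar> \<le> (KE * L + real m * (KB * L)) * s" if s: "s \<in> {0..pi/2}" for s
    proof -
      have "R b s (\<phi> b s) - ?\<kappa> = (ang_E p m b (cl s (\<phi> b s)) - ang_E p m b 0) + real m * ang_B p s (cl s (\<phi> b s))"
        by (simp add: R_def ang_E_def ang_D_def)
      also have "\<bar>\<dots>\<bar> \<le> \<bar>ang_E p m b (cl s (\<phi> b s)) - ang_E p m b 0\<bar> + real m * \<bar>ang_B p s (cl s (\<phi> b s))\<bar>"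
        by (rule order_trans[OF abs_triangle_ineq]) (simp add: abs_mult)
      also have "\<dots> \<le> KE * (L * s) + real m * (KB * (L * s))"
        using clb[of s "\<phi> b s"] s KE0 by (intro add_mono mult_left_mono Bs order_trans[OF ElL[OF bb]]) auto
      finally show ?thesis by (simp add: algebra_simps)
    qed
    show "\<exists>C. \<forall>t\<in>{0..pi/2}. \<bar>\<phi> b t - ?\<kappa> / (real m + 1) * t\<bar> \<le> C * t\<^sup>2"
    proof (intro exI ballI)
      fix t :: real assume t: "t \<in> {0..pi/2}"
      define C where "C = KE * L + real m * (KB * L)"
      have C0: "0 \<le> C" using KE0 KB(1) L0 by (simp add: C_def)
      have ts: "t * s \<in> {0..pi/2}" if "s \<in> {0..1}" for s
      proof -
        have "t * s \<le> t * 1" by (intro mult_left_mono) (use that t in auto)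
        then show ?thesis using t that by auto
      qed
      have I1: "((\<lambda>s. t * s ^ m * ?\<kappa>) has_integral ?\<kappa> / (real m + 1) * t) {0..1}"
      proof -
        have "((\<lambda>s. t * s ^ m * ?\<kappa>) has_integral (t * ?\<kappa> / (real m + 1) * 1 ^ (Suc m) - t * ?\<kappa> / (real m + 1) * 0 ^ (Suc m))) {0..1}"
        proof (rule fundamental_theorem_of_calculus)
          fix s :: real
          have "((\<lambda>s. t * ?\<kappa> / (real m + 1) * s ^ (Suc m)) has_real_derivative t * ?\<kappa> / (real m + 1) * (real (Suc m) * s ^ m)) (at s within {0..1})"
          proof (rule DERIV_cmult)
            show "((\<lambda>s. s ^ Suc m) has_real_derivative real (Suc m) * s ^ m) (at s within {0..1})"
              by (rule DERIV_cong[OF DERIV_power[OF DERIV_ident]]) simp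
          qed
          also have "t * ?\<kappa> / (real m + 1) * (real (Suc m) * s ^ m) = t * s ^ m * ?\<kappa>"
          proof -
            have "real m + 1 \<noteq> 0" by linarith
            then show ?thesis by (simp add: field_simps)
          qed
          finally show "((\<lambda>s. t * ?\<kappa> / (real m + 1) * s ^ (Suc m)) has_vector_derivative t * s ^ m * ?\<kappa>) (at s within {0..1})"
            by (simp add: has_real_derivative_iff_has_vector_derivative)
        qed simp
        then show ?thesis by (simp add: mult.commute)
      qed
      have i2: "(\<lambda>s. t * s ^ m * R b (t * s) (\<phi> b (t * s))) integrable_on {0..1}"
      proof (rule integrable_continuous_interval)
        have c1: "continuous_on {0..1} (\<lambda>s. R b (t * s) (\<phi> b (t * s)))"
          by (rule continuous_on_compose2[OF rc[OF bb]]) (use ts in \<open>auto intro!: continuous_intros\<close>)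
        show "continuous_on {0..1} (\<lambda>s. t * s ^ m * R b (t * s) (\<phi> b (t * s)))"
          by (rule continuous_on_mult[OF _ c1]) (intro continuous_intros)
      qed
      have e1: "\<phi> b t - ?\<kappa> / (real m + 1) * t = integral {0..1} (\<lambda>s. t * s ^ m * R b (t * s) (\<phi> b (t * s)) - t * s ^ m * ?\<kappa>)"
        using phi[OF bb t] integral_unique[OF I1] i2 I1 by (simp add: Henstock_Kurzweil_Integration.integral_diff has_integral_integrable)
      have e2: "norm (integral {0..1} (\<lambda>s. t * s ^ m * R b (t * s) (\<phi> b (t * s)) - t * s ^ m * ?\<kappa>)) \<le> integral {0..1} (\<lambda>s::real. C * t\<^sup>2)"
      proof (rule integral_norm_bound_integral)
        show "(\<lambda>s. C * t\<^sup>2) integrable_on {0..1::real}" by (rule integrable_const_ivl)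
        show "(\<lambda>s. t * s ^ m * R b (t * s) (\<phi> b (t * s)) - t * s ^ m * ?\<kappa>) integrable_on {0..1}"
          by (rule Henstock_Kurzweil_Integration.integrable_diff[OF i2 has_integral_integrable[OF I1]])
        fix s :: real assume s: "s \<in> {0..1}"
        have "norm (t * s ^ m * R b (t * s) (\<phi> b (t * s)) - t * s ^ m * ?\<kappa>) = (t * s ^ m) * \<bar>R b (t * s) (\<phi> b (t * s)) - ?\<kappa>\<bar>"
          unfolding right_diff_distrib[symmetric] real_norm_def abs_mult using t s by simp
        also have "\<dots> \<le> (t * 1) * (C * (t * s))"
          using t s R\<kappa>[OF ts[OF s]] by (intro mult_mono) (auto simp: C_def power_le_one)
        also have "\<dots> \<le> (t * 1) * (C * (t * 1))"
          using t s C0 by (intro mult_left_mono) auto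
        finally show "norm (t * s ^ m * R b (t * s) (\<phi> b (t * s)) - t * s ^ m * ?\<kappa>) \<le> C * t\<^sup>2"
          by (simp add: power2_eq_square mult.left_commute)
      qed
      show "\<bar>\<phi> b t - ?\<kappa> / (real m + 1) * t\<bar> \<le> (KE * L + real m * (KB * L)) * t\<^sup>2"
        using e2 unfolding e1 C_def by simp
    qed
  qed
qed

text \<open>
  The intermediate value theorem in the parameter. For \<open>b0\<close>, the smallest admissible parameter, the
  angle at \<open>\<pi>/2\<close> is too small: if \<open>p < N\<close> then \<open>E(0) = 0\<close> and \<open>\<phi> = 0\<close> is a solution, and if
  \<open>p \<ge> N\<close> then \<open>b0 = 0\<close> and \<open>\<pi>/2\<close> is a barrier. For large parameters \<open>E\<close> is so large that
  \<open>\<phi> \<ge> 2 t\<close>. A solution that reaches \<open>\<pi>/2\<close> at the right endpoint does not reach it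
  before, since at \<open>\<pi>/2\<close> the equation reads \<open>\<phi>' = \<beta> > 0\<close>.
\<close>
lemma angular_shooting:
  assumes p: "1 < p"
  obtains \<beta> \<phi> L C where "0 < \<beta>" "0 < L" "continuous_on {0..pi/2} \<phi>" "\<phi> 0 = 0" "\<phi> (pi/2) = pi/2"
    "\<And>t. 0 \<le> t \<Longrightarrow> t < pi/2 \<Longrightarrow> \<phi> t < pi/2"
    "\<And>t. t \<in> {0..pi/2} \<Longrightarrow> 0 \<le> \<phi> t \<and> \<phi> t \<le> L * t"
    "\<And>t. 0 < t \<Longrightarrow> t < pi/2 \<Longrightarrow> (\<phi> has_real_derivative (ang_E p m \<beta> (\<phi> t) - real m * cot t * ang_S p (\<phi> t))) (at t)"
    "\<And>t. t \<in> {0..pi/2} \<Longrightarrow> \<bar>\<phi> t - (\<beta> * (p - 1) + p - (real m + 2)) / (real m + 1) * t\<bar> \<le> C * t\<^sup>2"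
proof -
  define d where "d = min 1 (p - 1)"
  define dm where "dm = max 1 (p - 1)"
  have d: "0 < d" "\<And>c. d \<le> ang_D p c" "0 < dm" "\<And>c. ang_D p c \<le> dm" "\<And>c. 0 < ang_D p c"
    using p ang_D_bounds[OF p] by (auto simp: d_def dm_def)
  define b0 where "b0 = max 0 (((real m + 2) - p) / (p - 1))"
  \<comment> \<open>bounds the retarding terms m cot t S and m (y - c) / t together, relative to y / t\<close>
  define M where "M = real m * max 1 (1 / d)"
  have M0: "0 \<le> M" by (simp add: M_def)
  define b1 where "b1 = b0 + (dm * (2 * (1 + M)) + \<bar>p - (real m + 2)\<bar>) / (p - 1)"
  have b: "0 \<le> b0" "b0 \<le> b1" using p M0 d by (auto simp: b0_def b1_def intro!: divide_nonneg_pos add_nonneg_nonneg mult_nonneg_nonneg)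
  have k0: "0 \<le> b0 * (p - 1) + p - (real m + 2)"
  proof -
    have "((real m + 2) - p) / (p - 1) \<le> b0" by (simp add: b0_def)
    then show ?thesis using p by (simp add: divide_le_eq)
  qed
  obtain \<phi> L where phi: "0 < L" "continuous_on ({b0..b1} \<times> {0..pi/2}) (\<lambda>x. \<phi> (fst x) (snd x))"
    "\<And>b t. b \<in> {b0..b1} \<Longrightarrow> t \<in> {0..pi/2} \<Longrightarrow> 0 \<le> \<phi> b t \<and> \<phi> b t \<le> L * t"
    and der: "\<And>b t. b \<in> {b0..b1} \<Longrightarrow> 0 < t \<Longrightarrow> t < pi/2 \<Longrightarrow> (\<phi> b has_real_derivative
       (ang_E p m b (min (\<phi> b t) (pi/2)) - real m * cot t * ang_S p (min (\<phi> b t) (pi/2)) - real m * (\<phi> b t - min (\<phi> b t) (pi/2)) / t)) (at t)"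
    and near: "\<And>b. b \<in> {b0..b1} \<Longrightarrow> \<exists>C. \<forall>t\<in>{0..pi/2}. \<bar>\<phi> b t - (b * (p - 1) + p - (real m + 2)) / (real m + 1) * t\<bar> \<le> C * t\<^sup>2"
    by (rule angular_family[OF p b k0], rule that, assumption+)
  have phi0: "\<phi> b 0 = 0" if "b \<in> {b0..b1}" for b using phi(3)[OF that, of 0] by simp
  have phicb: "continuous_on {0..pi/2} (\<phi> b)" if "b \<in> {b0..b1}" for b
  proof -
    have "continuous_on {0..pi/2} (Pair b)" by (intro continuous_intros)
    moreover have "Pair b ` {0..pi/2} \<subseteq> {b0..b1} \<times> {0..pi/2}" using that by (auto simp: image_subset_iff)
    ultimately show ?thesis using continuous_on_compose2[OF phi(2), of "{0..pi/2}" "Pair b"] by simp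
  qed
  \<comment> \<open>at the lower end the angle stays below the boundary value\<close>
  have low: "\<phi> b0 (pi/2) < pi/2"
  proof (cases "p < real m + 2")
    case True
    then have b0eq: "b0 * (p - 1) = (real m + 2) - p" using p by (simp add: b0_def max_def field_simps)
    have bb: "b0 \<in> {b0..b1}" using b by simp
    \<comment> \<open>here E vanishes at angle zero, and a Gronwall estimate for the barrier forces the angle to vanish identically\<close>
    define A where "A = ((real m + 2) - p) / d"
    have A0: "0 \<le> A" using True d by (simp add: A_def)
    obtain KE where KE: "0 \<le> KE" "\<And>c. 0 \<le> c \<Longrightarrow> ang_E p m b0 c \<le> KE * c"
    proof (rule that[of A])
      fix c :: real assume c: "0 \<le> c"
      have "ang_E p m b0 c = ((real m + 2) - p) * (sin c)\<^sup>2 / ang_D p c"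
        unfolding ang_E_def b0eq cos_squared_eq by (simp add: algebra_simps)
      also have "\<dots> \<le> ((real m + 2) - p) * c / d"
      proof (intro frac_le mult_left_mono)
        have "(sin c)\<^sup>2 = \<bar>sin c\<bar> * \<bar>sin c\<bar>" by (simp add: power2_eq_square)
        also have "\<dots> \<le> 1 * \<bar>c\<bar>" by (intro mult_mono abs_sin_x_le_abs_x) auto
        finally show "(sin c)\<^sup>2 \<le> c" using c by simp
      qed (use True d c in auto)
      finally show "ang_E p m b0 c \<le> A * c" by (simp add: A_def)
    qed (rule A0)
    obtain KB where KB: "0 \<le> KB" "\<And>t c c'. 0 < t \<Longrightarrow> t \<le> pi / 2 \<Longrightarrow> 0 \<le> c \<Longrightarrow> c \<le> pi / 2 \<Longrightarrow> c \<le> L * t \<Longrightarrow>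
      0 \<le> c' \<Longrightarrow> c' \<le> pi / 2 \<Longrightarrow> c' \<le> L * t \<Longrightarrow> \<bar>ang_B p t c - ang_B p t c'\<bar> \<le> KB * \<bar>c - c'\<bar>"
      using ang_B_lipschitz[OF p less_imp_le[OF phi(1)]] by metis
    define Z where "Z = KE + real m * KB"
    have Z0: "0 \<le> Z" using KE KB by (simp add: Z_def)
    have "0 \<le> - (exp (- Z * (pi/2)) * \<phi> b0 (pi/2))"
    proof (rule barrier[where g="\<lambda>t. - (exp (- Z * t) * \<phi> b0 t)" and a=0 and b="pi/2"])
      show "continuous_on {0..pi/2} (\<lambda>t. - (exp (- Z * t) * \<phi> b0 t))" by (intro continuous_intros phicb bb)
      fix t assume t: "0 < t" "t < pi/2"
      let ?y = "\<phi> b0 t" let ?c = "min (\<phi> b0 t) (pi/2)"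
      let ?r = "ang_E p m b0 ?c - real m * cot t * ang_S p ?c - real m * (?y - ?c) / t"
      show "((\<lambda>t. - (exp (- Z * t) * \<phi> b0 t)) has_real_derivative - (exp (- Z * t) * (?r - Z * ?y))) (at t)"
        by (auto intro!: derivative_eq_intros der[OF bb t] simp: algebra_simps)
      have y: "0 \<le> ?y" "?y \<le> L * t" using phi(3)[OF bb, of t] t by auto
      have c: "0 \<le> ?c" "?c \<le> pi/2" "?c \<le> L * t" "?c \<le> ?y" using y by auto
      have "?r = ang_E p m b0 ?c + real m * ang_B p t ?c - real m * ?y / t"
        by (simp add: ang_B_def algebra_simps diff_divide_distrib)
      also have "\<dots> \<le> KE * ?c + real m * (KB * ?c) - 0"
      proof (intro diff_mono add_mono mult_left_mono KE(2) c(1))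
        have "\<bar>ang_B p t ?c - ang_B p t 0\<bar> \<le> KB * \<bar>?c - 0\<bar>" by (rule KB(2)) (use t c y phi(1) in auto)
        from order_trans[OF abs_ge_self this]
        show "ang_B p t ?c \<le> KB * ?c" using c(1) by (simp add: ang_B_def[of p t 0] ang_S_def[of p 0])
        show "0 \<le> real m * ?y / t" using y t by simp
      qed simp
      also have "\<dots> = Z * ?c" by (simp add: Z_def algebra_simps)
      also have "\<dots> \<le> Z * ?y" by (rule mult_left_mono[OF c(4) Z0])
      finally show "0 \<le> - (exp (- Z * t) * (?r - Z * ?y))" by (simp add: mult_nonneg_nonpos)
    qed (use phi0[OF bb] in auto)
    then have "\<phi> b0 (pi/2) \<le> 0" by (simp add: mult_le_0_iff)
    then show ?thesis using pi_gt_zero by linarith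
  next
    case False
    then have "((real m + 2) - p) / (p - 1) \<le> 0" using p by (intro divide_nonpos_pos) auto
    then have b0z: "b0 = 0" by (simp add: b0_def)
    have bb: "b0 \<in> {b0..b1}" using b by simp
    \<comment> \<open>here E vanishes at the angle pi/2, which can therefore be approached at most exponentially\<close>
    define Z where "Z = (p - (real m + 2)) / d + 1"
    have Z0: "0 < Z" using False d by (auto simp: Z_def intro!: add_nonneg_pos divide_nonneg_pos)
    have E: "ang_E p m b0 c \<le> Z * (pi/2 - c)" if c: "0 \<le> c" "c \<le> pi/2" for c
    proof -
      have "ang_E p m b0 c = (p - (real m + 2)) * (cos c)\<^sup>2 / ang_D p c" by (simp add: ang_E_def b0z)
      also have "\<dots> \<le> (p - (real m + 2)) * (pi/2 - c) / d"
      proof (intro frac_le mult_left_mono)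
        have "(cos c)\<^sup>2 = sin (pi/2 - c) * sin (pi/2 - c)" by (simp add: power2_eq_square sin_diff)
        also have "\<dots> \<le> 1 * (pi/2 - c)" using c by (intro mult_mono sin_x_le_x) (auto intro!: sin_ge_zero)
        finally show "(cos c)\<^sup>2 \<le> pi/2 - c" by simp
      qed (use False d c in auto)
      also have "\<dots> \<le> Z * (pi/2 - c)" using c by (simp add: Z_def algebra_simps)
      finally show ?thesis .
    qed
    have "0 \<le> (pi/2) * (1 - exp (- Z * (pi/2))) - \<phi> b0 (pi/2)"
    proof (rule barrier[where g="\<lambda>t. (pi/2) * (1 - exp (- Z * t)) - \<phi> b0 t" and a=0 and b="pi/2"])
      show "continuous_on {0..pi/2} (\<lambda>t. (pi/2) * (1 - exp (- Z * t)) - \<phi> b0 t)" by (intro continuous_intros phicb bb)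
      fix t assume t: "0 < t" "t < pi/2"
      let ?y = "\<phi> b0 t" let ?c = "min (\<phi> b0 t) (pi/2)"
      let ?r = "ang_E p m b0 ?c - real m * cot t * ang_S p ?c - real m * (?y - ?c) / t"
      show "((\<lambda>t. (pi/2) * (1 - exp (- Z * t)) - \<phi> b0 t) has_real_derivative (pi/2) * (Z * exp (- Z * t)) - ?r) (at t)"
        by (auto intro!: derivative_eq_intros der[OF bb t] simp: algebra_simps)
      assume neg: "(pi/2) * (1 - exp (- Z * t)) - ?y < 0"
      have y: "0 \<le> ?y" using phi(3)[OF bb, of t] t by auto
      have c: "0 \<le> ?c" "?c \<le> pi/2" "?c \<le> ?y" using y by auto
      have "0 \<le> real m * cot t * ang_S p ?c" using cot_bounds(1)[of t] t ang_S_bounds(1)[OF p c(1,2)] by auto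
      moreover have "0 \<le> real m * (?y - ?c) / t" using c t by auto
      ultimately have "?r \<le> Z * (pi/2 - ?c)" using E[OF c(1,2)] by linarith
      also have "\<dots> \<le> Z * ((pi/2) * exp (- Z * t))"
      proof (intro mult_left_mono)
        have 1: "(pi/2) * (1 - exp (- Z * t)) \<le> ?y" using neg by linarith
        have 2: "(pi/2) * (1 - exp (- Z * t)) \<le> (pi/2) * 1" by (intro mult_left_mono) auto
        have "(pi/2) * (1 - exp (- Z * t)) \<le> ?c" by (rule min.boundedI[OF 1]) (use 2 in linarith)
        then show "pi/2 - ?c \<le> (pi/2) * exp (- Z * t)" unfolding right_diff_distrib by linarith
      qed (use Z0 in simp)
      finally have "?r \<le> (pi/2) * (Z * exp (- Z * t))" by (simp only: mult.left_commute)
      then show "0 \<le> (pi/2) * (Z * exp (- Z * t)) - ?r" by (simp only: diff_ge_0_iff_ge)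
    qed (use phi0[OF bb] in auto)
    moreover have "(pi/2) * (1 - exp (- Z * (pi/2))) < (pi/2) * 1"
      by (intro mult_strict_left_mono) auto
    ultimately show ?thesis by linarith
  qed
  \<comment> \<open>at the upper end the line of slope 2 is a lower barrier\<close>
  have high: "pi/2 \<le> \<phi> b1 (pi/2)"
  proof -
    have bb: "b1 \<in> {b0..b1}" using b by simp
    define a where "a = 2 * (1 + M)"
    have E: "a \<le> ang_E p m b1 c" for c
    proof -
      define Q where "Q = dm * a + \<bar>p - (real m + 2)\<bar>"
      have "b1 = b0 + Q / (p - 1)" by (simp add: b1_def Q_def a_def)
      then have e1: "b1 * (p - 1) = b0 * (p - 1) + (dm * a + \<bar>p - (real m + 2)\<bar>)"
        using p by (simp add: distrib_right Q_def[symmetric])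
      have e2: "0 \<le> b0 * (p - 1)" using b p by simp
      have e3: "- \<bar>p - (real m + 2)\<bar> \<le> (p - (real m + 2)) * (cos c)\<^sup>2"
      proof -
        have "\<bar>(p - (real m + 2)) * (cos c)\<^sup>2\<bar> \<le> \<bar>p - (real m + 2)\<bar> * 1"
          unfolding abs_mult by (intro mult_left_mono) (auto simp: abs_square_le_1)
        moreover have "- q \<le> X" if "\<bar>X\<bar> \<le> q * 1" for X q :: real using that by linarith
        ultimately show ?thesis by blast
      qed
      have "W \<le> A + X" if "A = B + (W + q)" "0 \<le> B" "- q \<le> X" for A B W X q :: real using that by linarith
      from this[OF e1 e2 e3] have "dm * a \<le> b1 * (p - 1) + (p - (real m + 2)) * (cos c)\<^sup>2" .
      moreover have "a * ang_D p c \<le> a * dm" by (rule mult_left_mono[OF d(4)]) (use M0 in \<open>simp add: a_def\<close>)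
      moreover have "a * dm = dm * a" by simp
      ultimately have "a * ang_D p c \<le> b1 * (p - 1) + (p - (real m + 2)) * (cos c)\<^sup>2" by linarith
      then show ?thesis unfolding ang_E_def using d(5)[of c] by (simp add: pos_le_divide_eq)
    qed
    have "0 \<le> \<phi> b1 (pi/2) - 2 * (pi/2)"
    proof (rule barrier[where g="\<lambda>t. \<phi> b1 t - 2 * t" and a=0 and b="pi/2"])
      show "continuous_on {0..pi/2} (\<lambda>t. \<phi> b1 t - 2 * t)" by (intro continuous_intros phicb bb)
      fix t assume t: "0 < t" "t < pi/2"
      let ?y = "\<phi> b1 t" let ?c = "min (\<phi> b1 t) (pi/2)"
      let ?r = "ang_E p m b1 ?c - real m * cot t * ang_S p ?c - real m * (?y - ?c) / t"
      show "((\<lambda>t. \<phi> b1 t - 2 * t) has_real_derivative ?r - 2) (at t)"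
        by (auto intro!: derivative_eq_intros der[OF bb t])
      assume neg: "?y - 2 * t < 0"
      have y: "0 \<le> ?y" using phi(3)[OF bb, of t] t by auto
      have c: "0 \<le> ?c" "?c \<le> pi/2" "?c \<le> ?y" using y by auto
      have "cot t * ang_S p ?c \<le> (1 / t) * (?c / d)"
        using cot_bounds[of t] t ang_S_bounds[OF p c(1,2)] by (intro mult_mono) (auto simp: d_def)
      also have "\<dots> \<le> (1 / t) * (?c * max 1 (1 / d))"
      proof -
        have "?c * (1 / d) \<le> ?c * max 1 (1 / d)" using c(1) by (intro mult_left_mono) auto
        then show ?thesis using t by (intro mult_left_mono) auto
      qed
      finally have "real m * (cot t * ang_S p ?c) \<le> real m * ((1 / t) * (?c * max 1 (1 / d)))" by (intro mult_left_mono) auto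
      moreover have "real m * ((1 / t) * (?y - ?c)) \<le> real m * ((1 / t) * ((?y - ?c) * max 1 (1 / d)))"
      proof -
        have "(?y - ?c) * 1 \<le> (?y - ?c) * max 1 (1 / d)" using c(3) by (intro mult_left_mono) auto
        then show ?thesis using t by (intro mult_left_mono) auto
      qed
      ultimately have "real m * (cot t * ang_S p ?c) + real m * ((1 / t) * (?y - ?c)) \<le> M * (?y / t)"
        unfolding M_def by (simp add: algebra_simps add_divide_distrib diff_divide_distrib)
      also have "\<dots> \<le> M * 2" using neg t M0 by (intro mult_left_mono) (auto simp: divide_le_eq)
      finally have f: "real m * (cot t * ang_S p ?c) + real m * ((1 / t) * (?y - ?c)) \<le> M * 2" .
      have "real m * cot t * ang_S p ?c = real m * (cot t * ang_S p ?c)" "real m * (?y - ?c) / t = real m * ((1 / t) * (?y - ?c))"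
        by simp_all
      moreover have "0 \<le> E - A1 - A2 - 2" if "A1 = R1" "A2 = R2" "2 * (1 + M) \<le> E" "R1 + R2 \<le> M * 2" for E A1 A2 R1 R2 :: real
      proof -
        have "A1 + A2 \<le> M * 2" using that by simp
        moreover have "2 + M * 2 \<le> E" using that(3) by (simp add: distrib_left)
        ultimately show ?thesis by (simp add: algebra_simps)
      qed
      ultimately show "0 \<le> ?r - 2" using E[of ?c, unfolded a_def] f by blast
    qed (use phi0[OF bb] in auto)
    then show ?thesis using pi_gt_zero by linarith
  qed
  have cb: "continuous_on {b0..b1} (\<lambda>b. \<phi> b (pi/2))"
  proof -
    have "continuous_on {b0..b1} (\<lambda>b. (b, pi/2))" by (intro continuous_intros)
    moreover have "(\<lambda>b. (b, pi/2)) ` {b0..b1} \<subseteq> {b0..b1} \<times> {0..pi/2}" by (auto simp: image_subset_iff)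
    ultimately show ?thesis using continuous_on_compose2[OF phi(2), of "{b0..b1}" "\<lambda>b. (b, pi/2)"] by simp
  qed
  obtain \<beta> where be: "b0 \<le> \<beta>" "\<beta> \<le> b1" "\<phi> \<beta> (pi/2) = pi/2"
    using IVT'[of "\<lambda>b. \<phi> b (pi/2)" b0 "pi/2" b1] low high b cb by force
  have bb: "\<beta> \<in> {b0..b1}" using be by simp
  have beta0: "0 < \<beta>" using be low b by (cases "\<beta> = b0") auto
  \<comment> \<open>after reaching pi/2 at t the solution could not return: it stays above by the strict barrier, and then strictly above by comparison with a linear equation\<close>
  have below: "\<phi> \<beta> t < pi/2" if t: "0 \<le> t" "t < pi/2" for t
  proof (rule ccontr)
    assume "\<not> \<phi> \<beta> t < pi/2"
    then have ge: "pi/2 \<le> \<phi> \<beta> t" by simp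
    have t0: "0 < t" using ge phi0[OF bb] pi_gt_zero t by (cases "t = 0") auto
    have E2: "ang_E p m \<beta> (pi/2) = \<beta>" using p by (simp add: ang_E_def ang_D_def)
    have S2: "ang_S p (pi/2) = 0" by (simp add: ang_S_def)
    have cc: "continuous_on {t..pi/2} (\<lambda>s. \<phi> \<beta> s - pi/2)"
      by (intro continuous_intros continuous_on_subset[OF phicb[OF bb]]) (use t0 in auto)
    have dd: "((\<lambda>s. \<phi> \<beta> s - pi/2) has_real_derivative
       (ang_E p m \<beta> (min (\<phi> \<beta> s) (pi/2)) - real m * cot s * ang_S p (min (\<phi> \<beta> s) (pi/2)) - real m * (\<phi> \<beta> s - min (\<phi> \<beta> s) (pi/2)) / s)) (at s)"
      if "t \<le> s" "s < pi/2" for s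
      using DERIV_diff[OF der[OF bb, of s] DERIV_const[of "pi/2"]] that t0 by simp
    have nonneg: "0 \<le> \<phi> \<beta> s - pi/2" if "t \<le> s" "s \<le> pi/2" for s
    proof (rule strict_barrier[OF cc _ dd _ that])
      fix s assume s: "t \<le> s" "s < pi/2" "\<phi> \<beta> s - pi/2 = 0"
      then have e: "\<phi> \<beta> s = pi/2" by simp
      show "0 < ang_E p m \<beta> (min (\<phi> \<beta> s) (pi/2)) - real m * cot s * ang_S p (min (\<phi> \<beta> s) (pi/2)) - real m * (\<phi> \<beta> s - min (\<phi> \<beta> s) (pi/2)) / s"
        unfolding e by (simp add: E2 S2 beta0)
    qed (use ge in auto)
    define Z where "Z = real m / t + 1"
    have Z0: "0 < Z" using t0 by (auto simp: Z_def intro!: add_nonneg_pos)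
    have "0 \<le> (\<phi> \<beta> (pi/2) - pi/2) - (\<beta> / Z) * (1 - exp (- Z * (pi/2 - t)))"
    proof (rule barrier[where g="\<lambda>s. (\<phi> \<beta> s - pi/2) - (\<beta> / Z) * (1 - exp (- Z * (s - t)))" and a=t and b="pi/2"])
      show "continuous_on {t..pi/2} (\<lambda>s. (\<phi> \<beta> s - pi/2) - (\<beta> / Z) * (1 - exp (- Z * (s - t))))"
        by (intro continuous_on_diff[OF cc] continuous_intros)
      fix s assume s: "t < s" "s < pi/2"
      let ?y = "\<phi> \<beta> s - pi/2"
      have y: "0 \<le> ?y" using nonneg s by auto
      have mn: "min (\<phi> \<beta> s) (pi/2) = pi/2" using y by auto
      have h1: "((\<lambda>s. \<phi> \<beta> s - pi/2) has_real_derivative \<beta> - real m * ?y / s) (at s)"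
        using dd[of s] s unfolding mn E2 S2 by simp
      have h2: "((\<lambda>s. (\<beta> / Z) * (1 - exp (- Z * (s - t)))) has_real_derivative \<beta> * exp (- Z * (s - t))) (at s)"
        using Z0 by (auto intro!: derivative_eq_intros)
      show "((\<lambda>s. (\<phi> \<beta> s - pi/2) - (\<beta> / Z) * (1 - exp (- Z * (s - t)))) has_real_derivative (\<beta> - real m * ?y / s) - \<beta> * exp (- Z * (s - t))) (at s)"
        by (rule DERIV_diff[OF h1 h2])
      assume neg: "?y - (\<beta> / Z) * (1 - exp (- Z * (s - t))) < 0"
      have "real m * ?y / s \<le> real m * ?y / t" using y s t0 by (intro divide_left_mono) auto
      also have "\<dots> \<le> Z * ?y"
      proof -
        have "(a / t + 1) * w = a * w / t + w" for a w :: real by (simp add: distrib_right)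
        then show ?thesis using y unfolding Z_def by simp
      qed
      also have "\<dots> \<le> Z * ((\<beta> / Z) * (1 - exp (- Z * (s - t))))" using neg Z0 by (intro mult_left_mono) auto
      also have "\<dots> = \<beta> * (1 - exp (- Z * (s - t)))" using Z0 by simp
      finally show "0 \<le> (\<beta> - real m * ?y / s) - \<beta> * exp (- Z * (s - t))" by (simp add: algebra_simps)
    qed (use ge t in auto)
    moreover have "0 < (\<beta> / Z) * (1 - exp (- Z * (pi/2 - t)))"
      using beta0 Z0 t by (intro mult_pos_pos) auto
    ultimately show False using be(3) by linarith
  qed
  obtain C where C: "\<forall>t\<in>{0..pi/2}. \<bar>\<phi> \<beta> t - (\<beta> * (p - 1) + p - (real m + 2)) / (real m + 1) * t\<bar> \<le> C * t\<^sup>2"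
    using near[OF bb] by blast
  show thesis
  proof (rule that[OF beta0 phi(1) phicb[OF bb] phi0[OF bb] be(3) below phi(3)[OF bb]])
    fix t assume t: "0 < t" "t < pi/2"
    have "min (\<phi> \<beta> t) (pi/2) = \<phi> \<beta> t" using below[of t] t by simp
    then show "(\<phi> \<beta> has_real_derivative (ang_E p m \<beta> (\<phi> \<beta> t) - real m * cot t * ang_S p (\<phi> \<beta> t))) (at t)"
      using der[OF bb t] by simp
  qed (use C in auto)
qed

section \<open>Closure properties of locally Lipschitz functions\<close>

lemma loc_lipschitz_I: "L-lipschitz_on S f \<Longrightarrow> loc_lipschitz S f"
  unfolding loc_lipschitz_def by (intro ballI exI[of _ 1] conjI exI[of _ L]) (auto elim: lipschitz_on_subset)

lemma loc_lipschitz_subset: "loc_lipschitz S f \<Longrightarrow> T \<subseteq> S \<Longrightarrow> loc_lipschitz T f"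
  unfolding loc_lipschitz_def by (meson Int_mono lipschitz_on_subset order_refl subsetD)

lemma loc_lipschitz_cong: "loc_lipschitz S f \<Longrightarrow> (\<And>x. x \<in> S \<Longrightarrow> f x = g x) \<Longrightarrow> loc_lipschitz S g"
  unfolding loc_lipschitz_def lipschitz_on_def by (metis (no_types, lifting) IntD2)

lemma loc_lipschitz_const: "loc_lipschitz S (\<lambda>x. c)"
  by (rule loc_lipschitz_I[of 0]) (simp add: lipschitz_on_def)

lemma loc_lipschitz_pair:
  assumes "loc_lipschitz S f" "x \<in> S" "loc_lipschitz S g"
  obtains u L where "0 < u" "u \<le> 1" "L-lipschitz_on (cball x u \<inter> S) f" "L-lipschitz_on (cball x u \<inter> S) g"
proof -
  obtain u1 L1 where 1: "0 < u1" "L1-lipschitz_on (cball x u1 \<inter> S) f" using assms unfolding loc_lipschitz_def by blast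
  obtain u2 L2 where 2: "0 < u2" "L2-lipschitz_on (cball x u2 \<inter> S) g" using assms unfolding loc_lipschitz_def by blast
  define u where "u = min 1 (min u1 u2)"
  have s: "cball x u \<inter> S \<subseteq> cball x u1 \<inter> S" "cball x u \<inter> S \<subseteq> cball x u2 \<inter> S" by (auto simp: u_def)
  show thesis
  proof (rule that[of u "max L1 L2"])
    show "(max L1 L2)-lipschitz_on (cball x u \<inter> S) f"
      by (rule lipschitz_on_mono[OF 1(2) s(1)]) simp
    show "(max L1 L2)-lipschitz_on (cball x u \<inter> S) g"
      by (rule lipschitz_on_mono[OF 2(2) s(2)]) simp
  qed (use 1 2 in \<open>auto simp: u_def\<close>)
qed

lemma loc_lipschitz_add:
  fixes f g :: "'a::metric_space \<Rightarrow> 'b::real_normed_vector"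
  assumes "loc_lipschitz S f" "loc_lipschitz S g"
  shows "loc_lipschitz S (\<lambda>x. f x + g x)"
  unfolding loc_lipschitz_def
proof
  fix x assume "x \<in> S"
  then obtain u L where u: "0 < u" "L-lipschitz_on (cball x u \<inter> S) f" "L-lipschitz_on (cball x u \<inter> S) g"
    using loc_lipschitz_pair[OF assms(1) _ assms(2)] by metis
  then show "\<exists>u>0. \<exists>L. L-lipschitz_on (cball x u \<inter> S) (\<lambda>x. f x + g x)"
    using lipschitz_on_add[OF u(2,3)] by blast
qed

lemma loc_lipschitz_mult:
  fixes f g :: "'a::metric_space \<Rightarrow> real"
  assumes "loc_lipschitz S f" "loc_lipschitz S g"
  shows "loc_lipschitz S (\<lambda>x. f x * g x)"
  unfolding loc_lipschitz_def
proof
  fix x assume x: "x \<in> S"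
  then obtain u L where u: "0 < u" "u \<le> 1" "L-lipschitz_on (cball x u \<inter> S) f" "L-lipschitz_on (cball x u \<inter> S) g"
    using loc_lipschitz_pair[OF assms(1) _ assms(2)] by metis
  have L0: "0 \<le> L" using u(3) by (rule lipschitz_on_nonneg)
  have b: "\<bar>h y\<bar> \<le> \<bar>h x\<bar> + L" if "L-lipschitz_on (cball x u \<inter> S) h" "y \<in> cball x u \<inter> S" for h :: "'a \<Rightarrow> real" and y
  proof -
    have "\<bar>h y - h x\<bar> \<le> L * dist y x" using lipschitz_onD[OF that, of x] x u(1) by (simp add: dist_real_def)
    also have "\<dots> \<le> L * 1" using that(2) u(2) L0 by (intro mult_left_mono) (auto simp: dist_commute)
    finally show ?thesis by linarith
  qed
  have "((\<bar>f x\<bar> + L) * L + (\<bar>g x\<bar> + L) * L)-lipschitz_on (cball x u \<inter> S) (\<lambda>x. f x * g x)"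
  proof (rule lipschitz_onI)
    fix y z assume yz: "y \<in> cball x u \<inter> S" "z \<in> cball x u \<inter> S"
    have "f y * g y - f z * g z = f y * (g y - g z) + g z * (f y - f z)" by (simp add: algebra_simps)
    also have "\<bar>\<dots>\<bar> \<le> \<bar>f y\<bar> * \<bar>g y - g z\<bar> + \<bar>g z\<bar> * \<bar>f y - f z\<bar>"
      by (rule order_trans[OF abs_triangle_ineq]) (simp add: abs_mult)
    also have "\<dots> \<le> (\<bar>f x\<bar> + L) * (L * dist y z) + (\<bar>g x\<bar> + L) * (L * dist y z)"
      using b[OF u(3) yz(1)] b[OF u(4) yz(2)] lipschitz_onD[OF u(3) yz] lipschitz_onD[OF u(4) yz] L0
      by (intro add_mono mult_mono) (auto simp: dist_real_def)
    finally show "dist (f y * g y) (f z * g z) \<le> ((\<bar>f x\<bar> + L) * L + (\<bar>g x\<bar> + L) * L) * dist y z"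
      by (simp add: dist_real_def algebra_simps)
  qed (use L0 in simp)
  then show "\<exists>u>0. \<exists>L. L-lipschitz_on (cball x u \<inter> S) (\<lambda>x. f x * g x)" using u(1) by blast
qed

lemma loc_lipschitz_compose:
  assumes f: "loc_lipschitz S f" and g: "loc_lipschitz T g" and sub: "\<And>x. x \<in> S \<Longrightarrow> f x \<in> T"
  shows "loc_lipschitz S (\<lambda>x. g (f x))"
  unfolding loc_lipschitz_def
proof
  fix x assume x: "x \<in> S"
  obtain u1 L1 where 1: "0 < u1" "L1-lipschitz_on (cball x u1 \<inter> S) f" using f x unfolding loc_lipschitz_def by blast
  obtain u2 L2 where 2: "0 < u2" "L2-lipschitz_on (cball (f x) u2 \<inter> T) g" using g sub[OF x] unfolding loc_lipschitz_def by blast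
  have L1: "0 \<le> L1" using 1(2) by (rule lipschitz_on_nonneg)
  define u where "u = min u1 (u2 / (L1 + 1))"
  have u0: "0 < u" using 1 2 L1 by (simp add: u_def)
  have fin: "f y \<in> cball (f x) u2 \<inter> T" if y: "y \<in> cball x u \<inter> S" for y
  proof -
    have "dist (f x) (f y) \<le> L1 * dist x y" using lipschitz_onD[OF 1(2), of x y] y x 1(1) by (auto simp: u_def)
    also have "\<dots> \<le> (L1 + 1) * (u2 / (L1 + 1))" using y L1 2(1) by (intro mult_mono) (auto simp: u_def)
    also have "\<dots> = u2" using L1 by simp
    finally show ?thesis using sub y by auto
  qed
  have "(L2 * L1)-lipschitz_on (cball x u \<inter> S) (\<lambda>x. g (f x))"
  proof (rule lipschitz_onI)
    fix y z assume yz: "y \<in> cball x u \<inter> S" "z \<in> cball x u \<inter> S"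
    have "dist (g (f y)) (g (f z)) \<le> L2 * dist (f y) (f z)" by (rule lipschitz_onD[OF 2(2) fin[OF yz(1)] fin[OF yz(2)]])
    also have "\<dots> \<le> L2 * (L1 * dist y z)"
      using yz lipschitz_on_nonneg[OF 2(2)] by (intro mult_left_mono lipschitz_onD[OF 1(2)]) (auto simp: u_def)
    finally show "dist (g (f y)) (g (f z)) \<le> L2 * L1 * dist y z" by (simp add: mult.assoc)
  qed (use L1 lipschitz_on_nonneg[OF 2(2)] in simp)
  then show "\<exists>u>0. \<exists>L. L-lipschitz_on (cball x u \<inter> S) (\<lambda>x. g (f x))" using u0 by blast
qed

lemma loc_lipschitz_C1:
  fixes g :: "real \<Rightarrow> real"
  assumes op: "open T" and d: "\<And>x. x \<in> T \<Longrightarrow> (g has_real_derivative g' x) (at x)" and c: "continuous_on T g'"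
  shows "loc_lipschitz T g"
  unfolding loc_lipschitz_def
proof
  fix x assume "x \<in> T"
  then obtain e where e: "0 < e" "cball x e \<subseteq> T" using op open_contains_cball by blast
  have "bounded (g' ` cball x e)" by (intro compact_imp_bounded compact_continuous_image continuous_on_subset[OF c] e) simp
  then obtain B where B: "\<forall>y\<in>g' ` cball x e. norm y \<le> B" unfolding bounded_iff by blast
  have "B-lipschitz_on (cball x e \<inter> T) g"
  proof (rule lipschitz_onI)
    fix y z assume yz: "y \<in> cball x e \<inter> T" "z \<in> cball x e \<inter> T"
    have "norm (g y - g z) \<le> B * norm (y - z)"
      by (rule field_differentiable_bound[where S="cball x e" and f'=g'])
        (use yz B in \<open>auto intro!: has_field_derivative_at_within d subsetD[OF e(2)]\<close>)
    then show "dist (g y) (g z) \<le> B * dist y z" by (simp add: dist_norm)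
  next
    have "norm (g' x) \<le> B" using B e(1) by simp
    then show "0 \<le> B" using norm_ge_zero order_trans by blast
  qed
  then show "\<exists>u>0. \<exists>L. L-lipschitz_on (cball x u \<inter> T) g" using e(1) by blast
qed

text \<open>
  The derivative may fail to exist at the endpoints; this is where the coefficients of the angle equation
  are singular.
\<close>
lemma lipschitz_of_bounded_derivative:
  fixes f :: "real \<Rightarrow> real"
  assumes c: "continuous_on {a..b} f" and d: "\<And>t. a < t \<Longrightarrow> t < b \<Longrightarrow> (f has_real_derivative f' t) (at t)"
    and bd: "\<And>t. a < t \<Longrightarrow> t < b \<Longrightarrow> \<bar>f' t\<bar> \<le> C" and C: "0 \<le> C"
  shows "loc_lipschitz {a..b} f"
proof (rule loc_lipschitz_I[of C])
  have key: "\<bar>f y - f x\<bar> \<le> C * (y - x)" if xy: "a \<le> x" "x < y" "y \<le> b" for x y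
  proof -
    have "continuous_on {x..y} f" using c xy by (auto intro: continuous_on_subset)
    moreover have "f differentiable (at z)" if "x < z" "z < y" for z
      using d[of z] xy that by (auto simp: real_differentiable_def)
    ultimately obtain l z where z: "x < z" "z < y" "DERIV f z :> l" "f y - f x = (y - x) * l"
      using MVT[OF xy(2)] by blast
    have "l = f' z" using DERIV_unique[OF z(3) d] z xy by auto
    then have "\<bar>l\<bar> \<le> C" using bd[of z] z xy by auto
    then show ?thesis unfolding z(4) abs_mult using xy by (simp add: mult.commute mult_right_mono)
  qed
  show "C-lipschitz_on {a..b} f"
  proof (rule lipschitz_onI[OF _ C])
    fix x y assume xy: "x \<in> {a..b}" "y \<in> {a..b}"
    consider "x < y" | "x = y" | "y < x" by linarith
    then show "dist (f x) (f y) \<le> C * dist x y"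
      by cases (use key[of x y] key[of y x] xy in \<open>auto simp: dist_real_def abs_minus_commute\<close>)
  qed
qed

lemma continuous_on_at_0:
  fixes f :: "real \<Rightarrow> real"
  assumes c: "continuous_on {0<..b} f" and n: "\<And>t. t \<in> {0..b} \<Longrightarrow> \<bar>f t - f 0\<bar> \<le> C * t"
  shows "continuous_on {0..b} f"
  unfolding continuous_on_eq_continuous_within
proof
  fix x assume x: "x \<in> {0..b}"
  show "continuous (at x within {0..b}) f"
  proof (cases "x = 0")
    case True
    have "((\<lambda>t. C * t) \<longlongrightarrow> C * 0) (at 0 within {0..b})" by (intro tendsto_intros)
    then have lim: "((\<lambda>t. C * t) \<longlongrightarrow> 0) (at 0 within {0..b})" by simp
    have "((\<lambda>t. f t - f 0) \<longlongrightarrow> 0) (at 0 within {0..b})"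
      by (rule Lim_null_comparison[OF _ lim]) (use n in \<open>auto simp: eventually_at_filter\<close>)
    then show ?thesis using True by (simp add: continuous_within LIM_zero_iff)
  next
    case False
    have "continuous (at x within {0<..b}) f" using c x False unfolding continuous_on_eq_continuous_within by auto
    moreover have "at x within {0<..b} = at x within {0..b}"
      by (rule at_within_nhd[where S="{0<..}"]) (use x False in auto)
    ultimately show ?thesis by simp
  qed
qed

section \<open>The angular profile\<close>

lemma one_minus_cos_le: "0 \<le> t \<Longrightarrow> t \<le> pi / 2 \<Longrightarrow> 1 - cos t \<le> t"
  using sin_cos_sum_ge_1[of t] sin_x_le_x[of t] by linarith

lemma sin_near: "0 \<le> t \<Longrightarrow> t \<le> pi / 2 \<Longrightarrow> \<bar>sin t - t\<bar> \<le> t\<^sup>2"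
proof -
  assume t: "0 \<le> t" "t \<le> pi / 2"
  have "t - sin t \<le> t * (1 - cos t)" using mult_cos_le_sin[OF t] by (simp add: algebra_simps)
  also have "\<dots> \<le> t * t" using one_minus_cos_le[OF t] t by (intro mult_left_mono) auto
  finally show ?thesis using sin_x_le_x[OF t(1)] by (simp add: power2_eq_square)
qed

lemma sin_ge_quarter: "0 \<le> t \<Longrightarrow> t \<le> pi / 2 \<Longrightarrow> t / 4 \<le> sin t"
proof (cases "cos t \<ge> 1/2")
  case True
  assume t: "0 \<le> t" "t \<le> pi / 2"
  have "t * (1/2) \<le> t * cos t" using True t by (intro mult_left_mono) auto
  then show ?thesis using mult_cos_le_sin[OF t] t by linarith
next
  case False
  assume t: "0 \<le> t" "t \<le> pi / 2"
  then show ?thesis using sin_cos_sum_ge_1[OF t] False pi_less_4 by linarith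
qed

text \<open>
  With \<open>r = |x|\<close> and \<open>e\<^sub>N\<close> the unit vector of the axis, \<open>U = r\<^sup>-\<^sup>\<beta> f(\<theta>)\<close> has the gradient
  \<open>r\<^sup>-\<^sup>\<beta>\<^sup>-\<^sup>1 \<sigma> X\<close> with the unit vector \<open>X = a x / r + k e\<^sub>N\<close>. The components are taken along
  \<open>x\<close> and \<open>e\<^sub>N\<close>, and not along the radial and the angular direction, because the latter is
  discontinuous on the axis, whereas \<open>a\<close> and \<open>k = sin \<phi> / sin \<theta>\<close> extend continuously. The three
  identities say that \<open>X\<close> has the right radial component, that \<open>|X| = 1\<close>, and (the last one) that
  the flux \<open>|\<nabla>U|\<^sup>p\<^sup>-\<^sup>2 \<nabla>U\<close> is divergence free.
\<close>
lemma singular_profile: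
  assumes p: "1 < p"
  obtains \<beta> f \<sigma> a k A' K' where "0 < \<beta>"
    "\<And>t. t \<in> {0..pi/2} \<Longrightarrow> 0 < \<sigma> t"
    "continuous_on {0..pi/2} \<sigma>" "continuous_on {0..pi/2} a" "continuous_on {0..pi/2} k"
    "f (pi/2) = 0" "\<And>t. 0 \<le> t \<Longrightarrow> t < pi/2 \<Longrightarrow> 0 < f t" "loc_lipschitz {0..pi/2} f"
    "\<And>t. 0 < t \<Longrightarrow> t < pi/2 \<Longrightarrow> (f has_real_derivative - (\<sigma> t * k t * sin t)) (at t)"
    "\<And>t. t \<in> {0..pi/2} \<Longrightarrow> \<sigma> t * (a t + cos t * k t) = - (\<beta> * f t)"
    "\<And>t. t \<in> {0..pi/2} \<Longrightarrow> (a t)\<^sup>2 + 2 * a t * k t * cos t + (k t)\<^sup>2 = 1"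
    "loc_lipschitz {0..pi/2} (\<lambda>t. \<sigma> t powr (p - 1) * a t)" "loc_lipschitz {0..pi/2} (\<lambda>t. \<sigma> t powr (p - 1) * k t)"
    "\<And>t. 0 < t \<Longrightarrow> t < pi/2 \<Longrightarrow> ((\<lambda>t. \<sigma> t powr (p - 1) * a t) has_real_derivative A' t) (at t)"
    "\<And>t. 0 < t \<Longrightarrow> t < pi/2 \<Longrightarrow> ((\<lambda>t. \<sigma> t powr (p - 1) * k t) has_real_derivative K' t) (at t)"
    "\<And>t. 0 < t \<Longrightarrow> t < pi/2 \<Longrightarrow> (real m + 1 - (\<beta> + 1) * (p - 1)) * (\<sigma> t powr (p - 1) * a t)
        - (\<beta> + 1) * (p - 1) * cos t * (\<sigma> t powr (p - 1) * k t) - K' t * sin t = 0"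
proof -
  obtain \<beta> \<phi> L C where be: "0 < \<beta>" and L: "0 < L" and pc: "continuous_on {0..pi/2} \<phi>" and p0: "\<phi> 0 = 0" and p1: "\<phi> (pi/2) = pi/2"
    and below: "\<And>t. 0 \<le> t \<Longrightarrow> t < pi/2 \<Longrightarrow> \<phi> t < pi/2"
    and bnd: "\<And>t. t \<in> {0..pi/2} \<Longrightarrow> 0 \<le> \<phi> t \<and> \<phi> t \<le> L * t"
    and der: "\<And>t. 0 < t \<Longrightarrow> t < pi/2 \<Longrightarrow> (\<phi> has_real_derivative (ang_E p m \<beta> (\<phi> t) - real m * cot t * ang_S p (\<phi> t))) (at t)"
    and near: "\<And>t. t \<in> {0..pi/2} \<Longrightarrow> \<bar>\<phi> t - (\<beta> * (p - 1) + p - (real m + 2)) / (real m + 1) * t\<bar> \<le> C * t\<^sup>2"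
    by (rule angular_shooting[OF p, of m], rule that, assumption+)
  define \<kappa> where "\<kappa> = \<beta> * (p - 1) + p - (real m + 2)"
  define w where "w = \<kappa> / (real m + 1)"
  define ph' where "ph' t = ang_E p m \<beta> (\<phi> t) - real m * cot t * ang_S p (\<phi> t)" for t
  have der': "(\<phi> has_real_derivative ph' t) (at t)" if "0 < t" "t < pi/2" for t
    using der[OF that] by (simp add: ph'_def)
  have near': "\<bar>\<phi> t - w * t\<bar> \<le> C * t\<^sup>2" if "t \<in> {0..pi/2}" for t
    using near[OF that] by (simp add: w_def \<kappa>_def)
  have C0: "0 \<le> C"
  proof -
    have "0 \<le> C * 1\<^sup>2" using near'[of 1] pi_gt3 abs_ge_zero order_trans by fastforce
    then show ?thesis by simp
  qed
  have ple: "\<phi> t \<le> pi/2" if "t \<in> {0..pi/2}" for t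
  proof (cases "t = pi/2")
    case True
    show ?thesis by (simp only: True p1 order_refl)
  next
    case False
    then show ?thesis using below[of t] that by auto
  qed
  obtain KB where KB: "0 \<le> KB" "\<And>t c c'. 0 < t \<Longrightarrow> t \<le> pi / 2 \<Longrightarrow> 0 \<le> c \<Longrightarrow> c \<le> pi / 2 \<Longrightarrow> c \<le> L * t \<Longrightarrow>
      0 \<le> c' \<Longrightarrow> c' \<le> pi / 2 \<Longrightarrow> c' \<le> L * t \<Longrightarrow> \<bar>ang_B p t c - ang_B p t c'\<bar> \<le> KB * \<bar>c - c'\<bar>"
    by (rule ang_B_lipschitz[OF p less_imp_le[OF L]], rule that, assumption+)
  define KE where "KE = \<bar>(p - (real m + 2)) + (\<beta> * (p - 1) + p - (real m + 2)) * (p - 2)\<bar> * (2 / (min 1 (p - 1))\<^sup>2)"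
  have KE: "0 \<le> KE" "\<bar>ang_E p m \<beta> c - ang_E p m \<beta> c'\<bar> \<le> KE * \<bar>c - c'\<bar>" for c c'
    using ang_E_lipschitz[OF p, of m \<beta> c c'] by (simp_all add: KE_def)
  \<comment> \<open>the derivative of the angle is w + O(t) at the axis; the quotient of sines needs this for its own derivative to be bounded\<close>
  define C2 where "C2 = KE * L + real m * (KB * L) + real m * C"
  have C20: "0 \<le> C2" using KE KB L C0 by (simp add: C2_def)
  have exp1: "\<bar>ph' t - w\<bar> \<le> C2 * t" if t: "0 < t" "t \<le> pi/2" for t
  proof -
    have b: "0 \<le> \<phi> t" "\<phi> t \<le> L * t" "\<phi> t \<le> pi/2" using bnd[of t] ple[of t] t by auto
    have e: "ph' t - w = (ang_E p m \<beta> (\<phi> t) - ang_E p m \<beta> 0) + real m * (ang_B p t (\<phi> t) - ang_B p t 0) - real m * ((\<phi> t - w * t) / t)"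
    proof -
      have E0: "ang_E p m \<beta> 0 = \<kappa>" by (simp add: ang_E_def ang_D_def \<kappa>_def)
      have "real m + 1 \<noteq> 0" by linarith
      then have "(real m + 1) * w = \<kappa>" unfolding w_def by simp
      then have ke: "\<kappa> = w + real m * w" unfolding distrib_right by simp
      have B0: "ang_B p t 0 = 0" by (simp add: ang_B_def ang_S_def)
      have qe: "(\<phi> t - w * t) / t = \<phi> t / t - w" using t by (simp add: diff_divide_distrib)
      show ?thesis unfolding ph'_def E0 B0 qe ang_B_def[of p t "\<phi> t"] right_diff_distrib mult.assoc using ke by linarith
    qed
    have x: "\<bar>ang_E p m \<beta> (\<phi> t) - ang_E p m \<beta> 0\<bar> \<le> KE * (L * t)"
      by (rule order_trans[OF KE(2)]) (use b KE(1) in \<open>auto intro!: mult_left_mono\<close>)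
    have y: "\<bar>real m * (ang_B p t (\<phi> t) - ang_B p t 0)\<bar> \<le> real m * (KB * (L * t))"
    proof -
      have "\<bar>ang_B p t (\<phi> t) - ang_B p t 0\<bar> \<le> KB * \<bar>\<phi> t - 0\<bar>" by (rule KB(2)) (use t b L in auto)
      also have "\<dots> \<le> KB * (L * t)" using b KB(1) by (intro mult_left_mono) auto
      finally show ?thesis unfolding abs_mult by (simp add: mult_left_mono)
    qed
    have z: "\<bar>real m * ((\<phi> t - w * t) / t)\<bar> \<le> real m * (C * t)"
    proof -
      have "\<bar>(\<phi> t - w * t) / t\<bar> = \<bar>\<phi> t - w * t\<bar> / t" using t by (simp add: abs_divide)
      also have "\<dots> \<le> C * t\<^sup>2 / t" using near'[of t] t by (intro divide_right_mono) auto
      also have "\<dots> = C * t" using t by (simp add: power2_eq_square)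
      finally have q: "\<bar>(\<phi> t - w * t) / t\<bar> \<le> C * t" .
      have "\<bar>real m * ((\<phi> t - w * t) / t)\<bar> = real m * \<bar>(\<phi> t - w * t) / t\<bar>" by (simp only: abs_mult abs_of_nat)
      also have "\<dots> \<le> real m * (C * t)" by (rule mult_left_mono[OF q]) simp
      finally show ?thesis .
    qed
    have tri: "\<bar>X + Y - Z\<bar> \<le> \<bar>X\<bar> + \<bar>Y\<bar> + \<bar>Z\<bar>" for X Y Z :: real by linarith
    have "\<bar>ph' t - w\<bar> \<le> KE * (L * t) + real m * (KB * (L * t)) + real m * (C * t)"
      unfolding e by (rule order_trans[OF tri]) (intro add_mono x y z)
    then show ?thesis by (simp add: C2_def algebra_simps)
  qed
  define C1 where "C1 = \<bar>w\<bar> + C2 * (pi/2)"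
  have C10: "0 \<le> C1" using C20 by (simp add: C1_def)
  have phb: "\<bar>ph' t\<bar> \<le> C1" if t: "0 < t" "t \<le> pi/2" for t
  proof -
    have "\<bar>ph' t\<bar> \<le> \<bar>w\<bar> + \<bar>ph' t - w\<bar>" by linarith
    also have "\<dots> \<le> \<bar>w\<bar> + C2 * (pi/2)"
      using t C20 by (intro add_left_mono order_trans[OF exp1[OF t]] mult_left_mono) auto
    finally show ?thesis by (simp add: C1_def)
  qed
  \<comment> \<open>the value w at the axis is the limit, by the expansion of the angle\<close>
  define k where "k t = (if t = 0 then w else sin (\<phi> t) / sin t)" for t
  have sinpos: "0 < sin t" if "0 < t" "t \<le> pi/2" for t using that by (auto intro: sin_gt_zero)
  have ks: "k t * sin t = sin (\<phi> t)" if "t \<in> {0..pi/2}" for t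
    using sinpos[of t] that by (auto simp: k_def p0)
  define k' where "k' t = (cos (\<phi> t) * ph' t * sin t - sin (\<phi> t) * cos t) / (sin t)\<^sup>2" for t
  have kd: "(k has_real_derivative k' t) (at t)" if t: "0 < t" "t < pi/2" for t
  proof -
    have d1: "((\<lambda>t. sin (\<phi> t)) has_real_derivative cos (\<phi> t) * ph' t) (at t)"
      using DERIV_chain2[OF DERIV_sin der'[OF t]] by simp
    have "((\<lambda>t. sin (\<phi> t) / sin t) has_real_derivative (cos (\<phi> t) * ph' t * sin t - sin (\<phi> t) * cos t) / (sin t * sin t)) (at t)"
      by (rule DERIV_divide[OF d1 DERIV_sin]) (use sinpos[of t] t in auto)
    then have "((\<lambda>t. sin (\<phi> t) / sin t) has_real_derivative k' t) (at t)" by (simp add: k'_def power2_eq_square)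
    then show ?thesis
      by (rule has_field_derivative_transform_within_open[where S="{0<..}"]) (use t in \<open>auto simp: k_def\<close>)
  qed
  \<comment> \<open>sum of the constants in the six error terms below, each quadratic in t\<close>
  define K2 where "K2 = L * C1 + C2 + \<bar>w\<bar> + C + L\<^sup>2 + L"
  have num: "\<bar>cos (\<phi> t) * ph' t * sin t - sin (\<phi> t) * cos t\<bar> \<le> K2 * t\<^sup>2" if t: "0 < t" "t \<le> pi/2" for t
  proof -
    have b: "0 \<le> \<phi> t" "\<phi> t \<le> L * t" "\<phi> t \<le> pi/2" using bnd[of t] ple[of t] t by auto
    have st: "0 \<le> sin t" "sin t \<le> t" using t sinpos[of t] sin_x_le_x[of t] by auto
    have e: "cos (\<phi> t) * ph' t * sin t - sin (\<phi> t) * cos t =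
      (cos (\<phi> t) - 1) * ph' t * sin t + (ph' t - w) * sin t + w * (sin t - t) + (w * t - \<phi> t) + (\<phi> t - sin (\<phi> t)) + sin (\<phi> t) * (1 - cos t)"
      by (simp add: algebra_simps)
    have a1: "\<bar>(cos (\<phi> t) - 1) * ph' t * sin t\<bar> \<le> (L * t) * C1 * t"
    proof -
      have "\<bar>cos (\<phi> t) - 1\<bar> \<le> L * t" using one_minus_cos_le[of "\<phi> t"] b cos_le_one[of "\<phi> t"] by linarith
      then show ?thesis unfolding abs_mult using phb[OF t] st C10 L t by (intro mult_mono) auto
    qed
    have a2: "\<bar>(ph' t - w) * sin t\<bar> \<le> (C2 * t) * t" unfolding abs_mult using exp1[OF t] st C20 t by (intro mult_mono) auto
    have a3: "\<bar>w * (sin t - t)\<bar> \<le> \<bar>w\<bar> * t\<^sup>2" unfolding abs_mult using sin_near[of t] t by (intro mult_left_mono) auto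
    have a4: "\<bar>w * t - \<phi> t\<bar> \<le> C * t\<^sup>2" using near'[of t] t by (simp add: abs_minus_commute)
    have a5: "\<bar>\<phi> t - sin (\<phi> t)\<bar> \<le> (L * t)\<^sup>2"
    proof -
      have "\<bar>\<phi> t - sin (\<phi> t)\<bar> \<le> (\<phi> t)\<^sup>2" using sin_near[of "\<phi> t"] b by (simp add: abs_minus_commute)
      also have "\<dots> \<le> (L * t)\<^sup>2" using b by (intro power_mono) auto
      finally show ?thesis .
    qed
    have a6: "\<bar>sin (\<phi> t) * (1 - cos t)\<bar> \<le> (L * t) * t"
    proof -
      have "\<bar>sin (\<phi> t)\<bar> \<le> L * t" using sin_x_le_x[OF b(1)] sin_ge_zero[of "\<phi> t"] b by auto
      moreover have "\<bar>1 - cos t\<bar> \<le> t" using one_minus_cos_le[of t] t cos_le_one[of t] by linarith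
      ultimately show ?thesis unfolding abs_mult using L t by (intro mult_mono) auto
    qed
    have tri: "\<bar>A + B + D + E + F + G\<bar> \<le> \<bar>A\<bar> + \<bar>B\<bar> + \<bar>D\<bar> + \<bar>E\<bar> + \<bar>F\<bar> + \<bar>G\<bar>" for A B D E F G :: real
      by (intro order_trans[OF abs_triangle_ineq] add_right_mono) (rule order_refl)
    have "\<bar>cos (\<phi> t) * ph' t * sin t - sin (\<phi> t) * cos t\<bar> \<le> (L * t) * C1 * t + (C2 * t) * t + \<bar>w\<bar> * t\<^sup>2 + C * t\<^sup>2 + (L * t)\<^sup>2 + (L * t) * t"
      unfolding e by (rule order_trans[OF tri]) (intro add_mono a1 a2 a3 a4 a5 a6)
    also have "\<dots> = K2 * t\<^sup>2" by (simp add: K2_def power2_eq_square algebra_simps)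
    finally show ?thesis .
  qed
  have K20: "0 \<le> K2" using L C10 C20 C0 by (simp add: K2_def)
  have kb: "\<bar>k' t\<bar> \<le> K2 * 16" if t: "0 < t" "t \<le> pi/2" for t
  proof -
    have "\<bar>k' t\<bar> = \<bar>cos (\<phi> t) * ph' t * sin t - sin (\<phi> t) * cos t\<bar> / (sin t)\<^sup>2" by (simp add: k'_def abs_divide)
    also have "\<dots> \<le> K2 * t\<^sup>2 / (t / 4)\<^sup>2"
      using num[OF t] sin_ge_quarter[of t] t K20 by (intro frac_le power_mono) auto
    also have "\<dots> = K2 * 16" using t by (simp add: power2_eq_square)
    finally show ?thesis .
  qed
  have kc: "continuous_on {0..pi/2} k"
  proof (rule continuous_on_at_0)
    have "continuous_on {0<..pi/2} (\<lambda>t. sin (\<phi> t) / sin t)"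
      by (intro continuous_intros continuous_on_subset[OF pc]) (use sinpos in force)+
    then show "continuous_on {0<..pi/2} k" by (rule continuous_on_eq) (auto simp: k_def)
    fix t :: real assume t: "t \<in> {0..pi/2}"
    show "\<bar>k t - k 0\<bar> \<le> ((L\<^sup>2 + C + \<bar>w\<bar>) * 4) * t"
    proof (cases "t = 0")
      case False
      then have t: "0 < t" "t \<le> pi/2" using t by auto
      have b: "0 \<le> \<phi> t" "\<phi> t \<le> L * t" "\<phi> t \<le> pi/2" using bnd[of t] ple[of t] t by auto
      have e: "k t - k 0 = ((sin (\<phi> t) - \<phi> t) + (\<phi> t - w * t) + w * (t - sin t)) / sin t"
        using sinpos[OF t] t by (simp add: k_def field_simps)
      have a1: "\<bar>sin (\<phi> t) - \<phi> t\<bar> \<le> (L * t)\<^sup>2"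
        by (rule order_trans[OF sin_near]) (use b in \<open>auto intro!: power_mono\<close>)
      have a2: "\<bar>\<phi> t - w * t\<bar> \<le> C * t\<^sup>2" using near'[of t] t by simp
      have a3: "\<bar>w * (t - sin t)\<bar> \<le> \<bar>w\<bar> * t\<^sup>2" unfolding abs_mult using sin_near[of t] t by (intro mult_left_mono) (auto simp: abs_minus_commute)
      have tri: "\<bar>X + Y + Z\<bar> \<le> \<bar>X\<bar> + \<bar>Y\<bar> + \<bar>Z\<bar>" for X Y Z :: real by linarith
      have n: "\<bar>(sin (\<phi> t) - \<phi> t) + (\<phi> t - w * t) + w * (t - sin t)\<bar> \<le> (L * t)\<^sup>2 + C * t\<^sup>2 + \<bar>w\<bar> * t\<^sup>2"
        by (rule order_trans[OF tri]) (intro add_mono a1 a2 a3)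
      have "\<bar>k t - k 0\<bar> \<le> ((L * t)\<^sup>2 + C * t\<^sup>2 + \<bar>w\<bar> * t\<^sup>2) / (t / 4)"
        unfolding e abs_divide using n sin_ge_quarter[of t] sinpos[OF t] t C0 by (intro frac_le) auto
      also have "\<dots> = ((L\<^sup>2 + C + \<bar>w\<bar>) * 4) * t" using t by (simp add: power2_eq_square field_simps)
      finally show ?thesis .
    qed simp
  qed
  \<comment> \<open>H is the logarithmic derivative of the amplitude; eq1 makes it consistent with the formula for f, and eq2 is the p-Laplace equation\<close>
  define H where "H t = sin (\<phi> t) * ((\<beta> * (p - 2) + p - (real m + 2)) * cos (\<phi> t) - real m * (cos t * k t)) / ang_D p (\<phi> t)" for t
  have Dnz: "ang_D p c \<noteq> 0" for c using ang_D_bounds(2)[OF p, of c] by simp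
  have Hc: "continuous_on {0..pi/2} H"
    unfolding H_def using Dnz unfolding ang_D_def by (intro continuous_intros pc kc) auto
  define l where "l t = integral {0..t} H" for t
  have ld: "(l has_real_derivative H t) (at t)" if t: "0 < t" "t < pi/2" for t
    unfolding l_def using integral_has_real_derivative[OF Hc, of t] t by (simp add: at_within_Icc_at)
  have lc: "continuous_on {0..pi/2} l"
    unfolding l_def by (rule indefinite_integral_continuous_1) (rule integrable_continuous_interval[OF Hc])
  have "bounded (H ` {0..pi/2})" by (intro compact_imp_bounded compact_continuous_image Hc) simp
  then obtain HB where HB: "\<forall>y\<in>H ` {0..pi/2}. norm y \<le> HB" unfolding bounded_iff by blast
  have HB': "\<bar>H t\<bar> \<le> HB" if "t \<in> {0..pi/2}" for t using HB that by auto
  have HB0: "0 \<le> HB" using HB'[of 0] by auto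
  have eq1: "cos (\<phi> t) * H t = sin (\<phi> t) * (ph' t - \<beta>)"
    and eq2: "cos (\<phi> t) * ph' t + (p - 1) * sin (\<phi> t) * H t = \<kappa> * cos (\<phi> t) - real m * cos t * k t"
    if t: "0 < t" "t < pi/2" for t
  proof -
    let ?s = "sin (\<phi> t)" let ?c = "cos (\<phi> t)" let ?D = "ang_D p (\<phi> t)" let ?x = "real m * (cos t * k t)"
    have sc: "?c\<^sup>2 = 1 - ?s\<^sup>2" by (simp add: cos_squared_eq)
    have D: "?D = 1 + (p - 2) * ?s\<^sup>2" by (simp add: ang_D_def)
    have ct: "cot t * ?s = cos t * k t" using t by (simp add: cot_def k_def)
    have "real m * cot t * ang_S p (\<phi> t) = real m * (cot t * ?s) * ?c / ?D" by (simp add: ang_S_def)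
    then have ph: "ph' t = (\<beta> * (p - 1) + (p - (real m + 2)) * ?c\<^sup>2 - ?x * ?c) / ?D"
      unfolding ph'_def ang_E_def ct by (simp add: diff_divide_distrib)
    have phD: "ph' t * ?D = \<beta> * (p - 1) + (p - (real m + 2)) * ?c\<^sup>2 - ?x * ?c" unfolding ph using Dnz by simp
    have HD: "H t * ?D = ?s * ((\<beta> * (p - 2) + p - (real m + 2)) * ?c - ?x)" unfolding H_def using Dnz by simp
    have "(cos (\<phi> t) * H t) * ?D = (sin (\<phi> t) * (ph' t - \<beta>)) * ?D"
    proof -
      have "(?c * H t) * ?D = ?c * (?s * ((\<beta> * (p - 2) + p - (real m + 2)) * ?c - ?x))" using HD by (simp add: mult.assoc)
      also have "\<dots> = ?s * ((\<beta> * (p - 1) + (p - (real m + 2)) * ?c\<^sup>2 - ?x * ?c) - \<beta> * ?D)"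
        using sc unfolding D by algebra
      also have "\<dots> = (?s * (ph' t - \<beta>)) * ?D" unfolding phD[symmetric] by (simp add: algebra_simps)
      finally show ?thesis .
    qed
    then show "cos (\<phi> t) * H t = sin (\<phi> t) * (ph' t - \<beta>)" using Dnz by simp
    have "(?c * ph' t + (p - 1) * ?s * H t) * ?D = (\<kappa> * ?c - ?x) * ?D"
    proof -
      have "(?c * ph' t + (p - 1) * ?s * H t) * ?D = ?c * (ph' t * ?D) + (p - 1) * ?s * (H t * ?D)" by (simp add: algebra_simps)
      also have "\<dots> = (\<kappa> * ?c - ?x) * ?D" unfolding phD HD unfolding \<kappa>_def D using sc by algebra
      finally show ?thesis .
    qed
    then have "?c * ph' t + (p - 1) * ?s * H t = \<kappa> * ?c - ?x" using Dnz by simp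
    then show "cos (\<phi> t) * ph' t + (p - 1) * sin (\<phi> t) * H t = \<kappa> * cos (\<phi> t) - real m * cos t * k t" by (simp add: mult.assoc)
  qed
  define \<sigma> where "\<sigma> t = \<beta> * exp (l t)" for t
  define f where "f t = exp (l t) * cos (\<phi> t)" for t
  define a where "a t = - (cos (\<phi> t) + cos t * k t)" for t
  define \<tau> where "\<tau> t = \<beta> powr (p - 1) * exp ((p - 1) * l t)" for t
  have \<tau>: "\<sigma> t powr (p - 1) = \<tau> t" for t
    using be by (simp add: \<sigma>_def \<tau>_def powr_mult exp_powr_real mult.commute)
  have td: "(\<tau> has_real_derivative (p - 1) * H t * \<tau> t) (at t)" if "0 < t" "t < pi/2" for t
    unfolding \<tau>_def by (auto intro!: derivative_eq_intros ld that)
  define K' where "K' t = (p - 1) * H t * \<tau> t * k t + \<tau> t * k' t" for t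
  have Kd: "((\<lambda>t. \<tau> t * k t) has_real_derivative K' t) (at t)" if "0 < t" "t < pi/2" for t
    using DERIV_mult[OF td[OF that] kd[OF that]] by (simp add: K'_def algebra_simps)
  define a' where "a' t = - (- sin (\<phi> t) * ph' t + (- sin t * k t + cos t * k' t))" for t
  have ad: "(a has_real_derivative a' t) (at t)" if "0 < t" "t < pi/2" for t
    unfolding a_def a'_def
    by (auto intro!: derivative_eq_intros kd that der'[OF that] DERIV_chain2[OF DERIV_cos] simp: algebra_simps)
  define A' where "A' t = (p - 1) * H t * \<tau> t * a t + \<tau> t * a' t" for t
  have Ad: "((\<lambda>t. \<tau> t * a t) has_real_derivative A' t) (at t)" if "0 < t" "t < pi/2" for t
    using DERIV_mult[OF td[OF that] ad[OF that]] by (simp add: A'_def algebra_simps)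
  have lipphi: "loc_lipschitz {0..pi/2} \<phi>"
    by (rule lipschitz_of_bounded_derivative[OF pc der' phb C10]) auto
  have lipk: "loc_lipschitz {0..pi/2} k"
    by (rule lipschitz_of_bounded_derivative[OF kc kd kb]) (use K20 in auto)
  have lipl: "loc_lipschitz {0..pi/2} l"
    by (rule lipschitz_of_bounded_derivative[OF lc ld HB' HB0]) auto
  have lipcos: "loc_lipschitz UNIV (cos :: real \<Rightarrow> real)"
    by (rule loc_lipschitz_C1[where g'="\<lambda>x. - sin x"]) (auto intro!: derivative_eq_intros continuous_intros)
  have lipexp: "loc_lipschitz UNIV (\<lambda>x::real. exp (c * x))" for c
    by (rule loc_lipschitz_C1[where g'="\<lambda>x. c * exp (c * x)"]) (auto intro!: derivative_eq_intros continuous_intros)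
  have lipcosphi: "loc_lipschitz {0..pi/2} (\<lambda>t. cos (\<phi> t))" by (rule loc_lipschitz_compose[OF lipphi lipcos]) auto
  have lipcos2: "loc_lipschitz {0..pi/2} (\<lambda>t::real. cos t)" by (rule loc_lipschitz_subset[OF lipcos]) auto
  have lipt: "loc_lipschitz {0..pi/2} \<tau>" unfolding \<tau>_def
    by (intro loc_lipschitz_mult loc_lipschitz_const loc_lipschitz_compose[OF lipl lipexp]) auto
  have lipa: "loc_lipschitz {0..pi/2} a"
  proof -
    have "loc_lipschitz {0..pi/2} (\<lambda>t. (-1) * (cos (\<phi> t) + cos t * k t))"
      by (intro loc_lipschitz_mult loc_lipschitz_add loc_lipschitz_const lipcosphi lipcos2 lipk)
    then show ?thesis by (simp add: a_def[abs_def])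
  qed
  have lipf: "loc_lipschitz {0..pi/2} f"
    unfolding f_def using loc_lipschitz_compose[OF lipl lipexp[of 1]] by (intro loc_lipschitz_mult lipcosphi) auto
  show thesis
  proof (rule that[of \<beta> \<sigma> a k f A' K', unfolded \<tau>])
    show "0 < \<beta>" by (rule be)
    show "0 < \<sigma> t" if "t \<in> {0..pi/2}" for t using be by (simp add: \<sigma>_def)
    show "continuous_on {0..pi/2} \<sigma>" unfolding \<sigma>_def by (intro continuous_intros lc)
    show "continuous_on {0..pi/2} a" unfolding a_def by (intro continuous_intros kc pc)
    show "continuous_on {0..pi/2} k" by (rule kc)
    show "f (pi/2) = 0" by (simp add: f_def p1)
    show "0 < f t" if "0 \<le> t" "t < pi/2" for t
      unfolding f_def using below[OF that] bnd[of t] that by (intro mult_pos_pos cos_gt_zero_pi) auto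
    show "loc_lipschitz {0..pi/2} f" by (rule lipf)
    show "(f has_real_derivative - (\<sigma> t * k t * sin t)) (at t)" if t: "0 < t" "t < pi/2" for t
    proof -
      have dc: "((\<lambda>t. cos (\<phi> t)) has_real_derivative - sin (\<phi> t) * ph' t) (at t)"
        using DERIV_chain2[OF DERIV_cos der'[OF t]] by simp
      have de: "((\<lambda>t. exp (l t)) has_real_derivative exp (l t) * H t) (at t)"
        using DERIV_chain2[OF DERIV_exp ld[OF t]] by simp
      have "(f has_real_derivative exp (l t) * H t * cos (\<phi> t) + (- sin (\<phi> t) * ph' t) * exp (l t)) (at t)"
        unfolding f_def by (rule DERIV_mult[OF de dc])
      also have "exp (l t) * H t * cos (\<phi> t) + (- sin (\<phi> t) * ph' t) * exp (l t) = exp (l t) * (cos (\<phi> t) * H t - sin (\<phi> t) * ph' t)"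
        by (simp add: algebra_simps)
      also have "\<dots> = - (\<sigma> t * (k t * sin t))" unfolding eq1[OF t] using ks[of t] t by (simp add: \<sigma>_def algebra_simps)
      finally show ?thesis by (simp add: mult.assoc)
    qed
    show "\<sigma> t * (a t + cos t * k t) = - (\<beta> * f t)" for t by (simp add: \<sigma>_def a_def f_def)
    show "(a t)\<^sup>2 + 2 * a t * k t * cos t + (k t)\<^sup>2 = 1" if t: "t \<in> {0..pi/2}" for t
    proof -
      have e: "(sin (\<phi> t))\<^sup>2 = (k t)\<^sup>2 * (1 - (cos t)\<^sup>2)"
        using ks[OF t] by (metis power_mult_distrib sin_squared_eq)
      have "(cos (\<phi> t))\<^sup>2 = 1 - (sin (\<phi> t))\<^sup>2" by (simp add: cos_squared_eq)
      then show ?thesis unfolding a_def using e by algebra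
    qed
    show "loc_lipschitz {0..pi/2} (\<lambda>t. \<tau> t * a t)" by (rule loc_lipschitz_mult[OF lipt lipa])
    show "loc_lipschitz {0..pi/2} (\<lambda>t. \<tau> t * k t)" by (rule loc_lipschitz_mult[OF lipt lipk])
    show "((\<lambda>t. \<tau> t * a t) has_real_derivative A' t) (at t)" if "0 < t" "t < pi/2" for t by (rule Ad[OF that])
    show "((\<lambda>t. \<tau> t * k t) has_real_derivative K' t) (at t)" if "0 < t" "t < pi/2" for t by (rule Kd[OF that])
    show "(real m + 1 - (\<beta> + 1) * (p - 1)) * (\<tau> t * a t) - (\<beta> + 1) * (p - 1) * cos t * (\<tau> t * k t) - K' t * sin t = 0" if t: "0 < t" "t < pi/2" for t
    proof -
      have s: "sin t \<noteq> 0" using sinpos[of t] t by simp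
      have k1: "k t * sin t = sin (\<phi> t)" using ks[of t] t by simp
      have k2: "k' t * sin t = cos (\<phi> t) * ph' t - k t * cos t"
      proof -
        have "k' t * sin t = (cos (\<phi> t) * ph' t * sin t - k t * sin t * cos t) / sin t"
          unfolding k'_def k1 using s by (simp add: power2_eq_square)
        then show ?thesis using s by (simp add: diff_divide_distrib)
      qed
      have "K' t * sin t = \<tau> t * ((p - 1) * H t * (k t * sin t) + k' t * sin t)" by (simp add: K'_def algebra_simps)
      also have "\<dots> = \<tau> t * (cos (\<phi> t) * ph' t + (p - 1) * sin (\<phi> t) * H t - k t * cos t)" unfolding k1 k2 by (simp add: algebra_simps)
      also have "\<dots> = \<tau> t * (\<kappa> * cos (\<phi> t) - real m * cos t * k t - k t * cos t)" unfolding eq2[OF t] ..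
      finally show ?thesis unfolding a_def \<kappa>_def by (simp add: algebra_simps)
    qed
  qed
qed

section \<open>The singular solution in the half-space\<close>

lemma loc_lipschitz_continuous_on:
  assumes "loc_lipschitz S f"
  shows "continuous_on S f"
  unfolding continuous_on_eq_continuous_within
proof
  fix x assume x: "x \<in> S"
  then obtain u L where u: "0 < u" "L-lipschitz_on (cball x u \<inter> S) f" using assms unfolding loc_lipschitz_def by blast
  have "continuous (at x within cball x u \<inter> S) f"
    using lipschitz_on_continuous_on[OF u(2)] x u(1) by (simp add: continuous_on_eq_continuous_within)
  moreover have "at x within cball x u \<inter> S = at x within S"
    by (rule at_within_nhd[where S="ball x u"]) (use u(1) in auto)
  ultimately show "continuous (at x within S) f" by simp
qed

lemma continuous_Lp_loc:
  fixes f :: "'a::euclidean_space \<Rightarrow> 'b::euclidean_space"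
  assumes op: "open \<Omega>" and c: "continuous_on \<Omega> f" and p: "0 < p"
  shows "f \<in> Lp_loc p \<Omega>"
proof -
  have m: "f \<in> borel_measurable (lebesgue_on \<Omega>)"
    by (rule continuous_imp_measurable_on_sets_lebesgue[OF c]) (use op in simp)
  have "integrable (lebesgue_on K) (\<lambda>x. norm (f x) powr p)" if K: "compact K" "K \<subseteq> \<Omega>" for K
  proof -
    have cK: "continuous_on K f" by (rule continuous_on_subset[OF c K(2)])
    have c2: "continuous_on K (\<lambda>x. norm (f x) powr p)"
      by (rule continuous_on_powr') (use p in \<open>auto intro!: continuous_intros cK\<close>)
    have i: "integrable lborel (\<lambda>x. indicator K x *\<^sub>R (norm (f x) powr p))" by (rule borel_integrable_compact[OF K(1) c2])
    have Kb: "K \<in> sets borel" using K(1) by (simp add: borel_compact)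
    have "f \<in> borel_measurable (lebesgue_on K)" using m K(2) by (rule measurable_restrict_mono)
    then have m2: "(\<lambda>x. norm (f x) powr p) \<in> borel_measurable (lebesgue_on K)" by measurable
    have "integrable (lebesgue_on K) (\<lambda>x. norm (f x) powr p) \<longleftrightarrow> integrable lborel (\<lambda>x. indicator K x *\<^sub>R (norm (f x) powr p))"
      by (rule lebesgue_on_integral_lborel(2)[OF _ m2]) (use i Kb in \<open>auto simp: indicator_def\<close>)
    then show ?thesis using i by simp
  qed
  then show ?thesis using m by (simp add: Lp_loc_def)
qed

lemma lebesgue_on_integral_of_representative:
  fixes f :: "'a::euclidean_space \<Rightarrow> real"
  assumes op: "open \<Omega>" and f: "f \<in> borel_measurable (lebesgue_on \<Omega>)" and d: "integrable lborel d'" "AE x in lborel. d' x = (if x \<in> \<Omega> then f x else 0)"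
  shows "integral\<^sup>L (lebesgue_on \<Omega>) f = integral\<^sup>L lborel d'"
  by (rule lebesgue_on_integral_lborel(1)[OF _ f _ d(2)]) (use op d(1) in auto)

text \<open>
  A classical solution off a null set is a weak solution, provided that it and the components of its
  flux \<open>A\<close> are locally Lipschitz: integrate by parts once to identify the weak gradient, and once more
  against the divergence free flux. The null set is needed because the angle is not differentiable on
  the axis.
\<close>
lemma p_harmonic_criterion:
  fixes u :: "'a::euclidean_space \<Rightarrow> real" and G :: "'a \<Rightarrow> 'a"
  assumes op: "open \<Omega>" and p: "1 < p" and uL: "loc_lipschitz \<Omega> u" and Gc: "continuous_on \<Omega> G"
    and ud: "AE x in lborel. x \<in> \<Omega> \<longrightarrow> (u has_derivative (\<lambda>h. G x \<bullet> h)) (at x)"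
    and A: "\<And>x. x \<in> \<Omega> \<Longrightarrow> norm (G x) powr (p - 2) *\<^sub>R G x = A x"
    and AL: "\<And>i. i \<in> Basis \<Longrightarrow> loc_lipschitz \<Omega> (\<lambda>x. A x \<bullet> i)"
    and Ad: "\<And>i. i \<in> Basis \<Longrightarrow> AE x in lborel. x \<in> \<Omega> \<longrightarrow> ((\<lambda>x. A x \<bullet> i) has_derivative DA i x) (at x)"
    and div: "AE x in lborel. x \<in> \<Omega> \<longrightarrow> (\<Sum>i\<in>Basis. DA i x i) = 0"
  shows "p_harmonic_on p \<Omega> u"
proof -
  have uc: "continuous_on \<Omega> u" by (rule loc_lipschitz_continuous[OF uL op])
  have L: "u \<in> Lp_loc p \<Omega>" "G \<in> Lp_loc p \<Omega>" "u \<in> Lp_loc 1 \<Omega>" "G \<in> Lp_loc 1 \<Omega>"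
    using continuous_Lp_loc[OF op uc] continuous_Lp_loc[OF op Gc] p by auto
  have um: "u \<in> borel_measurable (lebesgue_on \<Omega>)" and Gm: "G \<in> borel_measurable (lebesgue_on \<Omega>)" using L by (auto simp: Lp_loc_def)
  have wg: "weak_gradient \<Omega> u G"
    unfolding weak_gradient_def
  proof (intro conjI ballI L)
    fix \<phi> i assume phi: "\<phi> \<in> test_functions \<Omega>" and i: "i \<in> (Basis :: 'a set)"
    note P = test_function_props[OF phi i] and K = test_functionsD(2,3)[OF phi]
    obtain d' where d': "integrable lborel d'" "integral\<^sup>L lborel d' = 0"
      "AE x in lborel. d' x = (if x \<in> \<Omega> then (G x \<bullet> i) * \<phi> x + u x * frechet_derivative \<phi> (at x) i else 0)"
      by (rule integration_by_parts[OF op uL phi i ud])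
    have iu: "integrable (lebesgue_on \<Omega>) (\<lambda>x. u x * frechet_derivative \<phi> (at x) i)"
      using Lp_loc_1_test_integrable[OF L(3) op K P(2,4), of 1] by simp
    have iG: "integrable (lebesgue_on \<Omega>) (\<lambda>x. (G x \<bullet> i) * \<phi> x)"
      by (rule Lp_loc_1_test_integrable[OF L(4) op K P(1,3)])
    have "integral\<^sup>L (lebesgue_on \<Omega>) (\<lambda>x. (G x \<bullet> i) * \<phi> x + u x * frechet_derivative \<phi> (at x) i) = integral\<^sup>L lborel d'"
      by (rule lebesgue_on_integral_of_representative[OF op _ d'(1,3)]) (use iu iG in auto)
    then show "(\<integral>x. u x * (gradient \<phi> x \<bullet> i) \<partial>lebesgue_on \<Omega>) = - (\<integral>x. (G x \<bullet> i) * \<phi> x \<partial>lebesgue_on \<Omega>)"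
      using iu iG d'(2) by (simp add: gradient_inner i)
  qed
  have "(\<integral>x. norm (G x) powr (p - 2) * (G x \<bullet> gradient \<phi> x) \<partial>lebesgue_on \<Omega>) = 0" if phi: "\<phi> \<in> test_functions \<Omega>" for \<phi>
  proof -
    define Q where "Q i d' \<longleftrightarrow> integrable lborel d' \<and> integral\<^sup>L lborel d' = 0 \<and>
      (AE x in lborel. d' x = (if x \<in> \<Omega> then DA i x i * \<phi> x + (A x \<bullet> i) * frechet_derivative \<phi> (at x) i else 0))" for i d'
    have "\<forall>i\<in>Basis. \<exists>d'. Q i d'"
    proof
      fix i :: 'a assume i: "i \<in> Basis"
      obtain d' where "integrable lborel d'" "integral\<^sup>L lborel d' = 0"
        "AE x in lborel. d' x = (if x \<in> \<Omega> then DA i x i * \<phi> x + (A x \<bullet> i) * frechet_derivative \<phi> (at x) i else 0)"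
        by (rule integration_by_parts[OF op AL[OF i] phi i Ad[OF i]])
      then have "Q i d'" unfolding Q_def by - (intro conjI)
      then show "\<exists>d'. Q i d'" by - (rule exI)
    qed
    from bchoice[OF this] obtain d' where Q: "\<forall>i\<in>Basis. Q i (d' i)" by (rule exE)
    have d': "\<And>i. i \<in> Basis \<Longrightarrow> integrable lborel (d' i)" "\<And>i. i \<in> Basis \<Longrightarrow> integral\<^sup>L lborel (d' i) = 0"
      "\<And>i. i \<in> Basis \<Longrightarrow> AE x in lborel. d' i x = (if x \<in> \<Omega> then DA i x i * \<phi> x + (A x \<bullet> i) * frechet_derivative \<phi> (at x) i else 0)"
      using Q unfolding Q_def by simp_all
    define e where "e x = (\<Sum>i\<in>Basis. d' i x)" for x
    have ei: "integrable lborel e" unfolding e_def by (rule Bochner_Integration.integrable_sum) (rule d'(1))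
    have e0: "integral\<^sup>L lborel e = 0" unfolding e_def using d'(1,2) by (subst Bochner_Integration.integral_sum) auto
    have "AE x in lborel. \<forall>i\<in>Basis. d' i x = (if x \<in> \<Omega> then DA i x i * \<phi> x + (A x \<bullet> i) * frechet_derivative \<phi> (at x) i else 0)"
      by (rule AE_finite_allI) (use d'(3) in auto)
    with div have ae: "AE x in lborel. e x = (if x \<in> \<Omega> then norm (G x) powr (p - 2) * (G x \<bullet> gradient \<phi> x) else 0)"
    proof eventually_elim
      case (elim x)
      show ?case
      proof (cases "x \<in> \<Omega>")
        case True
        have "e x = (\<Sum>i\<in>Basis. DA i x i) * \<phi> x + (\<Sum>i\<in>Basis. (A x \<bullet> i) * frechet_derivative \<phi> (at x) i)"
          unfolding e_def using elim(2) True by (simp add: sum.distrib sum_distrib_right)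
        also have "\<dots> = A x \<bullet> gradient \<phi> x" using elim True by (simp add: inner_gradient)
        finally show ?thesis using True by (simp add: A[OF True, symmetric])
      next
        case False
        then show ?thesis using elim by (simp add: e_def)
      qed
    qed
    have [measurable]: "gradient \<phi> \<in> borel_measurable (lebesgue_on \<Omega>)"
      unfolding gradient_def[abs_def]
      by (intro continuous_measurable_lebesgue_on continuous_on_sum continuous_on_scaleR continuous_on_const test_function_props(2)[OF phi])
    note Gm[measurable]
    have "(\<integral>x. norm (G x) powr (p - 2) * (G x \<bullet> gradient \<phi> x) \<partial>lebesgue_on \<Omega>) = integral\<^sup>L lborel e"
      by (rule lebesgue_on_integral_of_representative[OF op _ ei ae]) measurable
    then show ?thesis using e0 by simp
  qed
  then show ?thesis unfolding p_harmonic_on_def W1p_loc_def using uc wg L by blast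
qed

definition polar :: "((real^'m) \<times> real) \<Rightarrow> real" where
  "polar x = arccos (snd x / norm x)"

lemma polar_ratio:
  fixes x :: "(real^'m) \<times> real"
  assumes "0 \<le> snd x" "x \<noteq> 0"
  shows "0 \<le> snd x / norm x" "snd x / norm x \<le> 1"
proof -
  have "\<bar>snd x\<bar> \<le> norm x" using norm_snd_le[of "snd x" "fst x"] by simp
  then show "0 \<le> snd x / norm x" "snd x / norm x \<le> 1" using assms by (simp_all add: divide_le_eq)
qed

lemma cos_polar:
  assumes "0 \<le> snd x" "x \<noteq> 0"
  shows "cos (polar x) = snd x / norm x"
  unfolding polar_def using polar_ratio[OF assms] by (intro cos_arccos; linarith)

lemma polar_range:
  assumes "0 \<le> snd x" "x \<noteq> 0"
  shows "polar x \<in> {0..pi/2}"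
proof -
  note r = polar_ratio[OF assms]
  have "arccos (snd x / norm x) \<le> pi/2" by (rule arccos_le_pi2[OF r])
  moreover have "0 \<le> arccos (snd x / norm x)" by (rule arccos_lbound; use r in linarith)
  ultimately show ?thesis unfolding polar_def by simp
qed

text \<open>
  In contrast to \<open>arccos\<close>, which is not Lipschitz at \<open>1\<close>, this formula shows that the polar
  angle is locally Lipschitz across the axis.
\<close>
lemma polar_eq_arctan:
  fixes x :: "(real^'m) \<times> real"
  assumes "0 < snd x"
  shows "polar x = arctan (norm (fst x) / snd x)"
proof -
  define y where "y = norm (fst x) / snd x"
  have y: "0 \<le> y" using assms by (simp add: y_def)
  have n: "norm x = sqrt ((norm (fst x))\<^sup>2 + (snd x)\<^sup>2)" by (simp add: norm_prod_def)
  have "1 + y\<^sup>2 = ((norm (fst x))\<^sup>2 + (snd x)\<^sup>2) / (snd x)\<^sup>2" using assms by (simp add: y_def field_simps)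
  then have "sqrt (1 + y\<^sup>2) = norm x / snd x" using assms by (simp add: n real_sqrt_divide)
  then have "cos (arctan y) = snd x / norm x" by (simp add: cos_arctan)
  moreover have "arccos (cos (arctan y)) = arctan y"
  proof (rule arccos_cos)
    show "0 \<le> arctan y" using y by simp
    show "arctan y \<le> pi" using arctan_ubound[of y] pi_gt_zero by linarith
  qed
  ultimately show ?thesis by (simp add: polar_def y_def)
qed

lemma polar_open_range:
  fixes x :: "(real^'m) \<times> real"
  assumes "0 < snd x"
  shows "polar x < pi/2" "fst x \<noteq> 0 \<Longrightarrow> 0 < polar x"
  unfolding polar_eq_arctan[OF assms] using assms arctan_ubound by auto

lemma loc_lipschitz_polar: "loc_lipschitz {x :: (real^'m) \<times> real. 0 < snd x} polar"
proof -
  let ?H = "{x :: (real^'m) \<times> real. 0 < snd x}"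
  have 1: "loc_lipschitz ?H (\<lambda>x. norm (fst x))"
  proof (rule loc_lipschitz_I[of 1], rule lipschitz_onI)
    fix x y :: "(real^'m) \<times> real"
    have "\<bar>norm (fst x) - norm (fst y)\<bar> \<le> norm (fst x - fst y)" by (rule norm_triangle_ineq3)
    also have "\<dots> \<le> dist x y" using dist_fst_le[of x y] by (simp only: dist_norm)
    finally show "dist (norm (fst x)) (norm (fst y)) \<le> 1 * dist x y" by (simp add: dist_real_def)
  qed simp
  have 2: "loc_lipschitz ?H (\<lambda>x. snd x)"
    by (rule loc_lipschitz_I[of 1], rule lipschitz_onI) (use dist_snd_le in auto)
  have 3: "loc_lipschitz {0<..} (inverse :: real \<Rightarrow> real)"
  proof (rule loc_lipschitz_C1[where g'="\<lambda>x. - (inverse x ^ Suc (Suc 0))"])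
    show "(inverse has_real_derivative - (inverse x ^ Suc (Suc 0))) (at x)" if "x \<in> {0<..}" for x :: real
      using that by (intro DERIV_inverse) simp
  qed (auto intro!: continuous_intros)
  have 4: "loc_lipschitz UNIV arctan"
    by (rule loc_lipschitz_C1[where g'="\<lambda>x. inverse (1 + x\<^sup>2)"]) (auto intro!: DERIV_arctan continuous_intros simp: add_nonneg_eq_0_iff)
  have "loc_lipschitz ?H (\<lambda>x. arctan (norm (fst x) * inverse (snd x)))"
    by (intro loc_lipschitz_compose[OF loc_lipschitz_mult[OF 1 loc_lipschitz_compose[OF 2 3]] 4]) auto
  then show ?thesis by (rule loc_lipschitz_cong) (simp add: polar_eq_arctan divide_inverse)
qed

lemma continuous_on_polar: "continuous_on {x :: (real^'m) \<times> real. 0 \<le> snd x \<and> x \<noteq> 0} polar"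
proof -
  have c: "continuous_on {x :: (real^'m) \<times> real. 0 \<le> snd x \<and> x \<noteq> 0} (\<lambda>x. snd x / norm x)"
    by (intro continuous_intros) auto
  show ?thesis unfolding polar_def[abs_def]
  proof (rule continuous_on_compose2[OF continuous_on_arccos' c])
    show "(\<lambda>x. snd x / norm x) ` {x :: (real^'m) \<times> real. 0 \<le> snd x \<and> x \<noteq> 0} \<subseteq> {-1..1}"
    proof
      fix y assume "y \<in> (\<lambda>x. snd x / norm x) ` {x :: (real^'m) \<times> real. 0 \<le> snd x \<and> x \<noteq> 0}"
      then obtain x :: "(real^'m) \<times> real" where x: "y = snd x / norm x" "0 \<le> snd x" "x \<noteq> 0" by blast
      have "0 \<le> y" "y \<le> 1" unfolding x(1) by (rule polar_ratio[OF x(2,3)])+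
      then show "y \<in> {-1..1}" by simp
    qed
  qed
qed

lemma loc_lipschitz_radial: "loc_lipschitz {x :: (real^'m) \<times> real. 0 < snd x} (\<lambda>x. norm x powr q)"
proof -
  have 1: "loc_lipschitz {x :: (real^'m) \<times> real. 0 < snd x} norm"
    by (rule loc_lipschitz_I[of 1], rule lipschitz_onI) (auto simp: dist_norm norm_triangle_ineq3)
  have 2: "loc_lipschitz {0<..} (\<lambda>r::real. r powr q)"
    by (rule loc_lipschitz_C1[where g'="\<lambda>r. q * r powr (q - 1)"])
      (auto intro!: has_real_derivative_powr continuous_intros)
  show ?thesis by (rule loc_lipschitz_compose[OF 1 2]) auto
qed

lemma loc_lipschitz_separated:
  assumes "loc_lipschitz {0..pi/2} F"
  shows "loc_lipschitz {x :: (real^'m) \<times> real. 0 < snd x} (\<lambda>x. norm x powr q * F (polar x))"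
proof (intro loc_lipschitz_mult loc_lipschitz_radial loc_lipschitz_compose[OF loc_lipschitz_polar assms])
  fix x :: "(real^'m) \<times> real" assume "x \<in> {x. 0 < snd x}"
  then show "polar x \<in> {0..pi/2}" by (intro polar_range) auto
qed

text \<open>
  Off the axis \<open>F(\<theta>)\<close> is a differentiable function of \<open>cos \<theta> = x\<^sub>N / r\<close>, with derivative
  \<open>- F' / sin \<theta>\<close>; the last factor is the derivative of \<open>x\<^sub>N / r\<close>.
\<close>
lemma separated_has_derivative:
  fixes x :: "(real^'m) \<times> real"
  assumes x: "0 < snd x" "fst x \<noteq> 0" and F: "(F has_real_derivative F') (at (polar x))"
  shows "((\<lambda>x. norm x powr q * F (polar x)) has_derivative (\<lambda>h. q * norm x powr (q - 2) * (x \<bullet> h) * F (polar x)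
     - norm x powr q * (F' / sin (polar x)) * (snd h / norm x - snd x * (x \<bullet> h) / norm x ^ 3))) (at x)"
proof -
  have x0: "x \<noteq> 0" "0 < norm x" using x(2) by auto
  have dn: "(norm has_derivative (\<lambda>h. (x \<bullet> h) / norm x)) (at x)"
    by (rule has_derivative_eq_rhs[OF has_derivative_norm[OF x0(1)]]) (simp add: sgn_div_norm inner_commute divide_inverse mult.commute)
  have dp: "((\<lambda>x. norm x powr q) has_derivative (\<lambda>h. q * norm x powr (q - 1) * ((x \<bullet> h) / norm x))) (at x)"
    using has_derivative_compose[OF dn has_real_derivative_powr[OF x0(2), of q, unfolded has_field_derivative_def]] by simp
  have ds: "(snd has_derivative snd) (at x)" by (rule bounded_linear_imp_has_derivative[OF bounded_linear_snd])
  have dz: "((\<lambda>x. snd x / norm x) has_derivative (\<lambda>h. snd h / norm x - snd x * (x \<bullet> h) / norm x ^ 3)) (at x)"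
    by (rule has_derivative_eq_rhs[OF has_derivative_divide'[OF ds dn]])
      (use x0 in \<open>auto simp: fun_eq_iff field_simps power2_eq_square power3_eq_cube\<close>)
  have s: "0 < sin (polar x)" using polar_open_range[OF x(1)] x(2) by (intro sin_gt_zero) auto
  have r: "0 \<le> snd x / norm x" "snd x / norm x \<le> 1" using polar_ratio[of x] x x0 by auto
  have c: "cos (polar x) = snd x / norm x" using cos_polar[of x] x x0 by simp
  have ss: "sqrt (1 - (snd x / norm x)\<^sup>2) = sin (polar x)"
    using s unfolding c[symmetric] sin_squared_eq[symmetric] by simp
  have r1: "snd x / norm x < 1"
  proof (rule ccontr)
    assume "\<not> ?thesis"
    then have z1: "snd x / norm x = 1" using r by linarith
    have "sin (polar x) = 0" using ss unfolding z1 by simp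
    then show False using s by simp
  qed
  have da: "(arccos has_real_derivative inverse (- sqrt (1 - (snd x / norm x)\<^sup>2))) (at (snd x / norm x))"
    by (rule DERIV_arccos) (use r r1 in auto)
  have dpol: "(polar has_derivative (\<lambda>h. inverse (- sin (polar x)) * (snd h / norm x - snd x * (x \<bullet> h) / norm x ^ 3))) (at x)"
    using has_derivative_compose[OF dz da[unfolded has_field_derivative_def]] unfolding ss polar_def[abs_def, symmetric] by simp
  have dF: "((\<lambda>x. F (polar x)) has_derivative (\<lambda>h. F' * (inverse (- sin (polar x)) * (snd h / norm x - snd x * (x \<bullet> h) / norm x ^ 3)))) (at x)"
    using has_derivative_compose[OF dpol F[unfolded has_field_derivative_def]] by simp
  have pw: "norm x powr (q - 1) / norm x = norm x powr (q - 2)"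
    using x0 powr_diff[of "norm x" "q - 1" 1] by simp
  have "((\<lambda>x. norm x powr q * F (polar x)) has_derivative (\<lambda>h. norm x powr q * (F' * (inverse (- sin (polar x)) * (snd h / norm x - snd x * (x \<bullet> h) / norm x ^ 3)))
      + q * norm x powr (q - 1) * ((x \<bullet> h) / norm x) * F (polar x))) (at x)"
    by (rule has_derivative_mult[OF dp dF])
  then show ?thesis
  proof (rule has_derivative_eq_rhs)
    have "q * norm x powr (q - 1) * ((x \<bullet> h) / norm x) * F (polar x) = q * norm x powr (q - 2) * (x \<bullet> h) * F (polar x)" for h
      unfolding pw[symmetric] by simp
    then show "(\<lambda>h. norm x powr q * (F' * (inverse (- sin (polar x)) * (snd h / norm x - snd x * (x \<bullet> h) / norm x ^ 3)))
      + q * norm x powr (q - 1) * ((x \<bullet> h) / norm x) * F (polar x)) = (\<lambda>h. q * norm x powr (q - 2) * (x \<bullet> h) * F (polar x)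
     - norm x powr q * (F' / sin (polar x)) * (snd h / norm x - snd x * (x \<bullet> h) / norm x ^ 3))"
      using s by (simp add: fun_eq_iff divide_inverse algebra_simps)
  qed
qed

text \<open>
  The divergence of a field \<open>\<alpha>(x) x + \<kappa>(x) e\<^sub>N\<close> is \<open>N \<alpha> + d\<alpha>(x) + d\<kappa>(e\<^sub>N)\<close>. For the
  flux of \<open>U\<close> the function \<open>\<alpha>\<close> is homogeneous, so Euler's relation evaluates \<open>d\<alpha>(x)\<close>, and the sum
  vanishes by the last identity of \<open>singular_profile\<close>.
\<close>
lemma singular_solution:
  fixes p :: real
  assumes p: "1 < p"
  obtains \<beta> and U :: "((real^'m) \<times> real) \<Rightarrow> real" and M where "0 < \<beta>" "0 < M"
    "continuous_on {x. 0 \<le> snd x \<and> x \<noteq> 0} U"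
    "\<And>x. snd x = 0 \<Longrightarrow> x \<noteq> 0 \<Longrightarrow> U x = 0"
    "\<And>x. 0 < snd x \<Longrightarrow> 0 < U x"
    "\<And>c x. 0 < c \<Longrightarrow> U (c *\<^sub>R x) = c powr (- \<beta>) * U x"
    "\<And>x. 0 \<le> snd x \<Longrightarrow> x \<noteq> 0 \<Longrightarrow> U x \<le> M * norm x powr (- \<beta>)"
    "\<And>D c d e. open D \<Longrightarrow> 0 < c \<Longrightarrow> (\<And>x. x \<in> D \<Longrightarrow> 0 < snd (x + d)) \<Longrightarrow> p_harmonic_on p D (\<lambda>x. c * U (x + d) - e)"
proof -
  define m where "m = CARD('m) - 1"
  have cm: "0 < CARD('m)" by simp
  have m: "real m + 1 = real CARD('m)" unfolding m_def using cm by linarith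
  obtain \<beta> f \<sigma> a k A' K' where be: "0 < \<beta>"
    and sp: "\<And>t. t \<in> {0..pi/2} \<Longrightarrow> 0 < \<sigma> t"
    and sc: "continuous_on {0..pi/2} \<sigma>" and ac: "continuous_on {0..pi/2} a" and kc: "continuous_on {0..pi/2} k"
    and f1: "f (pi/2) = 0" and fp: "\<And>t. 0 \<le> t \<Longrightarrow> t < pi/2 \<Longrightarrow> 0 < f t" and fL: "loc_lipschitz {0..pi/2} f"
    and fd: "\<And>t. 0 < t \<Longrightarrow> t < pi/2 \<Longrightarrow> (f has_real_derivative - (\<sigma> t * k t * sin t)) (at t)"
    and rel: "\<And>t. t \<in> {0..pi/2} \<Longrightarrow> \<sigma> t * (a t + cos t * k t) = - (\<beta> * f t)"
    and unit: "\<And>t. t \<in> {0..pi/2} \<Longrightarrow> (a t)\<^sup>2 + 2 * a t * k t * cos t + (k t)\<^sup>2 = 1"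
    and AL: "loc_lipschitz {0..pi/2} (\<lambda>t. \<sigma> t powr (p - 1) * a t)" and KL: "loc_lipschitz {0..pi/2} (\<lambda>t. \<sigma> t powr (p - 1) * k t)"
    and Ad: "\<And>t. 0 < t \<Longrightarrow> t < pi/2 \<Longrightarrow> ((\<lambda>t. \<sigma> t powr (p - 1) * a t) has_real_derivative A' t) (at t)"
    and Kd: "\<And>t. 0 < t \<Longrightarrow> t < pi/2 \<Longrightarrow> ((\<lambda>t. \<sigma> t powr (p - 1) * k t) has_real_derivative K' t) (at t)"
    and divf: "\<And>t. 0 < t \<Longrightarrow> t < pi/2 \<Longrightarrow> (real m + 1 - (\<beta> + 1) * (p - 1)) * (\<sigma> t powr (p - 1) * a t)
        - (\<beta> + 1) * (p - 1) * cos t * (\<sigma> t powr (p - 1) * k t) - K' t * sin t = 0"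
    by (rule singular_profile[OF p, of m], rule that, assumption+)
  \<comment> \<open>the flux is homogeneous of this degree, with opposite sign\<close>
  define \<gamma> where "\<gamma> = (\<beta> + 1) * (p - 1)"
  define FA where "FA t = \<sigma> t powr (p - 1) * a t" for t
  define FK where "FK t = \<sigma> t powr (p - 1) * k t" for t
  let ?H = "{x :: (real^'m) \<times> real. 0 < snd x}"
  let ?C = "{x :: (real^'m) \<times> real. 0 \<le> snd x \<and> x \<noteq> 0}"
  define ev :: "(real^'m) \<times> real" where "ev = (0, 1)"
  have ev: "x \<bullet> ev = snd x" "ev \<bullet> x = snd x" for x by (simp_all add: ev_def inner_prod_def)
  define U where "U x = norm x powr (- \<beta>) * f (polar x)" for x :: "(real^'m) \<times> real"
  define G where "G x = (norm x powr (- \<beta> - 2) * (\<sigma> (polar x) * a (polar x))) *\<^sub>R x + (norm x powr (- \<beta> - 1) * (\<sigma> (polar x) * k (polar x))) *\<^sub>R ev" for x :: "(real^'m) \<times> real"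
  define \<alpha> where "\<alpha> x = norm x powr (- \<gamma> - 1) * FA (polar x)" for x :: "(real^'m) \<times> real"
  define \<kappa> where "\<kappa> x = norm x powr (- \<gamma>) * FK (polar x)" for x :: "(real^'m) \<times> real"
  define A where "A x = \<alpha> x *\<^sub>R x + \<kappa> x *\<^sub>R ev" for x
  have pw: "r powr (q - 1) = r powr q / r" "r powr (q - 2) = r powr q / r\<^sup>2" if "0 < r" for r q :: real
    using that powr_diff[of r q 1] powr_diff[of r q 2] by simp_all
  have Uc: "continuous_on ?C U"
    unfolding U_def
    by (intro continuous_intros continuous_on_compose2[OF loc_lipschitz_continuous_on[OF fL] continuous_on_polar])
      (use polar_range in \<open>auto simp del: atLeastAtMost_iff\<close>)
  have Gc: "continuous_on ?H G"
  proof -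
    have pc: "continuous_on ?H polar" by (rule continuous_on_subset[OF continuous_on_polar]) auto
    have pr: "polar ` ?H \<subseteq> {0..pi/2}" by (rule image_subsetI, rule polar_range) auto
    have s': "continuous_on ?H (\<lambda>x. \<sigma> (polar x))" by (rule continuous_on_compose2[OF sc pc pr])
    have a': "continuous_on ?H (\<lambda>x. a (polar x))" by (rule continuous_on_compose2[OF ac pc pr])
    have k': "continuous_on ?H (\<lambda>x. k (polar x))" by (rule continuous_on_compose2[OF kc pc pr])
    show ?thesis unfolding G_def by (intro continuous_intros s' a' k') (auto simp: zero_prod_def)
  qed
  have GA: "norm (G x) powr (p - 2) *\<^sub>R G x = A x" and nG: "0 < norm (G x)" if x: "x \<in> ?H" for x
  proof -
    have x': "0 \<le> snd x" "x \<noteq> 0" "0 < norm x" using x by auto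
    define t r s where "t = polar x" and "r = norm x" and "s = norm x powr (- \<beta> - 1) * \<sigma> (polar x)"
    have t: "t \<in> {0..pi/2}" unfolding t_def by (rule polar_range[OF x'(1,2)])
    have ct: "cos t = snd x / r" unfolding t_def r_def by (rule cos_polar[OF x'(1,2)])
    have r: "0 < r" using x' by (simp add: r_def)
    have s: "0 < s" using sp[OF t] x' by (simp add: s_def t_def)
    define X where "X = (a t / r) *\<^sub>R x + k t *\<^sub>R ev"
    have GX: "G x = s *\<^sub>R X"
      unfolding G_def X_def s_def t_def[symmetric] r_def[symmetric] using r pw(1)[OF r, of "- \<beta> - 1"]
      by (simp add: scaleR_add_right algebra_simps)
    have "X \<bullet> X = (a t)\<^sup>2 * ((x \<bullet> x) / r\<^sup>2) + 2 * a t * k t * (snd x / r) + (k t)\<^sup>2"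
      unfolding X_def by (simp add: inner_add_left inner_add_right ev power2_eq_square algebra_simps) (simp add: ev_def)
    also have "(x \<bullet> x) / r\<^sup>2 = 1" using r by (simp add: r_def dot_square_norm)
    finally have "X \<bullet> X = 1" using unit[OF t] by (simp add: ct)
    then have nX: "norm X = 1" by (simp add: norm_eq_1)
    have n: "norm (G x) = s" using s by (simp add: GX nX)
    show "0 < norm (G x)" using n s by simp
    have "norm (G x) powr (p - 2) *\<^sub>R G x = (s powr (p - 2) * s) *\<^sub>R X" unfolding n by (simp add: GX)
    also have "s powr (p - 2) * s = s powr (p - 1)" using s powr_mult_base[of s "p - 2"] by (simp add: mult.commute)
    also have "s powr (p - 1) = r powr (- \<gamma>) * \<sigma> t powr (p - 1)"
      unfolding s_def t_def[symmetric] r_def[symmetric] using r sp[OF t]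
      by (simp add: powr_mult powr_powr \<gamma>_def algebra_simps)
    also have "(r powr (- \<gamma>) * \<sigma> t powr (p - 1)) *\<^sub>R X = A x"
      unfolding A_def \<alpha>_def \<kappa>_def FA_def FK_def X_def t_def[symmetric] r_def[symmetric] using r pw(1)[OF r, of "- \<gamma>"]
      by (simp add: scaleR_add_right algebra_simps)
    finally show "norm (G x) powr (p - 2) *\<^sub>R G x = A x" .
  qed
  have UL: "loc_lipschitz ?H U" unfolding U_def by (rule loc_lipschitz_separated[OF fL])
  have \<alpha>L: "loc_lipschitz ?H \<alpha>" unfolding \<alpha>_def FA_def by (rule loc_lipschitz_separated[OF AL])
  have \<kappa>L: "loc_lipschitz ?H \<kappa>" unfolding \<kappa>_def FK_def by (rule loc_lipschitz_separated[OF KL])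
  have innerL: "loc_lipschitz S (\<lambda>x. x \<bullet> i)" if "i \<in> Basis" for S and i :: "(real^'m) \<times> real"
    by (rule loc_lipschitz_I[of 1], rule lipschitz_onI)
      (use Basis_le_norm[OF that] in \<open>auto simp: dist_norm inner_diff_left[symmetric]\<close>)
  have AiL: "loc_lipschitz ?H (\<lambda>x. A x \<bullet> i)" if "i \<in> Basis" for i
    unfolding A_def inner_add_left inner_scaleR_left
    by (intro loc_lipschitz_add loc_lipschitz_mult \<alpha>L \<kappa>L innerL[OF that] loc_lipschitz_const)
  have Ud: "(U has_derivative (\<lambda>h. G x \<bullet> h)) (at x)" if x: "0 < snd x" "fst x \<noteq> 0" for x
  proof -
    have x': "0 \<le> snd x" "x \<noteq> 0" "0 < norm x" using x by auto
    define t r where "t = polar x" and "r = norm x"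
    have t: "0 < t" "t < pi/2" unfolding t_def using polar_open_range[OF x(1)] x(2) by auto
    have r: "0 < r" using x' by (simp add: r_def)
    have st: "0 < sin t" using t by (intro sin_gt_zero) auto
    have ct: "cos t = snd x / r" unfolding t_def r_def by (rule cos_polar[OF x'(1,2)])
    have "(U has_derivative (\<lambda>h. - \<beta> * r powr (- \<beta> - 2) * (x \<bullet> h) * f t
     - r powr (- \<beta>) * (- (\<sigma> t * k t * sin t) / sin t) * (snd h / r - snd x * (x \<bullet> h) / r ^ 3))) (at x)"
      unfolding U_def t_def r_def by (rule separated_has_derivative[OF x fd]) (use t in \<open>auto simp: t_def\<close>)
    then show ?thesis
    proof (rule has_derivative_eq_rhs)
      have "- \<beta> * r powr (- \<beta> - 2) * (x \<bullet> h) * f t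
     - r powr (- \<beta>) * (- (\<sigma> t * k t * sin t) / sin t) * (snd h / r - snd x * (x \<bullet> h) / r ^ 3) = G x \<bullet> h" for h
      proof -
        define P where "P = r powr (- \<beta>)"
        have "- \<beta> * r powr (- \<beta> - 2) * (x \<bullet> h) * f t
         - r powr (- \<beta>) * (- (\<sigma> t * k t * sin t) / sin t) * (snd h / r - snd x * (x \<bullet> h) / r ^ 3)
         = P / r\<^sup>2 * (x \<bullet> h) * (- (\<beta> * f t)) + P * (\<sigma> t * k t) * (snd h / r - (snd x / r) * (x \<bullet> h) / r\<^sup>2)"
        proof -
          have 1: "- (\<sigma> t * k t * sin t) / sin t = - (\<sigma> t * k t)" using st by simp
          have 2: "snd x * (x \<bullet> h) / r ^ 3 = (snd x / r) * (x \<bullet> h) / r\<^sup>2" by (simp add: power2_eq_square power3_eq_cube)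
          have 3: "- \<beta> * (P / r\<^sup>2) * w * y - P * (- z) * v = P / r\<^sup>2 * w * (- (\<beta> * y)) + P * z * v" for w y z v
            by simp
          show ?thesis unfolding 1 2 pw(2)[OF r] P_def[symmetric] by (rule 3)
        qed
        also have "- (\<beta> * f t) = \<sigma> t * (a t + snd x / r * k t)" using rel[of t] t ct by simp
        also have "P / r\<^sup>2 * (x \<bullet> h) * (\<sigma> t * (a t + snd x / r * k t)) + P * (\<sigma> t * k t) * (snd h / r - (snd x / r) * (x \<bullet> h) / r\<^sup>2)
          = P / r\<^sup>2 * (\<sigma> t * a t) * (x \<bullet> h) + P / r * (\<sigma> t * k t) * snd h"
          by (simp add: algebra_simps)
        also have "\<dots> = G x \<bullet> h"
          unfolding G_def t_def[symmetric] r_def[symmetric] pw(1)[OF r] pw(2)[OF r] P_def[symmetric]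
          by (simp add: inner_add_left ev)
        finally show ?thesis .
      qed
      then show "(\<lambda>h. - \<beta> * r powr (- \<beta> - 2) * (x \<bullet> h) * f t
     - r powr (- \<beta>) * (- (\<sigma> t * k t * sin t) / sin t) * (snd h / r - snd x * (x \<bullet> h) / r ^ 3)) = (\<lambda>h. G x \<bullet> h)" by (rule ext)
    qed
  qed
  define \<alpha>' where "\<alpha>' x h = (- \<gamma> - 1) * norm x powr (- \<gamma> - 1 - 2) * (x \<bullet> h) * FA (polar x)
     - norm x powr (- \<gamma> - 1) * (A' (polar x) / sin (polar x)) * (snd h / norm x - snd x * (x \<bullet> h) / norm x ^ 3)" for x h :: "(real^'m) \<times> real"
  define \<kappa>' where "\<kappa>' x h = - \<gamma> * norm x powr (- \<gamma> - 2) * (x \<bullet> h) * FK (polar x)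
     - norm x powr (- \<gamma>) * (K' (polar x) / sin (polar x)) * (snd h / norm x - snd x * (x \<bullet> h) / norm x ^ 3)" for x h :: "(real^'m) \<times> real"
  define DA where "DA i x h = (\<alpha> x * (h \<bullet> i) + \<alpha>' x h * (x \<bullet> i)) + \<kappa>' x h * (ev \<bullet> i)" for i x h
  have Adi: "((\<lambda>x. A x \<bullet> i) has_derivative DA i x) (at x)" if x: "0 < snd x" "fst x \<noteq> 0" for x i
  proof -
    have t: "0 < polar x" "polar x < pi/2" using polar_open_range[OF x(1)] x(2) by auto
    have d1: "(\<alpha> has_derivative \<alpha>' x) (at x)"
      unfolding \<alpha>_def \<alpha>'_def by (rule separated_has_derivative[OF x]) (use Ad[OF t] in \<open>simp add: FA_def[abs_def]\<close>)
    have d2: "(\<kappa> has_derivative \<kappa>' x) (at x)"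
      unfolding \<kappa>_def \<kappa>'_def by (rule separated_has_derivative[OF x]) (use Kd[OF t] in \<open>simp add: FK_def[abs_def]\<close>)
    have d3: "((\<lambda>x. x \<bullet> i) has_derivative (\<lambda>h. h \<bullet> i)) (at x)"
      by (rule bounded_linear_imp_has_derivative) (rule bounded_linear_inner_left)
    show ?thesis unfolding A_def inner_add_left inner_scaleR_left DA_def
      using has_derivative_add[OF has_derivative_mult[OF d1 d3] has_derivative_mult_left[OF d2, of "ev \<bullet> i"]] by simp
  qed
  have lin: "linear (\<alpha>' x)" "linear (\<kappa>' x)" for x
  proof -
    have L: "linear (\<lambda>h. c1 * (x \<bullet> h) * c2 - c3 * (snd h / r - s * (x \<bullet> h) / r3))" for c1 c2 c3 r s r3
    proof (rule linearI)
      fix h1 h2 :: "(real^'m) \<times> real"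
      show "c1 * (x \<bullet> (h1 + h2)) * c2 - c3 * (snd (h1 + h2) / r - s * (x \<bullet> (h1 + h2)) / r3) =
        c1 * (x \<bullet> h1) * c2 - c3 * (snd h1 / r - s * (x \<bullet> h1) / r3) + (c1 * (x \<bullet> h2) * c2 - c3 * (snd h2 / r - s * (x \<bullet> h2) / r3))"
        unfolding inner_add_right snd_add by (simp add: algebra_simps add_divide_distrib)
    next
      fix q :: real and h :: "(real^'m) \<times> real"
      show "c1 * (x \<bullet> (q *\<^sub>R h)) * c2 - c3 * (snd (q *\<^sub>R h) / r - s * (x \<bullet> (q *\<^sub>R h)) / r3) =
        q *\<^sub>R (c1 * (x \<bullet> h) * c2 - c3 * (snd h / r - s * (x \<bullet> h) / r3))"
        unfolding inner_scaleR_right snd_scaleR by (simp add: algebra_simps)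
    qed
    show "linear (\<alpha>' x)" "linear (\<kappa>' x)"
      unfolding \<alpha>'_def[abs_def] \<kappa>'_def[abs_def] by (rule L)+
  qed
  have div0: "(\<Sum>i\<in>Basis. DA i x i) = 0" if x: "0 < snd x" "fst x \<noteq> 0" for x
  proof -
    have x': "0 \<le> snd x" "x \<noteq> 0" "0 < norm x" using x by auto
    define t r where "t = polar x" and "r = norm x"
    have t: "0 < t" "t < pi/2" unfolding t_def using polar_open_range[OF x(1)] x(2) by auto
    have r: "0 < r" using x' by (simp add: r_def)
    have st: "0 < sin t" using t by (intro sin_gt_zero) auto
    have ct: "cos t = snd x / r" unfolding t_def r_def by (rule cos_polar[OF x'(1,2)])
    have sum_lin: "(\<Sum>i\<in>Basis. F i * (y \<bullet> i)) = F y" if "linear F" for F :: "(real^'m) \<times> real \<Rightarrow> real" and y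
    proof -
      have "F (\<Sum>i\<in>Basis. (y \<bullet> i) *\<^sub>R i) = (\<Sum>i\<in>Basis. (y \<bullet> i) * F i)" by (simp add: linear_sum[OF that] linear_scale[OF that])
      then show ?thesis by (simp add: euclidean_representation mult.commute)
    qed
    have dim: "(\<Sum>i\<in>(Basis :: ((real^'m) \<times> real) set). \<alpha> x * (i \<bullet> i)) = (real m + 2) * \<alpha> x"
      using m by (simp add: inner_Basis)
    have "(\<Sum>i\<in>Basis. DA i x i) = (real m + 2) * \<alpha> x + \<alpha>' x x + \<kappa>' x ev"
      unfolding DA_def sum.distrib dim sum_lin[OF lin(1)] sum_lin[OF lin(2)] ..
    also have "\<alpha>' x x = (- \<gamma> - 1) * \<alpha> x"
    proof -
      have "x \<bullet> x = r\<^sup>2" by (simp add: r_def dot_square_norm)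
      then show ?thesis unfolding \<alpha>'_def \<alpha>_def t_def[symmetric] r_def[symmetric] pw(2)[OF r, of "- \<gamma> - 1"]
        using r by (simp add: power2_eq_square power3_eq_cube)
    qed
    also have "\<kappa>' x ev = - \<gamma> * (r powr (- \<gamma> - 1) * (cos t * FK t)) - r powr (- \<gamma> - 1) * (K' t * sin t)"
    proof -
      have e1: "snd ev = 1" by (simp add: ev_def)
      have s2: "1 / r - snd x * snd x / r ^ 3 = (sin t)\<^sup>2 / r"
      proof -
        have "(sin t)\<^sup>2 = 1 - (snd x / r)\<^sup>2" unfolding sin_squared_eq ct ..
        moreover have "1 / r - snd x * snd x / r ^ 3 = (1 - (snd x / r)\<^sup>2) / r"
          using r by (simp add: diff_divide_distrib power2_eq_square power3_eq_cube)
        ultimately show ?thesis by (simp only:)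
      qed
      have "\<kappa>' x ev = - \<gamma> * r powr (- \<gamma> - 2) * snd x * FK t - r powr (- \<gamma>) * (K' t / sin t) * ((sin t)\<^sup>2 / r)"
        unfolding \<kappa>'_def ev e1 t_def[symmetric] r_def[symmetric] s2 ..
      also have "r powr (- \<gamma>) * (K' t / sin t) * ((sin t)\<^sup>2 / r) = r powr (- \<gamma> - 1) * (K' t * sin t)"
        unfolding pw(1)[OF r] using st by (simp add: power2_eq_square)
      also have "- \<gamma> * r powr (- \<gamma> - 2) * snd x * FK t = - \<gamma> * (r powr (- \<gamma> - 1) * (cos t * FK t))"
        unfolding pw(1)[OF r] pw(2)[OF r] ct using r by (simp add: power2_eq_square)
      finally show ?thesis .
    qed
    also have "(real m + 2) * \<alpha> x + (- \<gamma> - 1) * \<alpha> x + (- \<gamma> * (r powr (- \<gamma> - 1) * (cos t * FK t)) - r powr (- \<gamma> - 1) * (K' t * sin t))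
      = r powr (- \<gamma> - 1) * ((real m + 1 - \<gamma>) * FA t - \<gamma> * cos t * FK t - K' t * sin t)"
      unfolding \<alpha>_def t_def[symmetric] r_def[symmetric] by (simp add: algebra_simps)
    also have "\<dots> = 0" using divf[OF t] by (simp add: FA_def FK_def \<gamma>_def)
    finally show ?thesis .
  qed
  have harm: "p_harmonic_on p D (\<lambda>x. c * U (x + d) - e)"
    if op: "open D" and c: "0 < c" and D: "\<And>x. x \<in> D \<Longrightarrow> 0 < snd (x + d)" for D c d e
  proof (rule p_harmonic_criterion[OF op p, where G="\<lambda>x. c *\<^sub>R G (x + d)" and A="\<lambda>x. c powr (p - 1) *\<^sub>R A (x + d)" and DA="\<lambda>i x h. c powr (p - 1) * DA i (x + d) h"])
    have tL: "loc_lipschitz D (\<lambda>x. x + d)"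
      by (rule loc_lipschitz_I[of 1], rule lipschitz_onI) (auto simp: dist_norm)
    have shift: "loc_lipschitz D (\<lambda>x. F (x + d))" if "loc_lipschitz ?H F" for F :: "_ \<Rightarrow> real"
      by (rule loc_lipschitz_compose[OF tL that]) (use D in auto)
    have "loc_lipschitz D (\<lambda>x. c * U (x + d) + (- e))"
      by (intro loc_lipschitz_add loc_lipschitz_mult loc_lipschitz_const shift UL)
    then show "loc_lipschitz D (\<lambda>x. c * U (x + d) - e)" by simp
    show "continuous_on D (\<lambda>x. c *\<^sub>R G (x + d))"
      by (intro continuous_intros continuous_on_compose2[OF Gc]) (use D in auto)
    obtain i0 :: "'m" where "i0 \<in> UNIV" by blast
    \<comment> \<open>the shifted axis, where the polar angle is not differentiable, lies in a hyperplane\<close>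
    define b where "b = (axis i0 (1::real), 0::real)"
    have "b \<noteq> 0" by (simp add: b_def axis_eq_0_iff zero_prod_def)
    then have "negligible {x. b \<bullet> x = - (fst d $ i0)}" by (intro negligible_hyperplane) auto
    then have "AE x in lebesgue. x \<notin> {x. b \<bullet> x = - (fst d $ i0)}" unfolding negligible_iff_null_sets by (rule AE_not_in)
    then have "AE x in lborel. x \<notin> {x. b \<bullet> x = - (fst d $ i0)}" by (simp add: AE_completion_iff)
    then have ae: "AE x in lborel. fst (x + d) \<noteq> 0"
    proof eventually_elim
      case (elim x)
      show ?case
      proof
        assume "fst (x + d) = 0"
        then have "(fst x + fst d) $ i0 = 0" by simp
        then have "fst x $ i0 = - (fst d $ i0)" by simp
        then show False using elim by (simp add: b_def inner_prod_def inner_axis' )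
      qed
    qed
    have dt: "((\<lambda>x. x + d) has_derivative (\<lambda>h. h)) (at x)" for x
      by (auto intro!: derivative_eq_intros)
    have sd: "((\<lambda>x. F (x + d)) has_derivative F') (at x)" if "(F has_derivative F') (at (x + d))" for F :: "_ \<Rightarrow> real" and F' x
      by (rule has_derivative_compose[OF dt that])
    show "AE x in lborel. x \<in> D \<longrightarrow> ((\<lambda>x. c * U (x + d) - e) has_derivative (\<lambda>h. c *\<^sub>R G (x + d) \<bullet> h)) (at x)"
      using ae
    proof eventually_elim
      case (elim x)
      show ?case
      proof
        assume "x \<in> D"
        from has_derivative_diff[OF has_derivative_mult_right[OF sd[OF Ud[OF D[OF this] elim]], of c] has_derivative_const[of e]]
        show "((\<lambda>x. c * U (x + d) - e) has_derivative (\<lambda>h. c *\<^sub>R G (x + d) \<bullet> h)) (at x)" by simp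
      qed
    qed
    show "norm (c *\<^sub>R G (x + d)) powr (p - 2) *\<^sub>R c *\<^sub>R G (x + d) = c powr (p - 1) *\<^sub>R A (x + d)" if "x \<in> D" for x
    proof -
      have H: "x + d \<in> ?H" using D[OF that] by simp
      have "c powr (p - 2) * c = c powr (p - 1)" using c powr_mult_base[of c "p - 2"] by (simp add: mult.commute)
      then show ?thesis unfolding GA[OF H, symmetric] using c by (simp add: powr_mult mult.assoc mult.left_commute mult.commute)
    qed
    show "loc_lipschitz D (\<lambda>x. c powr (p - 1) *\<^sub>R A (x + d) \<bullet> i)" if "i \<in> Basis" for i
      unfolding inner_scaleR_left by (intro loc_lipschitz_mult loc_lipschitz_const shift AiL that)
    show "AE x in lborel. x \<in> D \<longrightarrow> ((\<lambda>x. c powr (p - 1) *\<^sub>R A (x + d) \<bullet> i) has_derivative (\<lambda>h. c powr (p - 1) * DA i (x + d) h)) (at x)" if "i \<in> Basis" for i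
      using ae
    proof eventually_elim
      case (elim x)
      show ?case
      proof
        assume "x \<in> D"
        from has_derivative_mult_right[OF sd[OF Adi[OF D[OF this] elim]], of "c powr (p - 1)"]
        show "((\<lambda>x. c powr (p - 1) *\<^sub>R A (x + d) \<bullet> i) has_derivative (\<lambda>h. c powr (p - 1) * DA i (x + d) h)) (at x)" by simp
      qed
    qed
    show "AE x in lborel. x \<in> D \<longrightarrow> (\<Sum>i\<in>Basis. c powr (p - 1) * DA i (x + d) i) = 0"
      using ae
    proof eventually_elim
      case (elim x)
      show ?case using div0[OF D elim] by (simp add: sum_distrib_left[symmetric])
    qed
  qed
  have fc: "continuous_on {0..pi/2} f" by (rule loc_lipschitz_continuous_on[OF fL])
  have "bounded (f ` {0..pi/2})" by (intro compact_imp_bounded compact_continuous_image fc) simp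
  then obtain B where B: "\<forall>y\<in>f ` {0..pi/2}. norm y \<le> B" unfolding bounded_iff by blast
  show thesis
  proof (rule that[OF be, of "\<bar>B\<bar> + 1" U])
    show "continuous_on ?C U" by (rule Uc)
    show "U x = 0" if "snd x = 0" for x using f1 by (simp add: U_def polar_def that)
    show "0 < U x" if "0 < snd x" for x
    proof -
      have "x \<noteq> 0" using that by auto
      moreover have "0 < f (polar x)" using polar_range[of x] polar_open_range(1)[OF that] that \<open>x \<noteq> 0\<close> by (intro fp) auto
      ultimately show ?thesis by (simp add: U_def)
    qed
    show "U (c *\<^sub>R x) = c powr (- \<beta>) * U x" if "0 < c" for c x
      using that by (simp add: U_def polar_def powr_mult)
    show "U x \<le> (\<bar>B\<bar> + 1) * norm x powr (- \<beta>)" if "0 \<le> snd x" "x \<noteq> 0" for x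
    proof -
      have "norm (f (polar x)) \<le> B" using B polar_range[OF that] by blast
      then have "f (polar x) \<le> \<bar>B\<bar> + 1" by simp
      then show ?thesis unfolding U_def by (simp add: mult.commute mult_right_mono)
    qed
    show "p_harmonic_on p D (\<lambda>x. c * U (x + d) - e)" if "open D" "0 < c" "\<And>x. x \<in> D \<Longrightarrow> 0 < snd (x + d)" for D c d e
      by (rule harm[OF that])
  qed simp
qed

section \<open>Bounds for the harmonic measure\<close>

lemma continuous_le_Liminf:
  assumes "continuous_on T v" "x \<in> T" "S \<subseteq> T"
  shows "ereal (v x) \<le> Liminf (at x within S) (\<lambda>x. ereal (v x))"
proof -
  have "(v \<longlongrightarrow> v x) (at x within S)"
    using assms by (meson continuous_on tendsto_within_subset)
  then have "((\<lambda>x. ereal (v x)) \<longlongrightarrow> ereal (v x)) (at x within S)" by (rule tendsto_ereal)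
  from order_tendstoD(1)[OF this] show ?thesis unfolding le_Liminf_iff by blast
qed

lemma p_harmonic_imp_superharmonic:
  fixes v :: "'a::euclidean_space \<Rightarrow> real"
  assumes p: "1 < p" and ne: "\<Omega> \<noteq> {}" and c: "continuous_on \<Omega> v"
    and h: "\<And>D. open D \<Longrightarrow> D \<subseteq> \<Omega> \<Longrightarrow> p_harmonic_on p D v"
  shows "p_superharmonic_on p \<Omega> (\<lambda>x. ereal (v x))"
  unfolding p_superharmonic_on_def
proof (intro conjI allI impI ballI)
  show "lower_semicontinuous_on \<Omega> (\<lambda>x. ereal (v x))"
    unfolding lower_semicontinuous_on_def using continuous_le_Liminf[OF c _ subset_refl] by blast
  show "\<exists>x\<in>\<Omega>. ereal (v x) \<noteq> \<infinity>" using ne by auto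
  fix D g x
  assume A: "open D \<and> compact (closure D) \<and> closure D \<subseteq> \<Omega> \<and> continuous_on (closure D) g \<and> p_harmonic_on p D g \<and>
    (\<forall>x\<in>frontier D. ereal (g x) \<le> ereal (v x))" and x: "x \<in> D"
  have "D \<subseteq> \<Omega>" using A closure_subset[of D] by blast
  then have hv: "p_harmonic_on p D v" using h A by blast
  have cv: "continuous_on (closure D) v" using A c continuous_on_subset by blast
  have "g x \<le> v x"
    by (rule p_harmonic_comparison[OF p _ _ _ cv _ hv _ x]) (use A in simp_all)
  then show "ereal (g x) \<le> ereal (v x)" by simp
qed simp

lemma p_superharmonic_comparison:
  assumes "p_superharmonic_on p \<Omega> u" "open D" "bounded D" "closure D \<subseteq> \<Omega>"
    "continuous_on (closure D) h" "p_harmonic_on p D h"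
    "\<And>x. x \<in> frontier D \<Longrightarrow> ereal (h x) \<le> u x" "x \<in> D"
  shows "ereal (h x) \<le> u x"
proof -
  from assms(1) have "\<forall>D h. open D \<and> compact (closure D) \<and> closure D \<subseteq> \<Omega> \<and> continuous_on (closure D) h \<and> p_harmonic_on p D h \<and>
    (\<forall>x\<in>frontier D. ereal (h x) \<le> u x) \<longrightarrow> (\<forall>x\<in>D. ereal (h x) \<le> u x)"
    unfolding p_superharmonic_on_def by (elim conjE)
  from this[THEN spec, of D, THEN spec, of h, THEN mp] assms(2-7) have "\<forall>x\<in>D. ereal (h x) \<le> u x"
    by (simp add: compact_closure)
  then show ?thesis using assms(8) by blast
qed

text \<open>
  The boundary condition on the competitors holds pointwise; by compactness it becomes uniform on
  compact parts of the boundary ball.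
\<close>
lemma Liminf_uniform_near_compact:
  fixes K :: "'a::metric_space set" and c l :: ereal
  assumes K: "compact K" "K \<inter> \<Omega> = {}" and L: "\<And>y. y \<in> K \<Longrightarrow> l \<le> Liminf (at y within \<Omega>) u" and c: "c < l"
  obtains \<epsilon> where "0 < \<epsilon>" "\<And>x y. y \<in> K \<Longrightarrow> x \<in> \<Omega> \<Longrightarrow> dist y x < \<epsilon> \<Longrightarrow> c < u x"
proof -
  have "\<exists>d>0. \<forall>x\<in>\<Omega>. dist y x < d \<longrightarrow> c < u x" if y: "y \<in> K" for y
  proof -
    have "\<forall>\<^sub>F x in at y within \<Omega>. c < u x" using L[OF y] c unfolding le_Liminf_iff by blast
    then obtain d where d: "0 < d" "\<forall>x\<in>\<Omega>. x \<noteq> y \<and> dist x y < d \<longrightarrow> c < u x" unfolding eventually_at by blast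
    show ?thesis
    proof (intro exI[of _ d] conjI ballI impI d(1))
      fix x assume x: "x \<in> \<Omega>" "dist y x < d"
      then have "x \<noteq> y" using K(2) y by blast
      then show "c < u x" using d(2) x by (simp add: dist_commute)
    qed
  qed
  then have "\<forall>y\<in>K. \<exists>d. 0 < d \<and> (\<forall>x\<in>\<Omega>. dist y x < d \<longrightarrow> c < u x)" by blast
  from bchoice[OF this] obtain d where d: "\<forall>y\<in>K. 0 < d y \<and> (\<forall>x\<in>\<Omega>. dist y x < d y \<longrightarrow> c < u x)" by (rule exE)
  have "K \<subseteq> (\<Union>y\<in>K. ball y (d y))" using d by force
  then obtain \<epsilon> where \<epsilon>: "0 < \<epsilon>" "(\<Union>x\<in>K. ball x \<epsilon>) \<subseteq> (\<Union>y\<in>K. ball y (d y))"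
    using compact_subset_open_imp_ball_epsilon_subset[OF K(1), of "\<Union>y\<in>K. ball y (d y)"] by blast
  show thesis
  proof (rule that[OF \<epsilon>(1)])
    fix x y assume "y \<in> K" "x \<in> \<Omega>" "dist y x < \<epsilon>"
    then have "x \<in> (\<Union>y\<in>K. ball y \<epsilon>)" by auto
    with \<epsilon>(2) have "x \<in> (\<Union>y\<in>K. ball y (d y))" by (rule subsetD)
    then show "c < u x" using d \<open>x \<in> \<Omega>\<close> by auto
  qed
qed

lemma bounded_shifted_ball:
  fixes d :: "'a::real_normed_vector"
  assumes "\<And>x. x \<in> S \<Longrightarrow> norm (x + d) \<le> R"
  shows "bounded S"
proof (rule boundedI)
  fix x assume "x \<in> S"
  then show "norm x \<le> R + norm d" using assms[of x] norm_triangle_ineq4[of "x + d" d] by simp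
qed

locale half_space_singular_solution =
  fixes p \<beta> M :: real and U :: "(real^'m) \<times> real \<Rightarrow> real"
  assumes p: "1 < p" and \<beta>: "0 < \<beta>" and M: "0 < M"
    and Uc: "continuous_on {x. 0 \<le> snd x \<and> x \<noteq> 0} U"
    and U0: "\<And>x. snd x = 0 \<Longrightarrow> x \<noteq> 0 \<Longrightarrow> U x = 0"
    and Upos: "\<And>x. 0 < snd x \<Longrightarrow> 0 < U x"
    and Uhom: "\<And>c x. 0 < c \<Longrightarrow> U (c *\<^sub>R x) = c powr (- \<beta>) * U x"
    and UM: "\<And>x. 0 \<le> snd x \<Longrightarrow> x \<noteq> 0 \<Longrightarrow> U x \<le> M * norm x powr (- \<beta>)"
    and Uharm: "\<And>D c d e. open D \<Longrightarrow> 0 < c \<Longrightarrow> (\<And>x. x \<in> D \<Longrightarrow> 0 < snd (x + d)) \<Longrightarrow>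
      p_harmonic_on p D (\<lambda>x. c * U (x + d) - e)"
begin

lemma continuous_on_shifted:
  assumes "\<And>x. x \<in> T \<Longrightarrow> 0 \<le> snd (x + d) \<and> x + d \<noteq> 0"
  shows "continuous_on T (\<lambda>x. c * U (x + d) - e)"
  by (intro continuous_intros continuous_on_compose2[OF Uc]) (use assms in auto)

lemma Uhom_shift:
  assumes "0 < s"
  shows "U (x + s *\<^sub>R y) = s powr (- \<beta>) * U ((1 / s) *\<^sub>R x + y)"
proof -
  have "x + s *\<^sub>R y = s *\<^sub>R ((1 / s) *\<^sub>R x + y)" using assms by (simp add: scaleR_add_right)
  then show ?thesis using Uhom[OF assms] by simp
qed

text \<open>
  By homogeneity, \<open>\<delta>\<^sup>\<beta> U(x + \<delta> e) = U(x / \<delta> + e)\<close>. For \<open>x \<in> B\<^sub>\<delta>\<close> the argument on the right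
  lies in a fixed compact set on which \<open>U\<close> has a positive minimum \<open>m\<close>. Dividing by \<open>m\<close> gives a
  competitor.
\<close>
lemma harmonic_measure_upper_bound:
  obtains C where "0 < C" "\<And>\<delta>. 0 < \<delta> \<Longrightarrow>
    p_harmonic_measure p (boundary_ball \<delta>) ((0 :: real^'m), 1) upper_half_space \<le> ereal (C * \<delta> powr \<beta>)"
proof -
  define e where "e = ((0 :: real^'m), 1 :: real)"
  let ?K = "cball (0 :: real^'m) 1 \<times> {1 :: real}"
  have "compact ?K" by (intro compact_Times) auto
  moreover have "continuous_on ?K U" by (rule continuous_on_subset[OF Uc]) (auto simp: zero_prod_def)
  ultimately obtain y0 where y0: "y0 \<in> ?K" "\<forall>y\<in>?K. U y0 \<le> U y"
    using continuous_attains_inf[of ?K U] by fastforce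
  define m where "m = U y0"
  have m: "0 < m" unfolding m_def using y0(1) by (intro Upos) auto
  have ue: "0 < U e" by (intro Upos) (simp add: e_def)
  show thesis
  proof (rule that[of "U e / m"])
    show "0 < U e / m" using ue m by simp
    fix \<delta> :: real assume \<delta>: "0 < \<delta>"
    define v where "v x = \<delta> powr \<beta> / m * U (x + \<delta> *\<^sub>R e) - 0" for x
    have cp: "0 < \<delta> powr \<beta> / m" using \<delta> m by simp
    have ne: "0 < snd (x + \<delta> *\<^sub>R e)" if "0 \<le> snd x" for x using that \<delta> by (simp add: e_def)
    have cv: "continuous_on {x. 0 \<le> snd x} v" unfolding v_def
      by (rule continuous_on_shifted) (use ne in \<open>fastforce simp del: snd_add\<close>)
    have sup: "p_superharmonic_on p upper_half_space (\<lambda>x. ereal (v x))"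
    proof (rule p_harmonic_imp_superharmonic[OF p])
      have "e \<in> upper_half_space" by (simp add: e_def upper_half_space_def)
      then show "upper_half_space \<noteq> ({} :: ((real^'m) \<times> real) set)" by blast
      show "continuous_on upper_half_space v" by (rule continuous_on_subset[OF cv]) (auto simp: upper_half_space_def)
      show "p_harmonic_on p D v" if "open D" "D \<subseteq> upper_half_space" for D
        unfolding v_def by (rule Uharm[OF that(1) cp ne]) (use that(2) in \<open>auto simp: upper_half_space_def\<close>)
    qed
    have nn: "0 \<le> ereal (v z)" if "z \<in> upper_half_space" for z
    proof -
      have "0 \<le> snd z" using that by (auto simp: upper_half_space_def)
      from mult_pos_pos[OF cp Upos[OF ne[OF this]]] have "0 < v z" by (simp only: v_def diff_zero)
      then show ?thesis by simp
    qed
    have bd: "1 \<le> Liminf (at y within upper_half_space) (\<lambda>x. ereal (v x))" if "y \<in> boundary_ball \<delta>" for y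
    proof -
      have y: "norm (fst y) < \<delta>" "snd y = 0" using that by (auto simp: boundary_ball_def)
      have K: "(1 / \<delta>) *\<^sub>R y + e \<in> ?K" using y \<delta> by (cases y) (auto simp: e_def)
      have "m \<le> U ((1 / \<delta>) *\<^sub>R y + e)" unfolding m_def by (rule bspec[OF y0(2) K])
      moreover have "v y = U ((1 / \<delta>) *\<^sub>R y + e) / m"
        unfolding v_def Uhom_shift[OF \<delta>] using \<delta> by (simp add: powr_minus)
      ultimately have "1 \<le> v y" using m by simp
      moreover have "ereal (v y) \<le> Liminf (at y within upper_half_space) (\<lambda>x. ereal (v x))"
        by (rule continuous_le_Liminf[OF cv]) (auto simp: upper_half_space_def y)
      ultimately show ?thesis by (metis ereal_less_eq(3) one_ereal_def order_trans)
    qed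
    have "p_harmonic_measure p (boundary_ball \<delta>) e upper_half_space \<le> ereal (v e)"
      unfolding p_harmonic_measure_def
    proof (rule INF_lower2)
      show "(\<lambda>x. ereal (v x)) \<in> {u. p_superharmonic_on p upper_half_space u \<and> (\<forall>z\<in>upper_half_space. 0 \<le> u z) \<and>
        (\<forall>y\<in>boundary_ball \<delta>. 1 \<le> Liminf (at y within upper_half_space) u)}"
        using sup nn bd by simp
    qed simp
    also have "v e = \<delta> powr \<beta> / m * ((1 + \<delta>) powr (- \<beta>) * U e)"
    proof -
      have "e + \<delta> *\<^sub>R e = (1 + \<delta>) *\<^sub>R e" by (simp add: scaleR_add_left)
      then show ?thesis unfolding v_def using \<delta> by (simp add: Uhom)
    qed
    also have "\<dots> \<le> \<delta> powr \<beta> / m * (1 * U e)"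
    proof (intro mult_left_mono mult_right_mono)
      show "(1 + \<delta>) powr (- \<beta>) \<le> 1" using \<delta> \<beta> by (simp add: powr_minus_divide ge_one_powr_ge_zero)
    qed (use ue cp in auto)
    finally show "p_harmonic_measure p (boundary_ball \<delta>) ((0 :: real^'m), 1) upper_half_space \<le> ereal (U e / m * \<delta> powr \<beta>)"
      by (simp add: e_def mult.commute)
  qed
qed

text \<open>
  Let \<open>u0 = U(e)\<close>. Far from the origin \<open>U < u0 / 4\<close>, and near \<open>e\<close> it exceeds \<open>u0 / 2\<close>. With the
  singularity at depth \<open>s\<close> proportional to \<open>\<delta>\<close>, comparison on the set
  \<open>{U(x / s + e) > u0 / 4}\<close> shows that every competitor \<open>u\<close> is at least \<open>c0\<close> on a half-ball of
  radius \<open>\<rho> s\<close>, and comparison outside of a half-ball carries this over to the point \<open>e\<close>. In both steps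
  the domain has to be compactly contained in the half-space, so it is cut off at a small height
  \<open>\<tau>\<close>; in the second step the singularity is lifted to that height, which makes the comparison
  function nonpositive on the cut.
\<close>
lemma harmonic_measure_lower_bound:
  obtains C where "0 < C" "\<And>\<delta>. 0 < \<delta> \<Longrightarrow> \<delta> \<le> 1 \<Longrightarrow>
    ereal (C * \<delta> powr \<beta>) \<le> p_harmonic_measure p (boundary_ball \<delta>) ((0 :: real^'m), 1) upper_half_space"
proof -
  define e where "e = ((0 :: real^'m), 1 :: real)"
  define u0 where "u0 = U e"
  have se: "snd e = 1" and ne: "norm e = 1" by (simp_all add: e_def norm_Pair)
  have u0: "0 < u0" unfolding u0_def by (intro Upos) (simp add: se)
  have u0M: "u0 \<le> M" using UM[of e] se ne by (auto simp: u0_def e_def zero_prod_def)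
  \<comment> \<open>the radius at which the upper bound for U equals u0 / 4\<close>
  define Rad where "Rad = (4 * M / u0) powr (1 / \<beta>)"
  have Rad: "1 \<le> Rad" unfolding Rad_def using u0 u0M \<beta> by (intro ge_one_powr_ge_zero) (auto simp: field_simps)
  have RM: "M * Rad powr (- \<beta>) = u0 / 4"
    unfolding Rad_def using \<beta> u0 M by (simp add: powr_powr powr_minus field_simps)
  have far: "norm y \<le> Rad" if "0 < snd y" "u0 / 4 \<le> U y" for y
  proof (rule ccontr)
    assume "\<not> norm y \<le> Rad"
    then have "norm y powr (- \<beta>) < Rad powr (- \<beta>)" using Rad \<beta> by (intro powr_less_mono2_neg) auto
    then have "M * norm y powr (- \<beta>) < u0 / 4" using M RM by (metis mult_strict_left_mono)
    moreover have "U y \<le> M * norm y powr (- \<beta>)" by (rule UM) (use that(1) in auto)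
    ultimately show False using that(2) by simp
  qed
  have "e \<in> {x. 0 \<le> snd x \<and> x \<noteq> 0}" using se ne by auto
  with Uc u0 obtain \<rho>' where \<rho>': "0 < \<rho>'" "\<forall>y\<in>{x. 0 \<le> snd x \<and> x \<noteq> 0}. dist y e < \<rho>' \<longrightarrow> dist (U y) (U e) < u0 / 2"
    unfolding continuous_on_iff by (meson half_gt_zero)
  define \<rho> where "\<rho> = min \<rho>' 1"
  have \<rho>: "0 < \<rho>" "\<rho> \<le> 1" using \<rho>' by (auto simp: \<rho>_def)
  have near: "u0 / 2 < U y" if "0 < snd y" "norm (y - e) < \<rho>" for y
  proof -
    have "dist (U y) (U e) < u0 / 2"
      by (rule \<rho>'(2)[THEN bspec, THEN mp]) (use that in \<open>auto simp: \<rho>_def dist_norm\<close>)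
    then show ?thesis by (simp add: dist_real_def u0_def abs_if split: if_splits)
  qed
  have UM1: "U y \<le> M" if "1 \<le> snd y" for y
  proof -
    have "1 \<le> norm y" using that norm_snd_le[of "snd y" "fst y"] by (cases y) auto
    then have "norm y powr (- \<beta>) \<le> 1" using powr_mono[of "- \<beta>" 0 "norm y"] \<beta> by (simp split: if_splits)
    then have "M * norm y powr (- \<beta>) \<le> M" using M by simp
    moreover have "U y \<le> M * norm y powr (- \<beta>)" by (rule UM) (use that in auto)
    ultimately show ?thesis by simp
  qed
  define c0 where "c0 = u0 / (8 * M)"
  have c0: "0 < c0" using u0 M by (simp add: c0_def)
  show thesis
  proof (rule that[of "c0 * (\<rho> / (4 * Rad)) powr \<beta> / M * u0"])
    show "0 < c0 * (\<rho> / (4 * Rad)) powr \<beta> / M * u0" using c0 \<rho> Rad M u0 by simp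
    fix \<delta> :: real assume \<delta>: "0 < \<delta>" "\<delta> \<le> 1"
    show "ereal (c0 * (\<rho> / (4 * Rad)) powr \<beta> / M * u0 * \<delta> powr \<beta>)
      \<le> p_harmonic_measure p (boundary_ball \<delta>) ((0 :: real^'m), 1) upper_half_space"
      unfolding p_harmonic_measure_def
    proof (rule INF_greatest)
      fix u :: "(real^'m) \<times> real \<Rightarrow> ereal"
      assume "u \<in> {u. p_superharmonic_on p upper_half_space u \<and> (\<forall>z\<in>upper_half_space. 0 \<le> u z) \<and>
        (\<forall>y\<in>boundary_ball \<delta>. 1 \<le> Liminf (at y within upper_half_space) u)}"
      then have sup: "p_superharmonic_on p upper_half_space u"
        and nn: "\<And>z. z \<in> upper_half_space \<Longrightarrow> 0 \<le> u z"
        and bd: "\<And>y. y \<in> boundary_ball \<delta> \<Longrightarrow> 1 \<le> Liminf (at y within upper_half_space) u" by auto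
      have H: "x \<in> upper_half_space \<longleftrightarrow> 0 < snd x" for x :: "(real^'m) \<times> real"
        by (cases x) (simp add: upper_half_space_def)
      \<comment> \<open>chosen such that the superlevel set meets the boundary within the ball of radius \<open>\<delta> / 2\<close>, a compact part of the boundary ball\<close>
      define s where "s = \<delta> / (2 * Rad)"
      have s: "0 < s" "s \<le> 1 / 2" using \<delta> Rad by (auto simp: s_def field_simps)
      define V where "V x = U ((1 / s) *\<^sub>R x + e)" for x
      have Vs: "V x = s powr \<beta> * U (x + s *\<^sub>R e)" for x
        unfolding V_def Uhom_shift[OF s(1)] using s by (simp add: powr_minus)
      have snd_s: "snd ((1 / s) *\<^sub>R x + e) = snd x / s + 1" for x by (simp add: se)
      define K where "K = cball (0 :: real^'m) (\<delta> / 2) \<times> {0 :: real}"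
      have "compact K" unfolding K_def by (intro compact_Times) auto
      moreover have "K \<inter> upper_half_space = {}" by (auto simp: K_def H)
      moreover have "1 \<le> Liminf (at y within upper_half_space) u" if "y \<in> K" for y
        by (rule bd) (use that \<delta> in \<open>auto simp: K_def boundary_ball_def\<close>)
      moreover have "ereal (1 / 2) < 1" by (simp add: one_ereal_def)
      ultimately obtain \<epsilon> where \<epsilon>: "0 < \<epsilon>" "\<And>x y. y \<in> K \<Longrightarrow> x \<in> upper_half_space \<Longrightarrow> dist y x < \<epsilon> \<Longrightarrow> ereal (1 / 2) < u x"
        by (rule Liminf_uniform_near_compact) (blast, rule that, assumption+)
      have inner: "ereal c0 \<le> u x" if x: "0 < snd x" "norm x < \<rho> * s" for x
      proof -
        define \<tau> where "\<tau> = min (snd x) \<epsilon> / 2"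
        have \<tau>: "0 < \<tau>" "\<tau> < snd x" "\<tau> < \<epsilon>" using x \<epsilon>(1) by (auto simp: \<tau>_def)
        define T where "T = {z :: (real^'m) \<times> real. \<tau> \<le> snd z}"
        \<comment> \<open>scaled such that h is 0 on the level surface and at most 1/2 elsewhere\<close>
        define h where "h z = (s powr \<beta> / (2 * M)) * U (z + s *\<^sub>R e) - u0 / (8 * M)" for z
        have hV: "h z = (V z - u0 / 4) / (2 * M)" for z using M by (simp add: h_def Vs field_simps)
        have pos: "0 < snd (z + s *\<^sub>R e)" if "0 < snd z" for z using that s by (simp add: se)
        have hc: "continuous_on T h" unfolding h_def
        proof (rule continuous_on_shifted)
          fix z assume "z \<in> T"
          then have "0 < snd (z + s *\<^sub>R e)" using \<tau> by (intro pos) (auto simp: T_def)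
          moreover from this have "z + s *\<^sub>R e \<noteq> 0" by (rule contrapos_pn) simp
          ultimately show "0 \<le> snd (z + s *\<^sub>R e) \<and> z + s *\<^sub>R e \<noteq> 0" by linarith
        qed
        have clT: "closed T" unfolding T_def by (intro closed_Collect_le continuous_intros)
        have opT: "open {z :: (real^'m) \<times> real. \<tau> < snd z}" by (intro open_Collect_less continuous_intros)
        define D where "D = {z. \<tau> < snd z \<and> 0 < h z}"
        have D_eq: "D = {z. \<tau> < snd z} \<inter> h -` {0<..}" by (auto simp: D_def)
        have "continuous_on {z. \<tau> < snd z} h" by (rule continuous_on_subset[OF hc]) (auto simp: T_def)
        then have opD: "open D" unfolding D_eq by (rule continuous_open_preimage[OF _ opT]) simp
        have "closed (T \<inter> h -` {0..})" by (rule continuous_closed_preimage[OF hc clT]) simp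
        then have clD: "closure D \<subseteq> T \<inter> h -` {0..}" by (rule closure_minimal[rotated]) (auto simp: D_def T_def)
        have far': "norm ((1 / s) *\<^sub>R z + e) \<le> Rad" if "z \<in> closure D" for z
        proof (rule far)
          have z: "\<tau> \<le> snd z" "0 \<le> h z" using clD that by (auto simp: T_def)
          show "0 < snd ((1 / s) *\<^sub>R z + e)" unfolding snd_s using z(1) \<tau>(1) s by (simp add: add_pos_pos)
          show "u0 / 4 \<le> U ((1 / s) *\<^sub>R z + e)" using z(2) M by (simp add: hV V_def zero_le_divide_iff)
        qed
        have "bounded D"
        proof (rule bounded_shifted_ball[of _ "s *\<^sub>R e" "s * Rad"])
          fix z assume "z \<in> D"
          then have "norm ((1 / s) *\<^sub>R z + e) \<le> Rad" using far' closure_subset by blast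
          moreover have "z + s *\<^sub>R e = s *\<^sub>R ((1 / s) *\<^sub>R z + e)" using s by (simp add: scaleR_add_right)
          ultimately show "norm (z + s *\<^sub>R e) \<le> s * Rad" using s by simp
        qed
        have hx: "c0 \<le> h x"
        proof -
          have "norm ((1 / s) *\<^sub>R x + e - e) < \<rho>" using x(2) s by (simp add: field_simps)
          then have "u0 / 2 < V x" unfolding V_def
            by (rule near[rotated]) (use x s in \<open>simp add: se add_pos_pos\<close>)
          then have "u0 / 4 / (2 * M) \<le> h x" unfolding hV using M by (intro divide_right_mono) auto
          then show ?thesis by (simp add: c0_def)
        qed
        have "ereal (h x) \<le> u x"
        proof (rule p_superharmonic_comparison[OF sup opD \<open>bounded D\<close>])
          show "closure D \<subseteq> upper_half_space" using clD \<tau>(1) by (force simp: T_def H)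
          show "continuous_on (closure D) h" by (rule continuous_on_subset[OF hc]) (use clD in auto)
          show "p_harmonic_on p D h" unfolding h_def
          proof (rule Uharm[OF opD])
            show "0 < snd (z + s *\<^sub>R e)" if "z \<in> D" for z by (rule pos) (use that \<tau> in \<open>auto simp: D_def\<close>)
          qed (use s M in simp)
          show "x \<in> D" using \<tau> hx c0 by (simp add: D_def)
          fix z assume "z \<in> frontier D"
          then have zc: "z \<in> closure D" and "z \<notin> D" using opD by (auto simp: frontier_def interior_open)
          then have z: "\<tau> \<le> snd z" "0 \<le> h z" and z': "snd z = \<tau> \<or> h z = 0" using clD by (auto simp: T_def D_def)
          have zH: "z \<in> upper_half_space" using z \<tau> by (simp add: H)
          from z' show "ereal (h z) \<le> u z"
          proof
            assume "h z = 0"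
            then show ?thesis using nn[OF zH] by (simp add: zero_ereal_def)
          next
            assume sz: "snd z = \<tau>"
            have "V z \<le> M" unfolding V_def by (rule UM1) (use z \<tau> s in \<open>simp add: se\<close>)
            then have "(V z - u0 / 4) / (2 * M) \<le> M / (2 * M)" using M u0 by (intro divide_right_mono) auto
            then have h2: "h z \<le> 1 / 2" using M by (simp add: hV)
            have "fst ((1 / s) *\<^sub>R z + e) = (1 / s) *\<^sub>R fst z" by (simp add: e_def)
            moreover have "norm (fst w) \<le> norm w" for w :: "(real^'m) \<times> real"
              using norm_fst_le[of "fst w" "snd w"] by (simp only: prod.collapse)
            ultimately have "norm ((1 / s) *\<^sub>R fst z) \<le> Rad" using far'[OF zc] by (metis order_trans)
            then have "norm (fst z) \<le> s * Rad" using s by (simp add: field_simps)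
            then have "norm (fst z) \<le> \<delta> / 2" using Rad by (simp add: s_def)
            then have "(fst z, 0) \<in> K" by (simp add: K_def)
            moreover have "dist (fst z, 0) z < \<epsilon>" using sz \<tau> by (cases z) (simp add: dist_Pair_Pair)
            ultimately have "ereal (1 / 2) < u z" by (rule \<epsilon>(2)[OF _ zH])
            then show ?thesis using h2 by (meson ereal_less_eq(3) less_imp_le order_trans)
          qed
        qed
        then show ?thesis using hx by (meson ereal_less_eq(3) order_trans)
      qed
      define r where "r = \<rho> * s / 2"
      have r: "0 < r" "r \<le> 1 / 4" using \<rho> s mult_mono[of \<rho> 1 s "1/2"] by (auto simp: r_def)
      \<comment> \<open>chosen such that the comparison function is at most c0 on the sphere of radius r around its singularity\<close>
      define \<kappa> where "\<kappa> = c0 * r powr \<beta> / M"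
      have \<kappa>: "0 < \<kappa>" using c0 r M by (simp add: \<kappa>_def)
      have outer: "ereal (\<kappa> * u0 - \<eta>) \<le> u e" if \<eta>: "0 < \<eta>" for \<eta>
      proof -
        \<comment> \<open>beyond this radius the multiple of U is below \<open>\<eta>\<close>; subtracting \<open>\<eta>\<close> makes the domain of comparison bounded\<close>
        define R where "R = max 2 ((\<kappa> * M / \<eta>) powr (1 / \<beta>))"
        have R: "2 \<le> R" by (simp add: R_def)
        have R\<eta>: "\<kappa> * (M * R powr (- \<beta>)) \<le> \<eta>"
        proof -
          have "\<kappa> * M / \<eta> = ((\<kappa> * M / \<eta>) powr (1 / \<beta>)) powr \<beta>" using \<kappa> M \<eta> \<beta> by (simp add: powr_powr)
          also have "\<dots> \<le> R powr \<beta>" using \<beta> by (intro powr_mono2) (auto simp: R_def)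
          finally show ?thesis using \<eta> R by (simp add: powr_minus field_simps)
        qed
        define \<tau> where "\<tau> = r / 2"
        have \<tau>: "0 < \<tau>" "\<tau> < r" "\<tau> \<le> 1 / 8" using r by (auto simp: \<tau>_def)
        define d where "d = - (\<tau> *\<^sub>R e)"
        have sd: "snd (z + d) = snd z - \<tau>" for z by (simp add: d_def se)
        have nd: "norm d = \<tau>" using \<tau> by (simp add: d_def ne)
        define h where "h z = \<kappa> * U (z + d) - \<eta>" for z
        define D where "D = {z. \<tau> < snd z \<and> r < norm (z + d) \<and> norm (z + d) < R}"
        define T where "T = {z. \<tau> \<le> snd z \<and> r \<le> norm (z + d) \<and> norm (z + d) \<le> R}"
        have opD: "open D" unfolding D_def by (intro open_Collect_conj open_Collect_less continuous_intros)
        have "closed T" unfolding T_def by (intro closed_Collect_conj closed_Collect_le continuous_intros)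
        then have clD: "closure D \<subseteq> T" by (rule closure_minimal[rotated]) (auto simp: D_def T_def)
        have "bounded D" by (rule bounded_shifted_ball[of _ d R]) (auto simp: D_def)
        have ed: "e + d = (1 - \<tau>) *\<^sub>R e" by (simp add: d_def scaleR_diff_left)
        have "ereal (h e) \<le> u e"
        proof (rule p_superharmonic_comparison[OF sup opD \<open>bounded D\<close>])
          show "closure D \<subseteq> upper_half_space" using clD \<tau>(1) by (force simp: T_def H)
          show "continuous_on (closure D) h" unfolding h_def
            by (rule continuous_on_shifted) (use clD r in \<open>force simp: T_def sd simp del: snd_add\<close>)
          show "p_harmonic_on p D h" unfolding h_def by (rule Uharm[OF opD \<kappa>]) (simp add: D_def sd del: snd_add)
          show "e \<in> D" using \<tau> r R by (simp add: D_def ed se ne)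
          fix z assume "z \<in> frontier D"
          then have "z \<in> T" "z \<notin> D" using opD clD by (auto simp: frontier_def interior_open)
          then have z: "\<tau> \<le> snd z" "r \<le> norm (z + d)" and z': "snd z = \<tau> \<or> norm (z + d) = r \<or> norm (z + d) = R"
            by (auto simp: T_def D_def)
          have z0: "0 \<le> snd (z + d)" "z + d \<noteq> 0" using z r unfolding sd by auto
          have zH: "z \<in> upper_half_space" using z \<tau> by (simp add: H)
          have hU: "h z \<le> \<kappa> * (M * norm (z + d) powr (- \<beta>)) - \<eta>"
            unfolding h_def using UM[OF z0] \<kappa> by simp
          from z' consider "snd z = \<tau>" | "norm (z + d) = r" | "norm (z + d) = R" by blast
          then show "ereal (h z) \<le> u z"
          proof cases
            case 1
            then have "snd (z + d) = 0" unfolding sd by simp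
            then have "U (z + d) = 0" using z0(2) by (rule U0)
            then have "ereal (h z) \<le> 0" using \<eta> by (simp add: h_def)
            then show ?thesis using nn[OF zH] by (rule order_trans)
          next
            case 2
            have "norm z \<le> norm (z + d) + norm d" using norm_triangle_ineq4[of "z + d" d] by simp
            then have "norm z < \<rho> * s" using 2 nd \<tau> by (simp add: r_def)
            then have "ereal c0 \<le> u z" using z \<tau> by (intro inner) auto
            moreover have "h z \<le> c0" using hU \<eta> r M unfolding 2 \<kappa>_def by (simp add: powr_minus)
            ultimately show ?thesis by (meson ereal_less_eq(3) order_trans)
          next
            case 3
            then have "ereal (h z) \<le> 0" using hU R\<eta> by simp
            then show ?thesis using nn[OF zH] by (rule order_trans)
          qed
        qed
        moreover have "\<kappa> * u0 - \<eta> \<le> h e"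
        proof -
          have "1 \<le> (1 - \<tau>) powr (- \<beta>)" using \<tau> \<beta> by (simp add: powr_minus one_le_inverse_iff powr_le1)
          then have "u0 \<le> U (e + d)" unfolding ed using \<tau> u0 by (simp add: Uhom u0_def)
          then show ?thesis using \<kappa> by (simp add: h_def)
        qed
        ultimately show ?thesis by (meson ereal_less_eq(3) order_trans)
      qed
      have "ereal (\<kappa> * u0) \<le> u e"
      proof (rule ereal_le_epsilon2)
        fix \<eta> :: real assume "0 < \<eta>"
        from add_right_mono[OF outer[OF this], of "ereal \<eta>"] show "ereal (\<kappa> * u0) \<le> u e + ereal \<eta>" by simp
      qed
      moreover have "\<kappa> * u0 = c0 * (\<rho> / (4 * Rad)) powr \<beta> / M * u0 * \<delta> powr \<beta>"
      proof -
        have "r = \<rho> / (4 * Rad) * \<delta>" by (simp add: r_def s_def)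
        then have "r powr \<beta> = (\<rho> / (4 * Rad)) powr \<beta> * \<delta> powr \<beta>" using \<rho> Rad \<delta> by (simp only: powr_mult)
        then show ?thesis by (simp add: \<kappa>_def)
      qed
      ultimately show "ereal (c0 * (\<rho> / (4 * Rad)) powr \<beta> / M * u0 * \<delta> powr \<beta>) \<le> u (0, 1)" by (simp add: e_def)
    qed
  qed
qed

end

theorem corollary1p3:
  fixes p :: real
  assumes "1 < p"
  shows "\<exists>\<alpha> C1 C2 :: real. 0 < \<alpha> \<and> 0 < C1 \<and> 0 < C2 \<and>
    (\<forall>\<delta>::real. 0 < \<delta> \<and> \<delta> \<le> 1 \<longrightarrow>
      ereal (C1 * \<delta> powr \<alpha>)
        \<le> p_harmonic_measure p (boundary_ball \<delta>) ((0 :: real^'m), 1) upper_half_space \<and>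
      p_harmonic_measure p (boundary_ball \<delta>) ((0 :: real^'m), 1) upper_half_space
        \<le> ereal (C2 * \<delta> powr \<alpha>))"
proof -
  show ?thesis
  proof (rule singular_solution[OF assms])
    fix \<beta> M and U :: "(real^'m) \<times> real \<Rightarrow> real"
    assume U: "0 < \<beta>" "0 < M" "continuous_on {x. 0 \<le> snd x \<and> x \<noteq> 0} U"
      "\<And>x. snd x = 0 \<Longrightarrow> x \<noteq> 0 \<Longrightarrow> U x = 0" "\<And>x. 0 < snd x \<Longrightarrow> 0 < U x"
      "\<And>c x. 0 < c \<Longrightarrow> U (c *\<^sub>R x) = c powr (- \<beta>) * U x"
      "\<And>x. 0 \<le> snd x \<Longrightarrow> x \<noteq> 0 \<Longrightarrow> U x \<le> M * norm x powr (- \<beta>)"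
      "\<And>D c d e. open D \<Longrightarrow> 0 < c \<Longrightarrow> (\<And>x. x \<in> D \<Longrightarrow> 0 < snd (x + d)) \<Longrightarrow> p_harmonic_on p D (\<lambda>x. c * U (x + d) - e)"
    interpret half_space_singular_solution p \<beta> M U
      by (rule half_space_singular_solution.intro[OF assms U])
    obtain C1 where C1: "0 < C1" "\<And>\<delta>. 0 < \<delta> \<Longrightarrow> \<delta> \<le> 1 \<Longrightarrow>
      ereal (C1 * \<delta> powr \<beta>) \<le> p_harmonic_measure p (boundary_ball \<delta>) ((0 :: real^'m), 1) upper_half_space"
      by (rule harmonic_measure_lower_bound, rule that, assumption+)
    obtain C2 where C2: "0 < C2" "\<And>\<delta>. 0 < \<delta> \<Longrightarrow>
      p_harmonic_measure p (boundary_ball \<delta>) ((0 :: real^'m), 1) upper_half_space \<le> ereal (C2 * \<delta> powr \<beta>)"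
      by (rule harmonic_measure_upper_bound, rule that, assumption+)
    show ?thesis
    proof (intro exI conjI allI impI)
      fix \<delta> :: real assume \<delta>: "0 < \<delta> \<and> \<delta> \<le> 1"
      show "ereal (C1 * \<delta> powr \<beta>) \<le> p_harmonic_measure p (boundary_ball \<delta>) ((0 :: real^'m), 1) upper_half_space"
        using C1(2) \<delta> by blast
      show "p_harmonic_measure p (boundary_ball \<delta>) ((0 :: real^'m), 1) upper_half_space \<le> ereal (C2 * \<delta> powr \<beta>)"
        using C2(2) \<delta> by blast
    qed (rule U(1) C1(1) C2(1))+
  qed
qed

end
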